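(* Consider the multi-frequency angular synchronization model: let $x=(e^{i\varphi_1},\dots,e^{i\varphi_n})$ with $\varphi_1,\dots,\varphi_n$ i.i.d. uniform on $[0,2\pi)$, and observe $$Y_\ell=\frac{\lambda}{\sqrt n}\,x^{(\ell)}\big(x^{(\ell)}\big)^{*}+W_\ell,\qquad 1\le\ell\le L,$$ where $x^{(\ell)}$ is the entrywise $\ell$-th power of $x$ and $W_1,\dots,W_L$ are independent $\mathrm{GUE}(n)$ matrices, independent of $x$. Suppose that $L=n^{o(1)}$ and $0\le\lambda<1-\delta$ for some constant $\delta>0$. Assume that the low-degree heuristic holds for the hidden informative sample problems associated with this model (see context). Then, for any $\ell\in\{1,\dots,L\}$, any algorithm which, given $(Y_1,\dots,Y_L)$, outputs an estimator $\mathcal X$ achieving weak recovery of $\Theta_\ell=\frac{\lambda}{\sqrt n}x^{(\ell)}(x^{(\ell)})^{*}$, i.e. $\mathbb E\big[\langle\mathcal X,\Theta_\ell\rangle/(\|\mathcal X\|\,\|\Theta_\ell\|)\big]\ge c$ for some constant $c>0$, requires running time at least $\exp(n^{\Omega(1)})$.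
   Context: Asymptotic notation is with respect to $n\to\infty$; $x_n\ll y_n$ means $x_n/y_n\to0$. "Requires running time at least $\exp(n^{\Omega(1)})$" means no algorithm with running time $\exp(n^{o(1)})$ succeeds. A $\mathrm{GUE}(n)$ matrix is Hermitian with independent entries on and above the diagonal, the off-diagonal ones being standard complex Gaussians ($u+iv$ with $u,v\sim\mathcal N(0,\frac12)$ independent) and the diagonal ones real $\mathcal N(0,1)$. $x^*=\overline x^{\top}$; the inner product and norm on (Hermitian) matrices are Frobenius; the ratio in weak recovery is read as $0$ when its denominator vanishes. Low-degree heuristic. Let $P=P_n,Q=Q_n$ be probability measures on $\mathbb R^{N}$, $N=N_n$ (complex matrices are viewed as real vectors). For a degree $D=D_n$ put $\mathsf{Adv}_{\le D}(P;Q)=\sup_f \mathbb E_P[f]/\sqrt{\mathbb E_Q[f^2]}$, the supremum over real polynomials $f$ on $\mathbb R^N$ of degree at most $D$. A $\{0,1\}$-valued algorithm $\mathcal A$ achieves strong detection if $Q(\mathcal A=1)+P(\mathcal A=0)\to0$, and weak detection if this sum is at most $1-\epsilon$ for some fixed $\epsilon>0$. The low-degree heuristic holds for testing $P$ against $Q$ if: (1) whenever $\mathsf{Adv}_{\le D}(P;Q)=O(1)$ there is a constant $C$ such that no algorithm with running time $N^{D/(C\log N)}$ achieves strong detection; (2) whenever $\mathsf{Adv}_{\le D}(P;Q)=1+o(1)$ there is a constant $C$ such that no algorithm with running time $N^{D/(C\log N)}$ achieves weak detection. Hidden informative sample problem with base pair $(P,Q)$ and sample number $M=M_n$: test between $\overline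 Q$, the law of $(\mathsf Y_1,\dots,\mathsf Y_M)$ i.i.d. from $Q$, and $\overline P$, the law of $(\mathsf Y_1,\dots,\mathsf Y_M)$ where $\kappa$ is uniform on $\{1,\dots,M\}$ and, given $\kappa$, the $\mathsf Y_j$ are independent with $\mathsf Y_\kappa\sim P$ and $\mathsf Y_j\sim Q$ for $j\ne\kappa$ (dimension $MN$). The associated problems: the base pair is ($P$ = law of $(Y_1,\dots,Y_L)$, $Q$ = law of $(W_1,\dots,W_L)$), for any parameters $\lambda,L$ satisfying the assumptions of the claim (for some constant $\delta>0$); the sample number is any $M$ with $\Delta\ll M\le N\Delta$, where $\Delta>1$ is an upper bound for $\mathsf{Adv}_{\le D}(P;Q)^2$ and $N$ is the dimension of the base pair. The constant $C$ in the heuristic may be taken independent of the choice of $M$. *)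

theory Defs
  imports "HOL-Probability.Probability"
begin

section \<open>Algorithms: randomised real random-access machines\<close>

text \<open>
  Algorithms on real inputs are programs of a real RAM: unit-cost exact arithmetic and comparisons
  on real memory cells, natural-number index registers for indirect addressing, and an instruction
  drawing a fresh standard Gaussian. Division by zero yields zero.
\<close>

datatype addr = Direct nat | Indexed nat nat

datatype instr =
    LoadConst addr real
  | Gauss addr
  | Add addr addr addr
  | Sub addr addr addr
  | Mul addr addr addr
  | Div addr addr addr
  | JumpLess addr addr nat
  | IndexConst nat nat
  | IndexAdd nat nat nat
  | IndexSub nat nat nat
  | IndexJumpLess nat nat nat

text \<open>The field \<open>drawn\<close> is the number of Gaussians used so far.\<close>

record config =
  pc :: nat
  idx :: "nat \<Rightarrow> nat"
  mem :: "nat \<Rightarrow> real"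
  drawn :: nat

fun resolve :: "config \<Rightarrow> addr \<Rightarrow> nat" where
  "resolve s (Direct a) = a"
| "resolve s (Indexed i a) = idx s i + a"

definition rd :: "config \<Rightarrow> addr \<Rightarrow> real" where
  "rd s a = mem s (resolve s a)"

definition wr :: "addr \<Rightarrow> real \<Rightarrow> config \<Rightarrow> config" where
  "wr a v s = s\<lparr>mem := (mem s)(resolve s a := v), pc := Suc (pc s)\<rparr>"

definition set_idx :: "nat \<Rightarrow> nat \<Rightarrow> config \<Rightarrow> config" where
  "set_idx i v s = s\<lparr>idx := (idx s)(i := v), pc := Suc (pc s)\<rparr>"

definition branch :: "bool \<Rightarrow> nat \<Rightarrow> config \<Rightarrow> config" where
  "branch b k s = s\<lparr>pc := (if b then k else Suc (pc s))\<rparr>"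

text \<open>\<open>\<omega>\<close> is the stream of Gaussians available to the machine.\<close>

fun exec :: "(nat \<Rightarrow> real) \<Rightarrow> instr \<Rightarrow> config \<Rightarrow> config" where
  "exec \<omega> (LoadConst a r) s = wr a r s"
| "exec \<omega> (Gauss a) s = wr a (\<omega> (drawn s)) (s\<lparr>drawn := Suc (drawn s)\<rparr>)"
| "exec \<omega> (Add a b c) s = wr a (rd s b + rd s c) s"
| "exec \<omega> (Sub a b c) s = wr a (rd s b - rd s c) s"
| "exec \<omega> (Mul a b c) s = wr a (rd s b * rd s c) s"
| "exec \<omega> (Div a b c) s = wr a (rd s b / rd s c) s"
| "exec \<omega> (JumpLess a b k) s = branch (rd s a < rd s b) k s"
| "exec \<omega> (IndexConst i v) s = set_idx i v s"
| "exec \<omega> (IndexAdd i j k) s = set_idx i (idx s j + idx s k) s"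
| "exec \<omega> (IndexSub i j k) s = set_idx i (idx s j - idx s k) s"
| "exec \<omega> (IndexJumpLess i j k) s = branch (idx s i < idx s j) k s"

definition halted :: "instr list \<Rightarrow> config \<Rightarrow> bool" where
  "halted p s \<longleftrightarrow> length p \<le> pc s"

definition step :: "instr list \<Rightarrow> (nat \<Rightarrow> real) \<Rightarrow> config \<Rightarrow> config" where
  "step p \<omega> s = (if halted p s then s else exec \<omega> (p ! pc s) s)"

definition init_config :: "nat \<Rightarrow> (nat \<Rightarrow> real) \<Rightarrow> config" where
  "init_config N y =
     \<lparr>pc = 0, idx = (\<lambda>_. 0), mem = (\<lambda>i. if i < N then y i else 0), drawn = 0\<rparr>"

definition run :: "instr list \<Rightarrow> nat \<Rightarrow> (nat \<Rightarrow> real) \<Rightarrow> (nat \<Rightarrow> real) \<Rightarrow> nat \<Rightarrow> config" where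
  "run p N y \<omega> t = (step p \<omega> ^^ t) (init_config N y)"

text \<open>The memory on halting, on input \<open>y\<close> in \<open>\<real>\<^sup>N\<close>.\<close>

definition result :: "instr list \<Rightarrow> nat \<Rightarrow> (nat \<Rightarrow> real) \<Rightarrow> (nat \<Rightarrow> real) \<Rightarrow> nat \<Rightarrow> real" where
  "result p N y \<omega> = mem (run p N y \<omega> (LEAST t. halted p (run p N y \<omega> t)))"

text \<open>
  An algorithm is a sequence of programs, one for each \<open>n\<close>; so it may depend on \<open>n\<close> and on the
  parameters of the problem. Worst-case running time at most \<open>T\<close> therefore includes a bound on the
  length of the program: otherwise the program could be a lookup table of exponential size.
\<close>

definition runs_in_time :: "instr list \<Rightarrow> nat \<Rightarrow> real \<Rightarrow> bool" where
  "runs_in_time p N T \<longleftrightarrow>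
     real (length p) \<le> T \<and> (\<forall>y \<omega>. \<exists>t. real t \<le> T \<and> halted p (run p N y \<omega> t))"

definition seed :: "(nat \<Rightarrow> real) measure" where
  "seed = PiM UNIV (\<lambda>_. density lborel std_normal_density)"

section \<open>Testing problems and the low-degree heuristic\<close>

text \<open>Vectors in \<open>\<real>\<^sup>N\<close> are extensional functions on \<open>{..<N}\<close>.\<close>

abbreviation RN :: "nat \<Rightarrow> (nat \<Rightarrow> real) measure" where
  "RN N \<equiv> PiM {..<N} (\<lambda>_. borel)"

record testing_problem =
  dim :: nat
  planted :: "(nat \<Rightarrow> real) measure"
  null_law :: "(nat \<Rightarrow> real) measure"

definition exponents :: "nat \<Rightarrow> nat \<Rightarrow> (nat \<Rightarrow> nat) set" where
  "exponents N D = {a \<in> {..<N} \<rightarrow>\<^sub>E {..D}. (\<Sum>i<N. a i) \<le> D}"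

definition polys :: "nat \<Rightarrow> nat \<Rightarrow> ((nat \<Rightarrow> real) \<Rightarrow> real) set" where
  "polys N D = {\<lambda>y. \<Sum>a\<in>exponents N D. c a * (\<Prod>i<N. y i ^ a i) | c. True}"

text \<open>
  The quotient is taken in the extended reals, where \<open>0 / 0 = 0\<close> and \<open>r / 0 = \<infinity>\<close> for \<open>r > 0\<close>.
\<close>

definition Adv :: "nat \<Rightarrow> testing_problem \<Rightarrow> ereal" where
  "Adv D X = (SUP f\<in>polys (dim X) D.
     ereal (\<integral>y. f y \<partial>planted X) / ereal (sqrt (\<integral>y. (f y)\<^sup>2 \<partial>null_law X)))"

definition binary_valued :: "instr list \<Rightarrow> nat \<Rightarrow> bool" where
  "binary_valued p N \<longleftrightarrow> (\<forall>y \<omega>. result p N y \<omega> 0 \<in> {0, 1})"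

definition prob_output :: "instr list \<Rightarrow> nat \<Rightarrow> (nat \<Rightarrow> real) measure \<Rightarrow> real \<Rightarrow> real" where
  "prob_output p N \<mu> b =
     measure (\<mu> \<Otimes>\<^sub>M seed) {(y, \<omega>) \<in> space (\<mu> \<Otimes>\<^sub>M seed). result p N y \<omega> 0 = b}"

definition error_sum :: "instr list \<Rightarrow> testing_problem \<Rightarrow> real" where
  "error_sum p X = prob_output p (dim X) (null_law X) 1 + prob_output p (dim X) (planted X) 0"

definition strong_detection :: "(nat \<Rightarrow> instr list) \<Rightarrow> (nat \<Rightarrow> testing_problem) \<Rightarrow> bool" where
  "strong_detection A X \<longleftrightarrow> (\<lambda>n. error_sum (A n) (X n)) \<longlonglongrightarrow> 0"

definition weak_detection :: "(nat \<Rightarrow> instr list) \<Rightarrow> (nat \<Rightarrow> testing_problem) \<Rightarrow> bool" where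
  "weak_detection A X \<longleftrightarrow> (\<exists>\<epsilon>>0. \<forall>\<^sub>F n in sequentially. error_sum (A n) (X n) \<le> 1 - \<epsilon>)"

definition test_in_time ::
  "(nat \<Rightarrow> instr list) \<Rightarrow> (nat \<Rightarrow> testing_problem) \<Rightarrow> (nat \<Rightarrow> real) \<Rightarrow> bool" where
  "test_in_time A X T \<longleftrightarrow>
     (\<forall>\<^sub>F n in sequentially. binary_valued (A n) (dim (X n)) \<and> runs_in_time (A n) (dim (X n)) (T n))"

definition low_degree_time :: "real \<Rightarrow> (nat \<Rightarrow> nat) \<Rightarrow> (nat \<Rightarrow> testing_problem) \<Rightarrow> nat \<Rightarrow> real" where
  "low_degree_time C D X n =
     real (dim (X n)) powr (real (D n) / (C * ln (real (dim (X n)))))"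

text \<open>
  The low-degree heuristic for every sequence of testing problems in a class \<open>\<X>\<close>, with the constants
  chosen uniformly over \<open>\<X>\<close>. The heuristic for a single sequence \<open>X\<close> is the case \<open>\<X> = {X}\<close>.
\<close>

definition low_degree_heuristic :: "(nat \<Rightarrow> testing_problem) set \<Rightarrow> bool" where
  "low_degree_heuristic \<X> \<longleftrightarrow>
     (\<forall>D :: nat \<Rightarrow> nat.
        (\<exists>C>0. \<forall>X\<in>\<X>. (\<exists>B::real. \<forall>\<^sub>F n in sequentially. Adv (D n) (X n) \<le> ereal B) \<longrightarrow>
           \<not> (\<exists>A. test_in_time A X (low_degree_time C D X) \<and> strong_detection A X)) \<and>
        (\<exists>C>0. \<forall>X\<in>\<X>. (\<lambda>n. Adv (D n) (X n)) \<longlonglongrightarrow> 1 \<longrightarrow>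
           \<not> (\<exists>A. test_in_time A X (low_degree_time C D X) \<and> weak_detection A X)))"

section \<open>Hidden informative sample problems\<close>

definition concat_samples :: "nat \<Rightarrow> nat \<Rightarrow> (nat \<Rightarrow> nat \<Rightarrow> real) \<Rightarrow> nat \<Rightarrow> real" where
  "concat_samples N M s = (\<lambda>k\<in>{..<M * N}. s (k div N) (k mod N))"

definition hidden_sample :: "testing_problem \<Rightarrow> nat \<Rightarrow> testing_problem" where
  "hidden_sample X M =
     \<lparr>dim = M * dim X,
      planted = measure_pmf (pmf_of_set {..<M}) \<bind> (\<lambda>\<kappa>.
        distr (PiM {..<M} (\<lambda>j. if j = \<kappa> then planted X else null_law X))
              (RN (M * dim X)) (concat_samples (dim X) M)),
      null_law = distr (PiM {..<M} (\<lambda>_. null_law X))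
              (RN (M * dim X)) (concat_samples (dim X) M)\<rparr>"

section \<open>Multi-frequency angular synchronization\<close>

text \<open>An \<open>n \<times> n\<close> matrix is a function of which only the values at indices below \<open>n\<close> matter.\<close>

type_synonym cmat = "nat \<Rightarrow> nat \<Rightarrow> complex"

definition frob_inner :: "nat \<Rightarrow> cmat \<Rightarrow> cmat \<Rightarrow> real" where
  "frob_inner n A B = Re (\<Sum>i<n. \<Sum>j<n. cnj (A i j) * B i j)"

definition frob_norm :: "nat \<Rightarrow> cmat \<Rightarrow> real" where
  "frob_norm n A = sqrt (\<Sum>i<n. \<Sum>j<n. (cmod (A i j))\<^sup>2)"

definition phase_space :: "nat \<Rightarrow> (nat \<Rightarrow> real) measure" where
  "phase_space n = PiM {..<n} (\<lambda>_. uniform_measure lborel {0..<2 * pi})"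

definition noise_space :: "nat \<Rightarrow> nat \<Rightarrow> (nat \<times> nat \<times> nat \<Rightarrow> real) measure" where
  "noise_space L n = PiM ({1..L} \<times> {..<n} \<times> {..<n})
     (\<lambda>(l, i, j). density lborel (normal_density 0 (if i = j then 1 else sqrt (1 / 2))))"

text \<open>
  The family \<open>W\<^sub>1, \<dots>, W\<^sub>L\<close> of independent GUE matrices: for \<open>i < j\<close> the coordinates \<open>(l, i, j)\<close> and
  \<open>(l, j, i)\<close> carry the real and the imaginary part of the \<open>(i, j)\<close> entry of \<open>W\<^sub>l\<close>.
\<close>

definition gue :: "(nat \<times> nat \<times> nat \<Rightarrow> real) \<Rightarrow> nat \<Rightarrow> cmat" where
  "gue w l i j =
     (if i = j then complex_of_real (w (l, i, i))
      else if i < j then Complex (w (l, i, j)) (w (l, j, i))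
      else cnj (Complex (w (l, j, i)) (w (l, i, j))))"

text \<open>The matrix \<open>\<Theta>\<^sub>l\<close>, with \<open>x\<^sub>i = exp (\<i> \<phi>\<^sub>i)\<close>.\<close>

definition signal :: "real \<Rightarrow> nat \<Rightarrow> (nat \<Rightarrow> real) \<Rightarrow> nat \<Rightarrow> cmat" where
  "signal lam n \<phi> l i j =
     complex_of_real (lam / sqrt (real n)) * (cis (\<phi> i) ^ l * cnj (cis (\<phi> j) ^ l))"

definition observation ::
  "real \<Rightarrow> nat \<Rightarrow> (nat \<Rightarrow> real) \<Rightarrow> (nat \<times> nat \<times> nat \<Rightarrow> real) \<Rightarrow> nat \<Rightarrow> cmat" where
  "observation lam n \<phi> w l i j = signal lam n \<phi> l i j + gue w l i j"

text \<open>
  \<open>L\<close> complex \<open>n \<times> n\<close> matrices as a vector in \<open>\<real>\<^sup>N\<close>, \<open>N = 2 L n\<^sup>2\<close>: matrix after matrix, row by row,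
  the real part of each entry followed by its imaginary part.
\<close>

definition model_dim :: "nat \<Rightarrow> nat \<Rightarrow> nat" where
  "model_dim L n = 2 * L * n * n"

definition vectorize :: "nat \<Rightarrow> nat \<Rightarrow> (nat \<Rightarrow> cmat) \<Rightarrow> nat \<Rightarrow> real" where
  "vectorize L n Y = (\<lambda>k\<in>{..<model_dim L n}.
     let e = k div 2; z = Y (Suc (e div (n * n))) (e div n mod n) (e mod n)
     in if even k then Re z else Im z)"

definition matrix_of :: "nat \<Rightarrow> (nat \<Rightarrow> real) \<Rightarrow> cmat" where
  "matrix_of n v i j = Complex (v (2 * (i * n + j))) (v (2 * (i * n + j) + 1))"

definition sync_problem :: "real \<Rightarrow> nat \<Rightarrow> nat \<Rightarrow> testing_problem" where
  "sync_problem lam L n =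
     \<lparr>dim = model_dim L n,
      planted = distr (phase_space n \<Otimes>\<^sub>M noise_space L n) (RN (model_dim L n))
        (\<lambda>(\<phi>, w). vectorize L n (observation lam n \<phi> w)),
      null_law = distr (noise_space L n) (RN (model_dim L n)) (\<lambda>w. vectorize L n (gue w))\<rparr>"

definition subpolynomial :: "(nat \<Rightarrow> real) \<Rightarrow> bool" where
  "subpolynomial f \<longleftrightarrow>
     (\<exists>\<epsilon>. \<epsilon> \<longlonglongrightarrow> 0 \<and> (\<forall>\<^sub>F n in sequentially. f n = real n powr \<epsilon> n))"

definition admissible :: "(nat \<Rightarrow> real) \<Rightarrow> (nat \<Rightarrow> nat) \<Rightarrow> bool" where
  "admissible lam L \<longleftrightarrow>
     subpolynomial (\<lambda>n. real (L n)) \<and> (\<exists>\<delta>>0. \<forall>n. 0 \<le> lam n \<and> lam n < 1 - \<delta>)"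

text \<open>
  For the base pair given by \<open>lam\<close> and \<open>L\<close> and a bound \<open>\<Delta>\<close> on its squared advantage, the class of
  hidden informative sample problems with all sample numbers \<open>M\<close> such that \<open>\<Delta> \<lless> M \<le> N \<Delta>\<close>.
\<close>

definition hidden_sample_problems ::
  "(nat \<Rightarrow> real) \<Rightarrow> (nat \<Rightarrow> nat) \<Rightarrow> (nat \<Rightarrow> real) \<Rightarrow> (nat \<Rightarrow> testing_problem) set" where
  "hidden_sample_problems lam L \<Delta> =
     {\<lambda>n. hidden_sample (sync_problem (lam n) (L n) n) (M n) | M :: nat \<Rightarrow> nat.
        (\<lambda>n. \<Delta> n / real (M n)) \<longlonglongrightarrow> 0 \<and>
        (\<forall>\<^sub>F n in sequentially. 0 < M n \<and> real (M n) \<le> real (model_dim (L n) n) * \<Delta> n)}"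

definition sync_heuristic :: bool where
  "sync_heuristic \<longleftrightarrow>
     (\<forall>lam L. \<forall>D :: nat \<Rightarrow> nat. \<forall>\<Delta> :: nat \<Rightarrow> real.
        admissible lam L \<longrightarrow>
        (\<forall>n. 1 < \<Delta> n \<and> (Adv (D n) (sync_problem (lam n) (L n) n))\<^sup>2 \<le> ereal (\<Delta> n)) \<longrightarrow>
        low_degree_heuristic (hidden_sample_problems lam L \<Delta>))"

text \<open>
  The estimator is read off the first \<open>2 n\<^sup>2\<close> memory cells on halting. A quotient with zero
  denominator is zero.
\<close>

definition expected_correlation ::
  "real \<Rightarrow> nat \<Rightarrow> nat \<Rightarrow> nat \<Rightarrow> instr list \<Rightarrow> real" where
  "expected_correlation lam L n l p =
     (\<integral>(\<phi>, w, \<omega>).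
        (let X = matrix_of n (result p (model_dim L n) (vectorize L n (observation lam n \<phi> w)) \<omega>);
             \<Theta> = signal lam n \<phi> l
         in frob_inner n X \<Theta> / (frob_norm n X * frob_norm n \<Theta>))
      \<partial>(phase_space n \<Otimes>\<^sub>M (noise_space L n \<Otimes>\<^sub>M seed)))"

definition weak_recovery ::
  "(nat \<Rightarrow> real) \<Rightarrow> (nat \<Rightarrow> nat) \<Rightarrow> (nat \<Rightarrow> nat) \<Rightarrow> (nat \<Rightarrow> instr list) \<Rightarrow> bool" where
  "weak_recovery lam L l A \<longleftrightarrow>
     (\<exists>c>0. \<forall>\<^sub>F n in sequentially. c \<le> expected_correlation (lam n) (L n) n (l n) (A n))"

definition subexponential_time ::
  "(nat \<Rightarrow> nat) \<Rightarrow> (nat \<Rightarrow> instr list) \<Rightarrow> bool" where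
  "subexponential_time N A \<longleftrightarrow>
     (\<exists>f. subpolynomial f \<and> (\<forall>\<^sub>F n in sequentially. runs_in_time (A n) (N n) (exp (f n))))"

end

theory Submission
  imports Defs "HOL-Computational_Algebra.Polynomial" "HOL-Real_Asymp.Real_Asymp"
begin

text \<open>
  Fix \<open>r\<close> with \<open>\<lambda> < r < 1\<close>. In the hidden sample problem for signal strength \<open>r\<close>, a second-moment computation
  with Hermite polynomials bounds the squared advantage by \<open>1 + B / M\<close>, where \<open>B = E exp\<^sub>D(S)\<close> is a truncated
  exponential moment of the overlap \<open>S\<close> of two independent signals. For \<open>D = n\<^bsup>1/8\<^esup>\<close> one has \<open>B = exp(o(D))\<close>, so
  \<open>M \<approx> N B\<close> samples have advantage \<open>1 + o(1)\<close>, and weak detection is hard in time \<open>exp(\<Omega>(D))\<close>.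

  Conversely, an estimator for strength \<open>\<lambda>\<close> yields a test. Adding fresh Gaussian noise splits a sample into two
  independent ones, of strengths \<open>\<lambda>\<close> and \<open>\<beta> r\<close>, \<open>\<beta> > 0\<close>. The output of the estimator on the first is correlated
  with the second: on a planted sample this is of order \<open>\<surd>n\<close> with probability bounded below, on a null sample it
  has Gaussian tails, so that a union bound over \<open>M = exp(o(n))\<close> samples is affordable. Declaring \<open>P\<close> if one of the
  samples passes achieves weak detection in time \<open>M\<close> times that of the estimator.
\<close>

section \<open>Hermite polynomials\<close>

text \<open>Why B = exp(o(D)) below strength 1: the overlap is a sum of 2 L squares of nearly
  Gaussian y of variance at most 1/2. In E y^(2m) / m! the optimal exponential bound gains exp(- m)
  from Stirling's formula and loses exp(m) to the moment generating function. The two cancel, so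
  each square contributes only a polynomial in D, and B = exp(O(L ln D)). The Gaussian approximation
  wants (2 D)^3 <= sqrt n, whence D = n^(1/8).

  Why r > \<lambda>: on null samples nothing is known about the correlation of the output with the
  very sample it was computed from. The surplus of strength pays for a second sample, independent of
  the first given the signal; relative to it the output is a fixed matrix and the correlation a
  Gaussian linear form.

  The heuristic speaks of programs, so the test has to be one: M copies of the estimator, unrolled
  one after another, with separate memories. The permitted time exp(D / C) does not depend on the
  dimension, which is what lets M grow.\<close>

abbreviation std_gauss :: "real measure" where
  "std_gauss \<equiv> density lborel (\<lambda>x. ennreal (std_normal_density x))"

lemma prob_space_std_gauss: "prob_space std_gauss"
  using prob_space_normal_density[of 1 0] by simp

lemma std_gauss_integral:
  assumes "f \<in> borel_measurable borel"
  shows "(\<integral>x. f x \<partial>std_gauss) = (\<integral>x. std_normal_density x * f x \<partial>lborel)"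
  using assms by (subst integral_density) (auto simp: normal_density_nonneg)

lemma std_gauss_integrable:
  assumes "f \<in> borel_measurable borel"
  shows "integrable std_gauss f \<longleftrightarrow> integrable lborel (\<lambda>x. std_normal_density x * f x)"
  using assms by (subst integrable_density) (auto simp: normal_density_nonneg)

lemma integrable_std_gauss_power: "integrable std_gauss (\<lambda>x. x ^ k)"
  by (subst std_gauss_integrable) (auto intro: integrable_std_normal_moment)

lemma borel_measurable_poly [measurable]: "poly (p :: real poly) \<in> borel_measurable borel"
  by (intro borel_measurable_continuous_onI continuous_intros)

lemma integrable_std_gauss_poly: "integrable std_gauss (poly p)"
proof -
  have "integrable std_gauss (\<lambda>x. \<Sum>i\<le>degree p. coeff p i * x ^ i)"
    by (intro Bochner_Integration.integrable_sum integrable_mult_right integrable_std_gauss_power)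
  then show ?thesis by (simp add: poly_altdef[abs_def])
qed

text \<open>The argument is a formal polynomial: derivatives and shifts are then algebraic
  operations, and integrability holds throughout.\<close>

definition gmean :: "real poly \<Rightarrow> real" where
  "gmean p = (\<integral>x. poly p x \<partial>std_gauss)"

lemma gmean_add: "gmean (p + q) = gmean p + gmean q"
  by (simp add: gmean_def integrable_std_gauss_poly)

lemma gmean_diff: "gmean (p - q) = gmean p - gmean q"
  by (simp add: gmean_def integrable_std_gauss_poly)

lemma gmean_smult: "gmean (smult c p) = c * gmean p"
  by (simp add: gmean_def)

lemma gmean_1 [simp]: "gmean 1 = 1"
proof -
  interpret prob_space std_gauss by (rule prob_space_std_gauss)
  show ?thesis using prob_space by (simp add: gmean_def)
qed

lemma gmean_monom_even: "gmean (monom 1 (2 * k)) = fact (2 * k) / (2 ^ k * fact k)"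
  by (simp add: gmean_def poly_monom std_gauss_integral integral_std_normal_moment_even)

lemma gmean_monom_odd: "gmean (monom 1 (2 * k + 1)) = 0"
  using integral_std_normal_moment_odd[of k]
  by (simp add: gmean_def poly_monom std_gauss_integral)

text \<open>Gaussian integration by parts for x^m. At \<open>m = 0\<close> the truncated
  \<open>m - 1\<close> is harmless, its factor being 0.\<close>

lemma gmean_monom_rec: "gmean (monom 1 (Suc m)) = of_nat m * gmean (monom 1 (m - 1))"
proof (cases "even m")
  case True
  then obtain k where m: "m = 2 * k" by (elim evenE)
  have "gmean (monom 1 (Suc m)) = 0"
    using gmean_monom_odd[of k] by (simp add: m)
  moreover have "of_nat m * gmean (monom 1 (m - 1)) = 0"
    using gmean_monom_odd[of "k - 1"] by (cases k) (auto simp: m)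
  ultimately show ?thesis by simp
next
  case False
  then obtain k where m: "m = 2 * k + 1" by (elim oddE)
  have "gmean (monom 1 (Suc m)) = fact (2 * Suc k) / (2 ^ Suc k * fact (Suc k))"
    using gmean_monom_even[of "Suc k"] by (simp add: m)
  also have "\<dots> = of_nat m * (fact (2 * k) / (2 ^ k * fact k))"
    by (simp add: m divide_simps)
  finally show ?thesis by (simp add: m gmean_monom_even)
qed

text \<open>Both sides are linear in \<open>p\<close>, so the moment recursion on monomials
  suffices. As \<open>pCons 0 p\<close> is x p(x), this is Stein's identity; orthogonality and the
  shift formula for Hermite polynomials follow from it by algebra.\<close>

lemma gauss_stein: "gmean (pderiv p) = gmean (pCons 0 p)"
proof -
  have "gmean (pderiv (monom 1 m)) = gmean (pCons 0 (monom 1 m))" for m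
  proof -
    have "pderiv (monom 1 m) = smult (real m) (monom 1 (m - 1))"
      by (simp add: pderiv_monom smult_monom)
    then show ?thesis
      using gmean_monom_rec[of m] by (simp only: gmean_smult monom_Suc)
  qed
  then have m: "gmean (pderiv (monom c m)) = gmean (pCons 0 (monom c m))" for c m
    using gmean_smult[of c "pderiv (monom 1 m)"] gmean_smult[of c "pCons 0 (monom 1 m)"]
    by (simp add: smult_monom flip: pderiv_smult)
  have "gmean (pderiv (\<Sum>i\<le>n. monom (coeff p i) i)) = gmean (pCons 0 (\<Sum>i\<le>n. monom (coeff p i) i))" for n
  proof (induction n)
    case (Suc n)
    have "pCons 0 (\<Sum>i\<le>Suc n. monom (coeff p i) i)
        = pCons 0 (\<Sum>i\<le>n. monom (coeff p i) i) + pCons 0 (monom (coeff p (Suc n)) (Suc n))"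
      by simp
    then show ?case using Suc by (simp only: pderiv_add gmean_add m sum.atMost_Suc)
  qed (simp add: m)
  from this[of "degree p"] show ?thesis by (simp add: poly_as_sum_of_monoms)
qed

text \<open>Probabilists' normalisation: leading coefficient 1 and squared Gaussian norm j!.\<close>

fun herm :: "nat \<Rightarrow> real poly" where
  "herm 0 = 1"
| "herm (Suc 0) = pCons 0 1"
| "herm (Suc (Suc j)) = pCons 0 (herm (Suc j)) - smult (of_nat (Suc j)) (herm j)"

lemma herm_Suc: "herm (Suc j) = pCons 0 (herm j) - smult (of_nat j) (herm (j - 1))"
  by (cases j) auto

lemma pderiv_herm: "pderiv (herm j) = smult (of_nat j) (herm (j - 1))"
proof (induction j rule: herm.induct)
  case (3 j)
  have "pderiv (herm (Suc (Suc j))) = herm (Suc j) + pCons 0 (pderiv (herm (Suc j))) - smult (of_nat (Suc j)) (pderiv (herm j))"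
    by (simp add: pderiv_diff pderiv_smult pderiv_pCons)
  also have "\<dots> = herm (Suc j) + smult (of_nat (Suc j)) (pCons 0 (herm j) - smult (of_nat j) (herm (j - 1)))"
    by (simp only: 3) (simp add: smult_diff_right mult.commute)
  also have "\<dots> = smult (of_nat (Suc (Suc j))) (herm (Suc j))"
    unfolding herm_Suc[symmetric] of_nat_Suc[of "Suc j"] smult_add_left by simp
  finally show ?case by simp
qed (auto simp: pderiv_pCons)

text \<open>In \<open>rec\<close> the factor x of the recursion is traded for a derivative by
  Stein's identity. The derivative of \<open>herm i\<close> cancels the subtracted term, and the
  index drops by one in both factors.\<close>

lemma gmean_herm_mult: "gmean (herm i * herm j) = (if i = j then fact i else 0)"
proof -
  have rec: "gmean (herm (Suc i) * herm j) = of_nat j * gmean (herm i * herm (j - 1))" for i j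
  proof -
    have "gmean (herm (Suc i) * herm j) = gmean (pCons 0 (herm i * herm j)) - of_nat i * gmean (herm (i - 1) * herm j)"
      unfolding herm_Suc by (simp add: left_diff_distrib gmean_diff gmean_smult)
    also have "gmean (pCons 0 (herm i * herm j)) = gmean (pderiv (herm i * herm j))"
      by (rule gauss_stein[symmetric])
    also have "\<dots> = of_nat i * gmean (herm (i - 1) * herm j) + of_nat j * gmean (herm i * herm (j - 1))"
      by (simp add: pderiv_mult pderiv_herm gmean_add gmean_smult mult.commute)
    finally show ?thesis by simp
  qed
  have zero: "gmean (herm (Suc j)) = 0" for j
    using rec[of j 0] by simp
  show ?thesis
  proof (induction i arbitrary: j)
    case 0
    then show ?case by (cases j) (auto simp: zero)
  next
    case (Suc i)
    then show ?case by (cases j) (auto simp: rec zero)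
  qed
qed

text \<open>After the shift the factor x of the recursion becomes s + x. Stein's identity turns the
  part x into a derivative, which cancels the subtracted term and leaves s times the previous value.
  This makes the planted mean of a Hermite product a monomial in the signal.\<close>

lemma gmean_herm_shift: "gmean (pcompose (herm j) [:s, 1:]) = s ^ j"
proof (induction j rule: herm.induct)
  case 2
  have "gmean [:s, 1:] = gmean (smult s 1 + herm 1 * herm 0)"
    by (simp add: one_pCons)
  also have "\<dots> = s" by (simp only: gmean_add gmean_smult gmean_herm_mult) simp
  finally show ?case by (simp add: pcompose_pCons pcompose_1 one_pCons)
next
  case (3 j)
  let ?H = "\<lambda>j. pcompose (herm j) [:s, 1:]"
  have "?H (Suc (Suc j)) = smult s (?H (Suc j)) + pCons 0 (?H (Suc j)) - smult (of_nat (Suc j)) (?H j)"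
    by (simp add: pcompose_diff pcompose_smult pcompose_pCons)
  then have "gmean (?H (Suc (Suc j))) = s * s ^ Suc j + gmean (pCons 0 (?H (Suc j))) - of_nat (Suc j) * s ^ j"
    by (simp only: gmean_add gmean_diff gmean_smult 3)
  also have "gmean (pCons 0 (?H (Suc j))) = gmean (pderiv (?H (Suc j)))"
    by (rule gauss_stein[symmetric])
  also have "pderiv (?H (Suc j)) = smult (of_nat (Suc j)) (?H j)"
    by (simp add: pderiv_pcompose pderiv_herm pcompose_smult pderiv_pCons del: herm.simps)
  finally show ?case by (simp only: gmean_smult 3) simp
qed (simp add: pcompose_1)

lemma power_herm_expansion: "\<exists>b. \<forall>x. x ^ m = (\<Sum>j\<le>m. b j * poly (herm j) x)"
proof (induction m)
  case 0
  show ?case by (rule exI[of _ "\<lambda>_. 1"]) simp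
next
  case (Suc m)
  then obtain b where b: "\<And>x. x ^ m = (\<Sum>j\<le>m. b j * poly (herm j) x)" by blast
  have mul: "x * poly (herm j) x = poly (herm (Suc j)) x + of_nat j * poly (herm (j - 1)) x" for x j
    by (simp add: herm_Suc)
  \<comment> \<open>x times \<open>herm j\<close> is \<open>herm (Suc j)\<close> plus j times
    \<open>herm (j - 1)\<close>, so index j receives from j - 1 and from j + 1.\<close>
  define b' where "b' j = (if j = 0 then 0 else b (j - 1)) + (if Suc j \<le> m then b (Suc j) * of_nat (Suc j) else 0)" for j
  have "x ^ Suc m = (\<Sum>j\<le>Suc m. b' j * poly (herm j) x)" for x
  proof -
    have "x ^ Suc m = (\<Sum>j\<le>m. b j * (x * poly (herm j) x))"
      by (simp add: b sum_distrib_left algebra_simps)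
    also have "\<dots> = (\<Sum>j\<le>m. b j * poly (herm (Suc j)) x) + (\<Sum>j\<le>m. b j * (of_nat j * poly (herm (j - 1)) x))"
      by (simp add: mul algebra_simps sum.distrib)
    also have "(\<Sum>j\<le>m. b j * poly (herm (Suc j)) x) = (\<Sum>j\<le>Suc m. (if j = 0 then 0 else b (j - 1)) * poly (herm j) x)"
      by (subst sum.atMost_Suc_shift) simp
    also have "(\<Sum>j\<le>m. b j * (of_nat j * poly (herm (j - 1)) x)) 
       = (\<Sum>j<m. b (Suc j) * (of_nat (Suc j) * poly (herm j) x))"
      by (subst sum.atMost_shift) simp
    also have "\<dots> = (\<Sum>j\<le>Suc m. (if Suc j \<le> m then b (Suc j) * of_nat (Suc j) else 0) * poly (herm j) x)"
      by (rule sum.mono_neutral_cong_left) (auto simp del: herm.simps)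
    finally show ?thesis by (simp only: b'_def sum.distrib distrib_right)
  qed
  then show ?case by blast
qed

section \<open>The advantage in additive Gaussian models\<close>

text \<open>The likelihood ratios of two Gaussian shifts \<xi> and \<xi>' have a product whose null
  mean is exp of their inner product; restricted to degree at most D, this becomes
  \<open>texp D\<close> of it.\<close>

definition texp :: "nat \<Rightarrow> real \<Rightarrow> real" where
  "texp D x = (\<Sum>d\<le>D. x ^ d / fact d)"

text \<open>\<open>exponents\<close> over an arbitrary index set, because the Gaussian coordinates
  are indexed by triples, and by pairs with a sample number when there are several samples.\<close>

definition exps :: "'i set \<Rightarrow> nat \<Rightarrow> ('i \<Rightarrow> nat) set" where
  "exps I D = {a \<in> I \<rightarrow>\<^sub>E {..D}. (\<Sum>i\<in>I. a i) \<le> D}"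

lemma exponents_eq_exps: "exponents N D = exps {..<N} D"
  by (simp add: exponents_def exps_def)

lemma finite_exps [simp]: "finite I \<Longrightarrow> finite (exps I D)"
  by (rule finite_subset[of _ "I \<rightarrow>\<^sub>E {..D}"]) (auto simp: exps_def intro: finite_PiE)

lemma exps_memI: "finite I \<Longrightarrow> a \<in> extensional I \<Longrightarrow> (\<Sum>i\<in>I. a i) \<le> D \<Longrightarrow> a \<in> exps I D"
  by (auto simp: exps_def PiE_iff intro: order_trans[OF member_le_sum[of _ I a]])

text \<open>The binomial theorem sorted by the power j of y, which leaves degree
  \<open>D - j\<close> for x; it is the inductive step of \<open>texp_sum\<close>.\<close>

lemma texp_add: "texp D (x + y) = (\<Sum>j\<le>D. y ^ j / fact j * texp (D - j) x)"
proof -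
  have "(x + y) ^ d / fact d = (\<Sum>j\<le>d. (y ^ j / fact j) * (x ^ (d - j) / fact (d - j)))" for d
  proof -
    have "(x + y) ^ d = (\<Sum>j\<le>d. of_nat (d choose j) * y ^ j * x ^ (d - j))"
      using binomial_ring[of y x d] by (simp add: add.commute)
    also have "\<dots> / fact d = (\<Sum>j\<le>d. (y ^ j / fact j) * (x ^ (d - j) / fact (d - j)))"
      unfolding sum_divide_distrib
      by (rule sum.cong) (auto simp: binomial_fact field_simps)
    finally show ?thesis .
  qed
  then have "texp D (x + y) = (\<Sum>d\<le>D. \<Sum>j\<le>d. (y ^ j / fact j) * (x ^ (d - j) / fact (d - j)))"
    by (simp add: texp_def)
  also have "\<dots> = (\<Sum>j\<le>D. \<Sum>i\<le>D - j. (y ^ j / fact j) * (x ^ i / fact i))"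
  proof -
    have "(SIGMA j:{..D}. {..D - j}) = {(j, i). j + i \<le> D}" by auto
    then show ?thesis
      using sum.triangle_reindex_eq[of "\<lambda>j i. (y ^ j / fact j) * (x ^ i / fact i)" D]
        sum.Sigma[of "{..D}" "\<lambda>j. {..D - j}" "\<lambda>j i. (y ^ j / fact j) * (x ^ i / fact i)"]
      by simp
  qed
  also have "\<dots> = (\<Sum>j\<le>D. y ^ j / fact j * texp (D - j) x)"
    by (simp add: texp_def sum_distrib_left)
  finally show ?thesis .
qed

lemma exps_insert_bij:
  assumes "finite I" "k \<notin> I"
  shows "bij_betw (\<lambda>(j, a). a(k := j)) (SIGMA j:{..D}. exps I (D - j)) (exps (insert k I) D)"
proof (rule bij_betw_byWitness[where f'="\<lambda>a. (a k, restrict a I)"])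
  have s: "(\<Sum>i\<in>insert k I. (a(k := j)) i) = j + (\<Sum>i\<in>I. a i)" for a :: "'a \<Rightarrow> nat" and j
  proof -
    have "(\<Sum>i\<in>I. (a(k := j)) i) = (\<Sum>i\<in>I. a i)" using assms by (intro sum.cong) auto
    then show ?thesis using assms by simp
  qed
  show "(\<lambda>(j, a). a(k := j)) ` (SIGMA j:{..D}. exps I (D - j)) \<subseteq> exps (insert k I) D"
  proof safe
    fix j a assume j: "j \<le> D" and a: "a \<in> exps I (D - j)"
    show "a(k := j) \<in> exps (insert k I) D"
      by (rule exps_memI) (use assms j a s[of a j] in \<open>auto simp: exps_def PiE_iff extensional_def\<close>)
  qed
  show "(\<lambda>a. (a k, restrict a I)) ` exps (insert k I) D \<subseteq> (SIGMA j:{..D}. exps I (D - j))"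
  proof safe
    fix a assume a: "a \<in> exps (insert k I) D"
    then have "a k + (\<Sum>i\<in>I. a i) \<le> D" using assms by (auto simp: exps_def)
    then show "a k \<le> D" "restrict a I \<in> exps I (D - a k)"
      using assms by (auto intro!: exps_memI)
  qed
qed (use assms in \<open>auto simp: exps_def PiE_iff extensional_def fun_eq_iff\<close>)

text \<open>The multinomial theorem cut at total degree D. Read backwards, it expands a function of
  an inner product into the monomials that Hermite coefficients produce.\<close>

lemma texp_sum:
  assumes "finite I"
  shows "(\<Sum>a\<in>exps I D. \<Prod>i\<in>I. x i ^ a i / fact (a i)) = texp D (\<Sum>i\<in>I. x i)"
  using assms
proof (induction I arbitrary: D rule: finite_induct)
  case empty
  have "card (exps {} D) = 1" by (simp add: exps_def)
  moreover have "texp D 0 = 1" by (simp add: texp_def power_0_left if_distrib[of "\<lambda>x. x / _"] sum.delta cong: if_cong)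
  ultimately show ?case by simp
next
  case (insert k I)
  have *: "(\<Prod>i\<in>insert k I. x i ^ (a(k := j)) i / fact ((a(k := j)) i))
      = x k ^ j / fact j * (\<Prod>i\<in>I. x i ^ a i / fact (a i))" for a j
  proof -
    have "(\<Prod>i\<in>I. x i ^ (a(k := j)) i / fact ((a(k := j)) i)) = (\<Prod>i\<in>I. x i ^ a i / fact (a i))"
      using insert by (intro prod.cong) auto
    then show ?thesis using insert by simp
  qed
  have "(\<Sum>a\<in>exps (insert k I) D. \<Prod>i\<in>insert k I. x i ^ a i / fact (a i))
      = (\<Sum>(j, a)\<in>(SIGMA j:{..D}. exps I (D - j)). \<Prod>i\<in>insert k I. x i ^ (a(k := j)) i / fact ((a(k := j)) i))"
    by (subst sum.reindex_bij_betw[OF exps_insert_bij[OF insert(1,2)], symmetric])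
       (simp add: case_prod_beta)
  also have "\<dots> = (\<Sum>j\<le>D. \<Sum>a\<in>exps I (D - j). x k ^ j / fact j * (\<Prod>i\<in>I. x i ^ a i / fact (a i)))"
    unfolding * using insert(1) by (subst sum.Sigma) auto
  also have "\<dots> = texp D ((\<Sum>i\<in>I. x i) + x k)"
    by (simp only: sum_distrib_left[symmetric] insert.IH texp_add)
  finally show ?case using insert by (simp add: add.commute)
qed

text \<open>Independence and normality enter through the means of products of one-variable
  polynomials alone. In this form the property is inherited by the product of M copies of the
  probability space.\<close>

locale gaussian_family = prob_space \<Omega> for \<Omega> :: "'w measure" +
  fixes I :: "'i set" and G :: "'w \<Rightarrow> 'i \<Rightarrow> real"
  assumes finite_I [simp]: "finite I"
    and measurable_G: "\<And>i. i \<in> I \<Longrightarrow> (\<lambda>\<omega>. G \<omega> i) \<in> borel_measurable \<Omega>"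
    and integrable_prod_poly: "\<And>p. integrable \<Omega> (\<lambda>\<omega>. \<Prod>i\<in>I. poly (p i) (G \<omega> i))"
    and integral_prod_poly: "\<And>p. (\<integral>\<omega>. (\<Prod>i\<in>I. poly (p i) (G \<omega> i)) \<partial>\<Omega>) = (\<Prod>i\<in>I. gmean (p i))"
begin

definition hermI :: "('i \<Rightarrow> nat) \<Rightarrow> ('i \<Rightarrow> real) \<Rightarrow> real" where
  "hermI a u = (\<Prod>i\<in>I. poly (herm (a i)) (u i))"

lemma hermI_shift:
  "integrable \<Omega> (\<lambda>\<omega>. hermI a (\<lambda>i. G \<omega> i + \<xi> i))"
  "(\<integral>\<omega>. hermI a (\<lambda>i. G \<omega> i + \<xi> i) \<partial>\<Omega>) = (\<Prod>i\<in>I. \<xi> i ^ a i)"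
  using integrable_prod_poly[of "\<lambda>i. pcompose (herm (a i)) [:\<xi> i, 1:]"]
    integral_prod_poly[of "\<lambda>i. pcompose (herm (a i)) [:\<xi> i, 1:]"]
  by (simp_all add: hermI_def poly_pcompose add.commute gmean_herm_shift)

lemma hermI_mult:
  "integrable \<Omega> (\<lambda>\<omega>. hermI a (G \<omega>) * hermI b (G \<omega>))"
  "(\<integral>\<omega>. hermI a (G \<omega>) * hermI b (G \<omega>) \<partial>\<Omega>) = (\<Prod>i\<in>I. if a i = b i then fact (a i) else 0)"
  using integrable_prod_poly[of "\<lambda>i. herm (a i) * herm (b i)"]
    integral_prod_poly[of "\<lambda>i. herm (a i) * herm (b i)"]
  by (simp_all add: hermI_def prod.distrib gmean_herm_mult)

lemma hermI_orth:
  assumes "a \<in> exps I D" "b \<in> exps I D"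
  shows "(\<integral>\<omega>. hermI a (G \<omega>) * hermI b (G \<omega>) \<partial>\<Omega>) = (if a = b then (\<Prod>i\<in>I. fact (a i)) else 0)"
proof (cases "a = b")
  case False
  then obtain i where "a i \<noteq> b i" by blast
  then have "i \<in> I" using assms by (auto simp: exps_def PiE_iff extensional_def) metis+
  moreover note \<open>a i \<noteq> b i\<close>
  ultimately show ?thesis using False by (auto simp: hermI_mult intro!: prod_zero)
qed (simp add: hermI_mult)

lemma herm_norm:
  "(\<integral>\<omega>. (\<Sum>a\<in>exps I D. c a * hermI a (G \<omega>))\<^sup>2 \<partial>\<Omega>) = (\<Sum>a\<in>exps I D. (c a)\<^sup>2 * (\<Prod>i\<in>I. fact (a i)))"
proof -
  have "(\<integral>\<omega>. (\<Sum>a\<in>exps I D. c a * hermI a (G \<omega>))\<^sup>2 \<partial>\<Omega>)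
     = (\<integral>\<omega>. (\<Sum>a\<in>exps I D. \<Sum>b\<in>exps I D. c a * c b * (hermI a (G \<omega>) * hermI b (G \<omega>))) \<partial>\<Omega>)"
    by (simp add: power2_eq_square sum_product algebra_simps)
  also have "\<dots> = (\<Sum>a\<in>exps I D. \<Sum>b\<in>exps I D. c a * c b * (\<integral>\<omega>. hermI a (G \<omega>) * hermI b (G \<omega>) \<partial>\<Omega>))"
    by (simp add: hermI_mult(1))
  also have "\<dots> = (\<Sum>a\<in>exps I D. \<Sum>b\<in>exps I D. if a = b then (c a)\<^sup>2 * (\<Prod>i\<in>I. fact (a i)) else 0)"
    by (intro sum.cong) (auto simp: hermI_orth power2_eq_square)
  finally show ?thesis by simp
qed

text \<open>A power u^m involves Hermite polynomials of index at most m, so the total degree does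
  not grow.\<close>

lemma prod_power_herm_span:
  assumes "(\<Sum>i\<in>I. a i) \<le> D"
  shows "\<exists>c. \<forall>u. (\<Prod>i\<in>I. u i ^ a i) = (\<Sum>b\<in>exps I D. c b * hermI b u)"
proof -
  obtain \<beta> where \<beta>: "\<And>m x. x ^ m = (\<Sum>j\<le>m. \<beta> m j * poly (herm j) x)"
    using power_herm_expansion by metis
  let ?S = "Pi\<^sub>E I (\<lambda>i. {..a i})"
  have sub: "?S \<subseteq> exps I D"
  proof
    fix b assume b: "b \<in> ?S"
    then have "(\<Sum>i\<in>I. b i) \<le> (\<Sum>i\<in>I. a i)" by (intro sum_mono) (auto simp: PiE_iff)
    with assms b show "b \<in> exps I D" by (intro exps_memI) (auto simp: PiE_iff)
  qed
  have "(\<Prod>i\<in>I. u i ^ a i) = (\<Sum>b\<in>exps I D. (if b \<in> ?S then \<Prod>i\<in>I. \<beta> (a i) (b i) else 0) * hermI b u)" for u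
  proof -
    have "(\<Prod>i\<in>I. u i ^ a i) = (\<Prod>i\<in>I. \<Sum>j\<le>a i. \<beta> (a i) j * poly (herm j) (u i))"
      by (subst \<beta>) simp
    also have "\<dots> = (\<Sum>b\<in>?S. \<Prod>i\<in>I. \<beta> (a i) (b i) * poly (herm (b i)) (u i))"
      by (rule prod_sum_PiE) auto
    also have "\<dots> = (\<Sum>b\<in>?S. (\<Prod>i\<in>I. \<beta> (a i) (b i)) * hermI b u)"
      by (simp add: hermI_def prod.distrib)
    also have "\<dots> = (\<Sum>b\<in>exps I D. (if b \<in> ?S then \<Prod>i\<in>I. \<beta> (a i) (b i) else 0) * hermI b u)"
      by (rule sum.mono_neutral_cong_left) (use sub in auto)
    finally show ?thesis .
  qed
  then show ?thesis by (intro exI[of _ "\<lambda>b. if b \<in> ?S then \<Prod>i\<in>I. \<beta> (a i) (b i) else 0"]) blast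
qed

text \<open>Entries (i, j) and (j, i) of a Hermitian matrix read the same Gaussians, so
  \<open>ix\<close> cannot be assumed injective. The exponents that meet in one Gaussian are
  collected in \<open>a'\<close>, which preserves the total degree.\<close>

lemma monomial_herm_span:
  fixes e :: "nat \<Rightarrow> real"
  assumes "\<And>k. k < N \<Longrightarrow> ix k \<in> I" and "(\<Sum>k<N. a k) \<le> D"
  shows "\<exists>c. \<forall>u. (\<Prod>k<N. (e k * u (ix k)) ^ a k) = (\<Sum>b\<in>exps I D. c b * hermI b u)"
proof -
  define a' where "a' i = (\<Sum>k\<in>{k\<in>{..<N}. ix k = i}. a k)" for i
  have "(\<Sum>i\<in>I. a' i) = (\<Sum>k<N. a k)"
    unfolding a'_def by (rule sum.group) (use assms(1) in auto)
  then obtain c where c: "\<And>u. (\<Prod>i\<in>I. u i ^ a' i) = (\<Sum>b\<in>exps I D. c b * hermI b u)"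
    using prod_power_herm_span[of a' D] assms by auto
  have "(\<Prod>k<N. (e k * u (ix k)) ^ a k) = (\<Sum>b\<in>exps I D. ((\<Prod>k<N. e k ^ a k) * c b) * hermI b u)" for u
  proof -
    have "(\<Prod>k<N. (e k * u (ix k)) ^ a k) = (\<Prod>k<N. e k ^ a k) * (\<Prod>k<N. u (ix k) ^ a k)"
      by (simp add: power_mult_distrib prod.distrib)
    also have "(\<Prod>k<N. u (ix k) ^ a k) = (\<Prod>i\<in>I. \<Prod>k\<in>{k\<in>{..<N}. ix k = i}. u (ix k) ^ a k)"
      by (rule prod.group[symmetric]) (use assms(1) in auto)
    also have "\<dots> = (\<Prod>i\<in>I. u i ^ a' i)"
      by (intro prod.cong) (auto simp: a'_def power_sum)
    finally show ?thesis by (simp add: c sum_distrib_left mult.assoc)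
  qed
  then show ?thesis by (intro exI[of _ "\<lambda>b. (\<Prod>k<N. e k ^ a k) * c b"]) blast
qed

lemma poly_herm_span:
  fixes e :: "nat \<Rightarrow> real"
  assumes "\<And>k. k < N \<Longrightarrow> ix k \<in> I" and "f \<in> polys N D"
  shows "\<exists>c. \<forall>u y. (\<forall>k<N. y k = e k * u (ix k)) \<longrightarrow> f y = (\<Sum>b\<in>exps I D. c b * hermI b u)"
proof -
  obtain \<alpha> where f: "f = (\<lambda>y. \<Sum>a\<in>exponents N D. \<alpha> a * (\<Prod>i<N. y i ^ a i))"
    using assms(2) by (auto simp: polys_def)
  have "\<forall>a\<in>exponents N D. \<exists>c. \<forall>u. (\<Prod>k<N. (e k * u (ix k)) ^ a k) = (\<Sum>b\<in>exps I D. c b * hermI b u)"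
    by (intro ballI monomial_herm_span) (use assms in \<open>auto simp: exponents_def\<close>)
  then obtain c where c: "\<And>a u. a \<in> exponents N D \<Longrightarrow>
      (\<Prod>k<N. (e k * u (ix k)) ^ a k) = (\<Sum>b\<in>exps I D. c a b * hermI b u)"
    by metis
  have "f y = (\<Sum>b\<in>exps I D. (\<Sum>a\<in>exponents N D. \<alpha> a * c a b) * hermI b u)"
    if "\<forall>k<N. y k = e k * u (ix k)" for u y
  proof -
    have "f y = (\<Sum>a\<in>exponents N D. \<alpha> a * (\<Prod>k<N. (e k * u (ix k)) ^ a k))"
      using that by (simp add: f)
    also have "\<dots> = (\<Sum>a\<in>exponents N D. \<Sum>b\<in>exps I D. \<alpha> a * c a b * hermI b u)"
      by (simp add: c sum_distrib_left mult.assoc)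
    also have "\<dots> = (\<Sum>b\<in>exps I D. \<Sum>a\<in>exponents N D. \<alpha> a * c a b * hermI b u)"
      by (rule sum.swap)
    finally show ?thesis by (simp add: sum_distrib_right)
  qed
  then show ?thesis
    by (intro exI[of _ "\<lambda>b. \<Sum>a\<in>exponents N D. \<alpha> a * c a b"] allI impI)
qed

text \<open>In terms of the Hermite coefficients \<open>c\<close>, the planted mean is a linear form
  with coefficients \<open>m a\<close>, the averaged signal monomials, and the null second moment is
  diagonal with entries a!. Cauchy-Schwarz leaves the sum of (m a)^2 / a!, and writing the square
  with two independent copies of (\<kappa>, \<phi>) makes it a mean of \<open>texp D\<close>.
  Boundedness of the signal makes its monomials integrable.\<close>

lemma planted_le_null:
  fixes \<nu> :: "'p measure" and \<xi> :: "nat \<Rightarrow> 'p \<Rightarrow> 'i \<Rightarrow> real" and V :: "('i \<Rightarrow> real) \<Rightarrow> nat \<Rightarrow> real" and e :: "nat \<Rightarrow> real"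
  assumes "prob_space \<nu>"
    and ix: "\<And>k. k < N \<Longrightarrow> ix k \<in> I" and V: "\<And>u k. k < N \<Longrightarrow> V u k = e k * u (ix k)"
    and f: "f \<in> polys N D"
    and meas: "\<And>\<kappa> i. i \<in> I \<Longrightarrow> (\<lambda>\<phi>. \<xi> \<kappa> \<phi> i) \<in> borel_measurable \<nu>"
    and bdd: "\<And>\<kappa> \<phi> i. i \<in> I \<Longrightarrow> \<bar>\<xi> \<kappa> \<phi> i\<bar> \<le> R"
  shows "(\<Sum>\<kappa><M. \<integral>\<phi>. (\<integral>\<omega>. f (V (\<lambda>i. G \<omega> i + \<xi> \<kappa> \<phi> i)) \<partial>\<Omega>) \<partial>\<nu>) / real M
    \<le> sqrt ((\<Sum>\<kappa><M. \<Sum>\<kappa>'<M. \<integral>\<phi>. (\<integral>\<phi>'. texp D (\<Sum>i\<in>I. \<xi> \<kappa> \<phi> i * \<xi> \<kappa>' \<phi>' i) \<partial>\<nu>) \<partial>\<nu>) / (real M)\<^sup>2)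
      * sqrt (\<integral>\<omega>. (f (V (G \<omega>)))\<^sup>2 \<partial>\<Omega>)"
proof -
  interpret P: prob_space \<nu> by fact
  have "\<exists>c. \<forall>u y. (\<forall>k<N. y k = e k * u (ix k)) \<longrightarrow> f y = (\<Sum>b\<in>exps I D. c b * hermI b u)"
    by (rule poly_herm_span) (use ix f in auto)
  then obtain c where c': "\<forall>u y. (\<forall>k<N. y k = e k * u (ix k)) \<longrightarrow> f y = (\<Sum>b\<in>exps I D. c b * hermI b u)" ..
  have c: "f (V u) = (\<Sum>b\<in>exps I D. c b * hermI b u)" for u
    by (rule c'[rule_format]) (simp add: V)
  have R: "0 \<le> R" if "i \<in> I" for i using bdd[OF that, of undefined undefined] by linarith
  have int: "integrable \<nu> (\<lambda>\<phi>. \<Prod>i\<in>I. \<xi> \<kappa> \<phi> i ^ a i)" for \<kappa> a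
  proof (rule P.integrable_const_bound[where B="\<Prod>i\<in>I. R ^ a i"])
    show "AE x in \<nu>. norm (\<Prod>i\<in>I. \<xi> \<kappa> x i ^ a i) \<le> (\<Prod>i\<in>I. R ^ a i)"
      using bdd by (auto simp: abs_prod power_abs intro!: AE_I2 prod_mono power_mono)
  qed (use meas in measurable)
  define m where "m a = (\<Sum>\<kappa><M. \<integral>\<phi>. (\<Prod>i\<in>I. \<xi> \<kappa> \<phi> i ^ a i) \<partial>\<nu>) / real M" for a
  define F :: "('i \<Rightarrow> nat) \<Rightarrow> real" where "F a = (\<Prod>i\<in>I. fact (a i))" for a
  have F: "F a > 0" for a by (auto simp: F_def intro!: prod_pos)
  have lhs: "(\<Sum>\<kappa><M. \<integral>\<phi>. (\<integral>\<omega>. f (V (\<lambda>i. G \<omega> i + \<xi> \<kappa> \<phi> i)) \<partial>\<Omega>) \<partial>\<nu>) / real M = (\<Sum>a\<in>exps I D. c a * m a)"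
  proof -
    have "(\<integral>\<omega>. f (V (\<lambda>i. G \<omega> i + \<xi> \<kappa> \<phi> i)) \<partial>\<Omega>) = (\<Sum>a\<in>exps I D. c a * (\<Prod>i\<in>I. \<xi> \<kappa> \<phi> i ^ a i))" for \<kappa> \<phi>
      by (simp add: c hermI_shift)
    then have "(\<integral>\<phi>. (\<integral>\<omega>. f (V (\<lambda>i. G \<omega> i + \<xi> \<kappa> \<phi> i)) \<partial>\<Omega>) \<partial>\<nu>)
       = (\<Sum>a\<in>exps I D. c a * (\<integral>\<phi>. (\<Prod>i\<in>I. \<xi> \<kappa> \<phi> i ^ a i) \<partial>\<nu>))" for \<kappa>
      by (simp add: int)
    then have "(\<Sum>\<kappa><M. \<integral>\<phi>. (\<integral>\<omega>. f (V (\<lambda>i. G \<omega> i + \<xi> \<kappa> \<phi> i)) \<partial>\<Omega>) \<partial>\<nu>)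
       = (\<Sum>a\<in>exps I D. \<Sum>\<kappa><M. c a * (\<integral>\<phi>. (\<Prod>i\<in>I. \<xi> \<kappa> \<phi> i ^ a i) \<partial>\<nu>))"
      by (simp only: sum.swap[of _ "{..<M}"])
    then show ?thesis by (simp add: m_def sum_divide_distrib[of _ "exps I D"] flip: sum_distrib_left)
  qed
  have null: "(\<integral>\<omega>. (f (V (G \<omega>)))\<^sup>2 \<partial>\<Omega>) = (\<Sum>a\<in>exps I D. (c a)\<^sup>2 * F a)"
    by (simp add: c herm_norm F_def)
  have B: "(\<Sum>\<kappa><M. \<Sum>\<kappa>'<M. \<integral>\<phi>. (\<integral>\<phi>'. texp D (\<Sum>i\<in>I. \<xi> \<kappa> \<phi> i * \<xi> \<kappa>' \<phi>' i) \<partial>\<nu>) \<partial>\<nu>) / (real M)\<^sup>2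
      = (\<Sum>a\<in>exps I D. (m a)\<^sup>2 / F a)"
  proof -
    let ?J = "\<lambda>\<kappa> a. (\<integral>\<phi>. (\<Prod>i\<in>I. \<xi> \<kappa> \<phi> i ^ a i) \<partial>\<nu>)"
    have "texp D (\<Sum>i\<in>I. \<xi> \<kappa> \<phi> i * \<xi> \<kappa>' \<phi>' i)
       = (\<Sum>a\<in>exps I D. (\<Prod>i\<in>I. \<xi> \<kappa> \<phi> i ^ a i) * (\<Prod>i\<in>I. \<xi> \<kappa>' \<phi>' i ^ a i) / F a)" for \<kappa> \<kappa>' \<phi> \<phi>'
      by (subst texp_sum[symmetric]) (auto simp: F_def prod_dividef power_mult_distrib prod.distrib)
    then have "(\<integral>\<phi>. (\<integral>\<phi>'. texp D (\<Sum>i\<in>I. \<xi> \<kappa> \<phi> i * \<xi> \<kappa>' \<phi>' i) \<partial>\<nu>) \<partial>\<nu>)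
       = (\<Sum>a\<in>exps I D. ?J \<kappa> a * ?J \<kappa>' a / F a)" for \<kappa> \<kappa>'
      by (simp add: int)
    then have "(\<Sum>\<kappa><M. \<Sum>\<kappa>'<M. \<integral>\<phi>. (\<integral>\<phi>'. texp D (\<Sum>i\<in>I. \<xi> \<kappa> \<phi> i * \<xi> \<kappa>' \<phi>' i) \<partial>\<nu>) \<partial>\<nu>)
      = (\<Sum>\<kappa><M. \<Sum>\<kappa>'<M. \<Sum>a\<in>exps I D. ?J \<kappa> a * ?J \<kappa>' a / F a)" by simp
    also have "\<dots> = (\<Sum>a\<in>exps I D. \<Sum>\<kappa><M. \<Sum>\<kappa>'<M. ?J \<kappa> a * ?J \<kappa>' a / F a)"
      by (simp only: sum.swap[of _ "{..<M}" "exps I D"])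
    also have "\<dots> = (\<Sum>a\<in>exps I D. (\<Sum>\<kappa><M. ?J \<kappa> a)\<^sup>2 / F a)"
      by (simp add: power2_eq_square sum_product sum_divide_distrib)
    finally show ?thesis
      by (simp add: m_def sum_divide_distrib[of _ "exps I D"] power_divide mult.commute)
  qed
  \<comment> \<open>The weights sqrt (F a) make one factor of Cauchy-Schwarz equal to the null
    second moment.\<close>
  have "(\<Sum>a\<in>exps I D. c a * m a) = (\<Sum>a\<in>exps I D. (c a * sqrt (F a)) * (m a / sqrt (F a)))"
    using F by (intro sum.cong) (auto simp: field_simps less_le)
  also have "\<dots> \<le> sqrt ((\<Sum>a\<in>exps I D. (c a * sqrt (F a))\<^sup>2) * (\<Sum>a\<in>exps I D. (m a / sqrt (F a))\<^sup>2))"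
    by (rule real_le_rsqrt) (rule Cauchy_Schwarz_ineq_sum)
  also have "\<dots> = sqrt (\<Sum>a\<in>exps I D. (m a)\<^sup>2 / F a) * sqrt (\<Sum>a\<in>exps I D. (c a)\<^sup>2 * F a)"
    using F by (simp add: power_mult_distrib power_divide less_imp_le real_sqrt_mult)
  finally show ?thesis by (simp only: lhs null B)
qed

end

text \<open>Absolute values of the coefficients give a polynomial that is monotone for nonnegative
  arguments, so a shifted argument can be replaced by any upper bound of its modulus.\<close>

lemma abs_poly_le:
  fixes p :: "real poly"
  assumes "\<bar>y\<bar> \<le> z"
  shows "\<bar>poly p y\<bar> \<le> poly (map_poly abs p) z"
proof -
  have "degree (map_poly abs p) = degree p" by (rule degree_map_poly) auto
  then have eq: "poly (map_poly abs p) z = (\<Sum>i\<le>degree p. \<bar>coeff p i\<bar> * z ^ i)"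
    by (simp add: poly_altdef coeff_map_poly)
  have "\<bar>poly p y\<bar> \<le> (\<Sum>i\<le>degree p. \<bar>coeff p i * y ^ i\<bar>)"
    unfolding poly_altdef by (rule sum_abs)
  also have "\<dots> \<le> (\<Sum>i\<le>degree p. \<bar>coeff p i\<bar> * z ^ i)"
    using assms by (intro sum_mono) (auto simp: abs_mult power_abs intro!: mult_left_mono power_mono)
  finally show ?thesis by (simp add: eq)
qed

section \<open>Integrability over signal and noise jointly\<close>

lemma distr_pair_snd_prob:
  assumes "prob_space M" "prob_space N"
  shows "distr (M \<Otimes>\<^sub>M N) N snd = N"
proof (rule measure_eqI)
  interpret M: prob_space M by fact
  interpret N: prob_space N by fact
  fix A assume A: "A \<in> sets (distr (M \<Otimes>\<^sub>M N) N snd)"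
  have "snd -` A \<inter> space (M \<Otimes>\<^sub>M N) = space M \<times> A"
    using A sets.sets_into_space[of A N] by (auto simp: space_pair_measure)
  then show "emeasure (distr (M \<Otimes>\<^sub>M N) N snd) A = emeasure N A"
    using A by (simp add: emeasure_distr N.emeasure_pair_measure_Times M.emeasure_space_1)
qed simp

lemma integrable_pair_snd:
  fixes f :: "'b \<Rightarrow> real"
  assumes "prob_space M" "prob_space N" "integrable N f"
  shows "integrable (M \<Otimes>\<^sub>M N) (\<lambda>x. f (snd x))"
  using assms(3) integrable_distr[OF measurable_snd, of M N f] distr_pair_snd_prob[OF assms(1,2)] by simp

lemma borel_measurable_polys:
  assumes "f \<in> polys N D"
  shows "f \<in> borel_measurable (RN N)"
  using assms unfolding polys_def by (auto intro!: borel_measurable_sum borel_measurable_times borel_measurable_prod borel_measurable_power)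

lemma polys_restrict: "f \<in> polys N D \<Longrightarrow> f (restrict y {..<N}) = f y"
  by (auto simp: polys_def)

context gaussian_family
begin

lemma integrable_shift:
  fixes \<nu> :: "'p measure" and \<xi> :: "'p \<Rightarrow> 'i \<Rightarrow> real" and V :: "('i \<Rightarrow> real) \<Rightarrow> nat \<Rightarrow> real" and e :: "nat \<Rightarrow> real"
  assumes "prob_space \<nu>"
    and ix: "\<And>k. k < N \<Longrightarrow> ix k \<in> I" and V: "\<And>u k. k < N \<Longrightarrow> V u k = e k * u (ix k)"
    and f: "f \<in> polys N D"
    and meas: "\<And>i. i \<in> I \<Longrightarrow> (\<lambda>\<phi>. \<xi> \<phi> i) \<in> borel_measurable \<nu>"
    and bdd: "\<And>\<phi> i. i \<in> I \<Longrightarrow> \<bar>\<xi> \<phi> i\<bar> \<le> R"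
  shows "integrable (\<nu> \<Otimes>\<^sub>M \<Omega>) (\<lambda>(\<phi>, \<omega>). f (V (\<lambda>i. G \<omega> i + \<xi> \<phi> i)))"
proof -
  have "\<exists>c. \<forall>u y. (\<forall>k<N. y k = e k * u (ix k)) \<longrightarrow> f y = (\<Sum>b\<in>exps I D. c b * hermI b u)"
    by (rule poly_herm_span) (use ix f in auto)
  then obtain c where c': "\<forall>u y. (\<forall>k<N. y k = e k * u (ix k)) \<longrightarrow> f y = (\<Sum>b\<in>exps I D. c b * hermI b u)" ..
  have c: "f (V u) = (\<Sum>b\<in>exps I D. c b * hermI b u)" for u
    by (rule c'[rule_format]) (simp add: V)
  note [measurable] = meas measurable_G
  have "integrable (\<nu> \<Otimes>\<^sub>M \<Omega>) (\<lambda>x. hermI b (\<lambda>i. G (snd x) i + \<xi> (fst x) i))" for b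
  proof (rule Bochner_Integration.integrable_bound)
    \<comment> \<open>|g + x| is at most 1 + |R| + g^2, a polynomial in g. The dominating function
      is thus a product of polynomials in single Gaussians, which the locale declares
      integrable.\<close>
    let ?p = "\<lambda>i. pcompose (map_poly abs (herm (b i))) [:1 + \<bar>R\<bar>, 0, 1:]"
    show "integrable (\<nu> \<Otimes>\<^sub>M \<Omega>) (\<lambda>x. \<Prod>i\<in>I. poly (?p i) (G (snd x) i))"
      by (rule integrable_pair_snd[OF assms(1) prob_space_axioms integrable_prod_poly])
    show "(\<lambda>x. hermI b (\<lambda>i. G (snd x) i + \<xi> (fst x) i)) \<in> borel_measurable (\<nu> \<Otimes>\<^sub>M \<Omega>)"
      unfolding hermI_def by measurable
    have le: "\<bar>g + x\<bar> \<le> 1 + \<bar>R\<bar> + g * g" if "\<bar>x\<bar> \<le> R" for g x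
    proof -
      have "0 \<le> (\<bar>g\<bar> - 1)\<^sup>2 + (g * g)" by simp
      then have "2 * \<bar>g\<bar> \<le> 1 + 2 * (g * g)" by (simp add: power2_eq_square algebra_simps)
      then show ?thesis using that by (simp add: abs_if split: if_splits)
    qed
    have "\<bar>poly (herm (b i)) (G \<omega> i + \<xi> \<phi> i)\<bar> \<le> poly (?p i) (G \<omega> i)" if "i \<in> I" for i \<phi> \<omega>
      using abs_poly_le[OF le[OF bdd[OF that]], of "herm (b i)"] by (simp add: poly_pcompose)
    then show "AE x in \<nu> \<Otimes>\<^sub>M \<Omega>. norm (hermI b (\<lambda>i. G (snd x) i + \<xi> (fst x) i)) \<le> norm (\<Prod>i\<in>I. poly (?p i) (G (snd x) i))"
      unfolding hermI_def real_norm_def abs_prod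
      by (intro AE_I2 prod_mono conjI abs_ge_zero) (blast intro: order_trans abs_ge_self)
  qed
  then show ?thesis by (simp add: c case_prod_unfold)
qed

text \<open>The planted law is described only by its integrals of polynomials, as an average over M
  shifted noise laws. The single sample is the case M = 1, and the bind over \<kappa> of the hidden
  sample problem has this form as well. The lower bound 1 is attained by the constant
  polynomial.\<close>

lemma Adv_bounds:
  fixes \<nu> :: "'p measure" and \<xi> :: "nat \<Rightarrow> 'p \<Rightarrow> 'i \<Rightarrow> real" and V :: "('i \<Rightarrow> real) \<Rightarrow> nat \<Rightarrow> real" and e :: "nat \<Rightarrow> real"
  assumes "prob_space \<nu>"
    and ix: "\<And>k. k < N \<Longrightarrow> ix k \<in> I" and V: "\<And>u k. k < N \<Longrightarrow> V u k = e k * u (ix k)"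
    and meas: "\<And>\<kappa> i. i \<in> I \<Longrightarrow> (\<lambda>\<phi>. \<xi> \<kappa> \<phi> i) \<in> borel_measurable \<nu>"
    and bdd: "\<And>\<kappa> \<phi> i. i \<in> I \<Longrightarrow> \<bar>\<xi> \<kappa> \<phi> i\<bar> \<le> R"
    and "M > 0" and dim: "dim X = N"
    and null: "null_law X = distr \<Omega> (RN N) (\<lambda>\<omega>. \<lambda>k\<in>{..<N}. V (G \<omega>) k)"
    and planted: "\<And>f. f \<in> polys N D \<Longrightarrow>
        (\<And>\<kappa>. \<kappa> < M \<Longrightarrow> integrable (distr (\<nu> \<Otimes>\<^sub>M \<Omega>) (RN N) (\<lambda>(\<phi>, \<omega>). \<lambda>k\<in>{..<N}. V (\<lambda>i. G \<omega> i + \<xi> \<kappa> \<phi> i) k)) f) \<Longrightarrow>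
        (\<integral>y. f y \<partial>planted X) = (\<Sum>\<kappa><M. \<integral>y. f y \<partial>distr (\<nu> \<Otimes>\<^sub>M \<Omega>) (RN N)
          (\<lambda>(\<phi>, \<omega>). \<lambda>k\<in>{..<N}. V (\<lambda>i. G \<omega> i + \<xi> \<kappa> \<phi> i) k)) / real M"
  shows "Adv D X \<le> ereal (sqrt ((\<Sum>\<kappa><M. \<Sum>\<kappa>'<M. \<integral>\<phi>. (\<integral>\<phi>'. texp D (\<Sum>i\<in>I. \<xi> \<kappa> \<phi> i * \<xi> \<kappa>' \<phi>' i) \<partial>\<nu>) \<partial>\<nu>) / (real M)\<^sup>2))"
      (is "_ \<le> ereal (sqrt ?B)")
    and "1 \<le> Adv D X"
proof -
  interpret P: prob_space \<nu> by fact
  interpret PW: pair_sigma_finite \<nu> \<Omega> ..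
  note [measurable] = meas measurable_G borel_measurable_polys
  have mV: "(\<lambda>(\<phi>, \<omega>). \<lambda>k\<in>{..<N}. V (\<lambda>i. G \<omega> i + \<xi> \<kappa> \<phi> i) k) \<in> \<nu> \<Otimes>\<^sub>M \<Omega> \<rightarrow>\<^sub>M RN N" for \<kappa>
  proof -
    have "(\<lambda>x. \<lambda>k\<in>{..<N}. V (\<lambda>i. G (snd x) i + \<xi> \<kappa> (fst x) i) k) \<in> \<nu> \<Otimes>\<^sub>M \<Omega> \<rightarrow>\<^sub>M RN N"
      by (rule measurable_restrict) (simp add: V, use ix in measurable)
    then show ?thesis by (simp add: case_prod_beta)
  qed
  have mV0: "(\<lambda>\<omega>. \<lambda>k\<in>{..<N}. V (G \<omega>) k) \<in> \<Omega> \<rightarrow>\<^sub>M RN N"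
    by (rule measurable_restrict) (simp add: V, use ix in measurable)
  have int: "integrable (\<nu> \<Otimes>\<^sub>M \<Omega>) (\<lambda>(\<phi>, \<omega>). f (V (\<lambda>i. G \<omega> i + \<xi> \<kappa> \<phi> i)))" if "f \<in> polys N D" for f \<kappa>
    by (rule integrable_shift[where e=e and ix=ix and \<xi>="\<xi> \<kappa>"]) (use assms(1) ix V that meas bdd in auto)
  have E: "(\<integral>y. f y \<partial>planted X) = (\<Sum>\<kappa><M. \<integral>\<phi>. (\<integral>\<omega>. f (V (\<lambda>i. G \<omega> i + \<xi> \<kappa> \<phi> i)) \<partial>\<Omega>) \<partial>\<nu>) / real M"
    if f: "f \<in> polys N D" for f
  proof -
    have "integrable (distr (\<nu> \<Otimes>\<^sub>M \<Omega>) (RN N) (\<lambda>(\<phi>, \<omega>). \<lambda>k\<in>{..<N}. V (\<lambda>i. G \<omega> i + \<xi> \<kappa> \<phi> i) k)) f" for \<kappa>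
      using int[OF f, of \<kappa>] by (subst integrable_distr_eq[OF mV borel_measurable_polys[OF f]]) (simp add: case_prod_unfold polys_restrict[OF f])
    then have "(\<integral>y. f y \<partial>planted X) = (\<Sum>\<kappa><M. \<integral>y. f y \<partial>distr (\<nu> \<Otimes>\<^sub>M \<Omega>) (RN N)
          (\<lambda>(\<phi>, \<omega>). \<lambda>k\<in>{..<N}. V (\<lambda>i. G \<omega> i + \<xi> \<kappa> \<phi> i) k)) / real M"
      by (rule planted[OF f])
    also have "\<dots> = (\<Sum>\<kappa><M. \<integral>x. (case x of (\<phi>, \<omega>) \<Rightarrow> f (V (\<lambda>i. G \<omega> i + \<xi> \<kappa> \<phi> i))) \<partial>(\<nu> \<Otimes>\<^sub>M \<Omega>)) / real M"
      by (intro arg_cong2[where f="(/)"] sum.cong refl, subst integral_distr[OF mV borel_measurable_polys[OF f]])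
         (simp add: case_prod_unfold polys_restrict[OF f])
    also have "\<dots> = (\<Sum>\<kappa><M. \<integral>\<phi>. (\<integral>\<omega>. f (V (\<lambda>i. G \<omega> i + \<xi> \<kappa> \<phi> i)) \<partial>\<Omega>) \<partial>\<nu>) / real M"
      using PW.integral_fst'[OF int[OF f]] by simp
    finally show ?thesis .
  qed
  have Q: "(\<integral>y. (f y)\<^sup>2 \<partial>null_law X) = (\<integral>\<omega>. (f (V (G \<omega>)))\<^sup>2 \<partial>\<Omega>)" if f: "f \<in> polys N D" for f
    unfolding null by (subst integral_distr[OF mV0]) (use f in \<open>auto simp: polys_restrict borel_measurable_polys intro!: borel_measurable_power\<close>)
  have le: "(\<integral>y. f y \<partial>planted X) \<le> sqrt ?B * sqrt (\<integral>y. (f y)\<^sup>2 \<partial>null_law X)" if f: "f \<in> polys N D" for f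
    unfolding E[OF f] Q[OF f] by (rule planted_le_null[where e=e and ix=ix]) (use assms(1) ix V f meas bdd in auto)
  have one: "(\<lambda>_. 1) \<in> polys N D"
  proof -
    let ?z = "\<lambda>k\<in>{..<N}. 0::nat"
    have z: "?z \<in> exponents N D" by (auto simp: exponents_def)
    have "(\<Sum>a\<in>exponents N D. (if a = ?z then 1 else 0) * (\<Prod>i<N. y i ^ a i)) = 1" for y :: "nat \<Rightarrow> real"
    proof -
      have "(\<Sum>a\<in>exponents N D. (if a = ?z then 1 else 0) * (\<Prod>i<N. y i ^ a i))
          = (\<Sum>a\<in>exponents N D. if a = ?z then 1 else 0)"
        by (intro sum.cong) auto
      also have "\<dots> = 1" using z by (simp add: exponents_eq_exps)
      finally show ?thesis .
    qed
    then show ?thesis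
      unfolding polys_def by (auto intro!: exI[of _ "\<lambda>a. if a = ?z then 1 else 0"])
  qed
  have P1: "(\<integral>y. (1::real) \<partial>planted X) = 1" using E[OF one] \<open>M > 0\<close> by (simp add: prob_space P.prob_space)
  have Q1: "(\<integral>y. (1::real)\<^sup>2 \<partial>null_law X) = 1" using Q[OF one] by (simp add: prob_space)
  \<comment> \<open>The inequality \<open>le\<close> at f = 1; it also provides the sign of the
    bound for the degenerate case below.\<close>
  have "1 \<le> sqrt ?B" using le[OF one] P1 Q1 by simp
  then have B0: "0 \<le> sqrt ?B" by linarith
  show "Adv D X \<le> ereal (sqrt ?B)"
    unfolding Adv_def dim
  proof (rule SUP_least)
    fix f assume f: "f \<in> polys N D"
    let ?q = "sqrt (\<integral>y. (f y)\<^sup>2 \<partial>null_law X)"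
    have q: "0 \<le> ?q" by simp
    show "ereal (\<integral>y. f y \<partial>planted X) / ereal ?q \<le> ereal (sqrt ?B)"
    proof (cases "?q = 0")
      \<comment> \<open>With null norm 0 the planted mean is at most 0 by \<open>le\<close>, so the
        extended quotient is 0 or minus infinity, never infinity.\<close>
      case True
      then have "(\<integral>y. f y \<partial>planted X) \<le> 0" using le[OF f] by simp
      then show ?thesis using True B0 by (cases "(\<integral>y. f y \<partial>planted X) = 0") (auto simp: divide_ereal_def)
    next
      case False
      with q have "0 < ?q" by linarith
      then show ?thesis using le[OF f] by (simp add: divide_simps)
    qed
  qed
  show "1 \<le> Adv D X"
    unfolding Adv_def dim
    by (rule SUP_upper2[OF one]) (use P1 Q1 in \<open>simp add: one_ereal_def\<close>)
qed

end

section \<open>Products and mixtures of laws\<close>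

lemma gaussian_family_PiM:
  assumes "gaussian_family \<Omega> I G" and "finite J"
  shows "gaussian_family (PiM J (\<lambda>_. \<Omega>)) (J \<times> I) (\<lambda>s (j, i). G (s j) i)"
proof -
  interpret G: gaussian_family \<Omega> I G by fact
  interpret product_prob_space "\<lambda>_. \<Omega>" J ..
  interpret product_sigma_finite "\<lambda>_. \<Omega>" ..
  interpret PJ: prob_space "PiM J (\<lambda>_. \<Omega>)" by (rule prob_space_PiM) (rule G.prob_space_axioms)
  have eq: "(\<Prod>x\<in>J \<times> I. poly (p x) (case x of (j, i) \<Rightarrow> G (s j) i)) = (\<Prod>j\<in>J. \<Prod>i\<in>I. poly (p (j, i)) (G (s j) i))" for p s
    by (simp add: prod.cartesian_product case_prod_beta)
  show ?thesis
  proof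
    fix p :: "_ \<Rightarrow> real poly"
    show "integrable (Pi\<^sub>M J (\<lambda>_. \<Omega>)) (\<lambda>s. \<Prod>x\<in>J \<times> I. poly (p x) (case x of (j, i) \<Rightarrow> G (s j) i))"
      unfolding eq by (rule product_integrable_prod[OF \<open>finite J\<close>]) (rule G.integrable_prod_poly)
    show "(\<integral>s. (\<Prod>x\<in>J \<times> I. poly (p x) (case x of (j, i) \<Rightarrow> G (s j) i)) \<partial>Pi\<^sub>M J (\<lambda>_. \<Omega>)) = (\<Prod>x\<in>J \<times> I. gmean (p x))"
      unfolding eq by (subst product_integral_prod[OF \<open>finite J\<close>])
        (auto simp: G.integrable_prod_poly G.integral_prod_poly prod.cartesian_product)
  next
    fix x assume "x \<in> J \<times> I"
    then obtain j i where x: "x = (j, i)" "j \<in> J" "i \<in> I" by auto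
    have "(\<lambda>s. G (s j) i) \<in> borel_measurable (Pi\<^sub>M J (\<lambda>_. \<Omega>))"
      by (rule measurable_compose[OF measurable_component_singleton[OF x(2)] G.measurable_G[OF x(3)]])
    then show "(\<lambda>s. case x of (j, i) \<Rightarrow> G (s j) i) \<in> borel_measurable (Pi\<^sub>M J (\<lambda>_. \<Omega>))" by (simp add: x)
  qed (use assms(2) in auto)
qed

lemma normal_density_scale:
  assumes "\<sigma> > 0"
  shows "density lborel (\<lambda>x. ennreal (normal_density 0 \<sigma> x)) = distr std_gauss borel (\<lambda>x. \<sigma> * x)"
proof -
  interpret prob_space std_gauss by (rule prob_space_std_gauss)
  have "distributed std_gauss lborel (\<lambda>x. x) std_normal_density"
    unfolding distributed_def by (auto intro!: distr_id2)
  from normal_density_affine[OF this, of \<sigma> 0] assms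
  have "distributed std_gauss lborel (\<lambda>x. \<sigma> * x) (normal_density 0 \<sigma>)" by simp
  then have "distr std_gauss lborel (\<lambda>x. \<sigma> * x) = density lborel (\<lambda>x. ennreal (normal_density 0 \<sigma> x))"
    by (simp add: distributed_def)
  then show ?thesis by (simp cong: distr_cong)
qed

text \<open>All hidden sample laws, one for each \<kappa>, are realised on the same space: one phase
  vector and M independent noises, with the phases read by sample \<kappa> only. This is the shifted
  form that \<open>Adv_bounds\<close> expects. Equality is checked on boxes.\<close>

lemma PiM_planted_coordinate:
  fixes \<Phi> :: "'p measure" and W :: "'w measure" and R :: "'r measure"
  assumes "finite J" "\<kappa> \<in> J" "prob_space \<Phi>" "prob_space W"
    and F [measurable]: "F \<in> \<Phi> \<Otimes>\<^sub>M W \<rightarrow>\<^sub>M R" and F0 [measurable]: "F0 \<in> W \<rightarrow>\<^sub>M R"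
  shows "PiM J (\<lambda>j. if j = \<kappa> then distr (\<Phi> \<Otimes>\<^sub>M W) R F else distr W R F0)
    = distr (\<Phi> \<Otimes>\<^sub>M PiM J (\<lambda>_. W)) (PiM J (\<lambda>_. R))
        (\<lambda>(\<phi>, s). \<lambda>j\<in>J. if j = \<kappa> then F (\<phi>, s j) else F0 (s j))" (is "PiM J ?D = distr ?S ?T ?H")
proof -
  interpret P: prob_space \<Phi> by fact
  interpret W: prob_space W by fact
  interpret PW: pair_prob_space \<Phi> W ..
  interpret WJ: product_prob_space "\<lambda>_. W" J ..
  interpret S: prob_space "PiM J (\<lambda>_. W)" by (rule prob_space_PiM) (rule W.prob_space_axioms)
  interpret PS: pair_prob_space \<Phi> "PiM J (\<lambda>_. W)" ..
  have D: "prob_space (?D j)" for j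
    by (auto intro!: PW.prob_space_distr W.prob_space_distr)
  interpret D: product_prob_space ?D J
    by (rule product_prob_spaceI) (rule D)
  have mH: "?H \<in> ?S \<rightarrow>\<^sub>M ?T"
  proof -
    have "(\<lambda>x. \<lambda>j\<in>J. if j = \<kappa> then F (fst x, snd x j) else F0 (snd x j)) \<in> ?S \<rightarrow>\<^sub>M ?T"
      by (rule measurable_restrict) measurable
    then show ?thesis by (simp add: case_prod_unfold)
  qed
  show ?thesis
  proof (rule D.PiM_eqI[symmetric])
    show "sets (distr ?S ?T ?H) = sets (PiM J ?D)"
      by (simp, rule sets_PiM_cong) auto
  next
    fix A assume *: "\<And>j. j \<in> J \<Longrightarrow> A j \<in> sets (?D j)"
    have A: "A j \<in> sets R" if "j \<in> J" for j using *[OF that] by (cases "j = \<kappa>") auto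
    define b where "b \<phi> = {w \<in> space W. F (\<phi>, w) \<in> A \<kappa>}" for \<phi>
    define b0 where "b0 j = {w \<in> space W. F0 w \<in> A j}" for j
    have mA: "Pi\<^sub>E J A \<in> sets ?T" by (rule sets_PiM_I_finite) (use A \<open>finite J\<close> in auto)
    have mX: "?H -` Pi\<^sub>E J A \<inter> space ?S \<in> sets ?S" by (rule measurable_sets[OF mH mA])
    have b0: "b0 j \<in> sets W" if "j \<in> J" for j
    proof -
      have "F0 -` A j \<inter> space W \<in> sets W" by (rule measurable_sets[OF F0 A[OF that]])
      also have "F0 -` A j \<inter> space W = b0 j" by (auto simp: b0_def)
      finally show ?thesis .
    qed
    have mb: "b \<phi> \<in> sets W" if "\<phi> \<in> space \<Phi>" for \<phi>
    proof -
      have "(\<lambda>w. F (\<phi>, w)) -` A \<kappa> \<inter> space W \<in> sets W"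
        using A[OF \<open>\<kappa> \<in> J\<close>] that by (intro measurable_sets[where A=R]) measurable
      also have "(\<lambda>w. F (\<phi>, w)) -` A \<kappa> \<inter> space W = b \<phi>" by (auto simp: b_def)
      finally show ?thesis .
    qed
    \<comment> \<open>At fixed phases the event is again a box, so the product formula holds slice
      by slice, and only the factor of \<kappa> depends on \<phi>.\<close>
    have slice: "emeasure (PiM J (\<lambda>_. W)) (Pair \<phi> -` (?H -` Pi\<^sub>E J A \<inter> space ?S))
       = emeasure W (b \<phi>) * (\<Prod>j\<in>J - {\<kappa>}. emeasure W (b0 j))" if \<phi>: "\<phi> \<in> space \<Phi>" for \<phi>
    proof -
      have "Pair \<phi> -` (?H -` Pi\<^sub>E J A \<inter> space ?S) = Pi\<^sub>E J (\<lambda>j. if j = \<kappa> then b \<phi> else b0 j)"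
        using \<phi> \<open>\<kappa> \<in> J\<close> by (auto simp: space_pair_measure space_PiM PiE_iff b_def b0_def split: if_splits)
      also have "emeasure (PiM J (\<lambda>_. W)) \<dots> = (\<Prod>j\<in>J. emeasure W (if j = \<kappa> then b \<phi> else b0 j))"
        by (rule WJ.emeasure_PiM) (use mb[OF \<phi>] b0 \<open>finite J\<close> in auto)
      also have "\<dots> = emeasure W (b \<phi>) * (\<Prod>j\<in>J - {\<kappa>}. emeasure W (b0 j))"
        using \<open>finite J\<close> \<open>\<kappa> \<in> J\<close> by (subst prod.remove) (auto intro!: prod.cong)
      finally show ?thesis .
    qed
    have "(\<lambda>\<phi>. emeasure W (Pair \<phi> -` (F -` A \<kappa> \<inter> space (\<Phi> \<Otimes>\<^sub>M W)))) \<in> borel_measurable \<Phi>"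
      by (rule W.measurable_emeasure_Pair) (use A \<open>\<kappa> \<in> J\<close> in measurable)
    moreover have Pb: "Pair \<phi> -` (F -` A \<kappa> \<inter> space (\<Phi> \<Otimes>\<^sub>M W)) = b \<phi>" if "\<phi> \<in> space \<Phi>" for \<phi>
      using that by (auto simp: b_def space_pair_measure)
    ultimately have meas_b: "(\<lambda>\<phi>. emeasure W (b \<phi>)) \<in> borel_measurable \<Phi>"
      by (subst measurable_cong[of \<Phi> _ "\<lambda>\<phi>. emeasure W (Pair \<phi> -` (F -` A \<kappa> \<inter> space (\<Phi> \<Otimes>\<^sub>M W)))"]) auto
    have "emeasure (distr ?S ?T ?H) (Pi\<^sub>E J A) = emeasure ?S (?H -` Pi\<^sub>E J A \<inter> space ?S)"
      by (rule emeasure_distr[OF mH mA])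
    also have "\<dots> = (\<integral>\<^sup>+\<phi>. emeasure (PiM J (\<lambda>_. W)) (Pair \<phi> -` (?H -` Pi\<^sub>E J A \<inter> space ?S)) \<partial>\<Phi>)"
      by (rule sigma_finite_measure.emeasure_pair_measure_alt[OF _ mX])
        (intro prob_space_imp_sigma_finite prob_space_PiM W.prob_space_axioms)
    also have "\<dots> = (\<integral>\<^sup>+\<phi>. emeasure W (b \<phi>) * (\<Prod>j\<in>J - {\<kappa>}. emeasure W (b0 j)) \<partial>\<Phi>)"
      by (rule nn_integral_cong) (rule slice)
    also have "\<dots> = (\<integral>\<^sup>+\<phi>. emeasure W (b \<phi>) \<partial>\<Phi>) * (\<Prod>j\<in>J - {\<kappa>}. emeasure W (b0 j))"
      by (rule nn_integral_multc[OF meas_b])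
    also have "(\<integral>\<^sup>+\<phi>. emeasure W (b \<phi>) \<partial>\<Phi>) = emeasure (distr (\<Phi> \<Otimes>\<^sub>M W) R F) (A \<kappa>)"
    proof -
      have "(\<integral>\<^sup>+\<phi>. emeasure W (b \<phi>) \<partial>\<Phi>)
          = (\<integral>\<^sup>+\<phi>. emeasure W (Pair \<phi> -` (F -` A \<kappa> \<inter> space (\<Phi> \<Otimes>\<^sub>M W))) \<partial>\<Phi>)"
        by (rule nn_integral_cong) (simp only: Pb)
      also have "\<dots> = emeasure (\<Phi> \<Otimes>\<^sub>M W) (F -` A \<kappa> \<inter> space (\<Phi> \<Otimes>\<^sub>M W))"
        by (rule W.emeasure_pair_measure_alt[symmetric]) (rule measurable_sets[OF F A[OF \<open>\<kappa> \<in> J\<close>]])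
      also have "\<dots> = emeasure (distr (\<Phi> \<Otimes>\<^sub>M W) R F) (A \<kappa>)"
        by (rule emeasure_distr[OF F A[OF \<open>\<kappa> \<in> J\<close>], symmetric])
      finally show ?thesis .
    qed
    also have "(\<Prod>j\<in>J - {\<kappa>}. emeasure W (b0 j)) = (\<Prod>j\<in>J - {\<kappa>}. emeasure (?D j) (A j))"
    proof (intro prod.cong refl)
      fix j assume j: "j \<in> J - {\<kappa>}"
      have "b0 j = F0 -` A j \<inter> space W" by (auto simp: b0_def)
      then show "emeasure W (b0 j) = emeasure (?D j) (A j)" using j A[of j] by (simp add: emeasure_distr)
    qed
    also have "emeasure (distr (\<Phi> \<Otimes>\<^sub>M W) R F) (A \<kappa>) * \<dots> = (\<Prod>j\<in>J. emeasure (?D j) (A j))"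
      using \<open>finite J\<close> \<open>\<kappa> \<in> J\<close> by (subst prod.remove[of J \<kappa>]) auto
    finally show "emeasure (distr ?S ?T ?H) (Pi\<^sub>E J A) = (\<Prod>j\<in>J. emeasure (?D j) (A j))" .
  qed (rule \<open>finite J\<close>)
qed

lemma nn_integral_bind_pmf_of_set:
  assumes "M > 0" and K: "\<And>\<kappa>. prob_space (K \<kappa>)" "\<And>\<kappa>. sets (K \<kappa>) = sets N"
    and [measurable]: "f \<in> borel_measurable N"
  shows "(\<integral>\<^sup>+y. f y \<partial>(measure_pmf (pmf_of_set {..<M::nat}) \<bind> K)) = (\<Sum>\<kappa><M. \<integral>\<^sup>+y. f y \<partial>K \<kappa>) / of_nat M"
proof -
  have "K \<in> measure_pmf (pmf_of_set {..<M}) \<rightarrow>\<^sub>M subprob_algebra N"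
    using K by (auto simp: measurable_def space_subprob_algebra intro: prob_space_imp_subprob_space)
  then have "(\<integral>\<^sup>+y. f y \<partial>(measure_pmf (pmf_of_set {..<M}) \<bind> K)) = (\<integral>\<^sup>+\<kappa>. \<integral>\<^sup>+y. f y \<partial>K \<kappa> \<partial>measure_pmf (pmf_of_set {..<M}))"
    by (intro nn_integral_bind) auto
  then show ?thesis using assms(1)
    by (subst (asm) nn_integral_pmf_of_set) (auto simp: lessThan_empty_iff)
qed

text \<open>The nonnegative case is applied to the positive and to the negative part of f.\<close>

lemma integral_bind_pmf_of_set:
  fixes f :: "'a \<Rightarrow> real"
  assumes "M > 0" and K: "\<And>\<kappa>. prob_space (K \<kappa>)" "\<And>\<kappa>. sets (K \<kappa>) = sets N"
    and f: "f \<in> borel_measurable N" and int: "\<And>\<kappa>. \<kappa> < M \<Longrightarrow> integrable (K \<kappa>) f"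
  shows "(\<integral>y. f y \<partial>(measure_pmf (pmf_of_set {..<M::nat}) \<bind> K)) = (\<Sum>\<kappa><M. \<integral>y. f y \<partial>K \<kappa>) / real M"
proof -
  let ?B = "measure_pmf (pmf_of_set {..<M::nat}) \<bind> K"
  have sB: "sets ?B = sets N"
    by (rule sets_bind) (use K in auto)
  have *: "has_bochner_integral ?B g ((\<Sum>\<kappa><M. \<integral>y. g y \<partial>K \<kappa>) / real M)"
    if g: "g \<in> borel_measurable N" "\<And>x. 0 \<le> g x" "\<And>\<kappa>. \<kappa> < M \<Longrightarrow> integrable (K \<kappa>) g" for g
  proof (rule has_bochner_integral_nn_integral)
    show "g \<in> borel_measurable ?B" using g(1) sB by (simp cong: measurable_cong_sets)
    have "(\<integral>\<^sup>+y. ennreal (g y) \<partial>?B) = (\<Sum>\<kappa><M. \<integral>\<^sup>+y. ennreal (g y) \<partial>K \<kappa>) / of_nat M"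
      by (rule nn_integral_bind_pmf_of_set) (use assms(1) K g in auto)
    also have "\<dots> = (\<Sum>\<kappa><M. ennreal (\<integral>y. g y \<partial>K \<kappa>)) / of_nat M"
      using g by (simp add: nn_integral_eq_integral)
    also have "\<dots> = ennreal ((\<Sum>\<kappa><M. \<integral>y. g y \<partial>K \<kappa>) / real M)"
      using g assms(1) by (subst sum_ennreal) (auto simp: divide_ennreal[symmetric] ennreal_of_nat_eq_real_of_nat sum_nonneg)
    finally show "(\<integral>\<^sup>+y. ennreal (g y) \<partial>?B) = ennreal ((\<Sum>\<kappa><M. \<integral>y. g y \<partial>K \<kappa>) / real M)" .
  qed (use g in \<open>auto intro!: divide_nonneg_nonneg sum_nonneg\<close>)
  have p: "has_bochner_integral ?B (\<lambda>x. max 0 (f x)) ((\<Sum>\<kappa><M. \<integral>y. max 0 (f y) \<partial>K \<kappa>) / real M)"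
    by (rule *) (use f int in \<open>auto intro!: integrable_max\<close>)
  have m: "has_bochner_integral ?B (\<lambda>x. max 0 (- f x)) ((\<Sum>\<kappa><M. \<integral>y. max 0 (- f y) \<partial>K \<kappa>) / real M)"
    by (rule *) (use f int in \<open>auto intro!: integrable_max\<close>)
  have f': "f y = max 0 (f y) - max 0 (- f y)" for y by auto
  have "(\<integral>y. f y \<partial>?B) = (\<Sum>\<kappa><M. \<integral>y. max 0 (f y) \<partial>K \<kappa>) / real M - (\<Sum>\<kappa><M. \<integral>y. max 0 (- f y) \<partial>K \<kappa>) / real M"
    by (subst f') (rule has_bochner_integral_integral_eq[OF has_bochner_integral_diff[OF p m]])
  also have "\<dots> = (\<Sum>\<kappa><M. (\<integral>y. max 0 (f y) \<partial>K \<kappa>) - (\<integral>y. max 0 (- f y) \<partial>K \<kappa>)) / real M"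
    by (simp add: sum_subtractf diff_divide_distrib)
  also have "(\<Sum>\<kappa><M. (\<integral>y. max 0 (f y) \<partial>K \<kappa>) - (\<integral>y. max 0 (- f y) \<partial>K \<kappa>)) = (\<Sum>\<kappa><M. \<integral>y. f y \<partial>K \<kappa>)"
  proof (intro sum.cong refl)
    fix \<kappa> assume "\<kappa> \<in> {..<M}"
    then have "(\<integral>y. max 0 (f y) - max 0 (- f y) \<partial>K \<kappa>) = (\<integral>y. max 0 (f y) \<partial>K \<kappa>) - (\<integral>y. max 0 (- f y) \<partial>K \<kappa>)"
      using int by (intro Bochner_Integration.integral_diff integrable_max) auto
    then show "(\<integral>y. max 0 (f y) \<partial>K \<kappa>) - (\<integral>y. max 0 (- f y) \<partial>K \<kappa>) = (\<integral>y. f y \<partial>K \<kappa>)"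
      by (simp flip: f')
  qed
  finally show ?thesis .
qed

section \<open>The advantage in the synchronization model\<close>

definition noise_index :: "nat \<Rightarrow> nat \<Rightarrow> (nat \<times> nat \<times> nat) set" where
  "noise_index L n = {1..L} \<times> {..<n} \<times> {..<n}"

definition noise_sd :: "nat \<times> nat \<times> nat \<Rightarrow> real" where
  "noise_sd = (\<lambda>(l, i, j). if i = j then 1 else sqrt (1 / 2))"

lemma noise_sd_pos: "noise_sd q > 0"
  by (simp add: noise_sd_def split: prod.split)

lemma finite_noise_index [simp]: "finite (noise_index L n)"
  by (simp add: noise_index_def)

lemma noise_space_eq:
  "noise_space L n = PiM (noise_index L n) (\<lambda>q. density lborel (\<lambda>x. ennreal (normal_density 0 (noise_sd q) x)))"
  unfolding noise_space_def noise_index_def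
  by (rule PiM_cong) (auto simp: noise_sd_def)

lemma gaussian_family_noise:
  "gaussian_family (noise_space L n) (noise_index L n) (\<lambda>w q. w q / noise_sd q)"
proof -
  let ?\<mu> = "\<lambda>q. density lborel (\<lambda>x. ennreal (normal_density 0 (noise_sd q) x))"
  have prob: "prob_space (?\<mu> q)" for q by (rule prob_space_normal_density[OF noise_sd_pos])
  interpret product_prob_space ?\<mu> "noise_index L n" by (rule product_prob_spaceI) (rule prob)
  interpret product_sigma_finite ?\<mu> ..
  interpret prob_space "noise_space L n" unfolding noise_space_eq by (rule prob_space_PiM) (rule prob)
  have "integrable (?\<mu> q) (\<lambda>x. poly p (x / noise_sd q)) \<and> (\<integral>x. poly p (x / noise_sd q) \<partial>?\<mu> q) = gmean p" for p q
    using integrable_std_gauss_poly[of p] noise_sd_pos[of q]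
    by (simp add: normal_density_scale[OF noise_sd_pos] integrable_distr_eq integral_distr gmean_def)
  then have i: "integrable (?\<mu> q) (\<lambda>x. poly p (x / noise_sd q))"
    and e: "(\<integral>x. poly p (x / noise_sd q) \<partial>?\<mu> q) = gmean p" for p q by auto
  show ?thesis
  proof
    fix p :: "_ \<Rightarrow> real poly"
    show "integrable (noise_space L n) (\<lambda>w. \<Prod>q\<in>noise_index L n. poly (p q) (w q / noise_sd q))"
      unfolding noise_space_eq by (rule product_integrable_prod[OF finite_noise_index]) (rule i)
    show "(\<integral>w. (\<Prod>q\<in>noise_index L n. poly (p q) (w q / noise_sd q)) \<partial>noise_space L n) = (\<Prod>q\<in>noise_index L n. gmean (p q))"
      unfolding noise_space_eq by (subst product_integral_prod[OF finite_noise_index]) (simp_all add: i e)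
  next
    fix q assume q: "q \<in> noise_index L n"
    show "(\<lambda>w. w q / noise_sd q) \<in> borel_measurable (noise_space L n)"
      unfolding noise_space_eq using measurable_component_singleton[OF q, of ?\<mu>]
      by (intro borel_measurable_divide) (auto cong: measurable_cong_sets)
  qed simp
qed

definition entry :: "nat \<Rightarrow> nat \<Rightarrow> nat \<times> nat \<times> nat" where
  "entry n k = (let e = k div 2 in (Suc (e div (n * n)), e div n mod n, e mod n))"

text \<open>Above the diagonal the real part sits at (l, i, j) and the imaginary part at (l, j, i).
  An entry below the diagonal is the conjugate of its mirror image, hence \<open>min\<close> and
  \<open>max\<close>.\<close>

definition coord :: "nat \<Rightarrow> nat \<Rightarrow> nat \<times> nat \<times> nat" where
  "coord n k = (case entry n k of (l, i, j) \<Rightarrow>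
     if even k then (l, min i j, max i j) else (l, max i j, min i j))"

text \<open>The sign -1 comes from conjugation, the 0 from the vanishing imaginary parts on the
  diagonal.\<close>

definition coord_sign :: "nat \<Rightarrow> nat \<Rightarrow> real" where
  "coord_sign n k = (case entry n k of (l, i, j) \<Rightarrow>
     if even k \<or> i < j then 1 else if j < i then - 1 else 0)"

lemma vectorize_gue:
  "k < model_dim L n \<Longrightarrow> vectorize L n (gue u) k = coord_sign n k * u (coord n k)"
  by (auto simp: vectorize_def coord_def coord_sign_def entry_def Let_def gue_def min_def max_def)

lemma vectorize_gue_eq:
  "vectorize L n (gue u) = (\<lambda>k\<in>{..<model_dim L n}. coord_sign n k * u (coord n k))"
proof
  fix k show "vectorize L n (gue u) k = (\<lambda>k\<in>{..<model_dim L n}. coord_sign n k * u (coord n k)) k"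
    by (cases "k < model_dim L n") (simp_all add: vectorize_gue, simp add: vectorize_def)
qed

lemma coord_mem:
  assumes "k < model_dim L n"
  shows "coord n k \<in> noise_index L n"
proof -
  have k: "k < 2 * (L * (n * n))" using assms by (simp add: model_dim_def mult.assoc)
  then have n: "n > 0" by (cases n) auto
  have "k div 2 div (n * n) < L"
    using k by (auto intro!: less_mult_imp_div_less)
  then show ?thesis
    using n by (auto simp: coord_def entry_def Let_def noise_index_def min_def max_def)
qed

text \<open>The signal is Hermitian, hence itself \<open>gue\<close> of a real vector, namely of
  this one. Adding it to the noise shifts the independent Gaussians.\<close>

definition signal_coord :: "real \<Rightarrow> nat \<Rightarrow> (nat \<Rightarrow> real) \<Rightarrow> nat \<times> nat \<times> nat \<Rightarrow> real" where
  "signal_coord lam n \<phi> = (\<lambda>(l, i, j).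
     if i \<le> j then Re (signal lam n \<phi> l i j) else Im (signal lam n \<phi> l j i))"

lemma signal_cis:
  "signal lam n \<phi> l i j = complex_of_real (lam / sqrt (real n)) * cis (real l * (\<phi> i - \<phi> j))"
  unfolding signal_def complex_cnj_power cis_cnj Complex.DeMoivre cis_mult
  by (simp only: distrib_left mult_minus_right diff_conv_add_uminus)

lemma Re_signal: "Re (signal lam n \<phi> l i j) = lam / sqrt (real n) * cos (real l * (\<phi> i - \<phi> j))"
  and Im_signal: "Im (signal lam n \<phi> l i j) = lam / sqrt (real n) * sin (real l * (\<phi> i - \<phi> j))"
  unfolding signal_cis by simp_all

lemma observation_eq_gue: "observation lam n \<phi> w = gue (\<lambda>q. w q + signal_coord lam n \<phi> q)"
proof (intro ext)
  fix l i j
  have "sin (real l * (\<phi> i - \<phi> j)) = - sin (real l * (\<phi> j - \<phi> i))"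
    using sin_minus[of "real l * (\<phi> j - \<phi> i)"] by (simp add: algebra_simps)
  moreover have "cos (real l * (\<phi> i - \<phi> j)) = cos (real l * (\<phi> j - \<phi> i))"
    using cos_minus[of "real l * (\<phi> j - \<phi> i)"] by (simp add: algebra_simps)
  ultimately show "observation lam n \<phi> w l i j = gue (\<lambda>q. w q + signal_coord lam n \<phi> q) l i j"
    by (auto simp: observation_def gue_def signal_coord_def complex_eq_iff Re_signal Im_signal)
qed

definition std_signal :: "real \<Rightarrow> nat \<Rightarrow> (nat \<Rightarrow> real) \<Rightarrow> nat \<times> nat \<times> nat \<Rightarrow> real" where
  "std_signal lam n \<phi> q = signal_coord lam n \<phi> q / noise_sd q"

lemma std_signal_bound: "\<bar>std_signal lam n \<phi> q\<bar> \<le> 2 * \<bar>lam / sqrt (real n)\<bar>"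
proof -
  obtain l i j where q: "q = (l, i, j)" by (cases q)
  have "\<bar>signal_coord lam n \<phi> q\<bar> \<le> \<bar>lam / sqrt (real n)\<bar>"
    unfolding q signal_coord_def
    by (auto simp: Re_signal Im_signal abs_mult simp del: times_divide_eq_left intro!: mult_left_le)
  moreover have "1 / noise_sd q \<le> 2" by (simp add: noise_sd_def q real_sqrt_divide sqrt_le_D real_le_lsqrt)
  ultimately have "\<bar>signal_coord lam n \<phi> q\<bar> * (1 / noise_sd q) \<le> \<bar>lam / sqrt (real n)\<bar> * 2"
    using noise_sd_pos[of q] by (intro mult_mono) auto
  then show ?thesis using noise_sd_pos[of q] by (simp add: std_signal_def abs_mult mult.commute)
qed

lemma prob_space_phase: "prob_space (phase_space n)"
  unfolding phase_space_def by (intro prob_space_PiM prob_space_uniform_measure) auto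

lemma measurable_phase: "i < n \<Longrightarrow> (\<lambda>\<phi>. \<phi> i) \<in> borel_measurable (phase_space n)"
proof -
  assume "i < n"
  then have "(\<lambda>\<phi>. \<phi> i) \<in> phase_space n \<rightarrow>\<^sub>M uniform_measure lborel {0..<2 * pi}"
    unfolding phase_space_def by (intro measurable_component_singleton) auto
  then show ?thesis by (simp cong: measurable_cong_sets)
qed

lemma measurable_std_signal:
  assumes "q \<in> noise_index L n"
  shows "(\<lambda>\<phi>. std_signal lam n \<phi> q) \<in> borel_measurable (phase_space n)"
proof -
  obtain l i j where q: "q = (l, i, j)" by (cases q)
  have "i < n" "j < n" using assms by (auto simp: q noise_index_def)
  note [measurable] = measurable_phase[OF this(1)] measurable_phase[OF this(2)]
  show ?thesis
    unfolding std_signal_def q signal_coord_def prod.case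
    by (cases "i \<le> j") (simp_all add: Re_signal Im_signal)
qed

text \<open>The sum over l of the Frobenius products of two signals with phases \<phi> and \<phi>',
  which is also the inner product of their standardised coordinates
  (\<open>sum_std_signal\<close>).\<close>

definition overlap :: "real \<Rightarrow> nat \<Rightarrow> nat \<Rightarrow> (nat \<Rightarrow> real) \<Rightarrow> (nat \<Rightarrow> real) \<Rightarrow> real" where
  "overlap lam L n \<phi> \<phi>' = lam\<^sup>2 / real n * (\<Sum>l\<in>{1..L}. (cmod (\<Sum>i<n. cis (real l * (\<phi> i - \<phi>' i))))\<^sup>2)"

text \<open>Coordinates (i, j) and (j, i) carry a real and an imaginary part, so identities between
  summands hold only for the two together.\<close>

lemma sum_symmetrize:
  fixes g h :: "nat \<Rightarrow> nat \<Rightarrow> real"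
  assumes "\<And>i j. h i j + h j i = g i j + g j i"
  shows "(\<Sum>i<n. \<Sum>j<n. h i j) = (\<Sum>i<n. \<Sum>j<n. g i j)"
proof -
  have e: "(\<Sum>i<n. \<Sum>j<n. f i j + f j i) = 2 * (\<Sum>i<n. \<Sum>j<n. f i j)" for f :: "nat \<Rightarrow> nat \<Rightarrow> real"
    using sum.swap[of "\<lambda>i j. f j i" "{..<n}" "{..<n}"] unfolding sum.distrib by linarith
  have "(\<Sum>i<n. \<Sum>j<n. h i j + h j i) = (\<Sum>i<n. \<Sum>j<n. g i j + g j i)" by (simp only: assms)
  then show ?thesis unfolding e by linarith
qed

lemma sum_std_signal:
  "(\<Sum>q\<in>noise_index L n. std_signal lam n \<phi> q * std_signal lam n \<phi>' q) = overlap lam L n \<phi> \<phi>'"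
proof -
  have "(\<Sum>i<n. \<Sum>j<n. std_signal lam n \<phi> (l, i, j) * std_signal lam n \<phi>' (l, i, j))
     = lam\<^sup>2 / real n * (cmod (\<Sum>i<n. cis (real l * (\<phi> i - \<phi>' i))))\<^sup>2" for l
  proof -
    let ?c = "\<lambda>\<phi> i j. cos (real l * (\<phi> i - \<phi> j))" and ?s = "\<lambda>\<phi> i j. sin (real l * (\<phi> i - \<phi> j))"
    let ?g = "\<lambda>i j. lam\<^sup>2 / real n * (?c \<phi> i j * ?c \<phi>' i j + ?s \<phi> i j * ?s \<phi>' i j)"
    have sn: "?s \<psi> i j = - ?s \<psi> j i" "?c \<psi> i j = ?c \<psi> j i" for \<psi> :: "nat \<Rightarrow> real" and i j
      using sin_minus[of "real l * (\<psi> j - \<psi> i)"] cos_minus[of "real l * (\<psi> j - \<psi> i)"] by (simp_all add: algebra_simps)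
    have nn: "lam / sqrt (real n) * (lam / sqrt (real n)) = lam\<^sup>2 / real n"
      by (simp add: power2_eq_square)
    let ?A = "lam / sqrt (real n)"
    have lt: "std_signal lam n \<psi> (l, i, j) = ?A * ?c \<psi> i j / sqrt (1 / 2)" if "i < j" for \<psi> i j
      using that by (simp add: std_signal_def signal_coord_def noise_sd_def Re_signal)
    have gt: "std_signal lam n \<psi> (l, i, j) = ?A * ?s \<psi> j i / sqrt (1 / 2)" if "j < i" for \<psi> i j
      using that by (simp add: std_signal_def signal_coord_def noise_sd_def Im_signal)
    have eq: "std_signal lam n \<psi> (l, i, i) = ?A * ?c \<psi> i i" for \<psi> i
      by (simp add: std_signal_def signal_coord_def noise_sd_def Re_signal)
    \<comment> \<open>Off the diagonal the variance is 1/2. The resulting factor 2 makes up for each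
      real or imaginary part being stored once for two mirror entries.\<close>
    have half: "a / sqrt (1 / 2) * (b / sqrt (1 / 2)) = 2 * (a * b)" for a b :: real
      using real_sqrt_mult_self[of "1/2"] by (simp only: times_divide_times_eq) simp
    have h: "std_signal lam n \<phi> (l, i, j) * std_signal lam n \<phi>' (l, i, j)
       = lam\<^sup>2 / real n * (if i = j then ?c \<phi> i j * ?c \<phi>' i j else if i < j then 2 * (?c \<phi> i j * ?c \<phi>' i j) else 2 * (?s \<phi> j i * ?s \<phi>' j i))" for i j
      unfolding nn[symmetric]
      by (cases i j rule: linorder_cases) (simp_all only: lt gt eq half, simp_all)
    have "(\<Sum>i<n. \<Sum>j<n. std_signal lam n \<phi> (l, i, j) * std_signal lam n \<phi>' (l, i, j)) = (\<Sum>i<n. \<Sum>j<n. ?g i j)"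
    proof (rule sum_symmetrize)
      fix i j
      show "std_signal lam n \<phi> (l, i, j) * std_signal lam n \<phi>' (l, i, j) + std_signal lam n \<phi> (l, j, i) * std_signal lam n \<phi>' (l, j, i) = ?g i j + ?g j i"
        unfolding h by (cases i j rule: linorder_cases) (auto simp: sn[of \<phi> j i] sn[of \<phi>' j i] distrib_left mult.left_commute[of _ "2::real"])
    qed
    also have "\<dots> = lam\<^sup>2 / real n * (\<Sum>i<n. \<Sum>j<n. ?c \<phi> i j * ?c \<phi>' i j + ?s \<phi> i j * ?s \<phi>' i j)"
      by (simp add: sum_distrib_left)
    \<comment> \<open>The summand is the cosine of a difference of phase differences. Grouped by the
      indices i and j rather than by the two signals, this angle makes the double sum a sum times
      its conjugate.\<close>
    also have "(\<Sum>i<n. \<Sum>j<n. ?c \<phi> i j * ?c \<phi>' i j + ?s \<phi> i j * ?s \<phi>' i j)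
        = (\<Sum>i<n. \<Sum>j<n. Re (cis (real l * (\<phi> i - \<phi>' i)) * cnj (cis (real l * (\<phi> j - \<phi>' j)))))"
    proof (intro sum.cong refl)
      fix i j
      have "?c \<phi> i j * ?c \<phi>' i j + ?s \<phi> i j * ?s \<phi>' i j = cos (real l * (\<phi> i - \<phi> j) - real l * (\<phi>' i - \<phi>' j))"
        by (simp add: cos_diff)
      also have "\<dots> = cos (real l * (\<phi> i - \<phi>' i) - real l * (\<phi> j - \<phi>' j))"
        by (simp add: algebra_simps)
      finally show "?c \<phi> i j * ?c \<phi>' i j + ?s \<phi> i j * ?s \<phi>' i j = Re (cis (real l * (\<phi> i - \<phi>' i)) * cnj (cis (real l * (\<phi> j - \<phi>' j))))"
        by (simp add: cos_diff)
    qed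
    also have "\<dots> = Re ((\<Sum>i<n. cis (real l * (\<phi> i - \<phi>' i))) * cnj (\<Sum>i<n. cis (real l * (\<phi> i - \<phi>' i))))"
      by (simp add: sum_product)
    also have "\<dots> = (cmod (\<Sum>i<n. cis (real l * (\<phi> i - \<phi>' i))))\<^sup>2"
      by (simp only: complex_norm_square[symmetric] Re_complex_of_real)
    finally show ?thesis .
  qed
  moreover have "(\<Sum>q\<in>noise_index L n. F q) = (\<Sum>l\<in>{1..L}. \<Sum>i<n. \<Sum>j<n. F (l, i, j))" for F :: "_ \<Rightarrow> real"
    by (simp add: noise_index_def sum.cartesian_product case_prod_unfold)
  ultimately show ?thesis
    by (simp only: overlap_def sum_distrib_left)
qed

definition adv_bound :: "real \<Rightarrow> nat \<Rightarrow> nat \<Rightarrow> nat \<Rightarrow> real" where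
  "adv_bound lam L n D = (\<integral>\<phi>. (\<integral>\<phi>'. texp D (overlap lam L n \<phi> \<phi>') \<partial>phase_space n) \<partial>phase_space n)"

lemma texp_0 [simp]: "texp D 0 = 1"
  by (simp add: texp_def power_0_left if_distrib[of "\<lambda>x. x / _"] sum.delta cong: if_cong)

lemma overlap_nonneg: "0 \<le> overlap lam L n \<phi> \<phi>'"
  unfolding overlap_def by (intro mult_nonneg_nonneg sum_nonneg divide_nonneg_nonneg) auto

lemma adv_bound_nonneg: "0 \<le> adv_bound lam L n D"
  unfolding adv_bound_def texp_def
  by (intro integral_nonneg_AE AE_I2 sum_nonneg divide_nonneg_nonneg zero_le_power overlap_nonneg) auto

section \<open>Advantage of one sample and of M samples\<close>

lemma Adv_sync_problem:
  "Adv D (sync_problem lam L n) \<le> ereal (sqrt (adv_bound lam L n D))"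
  "1 \<le> Adv D (sync_problem lam L n)"
proof -
  let ?N = "model_dim L n" and ?\<Omega> = "noise_space L n" and ?\<nu> = "phase_space n"
  let ?G = "\<lambda>w q. w q / noise_sd q"
  let ?V = "\<lambda>u k. coord_sign n k * noise_sd (coord n k) * u (coord n k) :: real"
  let ?\<xi> = "\<lambda>(\<kappa>::nat) \<phi>. std_signal lam n \<phi>"
  let ?X = "sync_problem lam L n"
  interpret G: gaussian_family ?\<Omega> "noise_index L n" ?G by (rule gaussian_family_noise)
  have V0: "(\<lambda>k\<in>{..<?N}. ?V (?G w) k) = vectorize L n (gue w)" for w
    unfolding vectorize_gue_eq using noise_sd_pos by (intro restrict_ext) (simp add: less_imp_neq[symmetric])
  have V1: "(\<lambda>k\<in>{..<?N}. ?V (\<lambda>i. ?G w i + ?\<xi> \<kappa> \<phi> i) k) = vectorize L n (observation lam n \<phi> w)" for w \<phi> \<kappa>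
    unfolding observation_eq_gue vectorize_gue_eq using noise_sd_pos
    by (intro restrict_ext) (simp add: less_imp_neq[symmetric] std_signal_def add_divide_distrib[symmetric])
  note * = G.Adv_bounds[where \<nu>="?\<nu>" and N="?N" and ix="coord n" and V="?V" and e="\<lambda>k. coord_sign n k * noise_sd (coord n k)"
      and \<xi>="?\<xi>" and R="2 * \<bar>lam / sqrt (real n)\<bar>" and M=1 and X="?X" and D=D,
      OF prob_space_phase coord_mem refl measurable_std_signal std_signal_bound, unfolded V0 V1 sum_std_signal]
  have d: "dim ?X = ?N" "null_law ?X = distr ?\<Omega> (RN ?N) (\<lambda>w. vectorize L n (gue w))"
    "planted ?X = distr (?\<nu> \<Otimes>\<^sub>M ?\<Omega>) (RN ?N) (\<lambda>(\<phi>, w). vectorize L n (observation lam n \<phi> w))"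
    by (simp_all add: sync_problem_def)
  show "Adv D ?X \<le> ereal (sqrt (adv_bound lam L n D))"
    using *(1) by (simp add: d adv_bound_def)
  show "1 \<le> Adv D ?X"
    using *(2) by (simp add: d)
qed

text \<open>Signals planted in different samples occupy disjoint coordinates, so their inner product
  is 0 and \<open>texp\<close> is 1. Only M of the M^2 pairs (\<kappa>, \<kappa>') contribute
  \<open>adv_bound\<close>, whose weight thus drops to 1 / M.\<close>

lemma Adv_hidden_sample:
  assumes M: "M > 0"
  shows "Adv D (hidden_sample (sync_problem lam L n) M) \<le> ereal (sqrt (1 + adv_bound lam L n D / real M))"
    and "1 \<le> Adv D (hidden_sample (sync_problem lam L n) M)"
proof -
  let ?N = "model_dim L n" and ?W = "noise_space L n" and ?\<nu> = "phase_space n" and ?I = "{..<M} \<times> noise_index L n"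
  let ?\<Omega> = "PiM {..<M} (\<lambda>_. ?W)"
  let ?G = "\<lambda>s (j, q). s j q / noise_sd q"
  let ?e = "\<lambda>k. coord_sign n (k mod ?N) * noise_sd (coord n (k mod ?N))"
  let ?ix = "\<lambda>k. (k div ?N, coord n (k mod ?N))"
  let ?V = "\<lambda>u k. ?e k * u (?ix k) :: real"
  let ?\<xi> = "\<lambda>\<kappa> \<phi> (j, q). if j = \<kappa> then std_signal lam n \<phi> q else 0"
  let ?S = "sync_problem lam L n"
  let ?X = "hidden_sample ?S M"
  let ?F = "\<lambda>(\<phi>, w). vectorize L n (observation lam n \<phi> w)" and ?Fn = "\<lambda>w. vectorize L n (gue w)"
  interpret W: gaussian_family ?W "noise_index L n" "\<lambda>w q. w q / noise_sd q" by (rule gaussian_family_noise)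
  interpret G: gaussian_family ?\<Omega> ?I ?G
    by (rule gaussian_family_PiM) (use gaussian_family_noise in auto)
  interpret P: prob_space ?\<nu> by (rule prob_space_phase)
  interpret PW: pair_prob_space ?\<nu> ?W ..
  have k: "k div ?N < M" "k mod ?N < ?N" if "k < M * ?N" for k
  proof -
    have "?N > 0" using that by (cases "?N") auto
    then show "k div ?N < M" "k mod ?N < ?N" using that by (auto simp: less_mult_imp_div_less)
  qed
  have mW: "(\<lambda>w. w q) \<in> borel_measurable ?W" if "q \<in> noise_index L n" for q
    using borel_measurable_times[OF borel_measurable_const[of "noise_sd q"] W.measurable_G[OF that]] noise_sd_pos[of q]
    by (simp add: less_imp_neq[symmetric])
  have mF0: "?Fn \<in> ?W \<rightarrow>\<^sub>M RN ?N"
    unfolding vectorize_gue_eq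
    by (rule measurable_restrict) (auto intro!: borel_measurable_times mW coord_mem)
  have mF: "?F \<in> ?\<nu> \<Otimes>\<^sub>M ?W \<rightarrow>\<^sub>M RN ?N"
  proof -
    have sc: "(\<lambda>\<phi>. signal_coord lam n \<phi> q) \<in> borel_measurable ?\<nu>" if "q \<in> noise_index L n" for q
      using borel_measurable_times[OF borel_measurable_const[of "noise_sd q"] measurable_std_signal[OF that, of lam]] noise_sd_pos[of q]
      by (simp add: std_signal_def less_imp_neq[symmetric])
    have "(\<lambda>x. vectorize L n (observation lam n (fst x) (snd x))) \<in> ?\<nu> \<Otimes>\<^sub>M ?W \<rightarrow>\<^sub>M RN ?N"
      unfolding observation_eq_gue vectorize_gue_eq
      by (intro measurable_restrict borel_measurable_times borel_measurable_add borel_measurable_const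
           measurable_compose[OF measurable_snd mW] measurable_compose[OF measurable_fst sc]) (auto intro: coord_mem)
    then show ?thesis by (simp add: case_prod_unfold)
  qed
  have mC: "concat_samples ?N M \<in> PiM {..<M} (\<lambda>_. RN ?N) \<rightarrow>\<^sub>M RN (M * ?N)"
    unfolding concat_samples_def
  proof (rule measurable_restrict)
    fix k' assume "k' \<in> {..<M * ?N}"
    then show "(\<lambda>s. s (k' div ?N) (k' mod ?N)) \<in> borel_measurable (PiM {..<M} (\<lambda>_. RN ?N))"
      using k[of k'] measurable_compose[OF
          measurable_component_singleton[of "k' div ?N" "{..<M}" "\<lambda>_. RN ?N"]
          measurable_component_singleton[of "k' mod ?N" "{..<?N}" "\<lambda>_. borel"]]
      by simp
  qed
  have V0: "(\<lambda>k\<in>{..<M * ?N}. ?V (?G s) k) = concat_samples ?N M (compose {..<M} ?Fn s)" for s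
    unfolding concat_samples_def vectorize_gue_eq using noise_sd_pos k
    by (intro restrict_ext) (simp add: less_imp_neq[symmetric] compose_def)
  have V1: "(\<lambda>k\<in>{..<M * ?N}. ?V (\<lambda>i. ?G s i + ?\<xi> \<kappa> \<phi> i) k)
      = concat_samples ?N M (\<lambda>j\<in>{..<M}. if j = \<kappa> then ?F (\<phi>, s j) else ?Fn (s j))" for s \<phi> \<kappa>
    unfolding concat_samples_def observation_eq_gue vectorize_gue_eq prod.case using noise_sd_pos k
    by (intro restrict_ext) (simp add: less_imp_neq[symmetric] std_signal_def add_divide_distrib[symmetric])
  have sum: "(\<Sum>i\<in>?I. ?\<xi> \<kappa> \<phi> i * ?\<xi> \<kappa>' \<phi>' i) = (if \<kappa> = \<kappa>' then overlap lam L n \<phi> \<phi>' else 0)"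
    if "\<kappa> < M" for \<kappa> \<kappa>' \<phi> \<phi>'
  proof -
    have "(\<Sum>i\<in>?I. ?\<xi> \<kappa> \<phi> i * ?\<xi> \<kappa>' \<phi>' i) = (\<Sum>j<M. \<Sum>q\<in>noise_index L n. ?\<xi> \<kappa> \<phi> (j, q) * ?\<xi> \<kappa>' \<phi>' (j, q))"
      by (simp only: sum.cartesian_product case_prod_unfold fst_conv snd_conv)
    also have "\<dots> = (\<Sum>j<M. if j = \<kappa> then (if \<kappa> = \<kappa>' then overlap lam L n \<phi> \<phi>' else 0) else 0)"
      by (intro sum.cong refl) (auto simp: sum_std_signal)
    finally show ?thesis using that by simp
  qed
  have d: "dim ?X = M * ?N" by (simp add: hidden_sample_def sync_problem_def)
  have "null_law ?X = distr (PiM {..<M} (\<lambda>_. distr ?W (RN ?N) ?Fn)) (RN (M * ?N)) (concat_samples ?N M)"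
    by (simp add: hidden_sample_def sync_problem_def)
  also have "PiM {..<M} (\<lambda>_. distr ?W (RN ?N) ?Fn) = distr ?\<Omega> (PiM {..<M} (\<lambda>_. RN ?N)) (compose {..<M} ?Fn)"
  proof -
    let ?Q = "distr ?W (RN ?N) ?Fn"
    have "PiM {..<M} (\<lambda>_. ?Q) = PiM {..<M} (\<lambda>_. distr ?W ?Q ?Fn)"
      by (intro PiM_cong distr_cong) auto
    also have "\<dots> = distr ?\<Omega> (PiM {..<M} (\<lambda>_. ?Q)) (compose {..<M} ?Fn)"
      by (rule distr_PiM_finite_prob_space'[symmetric])
         (use W.prob_space_axioms W.prob_space_distr[OF mF0] mF0 in auto)
    also have "\<dots> = distr ?\<Omega> (PiM {..<M} (\<lambda>_. RN ?N)) (compose {..<M} ?Fn)"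
      by (rule distr_cong, simp, rule sets_PiM_cong, simp_all)
    finally show ?thesis .
  qed
  also have "distr \<dots> (RN (M * ?N)) (concat_samples ?N M) = distr ?\<Omega> (RN (M * ?N)) (\<lambda>s. \<lambda>k\<in>{..<M * ?N}. ?V (?G s) k)"
  proof -
    have "compose {..<M} ?Fn \<in> ?\<Omega> \<rightarrow>\<^sub>M PiM {..<M} (\<lambda>_. RN ?N)"
      unfolding compose_def
      by (rule measurable_restrict) (rule measurable_compose[OF measurable_component_singleton[where M="\<lambda>_. ?W"] mF0])
    then show ?thesis unfolding V0 by (subst distr_distr[OF mC]) (simp_all add: comp_def)
  qed
  finally have null: "null_law ?X = distr ?\<Omega> (RN (M * ?N)) (\<lambda>s. \<lambda>k\<in>{..<M * ?N}. ?V (?G s) k)" .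
  let ?K = "\<lambda>\<kappa>. distr (PiM {..<M} (\<lambda>j. if j = \<kappa> then distr (?\<nu> \<Otimes>\<^sub>M ?W) (RN ?N) ?F else distr ?W (RN ?N) ?Fn))
              (RN (M * ?N)) (concat_samples ?N M)"
  let ?H = "\<lambda>\<kappa> (\<phi>, s). \<lambda>j\<in>{..<M}. if j = \<kappa> then ?F (\<phi>, s j) else ?Fn (s j)"
  have K: "?K \<kappa> = distr (?\<nu> \<Otimes>\<^sub>M ?\<Omega>) (RN (M * ?N)) (\<lambda>(\<phi>, s). \<lambda>k\<in>{..<M * ?N}. ?V (\<lambda>i. ?G s i + ?\<xi> \<kappa> \<phi> i) k)" if "\<kappa> < M" for \<kappa>
  proof -
    have mH: "?H \<kappa> \<in> ?\<nu> \<Otimes>\<^sub>M ?\<Omega> \<rightarrow>\<^sub>M PiM {..<M} (\<lambda>_. RN ?N)"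
    proof -
      have "(\<lambda>x. \<lambda>j\<in>{..<M}. if j = \<kappa> then ?F (fst x, snd x j) else ?Fn (snd x j)) \<in> ?\<nu> \<Otimes>\<^sub>M ?\<Omega> \<rightarrow>\<^sub>M PiM {..<M} (\<lambda>_. RN ?N)"
      proof (rule measurable_restrict)
        fix j assume "j \<in> {..<M}"
        then have j: "(\<lambda>x. snd x j) \<in> ?\<nu> \<Otimes>\<^sub>M ?\<Omega> \<rightarrow>\<^sub>M ?W"
          by (intro measurable_compose[OF measurable_snd measurable_component_singleton[where M="\<lambda>_. ?W"]])
        show "(\<lambda>x. if j = \<kappa> then ?F (fst x, snd x j) else ?Fn (snd x j)) \<in> ?\<nu> \<Otimes>\<^sub>M ?\<Omega> \<rightarrow>\<^sub>M RN ?N"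
          using measurable_compose[OF j mF0] measurable_compose[OF measurable_Pair[OF measurable_fst j] mF]
          by (cases "j = \<kappa>") auto
      qed
      then show ?thesis by (simp add: case_prod_unfold)
    qed
    have "?K \<kappa> = distr (distr (?\<nu> \<Otimes>\<^sub>M ?\<Omega>) (PiM {..<M} (\<lambda>_. RN ?N)) (?H \<kappa>)) (RN (M * ?N)) (concat_samples ?N M)"
      by (subst PiM_planted_coordinate) (use that mF mF0 W.prob_space_axioms P.prob_space_axioms in auto)
    also have "\<dots> = distr (?\<nu> \<Otimes>\<^sub>M ?\<Omega>) (RN (M * ?N)) (concat_samples ?N M \<circ> ?H \<kappa>)"
      by (rule distr_distr[OF mC mH])
    also have "concat_samples ?N M \<circ> ?H \<kappa> = (\<lambda>(\<phi>, s). \<lambda>k\<in>{..<M * ?N}. ?V (\<lambda>i. ?G s i + ?\<xi> \<kappa> \<phi> i) k)"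
      unfolding V1 by (auto simp: fun_eq_iff)
    finally show ?thesis .
  qed
  have pX: "planted ?X = measure_pmf (pmf_of_set {..<M}) \<bind> ?K"
    unfolding hidden_sample_def sync_problem_def testing_problem.select_convs by (rule refl)
  have planted: "(\<integral>y. f y \<partial>planted ?X) = (\<Sum>\<kappa><M. \<integral>y. f y \<partial>distr (?\<nu> \<Otimes>\<^sub>M ?\<Omega>) (RN (M * ?N))
          (\<lambda>(\<phi>, s). \<lambda>k\<in>{..<M * ?N}. ?V (\<lambda>i. ?G s i + ?\<xi> \<kappa> \<phi> i) k)) / real M"
    if f: "f \<in> polys (M * ?N) D" and int: "\<And>\<kappa>. \<kappa> < M \<Longrightarrow> integrable (distr (?\<nu> \<Otimes>\<^sub>M ?\<Omega>) (RN (M * ?N))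
          (\<lambda>(\<phi>, s). \<lambda>k\<in>{..<M * ?N}. ?V (\<lambda>i. ?G s i + ?\<xi> \<kappa> \<phi> i) k)) f" for f
  proof -
    have "(\<integral>y. f y \<partial>planted ?X) = (\<Sum>\<kappa><M. \<integral>y. f y \<partial>?K \<kappa>) / real M"
      unfolding pX
    proof (rule integral_bind_pmf_of_set[OF M, where N="RN (M * ?N)"])
      show "prob_space (?K \<kappa>)" for \<kappa>
      proof (rule prob_space.prob_space_distr)
        let ?D = "\<lambda>j. if j = \<kappa> then distr (?\<nu> \<Otimes>\<^sub>M ?W) (RN ?N) ?F else distr ?W (RN ?N) ?Fn"
        show "prob_space (PiM {..<M} ?D)"
          by (rule prob_space_PiM) (auto intro: PW.prob_space_distr[OF mF] W.prob_space_distr[OF mF0])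
        have "sets (PiM {..<M} ?D) = sets (PiM {..<M} (\<lambda>_. RN ?N))"
          by (rule sets_PiM_cong) auto
        then show "concat_samples ?N M \<in> PiM {..<M} ?D \<rightarrow>\<^sub>M RN (M * ?N)"
          using mC by (simp cong: measurable_cong_sets)
      qed
      show "integrable (?K \<kappa>) f" if "\<kappa> < M" for \<kappa> using int[OF that] K[OF that] by simp
    qed (use borel_measurable_polys[OF f] in auto)
    then show ?thesis using K by simp
  qed
  have mem: "?ix k \<in> ?I" if "k < M * ?N" for k
    using k[OF that] by (auto intro: coord_mem)
  have meas: "(\<lambda>\<phi>. ?\<xi> \<kappa> \<phi> i) \<in> borel_measurable ?\<nu>" if "i \<in> ?I" for \<kappa> i
    using that measurable_std_signal by (cases i) auto
  have bdd: "\<bar>?\<xi> \<kappa> \<phi> i\<bar> \<le> 2 * \<bar>lam / sqrt (real n)\<bar>" for \<kappa> \<phi> i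
    using std_signal_bound by (auto split: prod.split)
  note * = G.Adv_bounds[where \<nu>="?\<nu>" and N="M * ?N" and ix="?ix" and V="?V" and e="?e"
      and \<xi>="?\<xi>" and R="2 * \<bar>lam / sqrt (real n)\<bar>" and M=M and X="?X" and D=D,
      OF prob_space_phase mem refl meas bdd M d null planted]
  show "1 \<le> Adv D ?X" by (rule *(2))
  have "(\<Sum>\<kappa><M. \<Sum>\<kappa>'<M. \<integral>\<phi>. (\<integral>\<phi>'. texp D (\<Sum>i\<in>?I. ?\<xi> \<kappa> \<phi> i * ?\<xi> \<kappa>' \<phi>' i) \<partial>?\<nu>) \<partial>?\<nu>)
      = (\<Sum>\<kappa><M. \<Sum>\<kappa>'<M. if \<kappa> = \<kappa>' then adv_bound lam L n D else 1)"
    by (intro sum.cong refl) (auto simp: sum adv_bound_def P.prob_space)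
  \<comment> \<open>The diagonal pairs keep the 1 of the others in addition, which gives a bound in
    closed form.\<close>
  also have "\<dots> \<le> (\<Sum>\<kappa><M. \<Sum>\<kappa>'<M. (if \<kappa> = \<kappa>' then adv_bound lam L n D else 0) + 1)"
    by (intro sum_mono) auto
  also have "\<dots> = real M * adv_bound lam L n D + (real M)\<^sup>2"
    by (simp add: sum.distrib power2_eq_square distrib_left)
  finally have "(\<Sum>\<kappa><M. \<Sum>\<kappa>'<M. \<integral>\<phi>. (\<integral>\<phi>'. texp D (\<Sum>i\<in>?I. ?\<xi> \<kappa> \<phi> i * ?\<xi> \<kappa>' \<phi>' i) \<partial>?\<nu>) \<partial>?\<nu>) / (real M)\<^sup>2
     \<le> (real M * adv_bound lam L n D + (real M)\<^sup>2) / (real M)\<^sup>2"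
    by (rule divide_right_mono) simp
  also have "\<dots> = 1 + adv_bound lam L n D / real M"
    using M by (simp add: field_simps power2_eq_square)
  finally have le: "sqrt ((\<Sum>\<kappa><M. \<Sum>\<kappa>'<M. \<integral>\<phi>. (\<integral>\<phi>'. texp D (\<Sum>i\<in>?I. ?\<xi> \<kappa> \<phi> i * ?\<xi> \<kappa>' \<phi>' i) \<partial>?\<nu>) \<partial>?\<nu>) / (real M)\<^sup>2)
     \<le> sqrt (1 + adv_bound lam L n D / real M)"
    by (rule real_sqrt_le_mono)
  show "Adv D ?X \<le> ereal (sqrt (1 + adv_bound lam L n D / real M))"
    using *(1) le by (meson ereal_less_eq(3) order_trans)
qed

section \<open>Moments of the overlap\<close>

text \<open>The induction step amounts to (m / (m + 1))^(m + 1) <= 1 / e, an instance of 1 + x <=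
  exp x.\<close>

lemma fact_le_stirling:
  assumes "m \<ge> 1"
  shows "fact m \<le> exp 1 * real m * real m ^ m * exp (- real m)"
  using assms
proof (induction m rule: nat_induct_at_least)
  case base
  show ?case by (simp flip: exp_add)
next
  case (Suc m)
  have "1 + (- 1 / real (Suc m)) \<le> exp (- 1 / real (Suc m))" by (rule exp_ge_add_one_self)
  then have "real m / real (Suc m) \<le> exp (- 1 / real (Suc m))" by (simp add: field_simps)
  then have "(real m / real (Suc m)) ^ Suc m \<le> exp (- 1 / real (Suc m)) ^ Suc m" by (intro power_mono) auto
  also have "\<dots> = exp (- 1)" by (simp add: exp_of_nat_mult[symmetric] del: power_Suc of_nat_Suc)
  finally have "real m ^ Suc m \<le> exp (- 1) * real (Suc m) ^ Suc m"
    by (simp add: power_divide divide_le_eq del: power_Suc of_nat_Suc)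
  then have "(exp 1 * real (Suc m) * exp (- real m)) * real m ^ Suc m \<le> (exp 1 * real (Suc m) * exp (- real m)) * (exp (- 1) * real (Suc m) ^ Suc m)"
    by (intro mult_left_mono) auto
  moreover have "fact (Suc m) \<le> (exp 1 * real (Suc m) * exp (- real m)) * real m ^ Suc m"
    using mult_left_mono[OF Suc.IH, of "real (Suc m)"] by (simp add: algebra_simps)
  moreover have "exp (- real m) * exp (- 1) = exp (- real (Suc m))" by (simp flip: exp_add)
  ultimately have "fact (Suc m) \<le> (exp 1 * real (Suc m) * exp (- real m)) * (exp (- 1) * real (Suc m) ^ Suc m)"
    by linarith
  also have "\<dots> = exp 1 * real (Suc m) * real (Suc m) ^ Suc m * exp (- real (Suc m))"
    by (simp only: \<open>exp (- real m) * exp (- 1) = exp (- real (Suc m))\<close>[symmetric] mult_ac)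
  finally show ?case .
qed

text \<open>A single term of the exponential series at m.\<close>

lemma fact_ge_stirling: "real m ^ m * exp (- real m) \<le> fact m"
proof -
  have "real m ^ m / fact m \<le> exp (real m)"
    using exp_ge_zero summable_exp_generic[of "real m"] sum_le_suminf[of "\<lambda>k. real m ^ k /\<^sub>R fact k" "{m}"]
    by (auto simp: exp_def divide_inverse mult.commute)
  then show ?thesis by (simp add: exp_minus field_simps)
qed

text \<open>By Stirling's formula (2m)! is about (2m / e)^(2m) = (4m)^m (m / e)^m exp(- m), whose
  middle factor is at most m!. Writing 2m + 1 for 2m includes the case m = 0.\<close>

lemma even_moment_ratio:
  "fact (2 * m) / (fact m * (4 * real m) ^ m) \<le> exp 1 * (2 * real m + 1) * exp (- real m)"
proof (cases "m = 0")
  case False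
  have "fact (2 * m) \<le> exp 1 * real (2 * m) * real (2 * m) ^ (2 * m) * exp (- real (2 * m))"
    by (rule fact_le_stirling) (use False in simp)
  also have "real (2 * m) ^ (2 * m) = (4 * real m) ^ m * real m ^ m"
  proof -
    have "(real (2 * m))\<^sup>2 = 4 * real m * real m" by (simp add: power2_eq_square)
    then show ?thesis by (simp only: power_mult power_mult_distrib)
  qed
  also have "exp (- real (2 * m)) = exp (- real m) * exp (- real m)"
    by (simp flip: exp_add)
  also have "exp 1 * real (2 * m) * ((4 * real m) ^ m * real m ^ m) * (exp (- real m) * exp (- real m))
      = (exp 1 * (2 * real m) * exp (- real m)) * ((4 * real m) ^ m * (real m ^ m * exp (- real m)))"
    by simp
  also have "\<dots> \<le> (exp 1 * (2 * real m + 1) * exp (- real m)) * ((4 * real m) ^ m * fact m)"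
    by (intro mult_mono fact_ge_stirling) auto
  finally show ?thesis using False by (simp add: divide_simps mult_ac)
qed (simp add: exp_ge_add_one_self)

lemma power_le_exp_abs: "\<bar>x\<bar> ^ k / fact k \<le> exp (x::real) + exp (- x)"
proof -
  have "\<bar>x\<bar> ^ k / fact k \<le> exp \<bar>x\<bar>"
    using summable_exp_generic[of "\<bar>x\<bar>"] sum_le_suminf[of "\<lambda>k. \<bar>x\<bar> ^ k /\<^sub>R fact k" "{k}"]
    by (auto simp: exp_def divide_inverse mult.commute)
  also have "\<dots> \<le> exp x + exp (- x)" by (auto simp: abs_if)
  finally show ?thesis .
qed

text \<open>The bound of |t y|^(2m) / (2m)! by exponentials, at t = 2 sqrt m. For y of variance 1/2
  the mean of exp(t y) is about exp(t^2 / 4) = exp(m), which the factor exp(- m) cancels; this t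
  minimises the resulting estimate.\<close>

lemma even_power_le_exp:
  "(y\<^sup>2) ^ m / fact m \<le> exp 1 * (2 * real m + 1) * exp (- real m) * (exp (2 * sqrt (real m) * y) + exp (- (2 * sqrt (real m) * y)))"
proof (cases "m = 0")
  case False
  let ?t = "2 * sqrt (real m)"
  have "(y\<^sup>2) ^ m * (4 * real m) ^ m = \<bar>?t * y\<bar> ^ (2 * m)"
  proof -
    have "\<bar>?t * y\<bar>\<^sup>2 = y\<^sup>2 * (4 * real m)" by (simp add: power_mult_distrib)
    then show ?thesis by (simp only: power_mult power_mult_distrib)
  qed
  then have "(y\<^sup>2) ^ m / fact m = \<bar>?t * y\<bar> ^ (2 * m) / fact (2 * m) * (fact (2 * m) / (fact m * (4 * real m) ^ m))"
    using False by (simp add: field_simps)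
  also have "\<dots> \<le> (exp (?t * y) + exp (- (?t * y))) * (exp 1 * (2 * real m + 1) * exp (- real m))"
    by (intro mult_mono power_le_exp_abs even_moment_ratio) auto
  finally show ?thesis by (simp add: mult.commute)
next
  case True
  have "1 \<le> exp (1::real)" by simp
  then have "1 \<le> exp (1::real) * 2" by linarith
  then show ?thesis unfolding True by simp
qed

text \<open>The Lagrange remainder is exp t z^3 / 6, where exp t is at most 3.\<close>

lemma exp_le_cubic:
  assumes "\<bar>z::real\<bar> \<le> 1"
  shows "exp z \<le> 1 + z + z\<^sup>2 / 2 + \<bar>z\<bar> ^ 3"
proof -
  obtain t where "\<bar>t\<bar> \<le> \<bar>z\<bar> \<and> exp z = (\<Sum>m<3. z ^ m / fact m) + exp t / fact 3 * z ^ 3"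
    using Maclaurin_exp_le[of z 3] ..
  then have t: "\<bar>t\<bar> \<le> \<bar>z\<bar>" "exp z = (\<Sum>m<3. z ^ m / fact m) + exp t / fact 3 * z ^ 3" by simp_all
  have "exp t \<le> exp 1" using t(1) assms by simp
  also have "\<dots> \<le> 3" by (rule exp_le)
  finally have e3: "exp t \<le> 3" .
  have "exp t / 6 * z ^ 3 \<le> exp t / 6 * \<bar>z\<bar> ^ 3"
  proof (rule mult_left_mono)
    show "z ^ 3 \<le> \<bar>z\<bar> ^ 3" using abs_ge_self[of "z ^ 3"] by (simp add: power_abs)
  qed auto
  also have "\<dots> \<le> 1 * \<bar>z\<bar> ^ 3" by (rule mult_right_mono) (use e3 in auto)
  finally show ?thesis using t(2) by (simp add: numeral_eq_Suc lessThan_Suc)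
qed

section \<open>Trigonometric polynomials of a uniform phase\<close>

abbreviation unif :: "real measure" where
  "unif \<equiv> uniform_measure lborel {0..<2 * pi}"

text \<open>A periodic antiderivative takes equal values at 0 and 2 pi, so the mean over the period
  vanishes.\<close>

lemma unif_integral_deriv:
  assumes "\<And>x. (F has_vector_derivative f x) (at x)" "\<And>x. isCont f x" "F (2 * pi) = F 0"
  shows "(\<integral>x. f x \<partial>unif) = (0::real)"
proof -
  have "(LBINT x=ereal 0..ereal (2 * pi). f x) = F (2 * pi) - F 0"
  proof (rule interval_integral_FTC_finite)
    show "continuous_on {min 0 (2 * pi)..max 0 (2 * pi)} f"
      by (intro continuous_at_imp_continuous_on ballI assms(2))
    show "(F has_vector_derivative f x) (at x within {min 0 (2 * pi)..max 0 (2 * pi)})" for x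
      by (rule has_vector_derivative_at_within[OF assms(1)])
  qed
  then have "(LBINT x:{0..<2 * pi}. f x) = 0"
    using assms(3) by (simp add: interval_integral_Ico)
  moreover have "f \<in> borel_measurable borel"
    using assms(2) by (intro borel_measurable_continuous_onI continuous_at_imp_continuous_on) auto
  moreover have "unif = density lborel (\<lambda>x. ennreal (indicator {0..<2 * pi} x / (2 * pi)))"
    unfolding uniform_measure_def
    by (rule arg_cong[where f="density lborel"]) (auto simp: fun_eq_iff indicator_def divide_ennreal[symmetric])
  ultimately have "(\<integral>x. f x \<partial>unif) = (\<integral>x. indicator {0..<2 * pi} x / (2 * pi) * f x \<partial>lborel)"
    by (simp add: integral_density)
  also have "\<dots> = (\<integral>x. 1 / (2 * pi) * (indicator {0..<2 * pi} x *\<^sub>R f x) \<partial>lborel)"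
    by simp
  also have "\<dots> = 1 / (2 * pi) * (LBINT x:{0..<2 * pi}. f x)"
    unfolding set_lebesgue_integral_def by (rule integral_mult_right_zero)
  finally show ?thesis using \<open>(LBINT x:{0..<2 * pi}. f x) = 0\<close> by simp
qed


lemma prob_space_unif: "prob_space unif"
  by (rule prob_space_uniform_measure) auto

lemma unif_integrable:
  fixes f :: "real \<Rightarrow> real"
  assumes "f \<in> borel_measurable borel" "\<And>x. \<bar>f x\<bar> \<le> B"
  shows "integrable unif f"
proof -
  interpret prob_space unif by (rule prob_space_unif)
  have "f \<in> borel_measurable unif" using assms(1) by (simp cong: measurable_cong_sets)
  then show ?thesis by (intro integrable_const_bound[where B=B]) (use assms(2) in auto)
qed

lemma unif_integral_cos:
  assumes "k \<noteq> 0"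
  shows "(\<integral>u. cos (real_of_int k * (x - u)) \<partial>unif) = 0"
proof (rule unif_integral_deriv[where F="\<lambda>u. - sin (real_of_int k * (x - u)) / real_of_int k"])
  show "((\<lambda>u. - sin (real_of_int k * (x - u)) / real_of_int k) has_vector_derivative cos (real_of_int k * (x - u))) (at u)" for u
    using assms by (auto intro!: derivative_eq_intros simp flip: has_real_derivative_iff_has_vector_derivative)
  have "sin (real_of_int k * (x - 2 * pi)) = sin (real_of_int k * x)"
    using sin.plus_of_int[of "real_of_int k * x" "- k"] by (simp add: algebra_simps)
  then show "- sin (real_of_int k * (x - 2 * pi)) / real_of_int k = - sin (real_of_int k * (x - 0)) / real_of_int k"
    by simp
qed (auto intro!: continuous_intros)

lemma unif_integral_sin:
  shows "(\<integral>u. sin (real_of_int k * (x - u)) \<partial>unif) = 0"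
proof (cases "k = 0")
  case False
  show ?thesis
  proof (rule unif_integral_deriv[where F="\<lambda>u. cos (real_of_int k * (x - u)) / real_of_int k"])
    show "((\<lambda>u. cos (real_of_int k * (x - u)) / real_of_int k) has_vector_derivative sin (real_of_int k * (x - u))) (at u)" for u
      using False by (auto intro!: derivative_eq_intros simp flip: has_real_derivative_iff_has_vector_derivative)
    have "cos (real_of_int k * (x - 2 * pi)) = cos (real_of_int k * x)"
      using cos.plus_of_int[of "real_of_int k * x" "- k"] by (simp add: algebra_simps)
    then show "cos (real_of_int k * (x - 2 * pi)) / real_of_int k = cos (real_of_int k * (x - 0)) / real_of_int k"
      by simp
  qed (auto intro!: continuous_intros)
next
  case True
  then show ?thesis by simp
qed

definition trig_poly :: "nat \<Rightarrow> (nat \<Rightarrow> real) \<Rightarrow> (nat \<Rightarrow> real) \<Rightarrow> real \<Rightarrow> real" where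
  "trig_poly L a b x = (\<Sum>l\<in>{1..L}. a l * cos (real l * x) + b l * sin (real l * x))"

lemma trig_poly_bound: "\<bar>trig_poly L a b x\<bar> \<le> (\<Sum>l\<in>{1..L}. \<bar>a l\<bar> + \<bar>b l\<bar>)"
  unfolding trig_poly_def
proof (rule order_trans[OF sum_abs], rule sum_mono, rule order_trans[OF abs_triangle_ineq], rule add_mono)
  show "\<bar>a l * cos (real l * x)\<bar> \<le> \<bar>a l\<bar>" "\<bar>b l * sin (real l * x)\<bar> \<le> \<bar>b l\<bar>" for l
    by (simp_all add: abs_mult mult_left_le)
qed

lemma trig_poly_measurable [measurable]: "trig_poly L a b \<in> borel_measurable borel"
  unfolding trig_poly_def[abs_def] by measurable

lemma trig_poly_mean: "(\<integral>u. trig_poly L a b (x - u) \<partial>unif) = 0"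
proof -
  have i: "integrable unif (\<lambda>u. cos (real l * (x - u)))" "integrable unif (\<lambda>u. sin (real l * (x - u)))" for l
    by (auto intro!: unif_integrable[where B=1])
  show ?thesis
    using unif_integral_cos[of "int _" x] unif_integral_sin[of "int _" x]
    unfolding trig_poly_def by (simp add: i)
qed

lemma trig_product:
  fixes p q :: real
  shows "(a * cos p + b * sin p) * (a' * cos q + b' * sin q)
    = ((a * a' + b * b') * cos (p - q) + (a * a' - b * b') * cos (p + q)
      + (a * b' + b * a') * sin (p + q) + (b * a' - a * b') * sin (p - q)) / 2"
  by (simp add: cos_add cos_diff sin_add sin_diff field_simps)

text \<open>Product-to-sum formulas leave the frequencies l + l' and l - l'. Nonzero frequencies
  have mean 0; l + l' is positive, and l - l' vanishes only for l = l', where the cosine term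
  survives.\<close>

lemma trig_poly_second_moment:
  "(\<integral>u. (trig_poly L a b (x - u))\<^sup>2 \<partial>unif) = (\<Sum>l\<in>{1..L}. (a l)\<^sup>2 + (b l)\<^sup>2) / 2"
proof -
  interpret prob_space unif by (rule prob_space_unif)
  let ?g = "\<lambda>l u. a l * cos (real l * (x - u)) + b l * sin (real l * (x - u))"
  have i: "integrable unif (\<lambda>u. cos (real_of_int k * (x - u)))" "integrable unif (\<lambda>u. sin (real_of_int k * (x - u)))" for k
    by (auto intro!: unif_integrable[where B=1])
  have cross: "integrable unif (\<lambda>u. ?g l u * ?g l' u) \<and> (\<integral>u. ?g l u * ?g l' u \<partial>unif) = (if l = l' then ((a l)\<^sup>2 + (b l)\<^sup>2) / 2 else 0)"
    if "l \<ge> 1" "l' \<ge> 1" for l l'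
  proof -
    let ?d = "int l - int l'" and ?s = "int l + int l'"
    have s: "?s \<noteq> 0" using that by linarith
    have eq: "?g l u * ?g l' u = ((a l * a l' + b l * b l') * cos (real_of_int ?d * (x - u)) + (a l * a l' - b l * b l') * cos (real_of_int ?s * (x - u))
      + (a l * b l' + b l * a l') * sin (real_of_int ?s * (x - u)) + (b l * a l' - a l * b l') * sin (real_of_int ?d * (x - u))) / 2" for u
      unfolding trig_product by (simp add: distrib_right left_diff_distrib)
    have d: "has_bochner_integral unif (\<lambda>u. cos (real_of_int ?d * (x - u))) (if l = l' then 1 else 0)"
      unfolding has_bochner_integral_iff
    proof (intro conjI i)
      show "(\<integral>u. cos (real_of_int ?d * (x - u)) \<partial>unif) = (if l = l' then 1 else 0)"
        using unif_integral_cos[of ?d x] prob_space by auto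
    qed
    have s': "has_bochner_integral unif (\<lambda>u. cos (real_of_int ?s * (x - u))) 0"
      unfolding has_bochner_integral_iff by (intro conjI i unif_integral_cos s)
    have sn: "has_bochner_integral unif (\<lambda>u. sin (real_of_int k * (x - u))) 0" for k
      unfolding has_bochner_integral_iff by (intro conjI i unif_integral_sin)
    have "has_bochner_integral unif (\<lambda>u. ?g l u * ?g l' u)
      (((a l * a l' + b l * b l') * (if l = l' then 1 else 0) + (a l * a l' - b l * b l') * 0
      + (a l * b l' + b l * a l') * 0 + (b l * a l' - a l * b l') * 0) / 2)"
      unfolding eq
      by (intro has_bochner_integral_divide_zero has_bochner_integral_add has_bochner_integral_mult_right d s' sn)
    then show ?thesis
      unfolding has_bochner_integral_iff by (auto simp: power2_eq_square)
  qed
  have "(\<integral>u. (trig_poly L a b (x - u))\<^sup>2 \<partial>unif) = (\<integral>u. (\<Sum>l\<in>{1..L}. \<Sum>l'\<in>{1..L}. ?g l u * ?g l' u) \<partial>unif)"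
    by (simp add: trig_poly_def power2_eq_square sum_product)
  also have "\<dots> = (\<Sum>l\<in>{1..L}. \<Sum>l'\<in>{1..L}. \<integral>u. ?g l u * ?g l' u \<partial>unif)"
    using cross by (subst Bochner_Integration.integral_sum) (auto intro!: sum.cong Bochner_Integration.integral_sum Bochner_Integration.integrable_sum)
  also have "\<dots> = (\<Sum>l\<in>{1..L}. \<Sum>l'\<in>{1..L}. if l = l' then ((a l)\<^sup>2 + (b l)\<^sup>2) / 2 else 0)"
    using cross by (intro sum.cong) auto
  also have "\<dots> = (\<Sum>l\<in>{1..L}. (a l)\<^sup>2 + (b l)\<^sup>2) / 2"
    by (simp add: sum_divide_distrib)
  finally show ?thesis .
qed

text \<open>In the third-order Taylor expansion the linear term has mean 0, half the second moment 2
  V gives V / n, and the remainder is at most B^3 / n^(3/2) <= 1 / n. The sum of squares is written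
  4 V because the coefficients will be 2 sqrt m in modulus, so that V becomes a total
  degree.\<close>

lemma trig_poly_mgf:
  assumes n: "n > 0" and B: "(\<Sum>l\<in>{1..L}. \<bar>a l\<bar> + \<bar>b l\<bar>) \<le> B" "B ^ 3 \<le> sqrt (real n)" 
    and V: "(\<Sum>l\<in>{1..L}. (a l)\<^sup>2 + (b l)\<^sup>2) = 4 * V"
  shows "(\<integral>u. exp (trig_poly L a b (x - u) / sqrt (real n)) \<partial>unif) \<le> exp ((V + 1) / real n)"
    and "integrable unif (\<lambda>u. exp (trig_poly L a b (x - u) / sqrt (real n)))"
proof -
  interpret prob_space unif by (rule prob_space_unif)
  let ?h = "\<lambda>u. trig_poly L a b (x - u)" and ?r = "sqrt (real n)"
  have r: "?r \<ge> 1" using n by simp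
  have B0: "0 \<le> B" by (rule order_trans[OF _ B(1)]) (auto intro: sum_nonneg)
  have hB: "\<bar>?h u\<bar> \<le> B" for u by (rule order_trans[OF trig_poly_bound B(1)])
  have "B \<le> ?r"
  proof (cases "B \<le> 1")
    case False
    then have "B ^ 1 \<le> B ^ 3" by (intro power_increasing) auto
    then show ?thesis using B(2) by simp
  qed (use r in linarith)
  then have z: "\<bar>?h u / ?r\<bar> \<le> 1" for u
    using hB[of u] r by (simp add: abs_divide)
  have cube: "\<bar>?h u / ?r\<bar> ^ 3 \<le> 1 / real n" for u
  proof -
    have "\<bar>?h u / ?r\<bar> ^ 3 \<le> (B / ?r) ^ 3"
      using hB[of u] by (intro power_mono) (auto simp: abs_divide intro!: divide_right_mono)
    also have "\<dots> = B ^ 3 / (?r * real n)"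
      by (simp add: power_divide power3_eq_cube)
    also have "\<dots> \<le> ?r / (?r * real n)"
      using B(2) n by (intro divide_right_mono) auto
    also have "\<dots> = 1 / real n" using r n by simp
    finally show ?thesis .
  qed
  have ih: "integrable unif ?h"
    by (rule unif_integrable[where B=B]) (use hB in auto)
  have ih2: "integrable unif (\<lambda>u. (?h u)\<^sup>2)"
    by (rule unif_integrable[where B="B\<^sup>2"]) (use hB B0 in \<open>auto simp: abs_le_square_iff[symmetric]\<close>)
  show ie: "integrable unif (\<lambda>u. exp (?h u / ?r))"
  proof (rule unif_integrable[where B="exp 1"])
    show "\<bar>exp (?h u / ?r)\<bar> \<le> exp 1" for u using abs_le_D1[OF z[of u]] by simp
  qed measurable
  have "(\<integral>u. exp (?h u / ?r) \<partial>unif) \<le> (\<integral>u. 1 + ?h u / ?r + (?h u)\<^sup>2 / (2 * real n) + 1 / real n \<partial>unif)"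
  proof (rule integral_mono[OF ie])
    show "integrable unif (\<lambda>u. 1 + ?h u / ?r + (?h u)\<^sup>2 / (2 * real n) + 1 / real n)"
      using ih ih2 by auto
    show "exp (?h u / ?r) \<le> 1 + ?h u / ?r + (?h u)\<^sup>2 / (2 * real n) + 1 / real n" for u
      using exp_le_cubic[OF z[of u]] cube[of u] by (simp add: power_divide mult.commute)
  qed
  also have "\<dots> = 1 + (V + 1) / real n"
    using ih ih2 prob_space V by (simp add: trig_poly_mean trig_poly_second_moment add_divide_distrib)
  also have "\<dots> \<le> exp ((V + 1) / real n)" by (rule exp_ge_add_one_self)
  finally show "(\<integral>u. exp (?h u / ?r) \<partial>unif) \<le> exp ((V + 1) / real n)" .
qed

text \<open>For fixed \<phi> the phases \<phi>' are independent, so the n one-phase bounds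
  multiply.\<close>

lemma phase_exp_sum:
  assumes n: "n > 0" and B: "(\<Sum>l\<in>{1..L}. \<bar>a l\<bar> + \<bar>b l\<bar>) \<le> B" "B ^ 3 \<le> sqrt (real n)" 
    and V: "(\<Sum>l\<in>{1..L}. (a l)\<^sup>2 + (b l)\<^sup>2) = 4 * V"
  shows "integrable (phase_space n) (\<lambda>\<phi>'. exp (\<Sum>i<n. trig_poly L a b (\<phi> i - \<phi>' i) / sqrt (real n)))"
    and "(\<integral>\<phi>'. exp (\<Sum>i<n. trig_poly L a b (\<phi> i - \<phi>' i) / sqrt (real n)) \<partial>phase_space n) \<le> exp (V + 1)"
proof -
  interpret product_prob_space "\<lambda>_. unif" "{..<n}" by (rule product_prob_spaceI) (rule prob_space_unif)
  interpret product_sigma_finite "\<lambda>_. unif" ..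
  note mgf = trig_poly_mgf[OF n B V]
  show "integrable (phase_space n) (\<lambda>\<phi>'. exp (\<Sum>i<n. trig_poly L a b (\<phi> i - \<phi>' i) / sqrt (real n)))"
    unfolding phase_space_def exp_sum[OF finite_lessThan]
    by (rule product_integrable_prod[OF finite_lessThan]) (rule mgf)
  have "(\<integral>\<phi>'. exp (\<Sum>i<n. trig_poly L a b (\<phi> i - \<phi>' i) / sqrt (real n)) \<partial>phase_space n)
      = (\<Prod>i<n. \<integral>u. exp (trig_poly L a b (\<phi> i - u) / sqrt (real n)) \<partial>unif)"
    unfolding phase_space_def exp_sum[OF finite_lessThan]
    by (rule product_integral_prod[OF finite_lessThan]) (rule mgf)
  also have "\<dots> \<le> (\<Prod>i<n. exp ((V + 1) / real n))"
    by (rule prod_mono) (use mgf in \<open>auto intro!: integral_nonneg_AE\<close>)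
  also have "\<dots> = exp (V + 1)"
    using n by (simp add: exp_of_nat_mult[symmetric])
  finally show "(\<integral>\<phi>'. exp (\<Sum>i<n. trig_poly L a b (\<phi> i - \<phi>' i) / sqrt (real n)) \<partial>phase_space n) \<le> exp (V + 1)" .
qed

lemma texp_mono: "0 \<le> x \<Longrightarrow> x \<le> y \<Longrightarrow> texp D x \<le> texp D y"
  unfolding texp_def by (intro sum_mono divide_right_mono power_mono) auto

lemma card_exps_le: "finite I \<Longrightarrow> card (exps I D) \<le> (D + 1) ^ card I"
  using card_mono[of "I \<rightarrow>\<^sub>E {..D}" "exps I D"] by (auto simp: exps_def card_PiE intro: finite_PiE)

text \<open>
  The overlap is a sum of \<open>2 L\<close> squares \<open>y\<^sup>2\<close>. Expanding the exponential of the sum, each \<open>y\<^bsup>2m\<^esup> / m!\<close> is at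
  most a small factor times \<open>exp (t y) + exp (- t y)\<close> with \<open>t = 2 \<surd>m\<close>; a product of such terms is the exponential
  of one trigonometric polynomial in independent phases, hence factorizes.
\<close>

lemma adv_bound_le:
  assumes n: "n > 0" and D: "(2 * real D) ^ 3 \<le> sqrt (real n)" and lam: "\<bar>lam\<bar> \<le> 1"
  shows "adv_bound lam L n D \<le> exp 1 * (2 * exp 1 * (real D + 1) * (2 * real D + 1)) ^ (2 * L)"
proof -
  interpret P: prob_space "phase_space n" by (rule prob_space_phase)
  let ?K = "{1..L} \<times> (UNIV :: bool set)" and ?r = "sqrt (real n)"
  let ?C = "exp 1 * (2 * real D + 1)"
  \<comment> \<open>Indexed by the frequency and by \<open>True\<close> for cosine,
    \<open>False\<close> for sine: real and imaginary parts of the phase sums, scaled to variance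
    1/2.\<close>
  define y where "y \<phi> \<phi>' = (\<lambda>(l, c). (\<Sum>i<n. (if c then cos else sin) (real l * (\<phi> i - \<phi>' i))) / ?r)" for \<phi> \<phi>' :: "nat \<Rightarrow> real"
  define S :: "(nat \<times> bool \<Rightarrow> real) set" where "S = ?K \<rightarrow>\<^sub>E {1, - 1}"
  define A where "A m s = (\<lambda>c l. s (l, c) * (2 * sqrt (real (m (l, c)))))" for m :: "nat \<times> bool \<Rightarrow> nat" and s :: "nat \<times> bool \<Rightarrow> real"
  define E where "E m s \<phi> \<phi>' = exp (\<Sum>i<n. trig_poly L (A m s True) (A m s False) (\<phi> i - \<phi>' i) / ?r)" for m s \<phi> \<phi>'
  have sumK: "(\<Sum>k\<in>?K. f k) = (\<Sum>l\<in>{1..L}. f (l, True) + f (l, False))" for f :: "_ \<Rightarrow> real"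
  proof -
    have "(\<Sum>k\<in>?K. f k) = (\<Sum>l\<in>{1..L}. \<Sum>c\<in>UNIV. f (l, c))"
      unfolding sum.cartesian_product by (simp add: case_prod_unfold)
    then show ?thesis by (simp add: UNIV_bool add.commute)
  qed
  have cardK: "card ?K = 2 * L" by (simp add: card_cartesian_product)
  have ov: "overlap lam L n \<phi> \<phi>' \<le> (\<Sum>k\<in>?K. (y \<phi> \<phi>' k)\<^sup>2)" for \<phi> \<phi>'
  proof -
    let ?T = "\<Sum>l\<in>{1..L}. (cmod (\<Sum>i<n. cis (real l * (\<phi> i - \<phi>' i))))\<^sup>2"
    have "(\<Sum>k\<in>?K. (y \<phi> \<phi>' k)\<^sup>2) = 1 / real n * ?T"
      unfolding sumK sum_distrib_left y_def
      by (intro sum.cong refl) (simp add: cmod_power2 power_divide add_divide_distrib)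
    moreover have "overlap lam L n \<phi> \<phi>' \<le> 1 / real n * ?T"
      unfolding overlap_def using lam
      by (intro mult_right_mono divide_right_mono sum_nonneg) (auto simp: abs_square_le_1)
    ultimately show ?thesis by simp
  qed
  have ptw: "texp D (overlap lam L n \<phi> \<phi>') \<le> (\<Sum>m\<in>exps ?K D. \<Sum>s\<in>S. ?C ^ (2 * L) * exp (- real (\<Sum>k\<in>?K. m k)) * E m s \<phi> \<phi>')" for \<phi> \<phi>'
  proof -
    have "texp D (overlap lam L n \<phi> \<phi>') \<le> texp D (\<Sum>k\<in>?K. (y \<phi> \<phi>' k)\<^sup>2)"
      by (intro texp_mono overlap_nonneg ov)
    also have "\<dots> = (\<Sum>m\<in>exps ?K D. \<Prod>k\<in>?K. ((y \<phi> \<phi>' k)\<^sup>2) ^ m k / fact (m k))"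
      by (rule texp_sum[symmetric]) simp
    also have "\<dots> \<le> (\<Sum>m\<in>exps ?K D. \<Prod>k\<in>?K. \<Sum>e\<in>{1, - 1}. ?C * exp (- real (m k)) * exp (e * (2 * sqrt (real (m k)) * y \<phi> \<phi>' k)))"
    proof (intro sum_mono prod_mono conjI)
      fix m k assume "m \<in> exps ?K D" "k \<in> ?K"
      then have "m k \<le> D" by (auto simp: exps_def PiE_iff)
      let ?e = "exp (2 * sqrt (real (m k)) * y \<phi> \<phi>' k) + exp (- (2 * sqrt (real (m k)) * y \<phi> \<phi>' k))"
      have "((y \<phi> \<phi>' k)\<^sup>2) ^ m k / fact (m k) \<le> exp 1 * (2 * real (m k) + 1) * exp (- real (m k)) * ?e"
        by (rule even_power_le_exp)
      also have "\<dots> \<le> ?C * exp (- real (m k)) * ?e"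
        using \<open>m k \<le> D\<close> by (intro mult_right_mono mult_left_mono) auto
      finally show "((y \<phi> \<phi>' k)\<^sup>2) ^ m k / fact (m k) \<le> (\<Sum>e\<in>{1, - 1}. ?C * exp (- real (m k)) * exp (e * (2 * sqrt (real (m k)) * y \<phi> \<phi>' k)))"
        by (simp add: distrib_left)
    qed simp
    \<comment> \<open>Multiplying out over k leaves one term for each choice of signs.\<close>
    also have "\<dots> = (\<Sum>m\<in>exps ?K D. \<Sum>s\<in>S. \<Prod>k\<in>?K. ?C * exp (- real (m k)) * exp (s k * (2 * sqrt (real (m k)) * y \<phi> \<phi>' k)))"
      unfolding S_def by (intro sum.cong refl prod_sum_PiE) auto
    also have "\<dots> = (\<Sum>m\<in>exps ?K D. \<Sum>s\<in>S. ?C ^ (2 * L) * exp (- real (\<Sum>k\<in>?K. m k)) * E m s \<phi> \<phi>')"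
    proof (intro sum.cong refl)
      fix m s
      have "(\<Sum>k\<in>?K. s k * (2 * sqrt (real (m k)) * y \<phi> \<phi>' k))
          = (\<Sum>l\<in>{1..L}. A m s True l * ((\<Sum>i<n. cos (real l * (\<phi> i - \<phi>' i))) / ?r) + A m s False l * ((\<Sum>i<n. sin (real l * (\<phi> i - \<phi>' i))) / ?r))"
        unfolding sumK by (simp add: A_def y_def mult.assoc)
      also have "\<dots> = (\<Sum>l\<in>{1..L}. \<Sum>i<n. (A m s True l * cos (real l * (\<phi> i - \<phi>' i)) + A m s False l * sin (real l * (\<phi> i - \<phi>' i))) / ?r)"
        by (intro sum.cong refl) (simp add: sum_distrib_left sum_divide_distrib sum.distrib add_divide_distrib)
      also have "\<dots> = (\<Sum>i<n. trig_poly L (A m s True) (A m s False) (\<phi> i - \<phi>' i) / ?r)"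
        unfolding trig_poly_def sum_divide_distrib by (rule sum.swap)
      finally have "E m s \<phi> \<phi>' = (\<Prod>k\<in>?K. exp (s k * (2 * sqrt (real (m k)) * y \<phi> \<phi>' k)))"
        by (simp add: E_def flip: exp_sum)
      then show "(\<Prod>k\<in>?K. ?C * exp (- real (m k)) * exp (s k * (2 * sqrt (real (m k)) * y \<phi> \<phi>' k)))
         = ?C ^ (2 * L) * exp (- real (\<Sum>k\<in>?K. m k)) * E m s \<phi> \<phi>'"
        unfolding prod.distrib by (simp add: cardK[unfolded One_nat_def] sum_negf power_mult_distrib mult.commute[of L 2] flip: exp_sum)
    qed
    finally show ?thesis .
  qed
  have E: "integrable (phase_space n) (E m s \<phi>) \<and> (\<integral>\<phi>'. E m s \<phi> \<phi>' \<partial>phase_space n) \<le> exp (real (\<Sum>k\<in>?K. m k) + 1)"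
    if m: "m \<in> exps ?K D" and s: "s \<in> S" for m s \<phi>
  proof -
    have s1: "\<bar>s k\<bar> = 1" if "k \<in> ?K" for k using PiE_mem[OF s[unfolded S_def] that] by auto
    have s2: "(s k)\<^sup>2 = 1" if "k \<in> ?K" for k using s1[OF that] by (simp add: abs_square_eq_1)
    \<comment> \<open>As sqrt j <= j for natural j, the moduli of the coefficients sum to at most 2
      D; hence the cube of 2 D in the hypothesis.\<close>
    have le: "2 * sqrt (real j) \<le> 2 * real j" for j
      by (cases "j = 0") (auto intro!: real_le_lsqrt simp: power2_eq_square)
    have "(\<Sum>l\<in>{1..L}. \<bar>A m s True l\<bar> + \<bar>A m s False l\<bar>) = (\<Sum>k\<in>?K. 2 * sqrt (real (m k)))"
      unfolding sumK by (intro sum.cong refl) (auto simp: A_def abs_mult s1)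
    also have "\<dots> \<le> (\<Sum>k\<in>?K. 2 * real (m k))" by (intro sum_mono le)
    also have "\<dots> = 2 * real (\<Sum>k\<in>?K. m k)" by (simp add: sum_distrib_left)
    also have "\<dots> \<le> 2 * real D" using m by (auto simp: exps_def simp del: of_nat_sum)
    finally have 1: "(\<Sum>l\<in>{1..L}. \<bar>A m s True l\<bar> + \<bar>A m s False l\<bar>) \<le> 2 * real D" .
    have "(\<Sum>l\<in>{1..L}. (A m s True l)\<^sup>2 + (A m s False l)\<^sup>2) = (\<Sum>k\<in>?K. 4 * real (m k))"
      unfolding sumK by (intro sum.cong refl) (auto simp: A_def power_mult_distrib s2)
    also have "\<dots> = 4 * real (\<Sum>k\<in>?K. m k)" by (simp add: sum_distrib_left)
    finally have 2: "(\<Sum>l\<in>{1..L}. (A m s True l)\<^sup>2 + (A m s False l)\<^sup>2) = 4 * real (\<Sum>k\<in>?K. m k)" .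
    show ?thesis unfolding E_def using phase_exp_sum[OF n 1 D 2, of \<phi>] by simp
  qed
  let ?B = "exp 1 * (2 * exp 1 * (real D + 1) * (2 * real D + 1)) ^ (2 * L)"
  have inner: "(\<integral>\<phi>'. texp D (overlap lam L n \<phi> \<phi>') \<partial>phase_space n) \<le> ?B" for \<phi>
  proof -
    let ?R = "\<lambda>\<phi>'. \<Sum>m\<in>exps ?K D. \<Sum>s\<in>S. ?C ^ (2 * L) * exp (- real (\<Sum>k\<in>?K. m k)) * E m s \<phi> \<phi>'"
    have iR: "integrable (phase_space n) ?R"
      using E by (intro Bochner_Integration.integrable_sum integrable_mult_right) auto
    have "(\<integral>\<phi>'. texp D (overlap lam L n \<phi> \<phi>') \<partial>phase_space n) \<le> (\<integral>\<phi>'. ?R \<phi>' \<partial>phase_space n)"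
      by (rule integral_mono'[OF iR ptw]) (auto intro!: sum_nonneg simp: E_def)
    also have "\<dots> = (\<Sum>m\<in>exps ?K D. \<Sum>s\<in>S. ?C ^ (2 * L) * exp (- real (\<Sum>k\<in>?K. m k)) * (\<integral>\<phi>'. E m s \<phi> \<phi>' \<partial>phase_space n))"
    proof -
      have "(\<integral>\<phi>'. ?R \<phi>' \<partial>phase_space n) = (\<Sum>m\<in>exps ?K D. \<integral>\<phi>'. (\<Sum>s\<in>S. ?C ^ (2 * L) * exp (- real (\<Sum>k\<in>?K. m k)) * E m s \<phi> \<phi>') \<partial>phase_space n)"
        using E by (intro Bochner_Integration.integral_sum Bochner_Integration.integrable_sum integrable_mult_right) auto
      also have "\<dots> = (\<Sum>m\<in>exps ?K D. \<Sum>s\<in>S. \<integral>\<phi>'. ?C ^ (2 * L) * exp (- real (\<Sum>k\<in>?K. m k)) * E m s \<phi> \<phi>' \<partial>phase_space n)"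
        using E by (intro sum.cong refl Bochner_Integration.integral_sum integrable_mult_right) auto
      finally show ?thesis by simp
    qed
    also have "\<dots> \<le> (\<Sum>m\<in>exps ?K D. \<Sum>s\<in>S. ?C ^ (2 * L) * exp (- real (\<Sum>k\<in>?K. m k)) * exp (real (\<Sum>k\<in>?K. m k) + 1))"
      using E by (intro sum_mono mult_left_mono) auto
    \<comment> \<open>The cancellation: exp(- m) from Stirling's formula meets exp(m + 1) from the
      phases, m being the total degree.\<close>
    also have "\<dots> = (\<Sum>m\<in>exps ?K D. \<Sum>s\<in>S. ?C ^ (2 * L) * exp 1)"
      by (intro sum.cong refl) (simp add: mult.assoc flip: exp_add)
    also have "\<dots> = real (card (exps ?K D)) * (real (card S) * (?C ^ (2 * L) * exp 1))"
      by simp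
    \<comment> \<open>At most (D + 1)^(2 L) exponents on the 2 L squares, and 2^(2 L) choices of
      signs.\<close>
    also have "\<dots> \<le> real ((D + 1) ^ (2 * L)) * (real (2 ^ (2 * L)) * (?C ^ (2 * L) * exp 1))"
    proof -
      have "card (exps ?K D) \<le> (D + 1) ^ (2 * L)" using card_exps_le[of ?K D, unfolded cardK] by simp
      moreover have "card S = 2 ^ (2 * L)"
      proof -
        have "card S = (\<Prod>k\<in>?K. card {1, - 1 :: real})" unfolding S_def by (rule card_PiE) simp
        also have "\<dots> = card {1, - 1 :: real} ^ (2 * L)" by (simp only: prod_constant cardK)
        finally show ?thesis by (simp add: numeral_2_eq_2)
      qed
      ultimately show ?thesis
        by (intro mult_mono) (auto simp del: of_nat_power)
    qed
    also have "\<dots> = ?B"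
    proof -
      have "2 * exp 1 * (real D + 1) * (2 * real D + 1) = real (D + 1) * (2 * ?C)" by simp
      then show ?thesis by (simp only: power_mult_distrib of_nat_power of_nat_numeral mult_ac)
    qed
    finally show ?thesis .
  qed
  have "adv_bound lam L n D \<le> (\<integral>\<phi>. ?B \<partial>phase_space n)"
    unfolding adv_bound_def by (rule integral_mono'[OF _ inner]) auto
  then show ?thesis by (simp add: P.prob_space)
qed

section \<open>Simulation of many copies of a program\<close>

definition code_at :: "instr list \<Rightarrow> nat \<Rightarrow> instr list \<Rightarrow> bool" where
  "code_at P b c \<longleftrightarrow> b + length c \<le> length P \<and> (\<forall>i<length c. P ! (b + i) = c ! i)"

lemma code_at_append: "code_at P b (c @ d) \<longleftrightarrow> code_at P b c \<and> code_at P (b + length c) d"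
proof
  assume *: "code_at P b (c @ d)"
  have "P ! (b + i) = c ! i" if "i < length c" for i
    using * that by (auto simp: code_at_def nth_append dest!: spec[of _ i])
  moreover have "P ! (b + length c + i) = d ! i" if "i < length d" for i
    using * that unfolding code_at_def by (auto simp: nth_append add.assoc dest!: spec[of _ "length c + i"])
  ultimately show "code_at P b c \<and> code_at P (b + length c) d" using * by (auto simp: code_at_def)
next
  assume *: "code_at P b c \<and> code_at P (b + length c) d"
  then have d: "P ! (b + length c + i) = d ! i" if "i < length d" for i using that by (auto simp: code_at_def)
  have "P ! (b + i) = (c @ d) ! i" if "i < length c + length d" for i
    using * that d[of "i - length c"] by (cases "i < length c") (auto simp: code_at_def nth_append)
  then show "code_at P b (c @ d)" using * by (auto simp: code_at_def)
qed

lemma code_at_Cons: "code_at P b (i # c) \<longleftrightarrow> b < length P \<and> P ! b = i \<and> code_at P (Suc b) c"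
  using code_at_append[of P b "[i]" c] by (auto simp: code_at_def)

lemma code_at_self: "P = c @ d @ e \<Longrightarrow> b = length c \<Longrightarrow> code_at P b d"
  by (auto simp: code_at_def nth_append)

text \<open>An upper bound on the number of steps rather than its value: the branches of a
  conditional take different times, and bounds add up under composition.\<close>

definition reaches :: "instr list \<Rightarrow> (nat \<Rightarrow> real) \<Rightarrow> nat \<Rightarrow> config \<Rightarrow> config \<Rightarrow> bool" where
  "reaches P \<omega> T s s' \<longleftrightarrow> (\<exists>t\<le>T. (step P \<omega> ^^ t) s = s')"

lemma reaches_refl: "reaches P \<omega> T s s"
  unfolding reaches_def by (rule exI[of _ 0]) simp

lemma reaches_trans:
  assumes "reaches P \<omega> T s s'" "reaches P \<omega> T' s' s''" "T + T' \<le> U"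
  shows "reaches P \<omega> U s s''"
proof -
  obtain t t' where "t \<le> T" "(step P \<omega> ^^ t) s = s'" "t' \<le> T'" "(step P \<omega> ^^ t') s' = s''"
    using assms by (auto simp: reaches_def)
  then show ?thesis unfolding reaches_def using assms(3)
    by (intro exI[of _ "t' + t"]) (auto simp: funpow_add)
qed

lemma reaches_mono: "reaches P \<omega> T s s' \<Longrightarrow> T \<le> U \<Longrightarrow> reaches P \<omega> U s s'"
  unfolding reaches_def using le_trans by blast

lemma reaches_step:
  assumes "pc s < length P" "1 \<le> T"
  shows "reaches P \<omega> T s (exec \<omega> (P ! pc s) s)"
  unfolding reaches_def using assms by (intro exI[of _ 1]) (simp add: step_def halted_def)

text \<open>Meaningful only for the instructions singled out by \<open>simple\<close>.\<close>

fun effect :: "instr \<Rightarrow> (nat \<Rightarrow> real) \<Rightarrow> nat \<Rightarrow> real" where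
  "effect (LoadConst (Direct a) r) m = m(a := r)"
| "effect (Add (Direct a) (Direct b) (Direct c)) m = m(a := m b + m c)"
| "effect (Sub (Direct a) (Direct b) (Direct c)) m = m(a := m b - m c)"
| "effect (Mul (Direct a) (Direct b) (Direct c)) m = m(a := m b * m c)"
| "effect _ m = m"

fun simple :: "instr \<Rightarrow> bool" where
  "simple (LoadConst (Direct a) r) = True"
| "simple (Add (Direct a) (Direct b) (Direct c)) = True"
| "simple (Sub (Direct a) (Direct b) (Direct c)) = True"
| "simple (Mul (Direct a) (Direct b) (Direct c)) = True"
| "simple _ = False"

lemma exec_simple: "simple i \<Longrightarrow> exec \<omega> i s = s\<lparr>mem := effect i (mem s), pc := Suc (pc s)\<rparr>"
  by (cases i rule: simple.cases) (auto simp: wr_def rd_def)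

lemma reaches_simple:
  assumes "code_at P (pc s) c" "\<forall>i\<in>set c. simple i" "length c \<le> T"
  shows "reaches P \<omega> T s (s\<lparr>mem := fold effect c (mem s), pc := pc s + length c\<rparr>)"
  using assms
proof (induction c arbitrary: s T)
  case Nil
  then show ?case by (simp add: reaches_refl)
next
  case (Cons i c)
  let ?s = "s\<lparr>mem := effect i (mem s), pc := Suc (pc s)\<rparr>"
  have "reaches P \<omega> 1 s ?s"
    using reaches_step[of s P 1 \<omega>] Cons.prems by (simp add: code_at_Cons exec_simple)
  moreover have "reaches P \<omega> (length c) ?s (?s\<lparr>mem := fold effect c (mem ?s), pc := pc ?s + length c\<rparr>)"
    by (rule Cons.IH) (use Cons.prems in \<open>auto simp: code_at_Cons\<close>)
  ultimately have "reaches P \<omega> T s (?s\<lparr>mem := fold effect c (mem ?s), pc := pc ?s + length c\<rparr>)"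
    by (rule reaches_trans) (use Cons.prems(3) in simp)
  then show ?case by simp
qed

text \<open>A conditional assignment: \<open>i\<close> is jumped over when the comparison
  holds.\<close>

lemma reaches_skip:
  assumes "code_at P (pc s) [JumpLess (Direct a) (Direct b) (pc s + 2), i]" "simple i" "2 \<le> T"
  shows "reaches P \<omega> T s (s\<lparr>mem := if mem s a < mem s b then mem s else effect i (mem s), pc := pc s + 2\<rparr>)"
proof (cases "mem s a < mem s b")
  case True
  have "reaches P \<omega> T s (exec \<omega> (P ! pc s) s)"
    using assms by (intro reaches_step) (auto simp: code_at_Cons)
  moreover have "exec \<omega> (P ! pc s) s = s\<lparr>pc := pc s + 2\<rparr>"
    using assms True by (simp add: code_at_Cons branch_def rd_def)
  ultimately show ?thesis using True by simp
next
  case False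
  let ?s = "s\<lparr>pc := Suc (pc s)\<rparr>"
  have "reaches P \<omega> 1 s (exec \<omega> (P ! pc s) s)"
    using assms by (intro reaches_step) (auto simp: code_at_Cons)
  moreover have "exec \<omega> (P ! pc s) s = ?s"
    using assms False by (simp add: code_at_Cons branch_def rd_def)
  moreover have "reaches P \<omega> 1 ?s (exec \<omega> (P ! pc ?s) ?s)"
    using assms by (intro reaches_step) (auto simp: code_at_Cons)
  moreover have "exec \<omega> (P ! pc ?s) ?s = s\<lparr>mem := effect i (mem s), pc := pc s + 2\<rparr>"
    using assms by (simp add: code_at_Cons exec_simple)
  ultimately have "reaches P \<omega> T s (s\<lparr>mem := effect i (mem s), pc := pc s + 2\<rparr>)"
    using assms(3) reaches_trans[of P \<omega> 1 s ?s 1 _ T] by simp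
  then show ?thesis using False by simp
qed

text \<open>The invariant rule for an unrolled loop, \<open>Q k\<close> describing the memory after
  k blocks.\<close>

lemma fold_effect_concat_upt:
  assumes step: "\<And>k m. k < n \<Longrightarrow> Q k m \<Longrightarrow> Q (Suc k) (fold effect (c k) m)" and "Q 0 m"
  shows "Q n (fold effect (concat (map c [0..<n])) m)"
  using assms by (induction n) auto

lemma funpow_step_halted:
  assumes "halted P s" shows "(step P \<omega> ^^ t) s = s"
  by (induction t) (use assms in \<open>auto simp: step_def\<close>)

text \<open>A halted configuration no longer changes, so any one that is reached has the memory of
  the first.\<close>

lemma result_eqI:
  assumes "reaches P \<omega> T (init_config N y) s" "halted P s"
  shows "result P N y \<omega> = mem s"
proof -
  obtain t where t: "(step P \<omega> ^^ t) (init_config N y) = s" using assms by (auto simp: reaches_def)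
  let ?h = "\<lambda>t. halted P (run P N y \<omega> t)"
  have "?h t" using t assms by (simp add: run_def)
  then have "?h (LEAST t. ?h t)" "(LEAST t. ?h t) \<le> t" by (auto intro: LeastI Least_le)
  then have "run P N y \<omega> t = run P N y \<omega> (LEAST t. ?h t)"
    using funpow_step_halted[where P=P and s="run P N y \<omega> (LEAST t. ?h t)" and \<omega>=\<omega> and t="t - (LEAST t. ?h t)"]
    by (simp add: run_def flip: funpow_add[unfolded comp_def, THEN fun_cong])
  then show ?thesis using t by (simp add: result_def run_def)
qed

text \<open>
  A program runs inside a larger one on the memory cells \<open>base + M a + c\<close> and on the index registers
  \<open>M i + c + 2\<close>. Index values are multiplied by \<open>M\<close>, so that indexed addresses are mapped correctly;
  its Gaussians are read from the cells from \<open>g\<close> on through the index register 1, and the index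
  register 0 holds the constant 1. Each instruction becomes two.
\<close>

locale embedding =
  fixes M c base g zero b :: nat and p :: "instr list"
  assumes c: "c < M" and zero: "zero < base"
begin

definition cell :: "nat \<Rightarrow> nat" where "cell a = base + M * a + c"
definition reg :: "nat \<Rightarrow> nat" where "reg i = M * i + c + 2"

fun emb_addr :: "addr \<Rightarrow> addr" where
  "emb_addr (Direct a) = Direct (cell a)"
| "emb_addr (Indexed i a) = Indexed (reg i) (cell a)"

text \<open>A jump past the end of \<open>p\<close> halts it, and has to lead to the first
  instruction after the embedded code.\<close>

definition target :: "nat \<Rightarrow> nat" where "target k = b + 2 * min k (length p)"

text \<open>A Gaussian takes two instructions, a read and an increment of the tape position.
  Elsewhere \<open>IndexConst 0 1\<close> rewrites the value that register 0 already has, so that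
  code addresses stay linear in those of \<open>p\<close>. The instruction set has no copying, hence
  the addition of the cell \<open>zero\<close>.\<close>

fun emb :: "instr \<Rightarrow> instr list" where
  "emb (LoadConst a r) = [LoadConst (emb_addr a) r, IndexConst 0 1]"
| "emb (Gauss a) = [Add (emb_addr a) (Indexed 1 g) (Direct zero), IndexAdd 1 1 0]"
| "emb (Add a a' a'') = [Add (emb_addr a) (emb_addr a') (emb_addr a''), IndexConst 0 1]"
| "emb (Sub a a' a'') = [Sub (emb_addr a) (emb_addr a') (emb_addr a''), IndexConst 0 1]"
| "emb (Mul a a' a'') = [Mul (emb_addr a) (emb_addr a') (emb_addr a''), IndexConst 0 1]"
| "emb (Div a a' a'') = [Div (emb_addr a) (emb_addr a') (emb_addr a''), IndexConst 0 1]"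
| "emb (JumpLess a a' k) = [JumpLess (emb_addr a) (emb_addr a') (target k), IndexConst 0 1]"
| "emb (IndexConst i v) = [IndexConst (reg i) (M * v), IndexConst 0 1]"
| "emb (IndexAdd i j k) = [IndexAdd (reg i) (reg j) (reg k), IndexConst 0 1]"
| "emb (IndexSub i j k) = [IndexSub (reg i) (reg j) (reg k), IndexConst 0 1]"
| "emb (IndexJumpLess i j k) = [IndexJumpLess (reg i) (reg j) (target k), IndexConst 0 1]"

definition emb_prog :: "instr list" where "emb_prog = concat (map emb p)"

lemma length_emb: "length (emb i) = 2"
  by (cases i) auto

lemma length_concat_emb: "length (concat (map emb q)) = 2 * length q"
  by (induction q) (auto simp: length_emb)

lemma length_emb_prog: "length emb_prog = 2 * length p"
  unfolding emb_prog_def by (rule length_concat_emb)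

lemma code_at_emb:
  assumes "code_at P b emb_prog" "k < length p"
  shows "code_at P (b + 2 * k) (emb (p ! k))"
proof -
  have "p = take k p @ p ! k # drop (Suc k) p" using assms(2) by (simp add: id_take_nth_drop)
  then have "emb_prog = concat (map emb (take k p)) @ emb (p ! k) @ concat (map emb (drop (Suc k) p))"
    unfolding emb_prog_def by (metis concat.simps(2) concat_append list.simps(9) map_append)
  moreover have "length (concat (map emb (take k p))) = 2 * k"
    using assms(2) by (simp add: length_concat_emb)
  ultimately show ?thesis using assms(1) by (simp add: code_at_append)
qed

lemma cell_inj [simp]: "cell a = cell a' \<longleftrightarrow> a = a'"
  using c by (auto simp: cell_def)

lemma reg_inj [simp]: "reg i = reg j \<longleftrightarrow> i = j"
  using c by (auto simp: reg_def)

lemma reg_neq [simp]: "reg i \<noteq> 0" "reg i \<noteq> Suc 0" "0 \<noteq> reg i" "Suc 0 \<noteq> reg i"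
  by (auto simp: reg_def)

lemma cell_ge: "base \<le> cell a"
  by (simp add: cell_def)

text \<open>The arguments \<open>m0\<close> and \<open>i0\<close> record memory and registers
  outside this copy, which have to survive for the other copies. Scaling index values by M commutes
  with addition, with truncated subtraction and, as M is positive, with comparison.\<close>

definition sim :: "(nat \<Rightarrow> real) \<Rightarrow> (nat \<Rightarrow> nat) \<Rightarrow> config \<Rightarrow> config \<Rightarrow> bool" where
  "sim m0 i0 s s' \<longleftrightarrow> pc s' = target (pc s) \<and> (\<forall>a. mem s' (cell a) = mem s a) \<and> (\<forall>i. idx s' (reg i) = M * idx s i)
     \<and> idx s' 0 = 1 \<and> idx s' 1 = drawn s \<and> (\<forall>a. a \<notin> range cell \<longrightarrow> mem s' a = m0 a)
     \<and> (\<forall>r. r \<notin> range reg \<longrightarrow> r \<noteq> 0 \<longrightarrow> r \<noteq> 1 \<longrightarrow> idx s' r = i0 r)"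

lemma resolve_emb: "sim m0 i0 s s' \<Longrightarrow> resolve s' (emb_addr a) = cell (resolve s a)"
  by (cases a) (auto simp: sim_def cell_def distrib_left)

lemma rd_emb: "sim m0 i0 s s' \<Longrightarrow> rd s' (emb_addr a) = rd s a"
  by (simp add: rd_def resolve_emb) (simp add: sim_def)

lemma sim_wr:
  assumes "sim m0 i0 s s'" "pc s < length p"
  shows "sim m0 i0 (wr a v s) (exec \<omega> (IndexConst 0 1) (wr (emb_addr a) v s'))"
  using assms(2) resolve_emb[OF assms(1), of a] assms(1)
  by (auto simp: sim_def wr_def set_idx_def target_def)

lemma sim_branch:
  assumes "sim m0 i0 s s'"
  shows "sim m0 i0 (branch True k s) (branch True (target k) s')"
    and "pc s < length p \<Longrightarrow> sim m0 i0 (branch False k s) (exec \<omega> (IndexConst 0 1) (branch False k' s'))"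
  using assms by (auto simp: sim_def branch_def set_idx_def target_def)

lemma sim_set_idx:
  assumes "sim m0 i0 s s'" "pc s < length p" "v' = M * v"
  shows "sim m0 i0 (set_idx i v s) (exec \<omega> (IndexConst 0 1) (set_idx (reg i) v' s'))"
  using assms by (auto simp: sim_def set_idx_def target_def)

lemma two_steps:
  assumes "code_at P (pc s) [i, j]" "pc (exec \<omega> i s) = Suc (pc s)"
  shows "reaches P \<omega> 2 s (exec \<omega> j (exec \<omega> i s))"
proof (rule reaches_trans)
  show "reaches P \<omega> 1 s (exec \<omega> i s)"
    using reaches_step[of s P 1 \<omega>] assms by (simp add: code_at_Cons)
  show "reaches P \<omega> 1 (exec \<omega> i s) (exec \<omega> j (exec \<omega> i s))"
    using reaches_step[of "exec \<omega> i s" P 1 \<omega>] assms by (simp add: code_at_Cons)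
qed simp

lemma sim_step:
  assumes P: "code_at P b emb_prog" and sim: "sim m0 i0 s s'" and pc: "pc s < length p"
    and gauss: "m0 (g + drawn s) = \<omega>' (drawn s)" "g + drawn s < base" and z: "m0 zero = 0"
  shows "\<exists>s''. reaches P \<omega> 2 s' s'' \<and> sim m0 i0 (step p \<omega>' s) s''"
proof -
  have pc': "pc s' = b + 2 * pc s" using sim pc by (simp add: sim_def target_def)
  have code: "code_at P (pc s') (emb (p ! pc s))" unfolding pc' by (rule code_at_emb[OF P pc])
  have st: "step p \<omega>' s = exec \<omega>' (p ! pc s) s" using pc by (simp add: step_def halted_def)
  have wr: "\<exists>s''. reaches P \<omega> 2 s' s'' \<and> sim m0 i0 (wr a v s) s''"
    if "code_at P (pc s') [i, IndexConst 0 1]" "exec \<omega> i s' = wr (emb_addr a) v s'" for a v i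
    using two_steps[OF that(1), of \<omega>] sim_wr[OF sim pc, of a v \<omega>] that(2)
    by (auto simp: wr_def)
  have ix: "\<exists>s''. reaches P \<omega> 2 s' s'' \<and> sim m0 i0 (set_idx i v s) s''"
    if "code_at P (pc s') [j, IndexConst 0 1]" "exec \<omega> j s' = set_idx (reg i) (M * v) s'" for i v j
    using two_steps[OF that(1), of \<omega>] sim_set_idx[OF sim pc refl, of i v \<omega>] that(2)
    by (auto simp: set_idx_def)
  have br: "\<exists>s''. reaches P \<omega> 2 s' s'' \<and> sim m0 i0 (branch B k s) s''"
    if "code_at P (pc s') [j, IndexConst 0 1]" "exec \<omega> j s' = branch B (target k) s'" for B k j
  proof (cases B)
    case True
    then show ?thesis
      using reaches_step[of s' P 2 \<omega>] that sim_branch(1)[OF sim, of k] by (auto simp: code_at_Cons)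
  next
    case False
    then show ?thesis
      using two_steps[OF that(1), of \<omega>] sim_branch(2)[OF sim pc, of k \<omega> "target k"] that(2)
      by (auto simp: branch_def)
  qed
  have idx: "idx s' (reg i) = M * idx s i" for i using sim by (simp add: sim_def)
  have Mpos: "0 < M" using c by simp
  show ?thesis
  proof (cases "p ! pc s")
    case (Gauss a)
    let ?s1 = "exec \<omega> (Add (emb_addr a) (Indexed 1 g) (Direct zero)) s'"
    have "reaches P \<omega> 2 s' (exec \<omega> (IndexAdd 1 1 0) ?s1)"
      using two_steps[of P s' "Add (emb_addr a) (Indexed 1 g) (Direct zero)" "IndexAdd 1 1 0" \<omega>] code
      by (simp add: Gauss wr_def)
    moreover have "rd s' (Indexed 1 g) + rd s' (Direct zero) = \<omega>' (drawn s)"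
    proof -
      \<comment> \<open>The stored Gaussians and the zero cell lie below \<open>base\<close>, out of
        reach of the simulated program.\<close>
      have "g + drawn s \<notin> range cell" "zero \<notin> range cell" using gauss(2) zero cell_ge by (auto simp: not_less[symmetric])
      then show ?thesis using sim gauss z by (simp add: sim_def rd_def add.commute)
    qed
    moreover have "sim m0 i0 (exec \<omega>' (Gauss a) s) (exec \<omega> (IndexAdd 1 1 0) (wr (emb_addr a) (\<omega>' (drawn s)) s'))"
    proof -
      have "resolve (s\<lparr>drawn := x\<rparr>) a = resolve s a" for x by (cases a) auto
      then show ?thesis
        using pc resolve_emb[OF sim, of a] sim
        by (auto simp: sim_def wr_def set_idx_def target_def)
    qed
    ultimately show ?thesis unfolding st Gauss by auto
  qed (use code wr ix br in \<open>auto simp: st rd_emb[OF sim] idx distrib_left diff_mult_distrib2 Mpos\<close>)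
qed

text \<open>Each step draws at most one Gaussian, so T stored ones suffice for T steps.\<close>

lemma drawn_le: "drawn (run p N y \<omega> t) \<le> t"
proof (induction t)
  case (Suc t)
  have "drawn (exec \<omega> i s) \<le> Suc (drawn s)" for i s
    by (cases i) (auto simp: wr_def set_idx_def branch_def)
  then have "drawn (step p \<omega> s) \<le> Suc (drawn s)" for s by (auto simp: step_def intro: le_SucI)
  then show ?case using Suc by (auto simp: run_def intro: order_trans)
qed (simp add: run_def init_config_def)

lemma sim_run:
  assumes P: "code_at P b emb_prog" and s': "sim m0 i0 (init_config N y) s'"
    and gauss: "\<And>r. r < T \<Longrightarrow> m0 (g + r) = \<omega>' r" "g + T \<le> base" and z: "m0 zero = 0"
    and h: "t \<le> T" "halted p (run p N y \<omega>' t)"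
  shows "\<exists>s''. reaches P \<omega> (2 * T) s' s'' \<and> pc s'' = b + length emb_prog
    \<and> (\<forall>a. mem s'' (cell a) = result p N y \<omega>' a) \<and> (\<forall>a. a \<notin> range cell \<longrightarrow> mem s'' a = m0 a)
    \<and> (\<forall>r. r \<notin> range reg \<longrightarrow> r \<noteq> 0 \<longrightarrow> r \<noteq> 1 \<longrightarrow> idx s'' r = i0 r) \<and> idx s'' 0 = 1"
proof -
  let ?h = "LEAST t. halted p (run p N y \<omega>' t)"
  have h': "halted p (run p N y \<omega>' ?h)" "?h \<le> t" using h by (auto intro: LeastI Least_le)
  have "u \<le> ?h \<Longrightarrow> \<exists>s''. reaches P \<omega> (2 * u) s' s'' \<and> sim m0 i0 (run p N y \<omega>' u) s''" for u
  proof (induction u)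
    case 0
    then show ?case using s' by (auto simp: run_def intro: reaches_refl)
  next
    case (Suc u)
    then obtain s1 where s1: "reaches P \<omega> (2 * u) s' s1" "sim m0 i0 (run p N y \<omega>' u) s1" by auto
    have "\<not> halted p (run p N y \<omega>' u)" using Suc.prems not_less_Least[of u "\<lambda>t. halted p (run p N y \<omega>' t)"] by auto
    then have pc: "pc (run p N y \<omega>' u) < length p" by (simp add: halted_def)
    have d: "drawn (run p N y \<omega>' u) < T" using drawn_le[of N y \<omega>' u] Suc.prems h h' by linarith
    obtain s2 where s2: "reaches P \<omega> 2 s1 s2" "sim m0 i0 (step p \<omega>' (run p N y \<omega>' u)) s2"
      using sim_step[where \<omega>'=\<omega>' and \<omega>=\<omega>, OF P s1(2) pc gauss(1)[OF d]] z d gauss(2) by auto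
    have "reaches P \<omega> (2 * Suc u) s' s2" by (rule reaches_trans[OF s1(1) s2(1)]) simp
    then show ?case using s2(2) by (auto simp: run_def)
  qed
  then obtain s'' where s'': "reaches P \<omega> (2 * ?h) s' s''" "sim m0 i0 (run p N y \<omega>' ?h) s''" by blast
  have "reaches P \<omega> (2 * T) s' s''"
    by (rule reaches_mono[OF s''(1)]) (use h h' in linarith)
  moreover have "pc s'' = b + length emb_prog"
    using s''(2) h'(1) by (simp add: sim_def target_def halted_def length_emb_prog)
  ultimately show ?thesis using s''(2)
    by (intro exI[of _ s'']) (simp add: sim_def result_def)
qed

end

text \<open>
  From a sample \<open>y\<close> and the Gaussians \<open>u\<close> form \<open>\<alpha> y + \<beta> Z\<close>, on which \<open>p\<close> is run, and \<open>\<beta> y - \<alpha> Z\<close>, whose block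
  at \<open>off\<close> is correlated with the output of \<open>p\<close>; here \<open>Z\<^sub>k = coef k * u (pos k)\<close>.
\<close>

definition sample_test ::
  "instr list \<Rightarrow> nat \<Rightarrow> nat \<Rightarrow> nat \<Rightarrow> real \<Rightarrow> real \<Rightarrow> real \<Rightarrow> (nat \<Rightarrow> real) \<Rightarrow> (nat \<Rightarrow> nat) \<Rightarrow> (nat \<Rightarrow> real) \<Rightarrow> (nat \<Rightarrow> real) \<Rightarrow> bool" where
  "sample_test p N n2 off \<alpha> \<beta> \<tau> coef pos y u \<longleftrightarrow>
     (let X = result p N (\<lambda>k. \<alpha> * y k + \<beta> * coef k * u (pos k)) (\<lambda>r. u (N + r));
          s = \<Sum>q<n2. X q * (\<beta> * y (off + q) - \<alpha> * coef (off + q) * u (pos (off + q)))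
      in \<tau> * (\<Sum>q<n2. X q * X q) < (max 0 s)\<^sup>2)"

section \<open>The testing program\<close>

locale tester =
  fixes M N T n2 off :: nat and p :: "instr list" and \<alpha> \<beta> \<tau> :: real
    and coef :: "nat \<Rightarrow> real" and pos :: "nat \<Rightarrow> nat"
  assumes M: "M > 0" and pos: "\<And>k. k < N \<Longrightarrow> pos k < N" and off: "off + n2 \<le> N"
    and halts: "\<And>y \<omega>. \<exists>t\<le>T. halted p (run p N y \<omega> t)"
begin

text \<open>
  Memory: the input, \<open>R\<close> pre-drawn Gaussians for each of the \<open>M\<close> samples, six scratch cells, and from \<open>base\<close> on
  the interleaved memories of the \<open>M\<close> copies of \<open>p\<close>.
\<close>

definition "R = N + T"
definition "czero = M * N + M * R"
definition "cflag = czero + 1"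
definition "ct1 = czero + 2"
definition "ct2 = czero + 3"
definition "csum = czero + 4"
definition "cnorm = czero + 5"
definition "base = czero + 6"
definition "yc \<kappa> k = \<kappa> * N + k" for \<kappa> k :: nat
definition "gc \<kappa> r = M * N + (\<kappa> * R + r)" for \<kappa> r :: nat
definition "xc \<kappa> a = base + M * a + \<kappa>" for \<kappa> a :: nat

lemmas cells = czero_def cflag_def ct1_def ct2_def csum_def cnorm_def base_def xc_def

lemma xc_eq: "\<kappa> < M \<Longrightarrow> \<kappa>' < M \<Longrightarrow> xc \<kappa> a = xc \<kappa>' a' \<longleftrightarrow> \<kappa> = \<kappa>' \<and> a = a'"
proof -
  assume k: "\<kappa> < M" "\<kappa>' < M"
  have mod: "(M * a + \<kappa>) mod M = \<kappa>" "(M * a' + \<kappa>') mod M = \<kappa>'" using k by simp_all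
  show ?thesis
  proof
    assume "xc \<kappa> a = xc \<kappa>' a'"
    then have eq: "M * a + \<kappa> = M * a' + \<kappa>'" by (simp add: xc_def)
    with mod have "\<kappa> = \<kappa>'" by simp
    with eq M show "\<kappa> = \<kappa>' \<and> a = a'" by simp
  qed simp
qed

lemma cells_distinct [simp]:
  "ct1 \<noteq> ct2" "ct2 \<noteq> ct1" "ct1 \<noteq> csum" "csum \<noteq> ct1" "ct1 \<noteq> cnorm" "cnorm \<noteq> ct1" "ct1 \<noteq> cflag" "cflag \<noteq> ct1"
  "ct2 \<noteq> csum" "csum \<noteq> ct2" "ct2 \<noteq> cnorm" "cnorm \<noteq> ct2" "ct2 \<noteq> cflag" "cflag \<noteq> ct2"
  "csum \<noteq> cnorm" "cnorm \<noteq> csum" "csum \<noteq> cflag" "cflag \<noteq> csum" "cnorm \<noteq> cflag" "cflag \<noteq> cnorm"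
  "czero \<noteq> ct1" "czero \<noteq> ct2" "czero \<noteq> csum" "czero \<noteq> cnorm" "czero \<noteq> cflag"
  "ct1 \<noteq> czero" "ct2 \<noteq> czero" "csum \<noteq> czero" "cnorm \<noteq> czero" "cflag \<noteq> czero"
  by (simp_all add: cflag_def ct1_def ct2_def csum_def cnorm_def)

lemma xc_distinct [simp]:
  "xc \<kappa> a \<noteq> ct1" "xc \<kappa> a \<noteq> ct2" "xc \<kappa> a \<noteq> csum" "xc \<kappa> a \<noteq> cnorm" "xc \<kappa> a \<noteq> cflag" "xc \<kappa> a \<noteq> czero"
  "ct1 \<noteq> xc \<kappa> a" "ct2 \<noteq> xc \<kappa> a" "csum \<noteq> xc \<kappa> a" "cnorm \<noteq> xc \<kappa> a" "cflag \<noteq> xc \<kappa> a" "czero \<noteq> xc \<kappa> a"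
  by (simp_all add: xc_def base_def cflag_def ct1_def ct2_def csum_def cnorm_def)

lemma low_distinct:
  assumes "a < czero"
  shows "a \<noteq> ct1" "a \<noteq> ct2" "a \<noteq> csum" "a \<noteq> cnorm" "a \<noteq> cflag" "a \<noteq> xc \<kappa> b"
    "ct1 \<noteq> a" "ct2 \<noteq> a" "csum \<noteq> a" "cnorm \<noteq> a" "cflag \<noteq> a" "xc \<kappa> b \<noteq> a"
  using assms by (simp_all add: xc_def base_def cflag_def ct1_def ct2_def csum_def cnorm_def)

lemma block_less: "\<kappa> < M \<Longrightarrow> k < K \<Longrightarrow> \<kappa> * K + k < M * K" for K :: nat
proof -
  assume "\<kappa> < M" "k < K"
  then have "\<kappa> * K + k < Suc \<kappa> * K" "Suc \<kappa> * K \<le> M * K" using mult_le_mono1[of "Suc \<kappa>" M K] by simp_all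
  then show ?thesis by linarith
qed

lemma yc_less: "\<kappa> < M \<Longrightarrow> k < N \<Longrightarrow> yc \<kappa> k < M * N"
  unfolding yc_def by (rule block_less)

lemma gc_less: "\<kappa> < M \<Longrightarrow> r < R \<Longrightarrow> gc \<kappa> r < czero"
  unfolding gc_def czero_def using block_less[of \<kappa> r R] by simp

definition prep :: "nat \<Rightarrow> nat \<Rightarrow> instr list" where
  "prep \<kappa> k = [LoadConst (Direct ct1) \<alpha>, Mul (Direct ct1) (Direct ct1) (Direct (yc \<kappa> k)),
     LoadConst (Direct ct2) (\<beta> * coef k), Mul (Direct ct2) (Direct ct2) (Direct (gc \<kappa> (pos k))),
     Add (Direct (xc \<kappa> k)) (Direct ct1) (Direct ct2)]"

definition stat :: "nat \<Rightarrow> nat \<Rightarrow> instr list" where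
  "stat \<kappa> q = [LoadConst (Direct ct1) \<beta>, Mul (Direct ct1) (Direct ct1) (Direct (yc \<kappa> (off + q))),
     LoadConst (Direct ct2) (\<alpha> * coef (off + q)), Mul (Direct ct2) (Direct ct2) (Direct (gc \<kappa> (pos (off + q)))),
     Sub (Direct ct1) (Direct ct1) (Direct ct2), Mul (Direct ct1) (Direct (xc \<kappa> q)) (Direct ct1),
     Add (Direct csum) (Direct csum) (Direct ct1),
     Mul (Direct ct2) (Direct (xc \<kappa> q)) (Direct (xc \<kappa> q)), Add (Direct cnorm) (Direct cnorm) (Direct ct2)]"

definition "c1 \<kappa> = concat (map (prep \<kappa>) [0..<N])"
definition "c3 \<kappa> b = embedding.emb_prog M \<kappa> base (gc \<kappa> N) czero b p"
definition "c4 \<kappa> = [LoadConst (Direct csum) 0, LoadConst (Direct cnorm) 0] @ concat (map (stat \<kappa>) [0..<n2])"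
text \<open>The positive part of the correlation is kept, so that the comparison of squares in
  \<open>c7\<close> rejects negative correlations. Squares are compared because the machine has no
  square root.\<close>

definition "c5 b = [JumpLess (Direct czero) (Direct csum) (b + 2), LoadConst (Direct csum) 0]"
definition "c6 = [Mul (Direct csum) (Direct csum) (Direct csum), LoadConst (Direct ct1) \<tau>,
  Mul (Direct cnorm) (Direct ct1) (Direct cnorm), LoadConst (Direct ct2) 1]"
definition "c7 b = [JumpLess (Direct cnorm) (Direct csum) (b + 2), LoadConst (Direct ct2) 0]"
text \<open>For bits, flag + t - flag t is the disjunction of flag and t.\<close>

definition "c8 = [Mul (Direct ct1) (Direct cflag) (Direct ct2), Add (Direct cflag) (Direct cflag) (Direct ct2),
  Sub (Direct cflag) (Direct cflag) (Direct ct1)]"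

text \<open>Jump targets are absolute, hence the addresses handed to the blocks: \<open>b\<close>
  plus the lengths of what precedes. \<open>IndexConst 1 0\<close> rewinds the tape position for the
  new copy.\<close>

definition copy :: "nat \<Rightarrow> nat \<Rightarrow> instr list" where
  "copy \<kappa> b = c1 \<kappa> @ [IndexConst 1 0] @ c3 \<kappa> (b + 5 * N + 1) @ c4 \<kappa> @ c5 (b + 5 * N + 2 * length p + 9 * n2 + 3)
     @ c6 @ c7 (b + 5 * N + 2 * length p + 9 * n2 + 9) @ c8"

definition "clen = 5 * N + 2 * length p + 9 * n2 + 14"

lemma length_c1: "length (c1 \<kappa>) = 5 * N"
  by (simp add: c1_def length_concat comp_def prep_def sum_list_triv)

lemma length_c3: "\<kappa> < M \<Longrightarrow> length (c3 \<kappa> b) = 2 * length p"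
  unfolding c3_def by (rule embedding.length_emb_prog) (unfold_locales, auto simp: base_def)

lemma length_c4: "length (c4 \<kappa>) = 9 * n2 + 2"
  by (simp add: c4_def length_concat comp_def stat_def sum_list_triv)

lemma length_copy: "\<kappa> < M \<Longrightarrow> length (copy \<kappa> b) = clen"
  by (simp add: copy_def length_c1 length_c3 length_c4 c5_def c6_def c7_def c8_def clen_def)

definition start :: nat where "start = M * R + 1"

text \<open>All Gaussians are drawn in advance, so that sample \<kappa> owns those from number
  \<open>\<kappa> * R\<close> on, whatever the other copies do. The last instruction copies the flag
  to cell 0, where the verdict is read.\<close>

definition prog :: "instr list" where
  "prog = map (\<lambda>r. Gauss (Direct (M * N + r))) [0..<M * R] @ [IndexConst 0 1]
     @ concat (map (\<lambda>\<kappa>. copy \<kappa> (start + \<kappa> * clen)) [0..<M]) @ [Add (Direct 0) (Direct cflag) (Direct czero)]"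

lemma length_copies: "K \<le> M \<Longrightarrow> length (concat (map (\<lambda>\<kappa>. copy \<kappa> (start + \<kappa> * clen)) [0..<K])) = K * clen"
  by (induction K) (auto simp: length_copy)

lemma length_prog: "length prog = start + M * clen + 1"
  by (simp add: prog_def length_copies) (simp add: start_def)

lemma code_at_copy:
  assumes "\<kappa> < M"
  shows "code_at prog (start + \<kappa> * clen) (copy \<kappa> (start + \<kappa> * clen))"
proof (rule code_at_self)
  let ?C = "\<lambda>K. concat (map (\<lambda>\<kappa>. copy \<kappa> (start + \<kappa> * clen)) K)"
  have "[0..<M] = [0..<\<kappa>] @ \<kappa> # [Suc \<kappa>..<M]"
    using assms by (metis le_add1 less_imp_add_positive upt_add_eq_append upt_conv_Cons zero_le append.simps less_add_eq_less)
  then show "prog = (map (\<lambda>r. Gauss (Direct (M * N + r))) [0..<M * R] @ [IndexConst 0 1] @ ?C [0..<\<kappa>])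
      @ copy \<kappa> (start + \<kappa> * clen) @ ?C [Suc \<kappa>..<M] @ [Add (Direct 0) (Direct cflag) (Direct czero)]"
    by (simp add: prog_def)
  show "start + \<kappa> * clen = length (map (\<lambda>r. Gauss (Direct (M * N + r))) [0..<M * R] @ [IndexConst 0 1] @ ?C [0..<\<kappa>])"
    using assms by (simp add: length_copies) (simp add: start_def)
qed

context
  fixes y \<omega> :: "nat \<Rightarrow> real"
begin

definition m0 :: "nat \<Rightarrow> real" where
  "m0 a = (if a < M * N then y a else if a < czero then \<omega> (a - M * N) else 0)"

lemma m0_yc: "\<kappa> < M \<Longrightarrow> k < N \<Longrightarrow> m0 (yc \<kappa> k) = y (\<kappa> * N + k)"
  using yc_less[of \<kappa> k] by (simp add: m0_def) (simp add: yc_def)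

lemma m0_gc: "\<kappa> < M \<Longrightarrow> r < R \<Longrightarrow> m0 (gc \<kappa> r) = \<omega> (\<kappa> * R + r)"
  using gc_less[of \<kappa> r] by (simp add: m0_def) (simp add: gc_def)

definition fixed :: "(nat \<Rightarrow> real) \<Rightarrow> bool" where
  "fixed m \<longleftrightarrow> (\<forall>a\<le>czero. m a = m0 a)"

definition passes :: "nat \<Rightarrow> bool" where
  "passes \<kappa> = sample_test p N n2 off \<alpha> \<beta> \<tau> coef pos (\<lambda>k. y (\<kappa> * N + k)) (\<lambda>r. \<omega> (\<kappa> * R + r))"

text \<open>Cells and registers of the copies still to run are zero, because \<open>p\<close> starts
  with zero registers and with zero memory beyond its input.\<close>

definition inv :: "nat \<Rightarrow> config \<Rightarrow> bool" where
  "inv \<kappa> s \<longleftrightarrow> pc s = start + \<kappa> * clen \<and> fixed (mem s)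
     \<and> (\<forall>\<kappa>' a. \<kappa> \<le> \<kappa>' \<longrightarrow> \<kappa>' < M \<longrightarrow> mem s (xc \<kappa>' a) = 0)
     \<and> mem s cflag = (if \<exists>\<kappa>'<\<kappa>. passes \<kappa>' then 1 else 0)
     \<and> idx s 0 = 1 \<and> (\<forall>\<kappa>' i. \<kappa> \<le> \<kappa>' \<longrightarrow> \<kappa>' < M \<longrightarrow> idx s (M * i + \<kappa>' + 2) = 0)"

lemma prep_effect:
  fixes m :: "nat \<Rightarrow> real"
  assumes \<kappa>: "\<kappa> < M" and m: "fixed m"
  shows "(\<forall>k<N. fold effect (c1 \<kappa>) m (xc \<kappa> k) = \<alpha> * y (\<kappa> * N + k) + \<beta> * coef k * \<omega> (\<kappa> * R + pos k))
    \<and> (\<forall>a. a \<noteq> ct1 \<longrightarrow> a \<noteq> ct2 \<longrightarrow> a \<notin> xc \<kappa> ` {..<N} \<longrightarrow> fold effect (c1 \<kappa>) m a = m a)"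
proof -
  let ?Q = "\<lambda>n m'. (\<forall>k<n. m' (xc \<kappa> k) = \<alpha> * y (\<kappa> * N + k) + \<beta> * coef k * \<omega> (\<kappa> * R + pos k))
    \<and> (\<forall>a. a \<noteq> ct1 \<longrightarrow> a \<noteq> ct2 \<longrightarrow> a \<notin> xc \<kappa> ` {..<n} \<longrightarrow> m' a = m a)"
  show ?thesis
    unfolding c1_def
  proof (rule fold_effect_concat_upt[where Q="?Q"])
    fix k m' assume k: "k < N" and Q: "?Q k m'"
    have 1: "yc \<kappa> k < czero" using yc_less[OF \<kappa> k] by (simp add: czero_def)
    have 2: "gc \<kappa> (pos k) < czero" using pos[OF k] by (intro gc_less \<kappa>) (simp add: R_def)
    note ne = low_distinct[OF 1] low_distinct[OF 2]
    have Q3: "m' a = m a" if "a \<noteq> ct1" "a \<noteq> ct2" "\<And>b. a \<noteq> xc \<kappa> b" for a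
    proof -
      have "a \<notin> xc \<kappa> ` {..<k}" using that(3) by blast
      then show ?thesis using Q that by blast
    qed
    have "m' (yc \<kappa> k) = m (yc \<kappa> k)" by (intro Q3 ne)
    moreover have "m (yc \<kappa> k) = y (\<kappa> * N + k)"
      using m 1 m0_yc[OF \<kappa> k] by (simp add: fixed_def)
    moreover have "m' (gc \<kappa> (pos k)) = m (gc \<kappa> (pos k))" by (intro Q3 ne)
    moreover have "m (gc \<kappa> (pos k)) = \<omega> (\<kappa> * R + pos k)"
      using m 2 m0_gc[OF \<kappa>, of "pos k"] pos[OF k] by (simp add: fixed_def R_def)
    ultimately have eq: "fold effect (prep \<kappa> k) m' = m'(ct1 := \<alpha> * y (\<kappa> * N + k),
        ct2 := \<beta> * coef k * \<omega> (\<kappa> * R + pos k), xc \<kappa> k := \<alpha> * y (\<kappa> * N + k) + \<beta> * coef k * \<omega> (\<kappa> * R + pos k))"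
      using ne by (simp add: prep_def fun_eq_iff)
    show "?Q (Suc k) (fold effect (prep \<kappa> k) m')"
      unfolding eq
    proof (intro conjI allI impI)
      fix k' assume "k' < Suc k"
      then show "(m'(ct1 := \<alpha> * y (\<kappa> * N + k), ct2 := \<beta> * coef k * \<omega> (\<kappa> * R + pos k), xc \<kappa> k := \<alpha> * y (\<kappa> * N + k) + \<beta> * coef k * \<omega> (\<kappa> * R + pos k))) (xc \<kappa> k')
         = \<alpha> * y (\<kappa> * N + k') + \<beta> * coef k' * \<omega> (\<kappa> * R + pos k')"
        using Q by (cases "k' = k") (simp_all add: xc_eq[OF \<kappa> \<kappa>])
    next
      fix a assume "a \<noteq> ct1" "a \<noteq> ct2" "a \<notin> xc \<kappa> ` {..<Suc k}"
      then show "(m'(ct1 := \<alpha> * y (\<kappa> * N + k), ct2 := \<beta> * coef k * \<omega> (\<kappa> * R + pos k), xc \<kappa> k := \<alpha> * y (\<kappa> * N + k) + \<beta> * coef k * \<omega> (\<kappa> * R + pos k))) a = m a"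
        using Q by (simp add: lessThan_Suc)
    qed
  qed simp
qed

lemma stat_effect:
  fixes m :: "nat \<Rightarrow> real"
  assumes \<kappa>: "\<kappa> < M" and m: "fixed m"
  shows "fold effect (c4 \<kappa>) m csum = (\<Sum>q<n2. m (xc \<kappa> q) * (\<beta> * y (\<kappa> * N + (off + q)) - \<alpha> * coef (off + q) * \<omega> (\<kappa> * R + pos (off + q))))
    \<and> fold effect (c4 \<kappa>) m cnorm = (\<Sum>q<n2. m (xc \<kappa> q) * m (xc \<kappa> q))
    \<and> (\<forall>a. a \<notin> {ct1, ct2, csum, cnorm} \<longrightarrow> fold effect (c4 \<kappa>) m a = m a)"
proof -
  let ?m = "m(csum := 0, cnorm := 0)"
  let ?Q = "\<lambda>n m'. m' csum = (\<Sum>q<n. m (xc \<kappa> q) * (\<beta> * y (\<kappa> * N + (off + q)) - \<alpha> * coef (off + q) * \<omega> (\<kappa> * R + pos (off + q))))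
    \<and> m' cnorm = (\<Sum>q<n. m (xc \<kappa> q) * m (xc \<kappa> q))
    \<and> (\<forall>a. a \<notin> {ct1, ct2, csum, cnorm} \<longrightarrow> m' a = m a)"
  have "?Q n2 (fold effect (concat (map (stat \<kappa>) [0..<n2])) ?m)"
  proof (rule fold_effect_concat_upt[where Q="?Q"])
    fix q m' assume q: "q < n2" and Q: "?Q q m'"
    then have k: "off + q < N" using off by simp
    have 1: "yc \<kappa> (off + q) < czero" using yc_less[OF \<kappa> k] by (simp add: czero_def)
    have 2: "gc \<kappa> (pos (off + q)) < czero" using pos[OF k] by (intro gc_less \<kappa>) (simp add: R_def)
    note ne = low_distinct[OF 1] low_distinct[OF 2]
    have Q3: "m' a = m a" if "a \<noteq> ct1" "a \<noteq> ct2" "a \<noteq> csum" "a \<noteq> cnorm" for a using Q that by blast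
    have "m' (yc \<kappa> (off + q)) = y (\<kappa> * N + (off + q))"
      using Q3[of "yc \<kappa> (off + q)"] ne m 1 m0_yc[OF \<kappa> k] by (simp add: fixed_def)
    moreover have "m' (gc \<kappa> (pos (off + q))) = \<omega> (\<kappa> * R + pos (off + q))"
      using Q3[of "gc \<kappa> (pos (off + q))"] ne m 2 m0_gc[OF \<kappa>, of "pos (off + q)"] pos[OF k] by (simp add: fixed_def R_def)
    moreover have "m' (xc \<kappa> q) = m (xc \<kappa> q)" by (rule Q3) simp_all
    ultimately have "fold effect (stat \<kappa> q) m' csum = m' csum + m (xc \<kappa> q) * (\<beta> * y (\<kappa> * N + (off + q)) - \<alpha> * coef (off + q) * \<omega> (\<kappa> * R + pos (off + q)))"
      and "fold effect (stat \<kappa> q) m' cnorm = m' cnorm + m (xc \<kappa> q) * m (xc \<kappa> q)"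
      using ne by (simp_all add: stat_def)
    moreover have "fold effect (stat \<kappa> q) m' a = m' a" if "a \<notin> {ct1, ct2, csum, cnorm}" for a
      using that by (simp add: stat_def)
    ultimately show "?Q (Suc q) (fold effect (stat \<kappa> q) m')"
      using Q by simp
  qed simp
  then show ?thesis by (simp add: c4_def)
qed

end

end

section \<open>Correctness and running time of the testing program\<close>

context tester
begin

definition "tlen = 5 * N + 2 * T + 9 * n2 + 14"

lemma gc_add: "gc \<kappa> (r + r') = gc \<kappa> r + r'"
  by (simp add: gc_def)

lemma copy_step:
  fixes y \<omega> :: "nat \<Rightarrow> real"
  assumes \<kappa>: "\<kappa> < M" and inv: "inv y \<omega> \<kappa> s"
  shows "\<exists>s'. reaches prog \<omega>' tlen s s' \<and> inv y \<omega> (Suc \<kappa>) s'"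
proof -
  define b where "b = start + \<kappa> * clen"
  let ?P = prog
  have pcs: "pc s = b" and fx: "fixed y \<omega> (mem s)"
    and x0: "\<And>\<kappa>' a. \<kappa> \<le> \<kappa>' \<Longrightarrow> \<kappa>' < M \<Longrightarrow> mem s (xc \<kappa>' a) = 0"
    and flag: "mem s cflag = (if \<exists>\<kappa>'<\<kappa>. passes y \<omega> \<kappa>' then 1 else 0)"
    and i0: "idx s 0 = 1" and i1: "\<And>\<kappa>' i. \<kappa> \<le> \<kappa>' \<Longrightarrow> \<kappa>' < M \<Longrightarrow> idx s (M * i + \<kappa>' + 2) = 0"
    using inv by (auto simp: inv_def b_def)
  have l3: "length (c3 \<kappa> b') = 2 * length p" for b' by (rule length_c3[OF \<kappa>])
  have code: "code_at ?P b (c1 \<kappa>)" "code_at ?P (b + 5 * N) [IndexConst 1 0]"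
    "code_at ?P (b + 5 * N + 1) (c3 \<kappa> (b + 5 * N + 1))"
    "code_at ?P (b + 5 * N + 2 * length p + 1) (c4 \<kappa>)"
    "code_at ?P (b + 5 * N + 2 * length p + 9 * n2 + 3) (c5 (b + 5 * N + 2 * length p + 9 * n2 + 3))"
    "code_at ?P (b + 5 * N + 2 * length p + 9 * n2 + 5) c6"
    "code_at ?P (b + 5 * N + 2 * length p + 9 * n2 + 9) (c7 (b + 5 * N + 2 * length p + 9 * n2 + 9))"
    "code_at ?P (b + 5 * N + 2 * length p + 9 * n2 + 11) c8"
  proof -
    let ?L = "b + 5 * N + 2 * length p"
    have len: "length [IndexConst 1 0] = 1" "length (c5 x) = 2" "length c6 = 4" "length (c7 x) = 2" for x
      by (simp_all add: c5_def c6_def c7_def)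
    have e: "b + 5 * N + 1 + 2 * length p = ?L + 1" "?L + 1 + (9 * n2 + 2) = ?L + 9 * n2 + 3"
      "?L + 9 * n2 + 3 + 2 = ?L + 9 * n2 + 5" "?L + 9 * n2 + 5 + 4 = ?L + 9 * n2 + 9"
      "?L + 9 * n2 + 9 + 2 = ?L + 9 * n2 + 11"
      by simp_all
    have "code_at ?P b (copy \<kappa> b)" using code_at_copy[OF \<kappa>] by (simp only: b_def)
    note this[unfolded copy_def code_at_append length_c1 l3 length_c4 len e]
    then show "code_at ?P b (c1 \<kappa>)" "code_at ?P (b + 5 * N) [IndexConst 1 0]"
      "code_at ?P (b + 5 * N + 1) (c3 \<kappa> (b + 5 * N + 1))"
      "code_at ?P (b + 5 * N + 2 * length p + 1) (c4 \<kappa>)"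
      "code_at ?P (b + 5 * N + 2 * length p + 9 * n2 + 3) (c5 (b + 5 * N + 2 * length p + 9 * n2 + 3))"
      "code_at ?P (b + 5 * N + 2 * length p + 9 * n2 + 5) c6"
      "code_at ?P (b + 5 * N + 2 * length p + 9 * n2 + 9) (c7 (b + 5 * N + 2 * length p + 9 * n2 + 9))"
      "code_at ?P (b + 5 * N + 2 * length p + 9 * n2 + 11) c8"
      by blast+
  qed
  interpret E: embedding M \<kappa> base "gc \<kappa> N" czero "b + 5 * N + 1" p
    by unfold_locales (auto simp: \<kappa> base_def)
  have Ecell: "E.cell = xc \<kappa>" by (auto simp: E.cell_def xc_def)
  define Y1 where "Y1 = (\<lambda>k. \<alpha> * y (\<kappa> * N + k) + \<beta> * coef k * \<omega> (\<kappa> * R + pos k))"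
  define u where "u = (\<lambda>r. \<omega> (\<kappa> * R + (N + r)))"
  define X where "X = result p N Y1 u"
  define m1 where "m1 = fold effect (c1 \<kappa>) (mem s)"
  define s1 where "s1 = s\<lparr>mem := m1, pc := pc s + length (c1 \<kappa>)\<rparr>"
  have r1: "reaches ?P \<omega>' (5 * N) s s1"
    unfolding s1_def m1_def
  proof (rule reaches_simple)
    show "\<forall>i\<in>set (c1 \<kappa>). simple i" by (auto simp: c1_def prep_def)
  qed (use code pcs length_c1 in auto)
  have m1x: "m1 (xc \<kappa> k) = Y1 k" if "k < N" for k
    using prep_effect[OF \<kappa> fx] that by (simp add: m1_def Y1_def)
  have m1o: "m1 a = mem s a" if "a \<noteq> ct1" "a \<noteq> ct2" "a \<notin> xc \<kappa> ` {..<N}" for a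
    using prep_effect[OF \<kappa> fx] that by (simp add: m1_def)
  define s2 where "s2 = exec \<omega>' (IndexConst 1 0) s1"
  have pc1: "pc s1 = b + 5 * N" by (simp add: s1_def pcs length_c1)
  have r2: "reaches ?P \<omega>' 1 s1 s2"
    using reaches_step[of s1 ?P 1 \<omega>'] code(2) by (simp add: s2_def pc1 code_at_Cons)
  have s2: "mem s2 = m1" "pc s2 = b + 5 * N + 1" "idx s2 = (idx s)(1 := 0)"
    by (simp_all add: s2_def set_idx_def pc1) (simp_all add: s1_def)
  have fx1: "m1 a = m0 y \<omega> a" if "a \<le> czero" for a
  proof -
    have "a \<noteq> ct1" "a \<noteq> ct2" "a \<notin> xc \<kappa> ` {..<N}"
      using that by (auto simp: ct1_def ct2_def xc_def base_def)
    then show ?thesis using m1o fx that by (simp add: fixed_def)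
  qed
  \<comment> \<open>The cells of this copy hold the input \<open>Y1\<close> below N and untouched
    zeros beyond, as in an initial configuration of \<open>p\<close>.\<close>
  have sim: "E.sim (mem s2) (idx s2) (init_config N Y1) s2"
    unfolding E.sim_def
  proof (intro conjI allI impI)
    show "mem s2 (E.cell a) = mem (init_config N Y1) a" for a
    proof (cases "a < N")
      case False
      then have "m1 (xc \<kappa> a) = mem s (xc \<kappa> a)" by (intro m1o) (auto simp: xc_eq[OF \<kappa> \<kappa>])
      then show ?thesis using False x0[of \<kappa> a] \<kappa> by (simp add: Ecell s2 init_config_def)
    qed (simp add: Ecell s2 init_config_def m1x)
    show "idx s2 (E.reg i) = M * idx (init_config N Y1) i" for i
      using i1[of \<kappa> i] \<kappa> by (simp add: s2 init_config_def E.reg_def)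
    have "E.target 0 = b + 5 * N + 1" unfolding E.target_def by simp
    then show "pc s2 = E.target (pc (init_config N Y1))"
      unfolding s2 init_config_def config.select_convs by (rule sym)
  qed (use i0 in \<open>auto simp: s2 init_config_def\<close>)
  obtain t where t: "t \<le> T" "halted p (run p N Y1 u t)" using halts by blast
  have g: "mem s2 (gc \<kappa> N + r) = u r" if "r < T" for r
    using fx1[of "gc \<kappa> (N + r)"] gc_less[OF \<kappa>, of "N + r"] m0_gc[OF \<kappa>, of "N + r" y \<omega>] that
    by (simp add: gc_add[symmetric] R_def u_def s2)
  have gb: "gc \<kappa> N + T \<le> base"
  proof -
    have "Suc \<kappa> * R \<le> M * R" using \<kappa> by (intro mult_le_mono1) simp
    then show ?thesis by (simp add: gc_def base_def czero_def R_def)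
  qed
  have z: "mem s2 czero = 0" using fx1[of czero] by (simp add: s2 m0_def czero_def)
  have code3: "code_at ?P (b + 5 * N + 1) E.emb_prog" using code(3) by (simp add: c3_def)
  obtain s3 where s3: "reaches ?P \<omega>' (2 * T) s2 s3" "pc s3 = b + 5 * N + 1 + length E.emb_prog"
    "\<And>a. mem s3 (xc \<kappa> a) = X a" "\<And>a. a \<notin> range (xc \<kappa>) \<Longrightarrow> mem s3 a = m1 a"
    "\<And>r. r \<notin> range E.reg \<Longrightarrow> r \<noteq> 0 \<Longrightarrow> r \<noteq> 1 \<Longrightarrow> idx s3 r = idx s2 r" "idx s3 0 = 1"
    using E.sim_run[where \<omega>=\<omega>', OF code3 sim g gb z t] unfolding Ecell X_def s2 by blast
  have pc3: "pc s3 = b + 5 * N + 2 * length p + 1" using s3(2) unfolding E.length_emb_prog by simp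
  define m3 where "m3 = mem s3"
  have fx3: "fixed y \<omega> m3"
    unfolding fixed_def
  proof (intro allI impI)
    fix a assume a: "a \<le> czero"
    then have "a \<notin> range (xc \<kappa>)" by (auto simp: xc_def base_def)
    then show "m3 a = m0 y \<omega> a" using s3(4) fx1[OF a] by (simp add: m3_def)
  qed
  define m4 where "m4 = fold effect (c4 \<kappa>) m3"
  define s4 where "s4 = s3\<lparr>mem := m4, pc := pc s3 + length (c4 \<kappa>)\<rparr>"
  have r4: "reaches ?P \<omega>' (9 * n2 + 2) s3 s4"
    unfolding s4_def m4_def m3_def
  proof (rule reaches_simple)
    show "\<forall>i\<in>set (c4 \<kappa>). simple i" by (auto simp: c4_def stat_def)
  qed (use code pc3 length_c4 in auto)
  have pc4: "pc s4 = b + 5 * N + 2 * length p + 9 * n2 + 3" by (simp add: s4_def pc3 length_c4)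
  define S where "S = (\<Sum>q<n2. X q * (\<beta> * y (\<kappa> * N + (off + q)) - \<alpha> * coef (off + q) * \<omega> (\<kappa> * R + pos (off + q))))"
  define NN where "NN = (\<Sum>q<n2. X q * X q)"
  have m4: "m4 csum = S" "m4 cnorm = NN" "\<And>a. a \<notin> {ct1, ct2, csum, cnorm} \<Longrightarrow> m4 a = m3 a"
    using stat_effect[OF \<kappa> fx3] s3(3) by (simp_all add: m4_def S_def NN_def m3_def)
  define s5 where "s5 = s4\<lparr>mem := if mem s4 czero < mem s4 csum then mem s4 else effect (LoadConst (Direct csum) 0) (mem s4), pc := pc s4 + 2\<rparr>"
  have r5: "reaches ?P \<omega>' 2 s4 s5"
    unfolding s5_def by (rule reaches_skip) (use code(5) in \<open>simp_all add: pc4 c5_def\<close>)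
  have pc5: "pc s5 = b + 5 * N + 2 * length p + 9 * n2 + 5" by (simp add: s5_def pc4)
  have m0z: "m0 y \<omega> czero = 0" by (simp add: m0_def czero_def)
  have "m4 czero = m3 czero" by (rule m4) simp
  then have zero4: "m4 czero = 0" using fx3 m0z by (simp add: fixed_def)
  have mem4: "mem s4 = m4" by (simp add: s4_def)
  have m5: "mem s5 csum = max 0 S" "\<And>a. a \<noteq> csum \<Longrightarrow> mem s5 a = m4 a"
    by (auto simp: s5_def mem4 zero4 m4)
  define s6 where "s6 = s5\<lparr>mem := fold effect c6 (mem s5), pc := pc s5 + length c6\<rparr>"
  have r6: "reaches ?P \<omega>' 4 s5 s6"
    unfolding s6_def by (rule reaches_simple) (use code(6) in \<open>simp_all add: pc5\<close>, auto simp: c6_def)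
  have pc6: "pc s6 = b + 5 * N + 2 * length p + 9 * n2 + 9" by (simp add: s6_def pc5 c6_def)
  have m6: "mem s6 csum = (max 0 S)\<^sup>2" "mem s6 cnorm = \<tau> * NN" "mem s6 ct2 = 1"
    "\<And>a. a \<notin> {csum, cnorm, ct1, ct2} \<Longrightarrow> mem s6 a = m4 a"
    using m5(2)[of cnorm] m4(2) by (auto simp: s6_def c6_def m5 power2_eq_square)
  define s7 where "s7 = s6\<lparr>mem := if mem s6 cnorm < mem s6 csum then mem s6 else effect (LoadConst (Direct ct2) 0) (mem s6), pc := pc s6 + 2\<rparr>"
  have r7: "reaches ?P \<omega>' 2 s6 s7"
    unfolding s7_def by (rule reaches_skip) (use code(7) in \<open>simp_all add: pc6 c7_def\<close>)
  have pc7: "pc s7 = b + 5 * N + 2 * length p + 9 * n2 + 11" by (simp add: s7_def pc6)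
  have pass: "passes y \<omega> \<kappa> \<longleftrightarrow> \<tau> * NN < (max 0 S)\<^sup>2"
    unfolding passes_def sample_test_def Let_def S_def NN_def X_def Y1_def u_def by simp
  have m7: "mem s7 ct2 = (if passes y \<omega> \<kappa> then 1 else 0)" "\<And>a. a \<notin> {csum, cnorm, ct1, ct2} \<Longrightarrow> mem s7 a = m4 a"
    by (auto simp: s7_def m6 pass)
  define s8 where "s8 = s7\<lparr>mem := fold effect c8 (mem s7), pc := pc s7 + length c8\<rparr>"
  have r8: "reaches ?P \<omega>' 3 s7 s8"
    unfolding s8_def by (rule reaches_simple) (use code(8) in \<open>simp_all add: pc7\<close>, auto simp: c8_def)
  have pc8: "pc s8 = b + clen" by (simp add: s8_def pc7 c8_def clen_def)
  have flag7: "mem s7 cflag = mem s cflag"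
  proof -
    have "mem s7 cflag = m4 cflag" by (rule m7) simp
    also have "\<dots> = m3 cflag" by (rule m4) simp
    also have "\<dots> = m1 cflag" unfolding m3_def by (rule s3(4)) auto
    also have "\<dots> = mem s cflag" by (rule m1o) auto
    finally show ?thesis .
  qed
  have m8: "mem s8 cflag = mem s cflag + mem s7 ct2 - mem s cflag * mem s7 ct2"
    "\<And>a. a \<notin> {csum, cnorm, ct1, ct2, cflag} \<Longrightarrow> mem s8 a = m4 a"
    by (auto simp: s8_def c8_def flag7 m7(2))
  have idx8: "idx s8 = idx s3" by (simp add: s8_def s7_def s6_def s5_def s4_def)
  have reach: "reaches ?P \<omega>' tlen s s8"
  proof -
    have "reaches ?P \<omega>' (5 * N + 1) s s2" by (rule reaches_trans[OF r1 r2]) simp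
    then have "reaches ?P \<omega>' (5 * N + 1 + 2 * T) s s3" by (rule reaches_trans[OF _ s3(1)]) simp
    then have "reaches ?P \<omega>' (5 * N + 1 + 2 * T + (9 * n2 + 2)) s s4" by (rule reaches_trans[OF _ r4]) simp
    then have "reaches ?P \<omega>' (5 * N + 1 + 2 * T + (9 * n2 + 2) + 2) s s5" by (rule reaches_trans[OF _ r5]) simp
    then have "reaches ?P \<omega>' (5 * N + 1 + 2 * T + (9 * n2 + 2) + 2 + 4) s s6" by (rule reaches_trans[OF _ r6]) simp
    then have "reaches ?P \<omega>' (5 * N + 1 + 2 * T + (9 * n2 + 2) + 2 + 4 + 2) s s7" by (rule reaches_trans[OF _ r7]) simp
    then show ?thesis by (rule reaches_trans[OF _ r8]) (simp add: tlen_def)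
  qed
  have "inv y \<omega> (Suc \<kappa>) s8"
    unfolding inv_def
  proof (intro conjI allI impI)
    show "pc s8 = start + Suc \<kappa> * clen" by (simp add: pc8 b_def)
    show "fixed y \<omega> (mem s8)"
      unfolding fixed_def
    proof (intro allI impI)
      fix a assume a: "a \<le> czero"
      then have a': "a \<notin> {csum, cnorm, ct1, ct2, cflag}"
        by (auto simp: csum_def cnorm_def ct1_def ct2_def cflag_def)
      have "mem s8 a = m4 a" by (rule m8(2)[OF a'])
      also have "\<dots> = m3 a" using a' by (intro m4) auto
      finally show "mem s8 a = m0 y \<omega> a" using fx3 a by (simp add: fixed_def)
    qed
    show "idx s8 0 = 1" by (simp add: idx8 s3)
  next
    fix \<kappa>' a assume k': "Suc \<kappa> \<le> \<kappa>'" "\<kappa>' < M"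
    have ne: "xc \<kappa>' a \<notin> range (xc \<kappa>)" using xc_eq[OF k'(2) \<kappa>] k' by auto
    have "mem s8 (xc \<kappa>' a) = m4 (xc \<kappa>' a)" by (rule m8) simp
    also have "\<dots> = m3 (xc \<kappa>' a)" by (rule m4) simp
    also have "\<dots> = m1 (xc \<kappa>' a)" unfolding m3_def by (rule s3(4)[OF ne])
    also have "\<dots> = mem s (xc \<kappa>' a)" by (rule m1o) (use ne in auto)
    also have "\<dots> = 0" using k' by (intro x0) auto
    finally show "mem s8 (xc \<kappa>' a) = 0" .
  next
    show "mem s8 cflag = (if \<exists>\<kappa>'<Suc \<kappa>. passes y \<omega> \<kappa>' then 1 else 0)"
      unfolding m8(1) flag m7(1) by (auto simp: less_Suc_eq)
  next
    fix \<kappa>' i assume k': "Suc \<kappa> \<le> \<kappa>'" "\<kappa>' < M"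
    \<comment> \<open>Registers of distinct copies differ modulo M.\<close>
    have ne: "M * i + \<kappa>' + 2 \<notin> range E.reg"
    proof
      assume "M * i + \<kappa>' + 2 \<in> range E.reg"
      then obtain j where "M * i + \<kappa>' = M * j + \<kappa>" by (auto simp: E.reg_def)
      then have "xc \<kappa>' i = xc \<kappa> j" by (simp add: xc_def)
      then show False using xc_eq[OF k'(2) \<kappa>] k' by auto
    qed
    have "idx s8 (M * i + \<kappa>' + 2) = idx s2 (M * i + \<kappa>' + 2)"
      unfolding idx8 by (rule s3(5)[OF ne]) auto
    also have "\<dots> = 0" using i1[of \<kappa>' i] k' by (simp add: s2)
    finally show "idx s8 (M * i + \<kappa>' + 2) = 0" .
  qed
  with reach show ?thesis by blast
qed

lemma copies:
  assumes "inv y \<omega> 0 s" "K \<le> M"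
  shows "\<exists>s'. reaches prog \<omega>' (K * tlen) s s' \<and> inv y \<omega> K s'"
  using assms(2)
proof (induction K)
  case 0
  then show ?case using assms(1) by (auto intro: reaches_refl)
next
  case (Suc K)
  then obtain s' where s': "reaches prog \<omega>' (K * tlen) s s'" "inv y \<omega> K s'" by auto
  obtain s'' where "reaches prog \<omega>' tlen s' s''" "inv y \<omega> (Suc K) s''"
    using copy_step[OF _ s'(2)] Suc.prems by auto
  then show ?case using reaches_trans[OF s'(1), of tlen s'' "Suc K * tlen"] by auto
qed

lemma code_at_draws: "code_at prog 0 (map (\<lambda>r. Gauss (Direct (M * N + r))) [0..<M * R] @ [IndexConst 0 1])"
  by (rule code_at_self[where c="[]"]) (simp_all add: prog_def)

lemma draws:
  assumes "K \<le> M * R"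
  shows "reaches prog \<omega> K (init_config (M * N) y)
    ((init_config (M * N) y)\<lparr>pc := K, drawn := K,
      mem := \<lambda>a. if a < M * N then y a else if a < M * N + K then \<omega> (a - M * N) else 0\<rparr>)"
  using assms
proof (induction K)
  case 0
  then show ?case by (simp add: init_config_def reaches_refl cong: if_cong)
next
  case (Suc K)
  let ?s = "\<lambda>K. (init_config (M * N) y)\<lparr>pc := K, drawn := K,
      mem := \<lambda>a. if a < M * N then y a else if a < M * N + K then \<omega> (a - M * N) else 0\<rparr>"
  have P: "prog ! K = Gauss (Direct (M * N + K))" "K < length prog"
    using Suc.prems code_at_draws by (auto simp: code_at_def nth_append dest!: spec[of _ K])
  have "reaches prog \<omega> 1 (?s K) (exec \<omega> (prog ! pc (?s K)) (?s K))"
    by (rule reaches_step) (use P in simp_all)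
  also have "exec \<omega> (prog ! pc (?s K)) (?s K) = ?s (Suc K)"
    using P by (auto simp: wr_def fun_eq_iff)
  finally have "reaches prog \<omega> 1 (?s K) (?s (Suc K))" .
  then show ?case using Suc reaches_trans[of prog \<omega> K _ "?s K" 1 "?s (Suc K)" "Suc K"] by simp
qed

lemma prog_correct:
  "\<exists>s'. reaches prog \<omega> (M * R + M * tlen + 2) (init_config (M * N) y) s' \<and> halted prog s'
    \<and> mem s' 0 = (if \<exists>\<kappa><M. passes y \<omega> \<kappa> then 1 else 0)"
proof -
  define s0 where "s0 = (init_config (M * N) y)\<lparr>pc := M * R, drawn := M * R,
      mem := \<lambda>a. if a < M * N then y a else if a < M * N + M * R then \<omega> (a - M * N) else 0\<rparr>"
  have r0: "reaches prog \<omega> (M * R) (init_config (M * N) y) s0"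
    unfolding s0_def by (rule draws) simp
  define s1 where "s1 = exec \<omega> (IndexConst 0 1) s0"
  have "code_at prog (M * R) [IndexConst 0 1]"
    using code_at_draws by (simp add: code_at_append)
  then have r1: "reaches prog \<omega> 1 s0 s1"
    using reaches_step[of s0 prog 1 \<omega>] by (simp add: s1_def s0_def code_at_Cons)
  have "inv y \<omega> 0 s1"
    by (auto simp: inv_def s1_def s0_def set_idx_def start_def fixed_def m0_def czero_def cflag_def xc_def base_def init_config_def)
  then obtain s2 where s2: "reaches prog \<omega> (M * tlen) s1 s2" "inv y \<omega> M s2"
    using copies[where K=M] by blast
  have pc2: "pc s2 = start + M * clen" using s2(2) by (simp add: inv_def)
  have P: "prog ! pc s2 = Add (Direct 0) (Direct cflag) (Direct czero)" "pc s2 < length prog"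
    unfolding pc2 using length_copies[of M] by (auto simp: prog_def nth_append start_def)
  define s3 where "s3 = exec \<omega> (prog ! pc s2) s2"
  have r3: "reaches prog \<omega> 1 s2 s3"
    unfolding s3_def by (rule reaches_step) (use P in simp_all)
  have m0z: "m0 y \<omega> czero = 0" by (simp add: m0_def czero_def)
  have "mem s2 czero = 0" using s2(2) m0z by (simp add: inv_def fixed_def)
  then have "mem s3 0 = (if \<exists>\<kappa><M. passes y \<omega> \<kappa> then 1 else 0)" "halted prog s3"
    using s2(2) unfolding s3_def P(1)
    by (simp_all add: wr_def rd_def inv_def halted_def length_prog)
  moreover have "reaches prog \<omega> (M * R + M * tlen + 2) (init_config (M * N) y) s3"
  proof -
    have "reaches prog \<omega> (M * R + 1) (init_config (M * N) y) s1" by (rule reaches_trans[OF r0 r1]) simp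
    then have "reaches prog \<omega> (M * R + 1 + M * tlen) (init_config (M * N) y) s2" by (rule reaches_trans[OF _ s2(1)]) simp
    then show ?thesis by (rule reaches_trans[OF _ r3]) simp
  qed
  ultimately show ?thesis by blast
qed

lemma result_prog: "result prog (M * N) y \<omega> 0 = (if \<exists>\<kappa><M. passes y \<omega> \<kappa> then 1 else 0)"
proof -
  obtain s' where s': "reaches prog \<omega> (M * R + M * tlen + 2) (init_config (M * N) y) s'" "halted prog s'"
    "mem s' 0 = (if \<exists>\<kappa><M. passes y \<omega> \<kappa> then 1 else 0)"
    using prog_correct by blast
  have "result prog (M * N) y \<omega> = mem s'" by (rule result_eqI[OF s'(1,2)])
  then show ?thesis using s'(3) by simp
qed

lemma prog_time:
  assumes "length p \<le> T"
  shows "runs_in_time prog (M * N) (60 * real M * (real N + 1) * (real T + 1))"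
  unfolding runs_in_time_def
proof (intro conjI allI)
  have n2: "n2 \<le> N" using off by simp
  have NT: "N + T + 1 \<le> (N + 1) * (T + 1)" by simp
  have "M * R + M * tlen + 2 \<le> M * (R + tlen + 2)" using M by (simp add: distrib_left)
  \<comment> \<open>As n2 <= N, the left side is at most 15 N + 3 T + 16.\<close>
  also have "R + tlen + 2 \<le> 16 * (N + T + 1)" using n2 by (simp add: R_def tlen_def)
  also have "\<dots> \<le> 60 * ((N + 1) * (T + 1))"
    by (rule order_trans[OF mult_le_mono2[OF NT]]) simp
  finally have t: "M * R + M * tlen + 2 \<le> M * (60 * ((N + 1) * (T + 1)))" by simp
  have "length prog \<le> M * (R + clen + 2)" unfolding length_prog start_def using M by (simp add: distrib_left)
  also have "R + clen + 2 \<le> 17 * (N + T + 1)" using n2 assms by (simp add: R_def clen_def)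
  also have "\<dots> \<le> 60 * ((N + 1) * (T + 1))"
    by (rule order_trans[OF mult_le_mono2[OF NT]]) simp
  finally have l: "length prog \<le> M * (60 * ((N + 1) * (T + 1)))" by simp
  have eq: "60 * real M * (real N + 1) * (real T + 1) = real (M * (60 * ((N + 1) * (T + 1))))"
    by (simp add: algebra_simps)
  show "real (length prog) \<le> 60 * real M * (real N + 1) * (real T + 1)"
    unfolding eq of_nat_le_iff by (rule l)
  show "\<exists>t. real t \<le> 60 * real M * (real N + 1) * (real T + 1) \<and> halted prog (run prog (M * N) y \<omega> t)" for y \<omega>
  proof -
    obtain s' t' where "t' \<le> M * R + M * tlen + 2" "(step prog \<omega> ^^ t') (init_config (M * N) y) = s'" "halted prog s'"
      using prog_correct[of \<omega> y] by (auto simp: reaches_def)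
    then show ?thesis using t unfolding eq of_nat_le_iff by (intro exI[of _ t']) (auto simp: run_def)
  qed
qed

end

section \<open>Measurability of the output of a program\<close>

text \<open>Componentwise, as a record carries no sigma-algebra of its own; all components other
  than memory cells are discrete.\<close>

definition config_measurable :: "'a measure \<Rightarrow> ('a \<Rightarrow> config) \<Rightarrow> bool" where
  "config_measurable S s \<longleftrightarrow> (\<lambda>x. pc (s x)) \<in> S \<rightarrow>\<^sub>M count_space UNIV
     \<and> (\<forall>i. (\<lambda>x. idx (s x) i) \<in> S \<rightarrow>\<^sub>M count_space UNIV)
     \<and> (\<lambda>x. drawn (s x)) \<in> S \<rightarrow>\<^sub>M count_space UNIV
     \<and> (\<forall>a. (\<lambda>x. mem (s x) a) \<in> borel_measurable S)"

lemma config_measurable_resolve: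
  assumes "config_measurable S s"
  shows "(\<lambda>x. resolve (s x) a) \<in> S \<rightarrow>\<^sub>M count_space UNIV"
proof (cases a)
  case (Indexed i b)
  have "(\<lambda>x. idx (s x) i) \<in> S \<rightarrow>\<^sub>M count_space UNIV" using assms by (simp add: config_measurable_def)
  then show ?thesis unfolding Indexed resolve.simps by measurable
qed simp

text \<open>Addresses are natural numbers, so reading at a random address glues together countably
  many reads at fixed ones.\<close>

lemma config_measurable_rd:
  assumes "config_measurable S s"
  shows "(\<lambda>x. rd (s x) a) \<in> borel_measurable S"
  unfolding rd_def
  by (rule measurable_compose_countable[OF _ config_measurable_resolve[OF assms]])
     (use assms in \<open>auto simp: config_measurable_def\<close>)

lemma config_measurable_wr:
  assumes s: "config_measurable S s" and v [measurable]: "v \<in> borel_measurable S"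
  shows "config_measurable S (\<lambda>x. wr a (v x) (s x))"
proof -
  note [measurable] = config_measurable_resolve[OF s, of a]
  have [measurable]: "(\<lambda>x. pc (s x)) \<in> S \<rightarrow>\<^sub>M count_space UNIV" "(\<lambda>x. mem (s x) b) \<in> borel_measurable S" for b
    using s by (auto simp: config_measurable_def)
  show ?thesis
    using s unfolding config_measurable_def wr_def by (auto simp: fun_upd_def)
qed

lemma config_measurable_set_idx:
  assumes s: "config_measurable S s" and v [measurable]: "v \<in> S \<rightarrow>\<^sub>M count_space UNIV"
  shows "config_measurable S (\<lambda>x. set_idx i (v x) (s x))"
proof -
  have [measurable]: "(\<lambda>x. pc (s x)) \<in> S \<rightarrow>\<^sub>M count_space UNIV" using s by (auto simp: config_measurable_def)
  have "(\<lambda>x. ((idx (s x))(i := v x)) j) \<in> S \<rightarrow>\<^sub>M count_space UNIV" for j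
    using s v by (cases "j = i") (auto simp: config_measurable_def)
  then show ?thesis using s by (auto simp: config_measurable_def set_idx_def simp del: fun_upd_apply)
qed

lemma config_measurable_branch:
  assumes s: "config_measurable S s" and b [measurable]: "Measurable.pred S b"
  shows "config_measurable S (\<lambda>x. branch (b x) k (s x))"
proof -
  have [measurable]: "(\<lambda>x. pc (s x)) \<in> S \<rightarrow>\<^sub>M count_space UNIV" using s by (auto simp: config_measurable_def)
  show ?thesis using s by (auto simp: config_measurable_def branch_def)
qed

lemma config_measurable_exec:
  assumes s: "config_measurable S s" and \<omega>: "\<And>r. (\<lambda>x. \<omega> x r) \<in> borel_measurable S"
  shows "config_measurable S (\<lambda>x. exec (\<omega> x) i (s x))"
proof -
  note [measurable] = config_measurable_rd[OF s]
  have idx [measurable]: "(\<lambda>x. idx (s x) j) \<in> S \<rightarrow>\<^sub>M count_space UNIV" for j using s by (auto simp: config_measurable_def)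
  have drawn [measurable]: "(\<lambda>x. drawn (s x)) \<in> S \<rightarrow>\<^sub>M count_space UNIV" using s by (auto simp: config_measurable_def)
  have "Measurable.pred S (\<lambda>x. m < idx (s x) k)" for m k
    using measurable_compose[OF idx[of k], of "\<lambda>j. m < j" "count_space UNIV"] by simp
  then have lt: "Measurable.pred S (\<lambda>x. idx (s x) j < idx (s x) k)" for j k
    by (rule measurable_compose_countable[where f="\<lambda>m x. m < idx (s x) k" and g="\<lambda>x. idx (s x) j"]) (rule idx)
  have lt': "Measurable.pred S (\<lambda>x. rd (s x) a < rd (s x) b)" for a b
    by measurable
  show ?thesis
  proof (cases i)
    case (Gauss a)
    have g: "(\<lambda>x. \<omega> x (drawn (s x))) \<in> borel_measurable S"
      by (rule measurable_compose_countable[OF \<omega> drawn])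
    have "config_measurable S (\<lambda>x. s x\<lparr>drawn := Suc (drawn (s x))\<rparr>)"
      using s by (auto simp: config_measurable_def)
    from config_measurable_wr[OF this g] show ?thesis by (simp add: Gauss)
  qed (auto intro!: config_measurable_wr config_measurable_set_idx config_measurable_branch s lt lt')
qed

lemma measurable_If_arg:
  assumes [measurable]: "(\<lambda>x. f (s x)) \<in> S \<rightarrow>\<^sub>M N" "(\<lambda>x. f (s' x)) \<in> S \<rightarrow>\<^sub>M N" "Measurable.pred S b"
  shows "(\<lambda>x. f (if b x then s x else s' x)) \<in> S \<rightarrow>\<^sub>M N"
  unfolding if_distrib[of f] by measurable

lemma config_measurable_if:
  assumes "config_measurable S s" "config_measurable S s'" and [measurable]: "Measurable.pred S b"
  shows "config_measurable S (\<lambda>x. if b x then s x else s' x)"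
proof -
  note m = measurable_If_arg[OF _ _ assms(3)]
  have "(\<lambda>x. idx (if b x then s x else s' x) i) \<in> S \<rightarrow>\<^sub>M count_space UNIV" for i
    by (rule m[where f="\<lambda>c. idx c i"]) (use assms in \<open>auto simp: config_measurable_def\<close>)
  moreover have "(\<lambda>x. mem (if b x then s x else s' x) a) \<in> borel_measurable S" for a
    by (rule m[where f="\<lambda>c. mem c a"]) (use assms in \<open>auto simp: config_measurable_def\<close>)
  moreover have "(\<lambda>x. pc (if b x then s x else s' x)) \<in> S \<rightarrow>\<^sub>M count_space UNIV"
    by (rule m) (use assms in \<open>auto simp: config_measurable_def\<close>)
  moreover have "(\<lambda>x. drawn (if b x then s x else s' x)) \<in> S \<rightarrow>\<^sub>M count_space UNIV"
    by (rule m) (use assms in \<open>auto simp: config_measurable_def\<close>)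
  ultimately show ?thesis unfolding config_measurable_def by blast
qed

lemma config_measurable_countable:
  assumes "\<And>k::nat. config_measurable S (f k)" "g \<in> S \<rightarrow>\<^sub>M count_space UNIV"
  shows "config_measurable S (\<lambda>x. f (g x) x)"
  using assms unfolding config_measurable_def by (auto intro: measurable_compose_countable)

lemma config_measurable_run:
  assumes y: "\<And>i. i < N \<Longrightarrow> (\<lambda>x. y x i) \<in> borel_measurable S" and \<omega>: "\<And>r. (\<lambda>x. \<omega> x r) \<in> borel_measurable S"
  shows "config_measurable S (\<lambda>x. run p N (y x) (\<omega> x) t)"
proof (induction t)
  case 0
  have "(\<lambda>x. if i < N then y x i else 0) \<in> borel_measurable S" for i
    using y by (cases "i < N") auto
  then show ?case by (simp add: run_def init_config_def config_measurable_def)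
next
  case (Suc t)
  let ?s = "\<lambda>x. run p N (y x) (\<omega> x) t"
  have pc: "(\<lambda>x. pc (?s x)) \<in> S \<rightarrow>\<^sub>M count_space UNIV" using Suc by (simp add: config_measurable_def)
  have "config_measurable S (\<lambda>x. if halted p (?s x) then ?s x else exec (\<omega> x) (p ! pc (?s x)) (?s x))"
  proof (rule config_measurable_if[OF Suc])
    show "config_measurable S (\<lambda>x. exec (\<omega> x) (p ! pc (?s x)) (?s x))"
      by (rule config_measurable_countable[where f="\<lambda>k x. exec (\<omega> x) (p ! k) (?s x)", OF config_measurable_exec[OF Suc \<omega>] pc])
    show "Measurable.pred S (\<lambda>x. halted p (?s x))" unfolding halted_def using pc by measurable
  qed
  moreover have "run p N (y x) (\<omega> x) (Suc t) = (if halted p (?s x) then ?s x else exec (\<omega> x) (p ! pc (?s x)) (?s x))" for x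
    by (simp add: run_def step_def)
  ultimately show ?case by simp
qed

text \<open>The halting time is a measurable natural number, and the output glues together the
  memories at fixed times.\<close>

lemma borel_measurable_result:
  assumes y: "\<And>i. i < N \<Longrightarrow> (\<lambda>x. y x i) \<in> borel_measurable S" and \<omega>: "\<And>r. (\<lambda>x. \<omega> x r) \<in> borel_measurable S"
  shows "(\<lambda>x. result p N (y x) (\<omega> x) a) \<in> borel_measurable S"
  unfolding result_def
proof (rule measurable_compose_countable[where f="\<lambda>t x. mem (run p N (y x) (\<omega> x) t) a"])
  note run = config_measurable_run[OF y \<omega>, where p=p]
  show "(\<lambda>x. mem (run p N (y x) (\<omega> x) t) a) \<in> borel_measurable S" for t
    using run by (simp add: config_measurable_def)
  have "Measurable.pred S (\<lambda>x. halted p (run p N (y x) (\<omega> x) t))" for t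
  proof -
    have "(\<lambda>x. pc (run p N (y x) (\<omega> x) t)) \<in> S \<rightarrow>\<^sub>M count_space UNIV" using run by (simp add: config_measurable_def)
    then show ?thesis unfolding halted_def by measurable
  qed
  then show "(\<lambda>x. LEAST t. halted p (run p N (y x) (\<omega> x) t)) \<in> S \<rightarrow>\<^sub>M count_space UNIV" by measurable
qed

section \<open>Splitting a sample\<close>

text \<open>Two successive substitutions \<open>u = a x + b y\<close> and \<open>v = (x - a u) / b\<close> make up the rotation.\<close>

lemma nn_integral_gaussian_rotation:
  fixes f :: "real \<Rightarrow> real \<Rightarrow> ennreal"
  assumes ab: "a\<^sup>2 + b\<^sup>2 = 1" "b > 0" and \<sigma>: "\<sigma> > 0"
    and f: "case_prod f \<in> borel_measurable (borel \<Otimes>\<^sub>M borel)"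
  defines "\<mu> \<equiv> density lborel (\<lambda>x. ennreal (normal_density 0 \<sigma> x))"
  shows "(\<integral>\<^sup>+x. \<integral>\<^sup>+y. f (a * x + b * y) (b * x - a * y) \<partial>\<mu> \<partial>\<mu>) = (\<integral>\<^sup>+u. \<integral>\<^sup>+v. f u v \<partial>\<mu> \<partial>\<mu>)"
proof -
  let ?d = "normal_density 0 \<sigma>"
  have [measurable]: "(\<lambda>x. f (g x) (h x)) \<in> borel_measurable N"
    if [measurable]: "g \<in> borel_measurable N" "h \<in> borel_measurable N" for g h and N :: "'b measure"
    using measurable_compose[OF measurable_Pair[OF that] f] by simp
  \<comment> \<open>The product of two densities depends only on x^2 + y^2, which a rotation
    preserves.\<close>
  have dd: "?d x * ?d y = ?d u * ?d v" if "u\<^sup>2 + v\<^sup>2 = x\<^sup>2 + y\<^sup>2" for x y u v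
  proof -
    have "- x\<^sup>2 + - y\<^sup>2 = - u\<^sup>2 + - v\<^sup>2" using that by simp
    then have "exp (- x\<^sup>2 / (2 * \<sigma>\<^sup>2)) * exp (- y\<^sup>2 / (2 * \<sigma>\<^sup>2)) = exp (- u\<^sup>2 / (2 * \<sigma>\<^sup>2)) * exp (- v\<^sup>2 / (2 * \<sigma>\<^sup>2))"
      by (simp only: exp_add[symmetric] add_divide_distrib[symmetric])
    then show ?thesis by (simp add: normal_density_def)
  qed
  have s1: "f (a * x + b * ((u - a * x) / b)) (b * x - a * ((u - a * x) / b)) = f u ((x - a * u) / b)" for x u
  proof -
    have "b * b * x + a * a * x = (a\<^sup>2 + b\<^sup>2) * x" by (simp add: algebra_simps power2_eq_square)
    then have e: "b * b * x + a * a * x = x" using ab by simp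
    have "b * x - a * ((u - a * x) / b) = (b * b * x + a * a * x - a * u) / b"
      using ab by (simp add: field_simps)
    then show ?thesis using ab unfolding e by simp
  qed
  have "(\<integral>\<^sup>+x. \<integral>\<^sup>+y. f (a * x + b * y) (b * x - a * y) \<partial>\<mu> \<partial>\<mu>)
     = (\<integral>\<^sup>+x. \<integral>\<^sup>+y. ennreal (?d x * ?d y) * f (a * x + b * y) (b * x - a * y) \<partial>lborel \<partial>lborel)"
    unfolding \<mu>_def by (simp add: nn_integral_density nn_integral_cmult[symmetric] ennreal_mult mult.assoc)
  also have "\<dots> = (\<integral>\<^sup>+x. (\<integral>\<^sup>+u. ennreal (1 / b) * (ennreal (?d x * ?d ((u - a * x) / b)) * f u ((x - a * u) / b)) \<partial>lborel) \<partial>lborel)"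
  proof (rule nn_integral_cong)
    fix x
    have "(\<integral>\<^sup>+y. ennreal (?d x * ?d y) * f (a * x + b * y) (b * x - a * y) \<partial>lborel)
       = ennreal \<bar>1 / b\<bar> * (\<integral>\<^sup>+u. ennreal (?d x * ?d (- a * x / b + 1 / b * u)) * f (a * x + b * (- a * x / b + 1 / b * u)) (b * x - a * (- a * x / b + 1 / b * u)) \<partial>lborel)"
      by (rule nn_integral_real_affine) (use ab in \<open>auto\<close>)
    also have "\<dots> = (\<integral>\<^sup>+u. ennreal (1 / b) * (ennreal (?d x * ?d ((u - a * x) / b)) * f u ((x - a * u) / b)) \<partial>lborel)"
    proof -
      have e: "- a * x / b + 1 / b * u = (u - a * x) / b" for u using ab by (simp add: field_simps)
      show ?thesis unfolding e s1 using ab by (simp add: nn_integral_cmult)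
    qed
    finally show "(\<integral>\<^sup>+y. ennreal (?d x * ?d y) * f (a * x + b * y) (b * x - a * y) \<partial>lborel) = \<dots>" .
  qed
  also have "\<dots> = (\<integral>\<^sup>+u. (\<integral>\<^sup>+x. ennreal (1 / b) * (ennreal (?d x * ?d ((u - a * x) / b)) * f u ((x - a * u) / b)) \<partial>lborel) \<partial>lborel)"
    by (rule lborel_pair.Fubini') measurable
  also have "\<dots> = (\<integral>\<^sup>+u. \<integral>\<^sup>+v. ennreal (?d u * ?d v) * f u v \<partial>lborel \<partial>lborel)"
  proof (rule nn_integral_cong)
    fix u
    have "(\<integral>\<^sup>+x. ennreal (1 / b) * (ennreal (?d x * ?d ((u - a * x) / b)) * f u ((x - a * u) / b)) \<partial>lborel)
       = ennreal \<bar>b\<bar> * (\<integral>\<^sup>+v. ennreal (1 / b) * (ennreal (?d (a * u + b * v) * ?d ((u - a * (a * u + b * v)) / b)) * f u ((a * u + b * v - a * u) / b)) \<partial>lborel)"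
      by (rule nn_integral_real_affine) (use ab in \<open>auto\<close>)
    also have "\<dots> = (\<integral>\<^sup>+v. ennreal (?d u * ?d v) * f u v \<partial>lborel)"
    proof -
      have "(u - a * (a * u + b * v)) / b = b * u - a * v" for v
      proof -
        have "u - a * (a * u + b * v) = u * (1 - a\<^sup>2) - a * b * v" by (simp add: algebra_simps power2_eq_square)
        also have "1 - a\<^sup>2 = b\<^sup>2" using ab by simp
        finally show ?thesis using ab by (simp add: field_simps power2_eq_square)
      qed
      moreover have "?d (a * u + b * v) * ?d (b * u - a * v) = ?d u * ?d v" for v
      proof (rule dd)
        have "(a * u + b * v)\<^sup>2 + (b * u - a * v)\<^sup>2 = (a\<^sup>2 + b\<^sup>2) * (u\<^sup>2 + v\<^sup>2)"
          by (simp add: algebra_simps power2_eq_square)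
        then show "u\<^sup>2 + v\<^sup>2 = (a * u + b * v)\<^sup>2 + (b * u - a * v)\<^sup>2" using ab by simp
      qed
      ultimately have "ennreal \<bar>b\<bar> * (\<integral>\<^sup>+v. ennreal (1 / b) * (ennreal (?d (a * u + b * v) * ?d ((u - a * (a * u + b * v)) / b)) * f u ((a * u + b * v - a * u) / b)) \<partial>lborel)
        = ennreal b * (\<integral>\<^sup>+v. ennreal (1 / b) * (ennreal (?d u * ?d v) * f u v) \<partial>lborel)" using ab by simp
      also have "\<dots> = ennreal b * (ennreal (1 / b) * (\<integral>\<^sup>+v. ennreal (?d u * ?d v) * f u v \<partial>lborel))"
        by (subst nn_integral_cmult) measurable
      also have "\<dots> = (\<integral>\<^sup>+v. ennreal (?d u * ?d v) * f u v \<partial>lborel)"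
        using ab by (simp add: mult.assoc[symmetric] ennreal_mult[symmetric])
      finally show ?thesis .
    qed
    finally show "(\<integral>\<^sup>+x. ennreal (1 / b) * (ennreal (?d x * ?d ((u - a * x) / b)) * f u ((x - a * u) / b)) \<partial>lborel) = \<dots>" .
  qed
  also have "\<dots> = (\<integral>\<^sup>+u. \<integral>\<^sup>+v. f u v \<partial>\<mu> \<partial>\<mu>)"
    unfolding \<mu>_def by (simp add: nn_integral_density nn_integral_cmult[symmetric] ennreal_mult mult.assoc)
  finally show ?thesis .
qed

text \<open>The coordinates are rotated separately. In the induction Fubini moves both integrals
  over the new coordinate k innermost, where the one-dimensional rotation applies. They leave a
  function \<open>?H\<close> of the other coordinates, the subject of the induction
  hypothesis.\<close>

lemma nn_integral_PiM_rotation: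
  fixes \<sigma> :: "'i \<Rightarrow> real" and f :: "('i \<Rightarrow> real) \<Rightarrow> ('i \<Rightarrow> real) \<Rightarrow> ennreal"
  assumes "finite K" and ab: "a\<^sup>2 + b\<^sup>2 = 1" "b > 0" and \<sigma>: "\<And>q. \<sigma> q > 0"
    and f: "case_prod f \<in> borel_measurable (PiM K (\<lambda>_. borel) \<Otimes>\<^sub>M PiM K (\<lambda>_. borel))"
  defines "\<mu> \<equiv> \<lambda>q. density lborel (\<lambda>x. ennreal (normal_density 0 (\<sigma> q) x))"
  shows "(\<integral>\<^sup>+x. \<integral>\<^sup>+y. f (\<lambda>q\<in>K. a * x q + b * y q) (\<lambda>q\<in>K. b * x q - a * y q) \<partial>PiM K \<mu> \<partial>PiM K \<mu>)
    = (\<integral>\<^sup>+u. \<integral>\<^sup>+v. f u v \<partial>PiM K \<mu> \<partial>PiM K \<mu>)"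
  using assms(1) f
proof (induction K arbitrary: f rule: finite_induct)
  case empty
  show ?case by (simp add: PiM_empty nn_integral_count_space_finite)
next
  case (insert k I)
  have pm: "prob_space (\<mu> q)" for q unfolding \<mu>_def by (intro prob_space_normal_density \<sigma>)
  interpret product_sigma_finite \<mu>
    unfolding product_sigma_finite_def by (intro allI prob_space_imp_sigma_finite pm)
  have kf: "sigma_finite_measure (\<mu> k)" by (intro prob_space_imp_sigma_finite pm)
  have If: "sigma_finite_measure (PiM S \<mu>)" for S by (intro prob_space_imp_sigma_finite prob_space_PiM pm)
  have sets_\<mu> [measurable_cong]: "sets (\<mu> q) = sets borel" for q by (simp add: \<mu>_def)
  have sP [measurable_cong]: "sets (PiM S \<mu>) = sets (PiM S (\<lambda>_. borel))" for S by (rule sets_PiM_cong) (auto simp: sets_\<mu>)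
  have idm: "(\<lambda>y. y) \<in> PiM S \<mu> \<rightarrow>\<^sub>M PiM S (\<lambda>_. borel)" for S by (rule measurable_ident_sets[OF sP])
  have mf: "(\<lambda>w. f (p w) (q w)) \<in> borel_measurable N"
    if "p \<in> N \<rightarrow>\<^sub>M PiM (insert k I) (\<lambda>_. borel)" "q \<in> N \<rightarrow>\<^sub>M PiM (insert k I) (\<lambda>_. borel)" for p q and N :: "'b measure"
    using measurable_compose[OF measurable_Pair[OF that] insert.prems] by simp
  have upd: "(\<lambda>w. (p w)(k := h w)) \<in> N \<rightarrow>\<^sub>M PiM (insert k I) (\<lambda>_. borel)"
    if "p \<in> N \<rightarrow>\<^sub>M PiM I (\<lambda>_. borel)" "h \<in> borel_measurable N" for p h and N :: "'b measure"
    by (rule measurable_fun_upd[where J=I]) (use that in auto)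
  let ?R = "\<lambda>S x y. \<lambda>q\<in>S. a * x q + b * y q :: real" and ?Q = "\<lambda>S x y. \<lambda>q\<in>S. b * x q - a * y q :: real"
  have comp: "(\<lambda>w. p w q) \<in> borel_measurable N" if "p \<in> N \<rightarrow>\<^sub>M PiM S (\<lambda>_. borel)" "q \<in> S" for p q S and N :: "'b measure"
    using measurable_compose[OF that(1) measurable_component_singleton[OF that(2)]] by simp
  have rot: "(\<lambda>w. ?R S (p w) (q w)) \<in> N \<rightarrow>\<^sub>M PiM S (\<lambda>_. borel)" "(\<lambda>w. ?Q S (p w) (q w)) \<in> N \<rightarrow>\<^sub>M PiM S (\<lambda>_. borel)"
    if "p \<in> N \<rightarrow>\<^sub>M PiM S (\<lambda>_. borel)" "q \<in> N \<rightarrow>\<^sub>M PiM S (\<lambda>_. borel)" for p q S and N :: "'b measure"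
    using comp[OF that(1)] comp[OF that(2)]
    by (auto intro!: measurable_restrict borel_measurable_add borel_measurable_diff borel_measurable_times)
  have R: "?R (insert k I) (x(k := u)) (y(k := v)) = (?R I x y)(k := a * u + b * v)"
    "?Q (insert k I) (x(k := u)) (y(k := v)) = (?Q I x y)(k := b * u - a * v)" for x y u v
    using insert.hyps by (auto simp: fun_eq_iff)
  let ?H = "\<lambda>p q. \<integral>\<^sup>+u. \<integral>\<^sup>+v. f (p(k := u)) (q(k := v)) \<partial>\<mu> k \<partial>\<mu> k"
  note [measurable] = mf upd rot
  have "(\<integral>\<^sup>+x. \<integral>\<^sup>+y. f (?R (insert k I) x y) (?Q (insert k I) x y) \<partial>PiM (insert k I) \<mu> \<partial>PiM (insert k I) \<mu>)
     = (\<integral>\<^sup>+x. \<integral>\<^sup>+u. \<integral>\<^sup>+y. f (?R (insert k I) (x(k := u)) y) (?Q (insert k I) (x(k := u)) y) \<partial>PiM (insert k I) \<mu> \<partial>\<mu> k \<partial>PiM I \<mu>)"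
  proof (rule product_nn_integral_insert[OF insert.hyps, where f="\<lambda>x. \<integral>\<^sup>+y. f (?R (insert k I) x y) (?Q (insert k I) x y) \<partial>PiM (insert k I) \<mu>"])
    have "(\<lambda>w. f (?R (insert k I) (fst w) (snd w)) (?Q (insert k I) (fst w) (snd w))) \<in> borel_measurable (PiM (insert k I) \<mu> \<Otimes>\<^sub>M PiM (insert k I) \<mu>)"
      by (intro mf rot) measurable
    then show "(\<lambda>x. \<integral>\<^sup>+y. f (?R (insert k I) x y) (?Q (insert k I) x y) \<partial>PiM (insert k I) \<mu>) \<in> borel_measurable (PiM (insert k I) \<mu>)"
      by (intro sigma_finite_measure.borel_measurable_nn_integral[OF If]) (simp add: case_prod_unfold)
  qed
  also have "\<dots> = (\<integral>\<^sup>+x. \<integral>\<^sup>+u. \<integral>\<^sup>+y. \<integral>\<^sup>+v. f ((?R I x y)(k := a * u + b * v)) ((?Q I x y)(k := b * u - a * v)) \<partial>\<mu> k \<partial>PiM I \<mu> \<partial>\<mu> k \<partial>PiM I \<mu>)"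
  proof (intro nn_integral_cong)
    fix x u assume [measurable]: "x \<in> space (PiM I \<mu>)" "u \<in> space (\<mu> k)"
    have xu: "x(k := u) \<in> space (PiM (insert k I) (\<lambda>_. borel))"
      using \<open>x \<in> space (PiM I \<mu>)\<close> by (auto simp: space_PiM PiE_iff extensional_def)
    have "(\<lambda>y. f (?R (insert k I) (x(k := u)) y) (?Q (insert k I) (x(k := u)) y)) \<in> borel_measurable (PiM (insert k I) \<mu>)"
      by (intro mf rot measurable_const[OF xu] idm)
    from product_nn_integral_insert[OF insert.hyps this]
    show "(\<integral>\<^sup>+y. f (?R (insert k I) (x(k := u)) y) (?Q (insert k I) (x(k := u)) y) \<partial>PiM (insert k I) \<mu>)
        = (\<integral>\<^sup>+y. \<integral>\<^sup>+v. f ((?R I x y)(k := a * u + b * v)) ((?Q I x y)(k := b * u - a * v)) \<partial>\<mu> k \<partial>PiM I \<mu>)"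
      by (simp only: R)
  qed
  also have "\<dots> = (\<integral>\<^sup>+x. \<integral>\<^sup>+y. \<integral>\<^sup>+u. \<integral>\<^sup>+v. f ((?R I x y)(k := a * u + b * v)) ((?Q I x y)(k := b * u - a * v)) \<partial>\<mu> k \<partial>\<mu> k \<partial>PiM I \<mu> \<partial>PiM I \<mu>)"
  proof (intro nn_integral_cong)
    fix x assume x: "x \<in> space (PiM I \<mu>)"
    then have x': "x \<in> space (PiM I (\<lambda>_. borel))" by (auto simp: space_PiM)
    have "(\<lambda>(y, u). \<integral>\<^sup>+v. f ((?R I x y)(k := a * u + b * v)) ((?Q I x y)(k := b * u - a * v)) \<partial>\<mu> k) \<in> borel_measurable (PiM I \<mu> \<Otimes>\<^sub>M \<mu> k)"
    proof -
      have "(\<lambda>w. f ((?R I x (fst (fst w)))(k := a * snd (fst w) + b * snd w)) ((?Q I x (fst (fst w)))(k := b * snd (fst w) - a * snd w)))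
          \<in> borel_measurable ((PiM I \<mu> \<Otimes>\<^sub>M \<mu> k) \<Otimes>\<^sub>M \<mu> k)"
        by (intro mf upd rot measurable_const[OF x']) measurable
      then show ?thesis unfolding case_prod_unfold by (intro sigma_finite_measure.borel_measurable_nn_integral[OF kf]) (simp add: case_prod_unfold)
    qed
    then show "(\<integral>\<^sup>+u. \<integral>\<^sup>+y. \<integral>\<^sup>+v. f ((?R I x y)(k := a * u + b * v)) ((?Q I x y)(k := b * u - a * v)) \<partial>\<mu> k \<partial>PiM I \<mu> \<partial>\<mu> k)
       = (\<integral>\<^sup>+y. \<integral>\<^sup>+u. \<integral>\<^sup>+v. f ((?R I x y)(k := a * u + b * v)) ((?Q I x y)(k := b * u - a * v)) \<partial>\<mu> k \<partial>\<mu> k \<partial>PiM I \<mu>)"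
      by (intro pair_sigma_finite.Fubini' pair_sigma_finite.intro If kf)
  qed
  also have "\<dots> = (\<integral>\<^sup>+x. \<integral>\<^sup>+y. ?H (?R I x y) (?Q I x y) \<partial>PiM I \<mu> \<partial>PiM I \<mu>)"
  proof (rule nn_integral_cong, rule nn_integral_cong)
    fix x y assume "x \<in> space (PiM I \<mu>)" "y \<in> space (PiM I \<mu>)"
    have m: "?R I x y \<in> space (PiM I (\<lambda>_. borel))" "?Q I x y \<in> space (PiM I (\<lambda>_. borel))"
      by (auto simp: space_PiM)
    have "(\<lambda>w. f ((?R I x y)(k := fst w)) ((?Q I x y)(k := snd w))) \<in> borel_measurable (borel \<Otimes>\<^sub>M borel)"
      by (intro mf upd measurable_const[OF m(1)] measurable_const[OF m(2)]) measurable
    then show "(\<integral>\<^sup>+u. \<integral>\<^sup>+v. f ((?R I x y)(k := a * u + b * v)) ((?Q I x y)(k := b * u - a * v)) \<partial>\<mu> k \<partial>\<mu> k)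
       = ?H (?R I x y) (?Q I x y)"
      unfolding \<mu>_def by (intro nn_integral_gaussian_rotation[OF ab \<sigma>]) (simp add: case_prod_unfold)
  qed
  also have "\<dots> = (\<integral>\<^sup>+x. \<integral>\<^sup>+y. ?H x y \<partial>PiM I \<mu> \<partial>PiM I \<mu>)"
  proof (rule insert.IH)
    have "(\<lambda>w. f ((fst (fst (fst w)))(k := snd (fst w))) ((snd (fst (fst w)))(k := snd w)))
        \<in> borel_measurable (((PiM I (\<lambda>_. borel) \<Otimes>\<^sub>M PiM I (\<lambda>_. borel)) \<Otimes>\<^sub>M \<mu> k) \<Otimes>\<^sub>M \<mu> k)"
      by (intro mf upd) measurable
    then have "(\<lambda>w. \<integral>\<^sup>+v. f ((fst (fst w))(k := snd w)) ((snd (fst w))(k := v)) \<partial>\<mu> k)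
        \<in> borel_measurable ((PiM I (\<lambda>_. borel) \<Otimes>\<^sub>M PiM I (\<lambda>_. borel)) \<Otimes>\<^sub>M \<mu> k)"
      by (intro sigma_finite_measure.borel_measurable_nn_integral[OF kf]) (simp add: case_prod_unfold)
    then show "case_prod ?H \<in> borel_measurable (PiM I (\<lambda>_. borel) \<Otimes>\<^sub>M PiM I (\<lambda>_. borel))"
      unfolding case_prod_unfold by (intro sigma_finite_measure.borel_measurable_nn_integral[OF kf]) (simp add: case_prod_unfold)
  qed
  also have "\<dots> = (\<integral>\<^sup>+x. \<integral>\<^sup>+u. \<integral>\<^sup>+y. \<integral>\<^sup>+v. f (x(k := u)) (y(k := v)) \<partial>\<mu> k \<partial>PiM I \<mu> \<partial>\<mu> k \<partial>PiM I \<mu>)"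
  proof (intro nn_integral_cong)
    fix x assume x: "x \<in> space (PiM I \<mu>)"
    then have x': "x \<in> space (PiM I (\<lambda>_. borel))" by (auto simp: space_PiM)
    have "(\<lambda>w. f (x(k := snd (fst w))) ((fst (fst w))(k := snd w))) \<in> borel_measurable ((PiM I \<mu> \<Otimes>\<^sub>M \<mu> k) \<Otimes>\<^sub>M \<mu> k)"
      by (intro mf upd measurable_const[OF x']) measurable
    then have "(\<lambda>(y, u). \<integral>\<^sup>+v. f (x(k := u)) (y(k := v)) \<partial>\<mu> k) \<in> borel_measurable (PiM I \<mu> \<Otimes>\<^sub>M \<mu> k)"
      unfolding case_prod_unfold by (intro sigma_finite_measure.borel_measurable_nn_integral[OF kf]) (simp add: case_prod_unfold)
    then show "(\<integral>\<^sup>+y. ?H x y \<partial>PiM I \<mu>) = (\<integral>\<^sup>+u. \<integral>\<^sup>+y. \<integral>\<^sup>+v. f (x(k := u)) (y(k := v)) \<partial>\<mu> k \<partial>PiM I \<mu> \<partial>\<mu> k)"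
      by (intro pair_sigma_finite.Fubini'[symmetric] pair_sigma_finite.intro If kf)
  qed
  also have "\<dots> = (\<integral>\<^sup>+x. \<integral>\<^sup>+u. \<integral>\<^sup>+y. f (x(k := u)) y \<partial>PiM (insert k I) \<mu> \<partial>\<mu> k \<partial>PiM I \<mu>)"
  proof (intro nn_integral_cong)
    fix x u assume x: "x \<in> space (PiM I \<mu>)"
    have xu: "x(k := u) \<in> space (PiM (insert k I) (\<lambda>_. borel))"
      using x by (auto simp: space_PiM PiE_iff extensional_def)
    have "(\<lambda>y. f (x(k := u)) y) \<in> borel_measurable (PiM (insert k I) \<mu>)"
      by (intro mf measurable_const[OF xu] idm)
    from product_nn_integral_insert[OF insert.hyps this]
    show "(\<integral>\<^sup>+y. \<integral>\<^sup>+v. f (x(k := u)) (y(k := v)) \<partial>\<mu> k \<partial>PiM I \<mu>) = (\<integral>\<^sup>+y. f (x(k := u)) y \<partial>PiM (insert k I) \<mu>)"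
      by simp
  qed
  also have "\<dots> = (\<integral>\<^sup>+x. \<integral>\<^sup>+y. f x y \<partial>PiM (insert k I) \<mu> \<partial>PiM (insert k I) \<mu>)"
  proof (rule product_nn_integral_insert[OF insert.hyps, where f="\<lambda>x. \<integral>\<^sup>+y. f x y \<partial>PiM (insert k I) \<mu>", symmetric])
    have "(\<lambda>w. f (fst w) (snd w)) \<in> borel_measurable (PiM (insert k I) \<mu> \<Otimes>\<^sub>M PiM (insert k I) \<mu>)"
      by (intro mf) measurable
    then show "(\<lambda>x. \<integral>\<^sup>+y. f x y \<partial>PiM (insert k I) \<mu>) \<in> borel_measurable (PiM (insert k I) \<mu>)"
      by (intro sigma_finite_measure.borel_measurable_nn_integral[OF If]) (simp add: case_prod_unfold)
  qed
  finally show ?case .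
qed

text \<open>\<open>comb_seq n g v\<close> continues the first n terms of g by v: the Gaussians that
  perturb a sample are independent of those left to the program.\<close>

lemma nn_integral_seed_split:
  assumes [measurable]: "f \<in> borel_measurable seed"
  shows "(\<integral>\<^sup>+u. f u \<partial>seed) = (\<integral>\<^sup>+g. \<integral>\<^sup>+v. f (comb_seq n g v) \<partial>seed \<partial>seed)"
proof -
  interpret prob_space std_gauss by (rule prob_space_std_gauss)
  interpret sequence_space std_gauss ..
  interpret S: prob_space seed unfolding seed_def by (rule prob_space_PiM) (rule prob_space_std_gauss)
  have seed: "seed = distr (seed \<Otimes>\<^sub>M seed) seed (\<lambda>(\<omega>, \<omega>'). comb_seq n \<omega> \<omega>')"
    unfolding seed_def by (rule PiM_comb_seq[symmetric])
  have m: "(\<lambda>(\<omega>, \<omega>'). comb_seq n \<omega> \<omega>') \<in> seed \<Otimes>\<^sub>M seed \<rightarrow>\<^sub>M seed"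
    unfolding seed_def by (rule measurable_comb_seq)
  have "(\<integral>\<^sup>+u. f u \<partial>seed) = (\<integral>\<^sup>+x. f (comb_seq n (fst x) (snd x)) \<partial>(seed \<Otimes>\<^sub>M seed))"
    by (subst seed, subst nn_integral_distr[OF m]) (simp_all add: case_prod_unfold)
  also have "\<dots> = (\<integral>\<^sup>+g. \<integral>\<^sup>+v. f (comb_seq n g v) \<partial>seed \<partial>seed)"
    using measurable_compose[OF m assms] by (subst S.nn_integral_fst[symmetric]) (simp_all add: case_prod_unfold)
  finally show ?thesis .
qed

text \<open>Distinct terms of the seed are independent; rescaled, they have the variances of the
  noise. Equality of the laws is checked on boxes, whose preimages are cylinders.\<close>

lemma nn_integral_seed_noise:
  assumes inj: "inj_on num (noise_index L n)" and f: "f \<in> borel_measurable (PiM (noise_index L n) (\<lambda>_. borel))"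
  shows "(\<integral>\<^sup>+g. f (\<lambda>q\<in>noise_index L n. noise_sd q * g (num q)) \<partial>seed) = (\<integral>\<^sup>+w. f w \<partial>noise_space L n)"
proof -
  let ?K = "noise_index L n" and ?\<mu> = "\<lambda>q. density lborel (\<lambda>x. ennreal (normal_density 0 (noise_sd q) x))"
  interpret prob_space std_gauss by (rule prob_space_std_gauss)
  interpret P: product_prob_space "\<lambda>_. std_gauss" UNIV by (rule product_prob_spaceI) (rule prob_space_std_gauss)
  have pm: "prob_space (?\<mu> q)" for q by (intro prob_space_normal_density noise_sd_pos)
  interpret N: product_prob_space ?\<mu> ?K by (rule product_prob_spaceI) (rule pm)
  let ?t = "\<lambda>g. \<lambda>q\<in>?K. noise_sd q * g (num q)"
  have mt: "?t \<in> seed \<rightarrow>\<^sub>M PiM ?K (\<lambda>_. borel)"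
  proof (rule measurable_restrict)
    fix q
    have "(\<lambda>g. g (num q)) \<in> borel_measurable seed"
      unfolding seed_def using measurable_component_singleton[of "num q" UNIV "\<lambda>_. std_gauss"] by (simp cong: measurable_cong_sets)
    then show "(\<lambda>g. noise_sd q * g (num q)) \<in> borel_measurable seed" by simp
  qed
  have "distr seed (PiM ?K (\<lambda>_. borel)) ?t = PiM ?K ?\<mu>"
  proof (rule N.PiM_eqI)
    show "sets (distr seed (PiM ?K (\<lambda>_. borel)) ?t) = sets (PiM ?K ?\<mu>)"
      by (simp, rule sets_PiM_cong) auto
    fix A assume "\<And>q. q \<in> ?K \<Longrightarrow> A q \<in> sets (?\<mu> q)"
    then have A: "A q \<in> sets borel" if "q \<in> ?K" for q using that by simp
    let ?B = "\<lambda>q. (\<lambda>x. noise_sd q * x) -` A q"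
    have B: "?B q \<in> sets borel" if "q \<in> ?K" for q
      using measurable_sets[of "\<lambda>x. noise_sd q * x" borel borel "A q"] A[OF that] by simp
    let ?C = "\<lambda>j. ?B (the_inv_into ?K num j)"
    have "?t -` Pi\<^sub>E ?K A \<inter> space seed = prod_emb UNIV (\<lambda>_. std_gauss) (num ` ?K) (Pi\<^sub>E (num ` ?K) ?C)"
      by (auto simp: prod_emb_def space_PiM seed_def PiE_iff the_inv_into_f_f[OF inj])
    then have "emeasure (distr seed (PiM ?K (\<lambda>_. borel)) ?t) (Pi\<^sub>E ?K A) = emeasure seed (prod_emb UNIV (\<lambda>_. std_gauss) (num ` ?K) (Pi\<^sub>E (num ` ?K) ?C))"
      using A by (subst emeasure_distr[OF mt]) (auto intro!: sets_PiM_I_finite)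
    also have "\<dots> = (\<Prod>j\<in>num ` ?K. emeasure std_gauss (?C j))"
      unfolding seed_def using B by (intro P.emeasure_PiM_emb) (auto simp: the_inv_into_f_f[OF inj])
    also have "\<dots> = (\<Prod>q\<in>?K. emeasure std_gauss (?B q))"
      by (subst prod.reindex[OF inj]) (auto intro!: prod.cong simp: the_inv_into_f_f[OF inj])
    also have "\<dots> = (\<Prod>q\<in>?K. emeasure (?\<mu> q) (A q))"
      using A by (intro prod.cong refl) (simp add: normal_density_scale[OF noise_sd_pos] emeasure_distr)
    finally show "emeasure (distr seed (PiM ?K (\<lambda>_. borel)) ?t) (Pi\<^sub>E ?K A) = (\<Prod>q\<in>?K. emeasure (?\<mu> q) (A q))" .
  qed simp
  then have "noise_space L n = distr seed (PiM ?K (\<lambda>_. borel)) ?t" by (simp add: noise_space_eq)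
  then show ?thesis by (simp add: nn_integral_distr[OF mt] f)
qed

section \<open>Numbering of the noise coordinates\<close>

definition num :: "nat \<Rightarrow> nat \<times> nat \<times> nat \<Rightarrow> nat" where
  "num n = (\<lambda>(l, i, j). (l - 1) * (n * n) + (i * n + j))"

lemma index_less: "i < n \<Longrightarrow> j < n \<Longrightarrow> i * n + j < n * n" for n :: nat
proof -
  assume "i < n" "j < n"
  then have "i * n + j < Suc i * n" by simp
  also have "\<dots> \<le> n * n" using \<open>i < n\<close> by (intro mult_le_mono1) simp
  finally show ?thesis .
qed

lemma index_eq_iff: "j < n \<Longrightarrow> j' < n \<Longrightarrow> i * n + j = i' * n + j' \<longleftrightarrow> i = i' \<and> j = j'" for n :: nat
proof
  assume j: "j < n" "j' < n" and eq: "i * n + j = i' * n + j'"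
  have "(i * n + j) div n = i" "(i' * n + j') div n = i'" using j by simp_all
  then have "i = i'" using eq by simp
  then show "i = i' \<and> j = j'" using eq by simp
qed simp

lemma inj_num: "inj_on (num n) (noise_index L n)"
proof (rule inj_onI)
  fix q q' assume q: "q \<in> noise_index L n" "q' \<in> noise_index L n" and eq: "num n q = num n q'"
  obtain l i j where 1: "q = (l, i, j)" by (cases q)
  obtain l' i' j' where 2: "q' = (l', i', j')" by (cases q')
  have b: "1 \<le> l" "1 \<le> l'" "i < n" "j < n" "i' < n" "j' < n" using q by (auto simp: noise_index_def 1 2)
  have "l - 1 = l' - 1 \<and> i * n + j = i' * n + j'"
    using eq index_eq_iff[OF index_less[OF b(3,4)] index_less[OF b(5,6)]] by (simp add: num_def 1 2)
  then show "q = q'" using b index_eq_iff[OF b(4,6)] by (auto simp: 1 2)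
qed

lemma num_less:
  assumes "q \<in> noise_index L n"
  shows "num n q < model_dim L n"
proof -
  obtain l i j where q: "q = (l, i, j)" "1 \<le> l" "l \<le> L" "i < n" "j < n" using assms by (cases q) (auto simp: noise_index_def)
  have "num n q < Suc (l - 1) * (n * n)" using index_less[OF q(4,5)] by (simp add: num_def q(1))
  also have "\<dots> \<le> L * (n * n)" using q by (intro mult_le_mono1) simp
  also have "\<dots> \<le> model_dim L n" by (simp add: model_dim_def)
  finally show ?thesis .
qed

text \<open>The artificial noise of entry k is \<open>noise_coef n k\<close> times the Gaussian
  numbered \<open>noise_pos n k\<close>. Mirror entries read the same Gaussians, so this noise is
  again a GUE family.\<close>

definition noise_pos :: "nat \<Rightarrow> nat \<Rightarrow> nat" where
  "noise_pos n k = num n (coord n k)"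

definition noise_coef :: "nat \<Rightarrow> nat \<Rightarrow> real" where
  "noise_coef n k = coord_sign n k * noise_sd (coord n k)"

lemma noise_pos_less: "k < model_dim L n \<Longrightarrow> noise_pos n k < model_dim L n"
  unfolding noise_pos_def by (intro num_less coord_mem)

lemma signal_coord_scale: "signal_coord lam n \<phi> q = lam * signal_coord 1 n \<phi> q"
  by (auto simp: signal_coord_def Re_signal Im_signal split: prod.split)

lemma vectorize_observation_nth:
  "k < model_dim L n \<Longrightarrow> vectorize L n (observation r n \<phi> w) k = coord_sign n k * (w (coord n k) + r * signal_coord 1 n \<phi> (coord n k))"
  unfolding observation_eq_gue vectorize_gue_eq by (simp add: signal_coord_scale[of r])

lemma prob_space_noise: "prob_space (noise_space L n)"
  unfolding noise_space_eq by (intro prob_space_PiM prob_space_normal_density noise_sd_pos)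

lemma prob_space_seed: "prob_space seed"
  unfolding seed_def by (intro prob_space_PiM prob_space_std_gauss)

lemma measurable_noise_component: "q \<in> noise_index L n \<Longrightarrow> (\<lambda>w. w q) \<in> borel_measurable (noise_space L n)"
  unfolding noise_space_eq
  using measurable_component_singleton[of q "noise_index L n" "\<lambda>q. density lborel (\<lambda>x. ennreal (normal_density 0 (noise_sd q) x))"]
  by (simp cong: measurable_cong_sets)

lemma measurable_seed_component: "(\<lambda>u. u j) \<in> borel_measurable seed"
  unfolding seed_def using measurable_component_singleton[of j UNIV "\<lambda>_. std_gauss"] by (simp cong: measurable_cong_sets)

lemma measurable_vectorize_observation:
  assumes "\<phi> \<in> S \<rightarrow>\<^sub>M phase_space n" "w \<in> S \<rightarrow>\<^sub>M noise_space L n"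
  shows "(\<lambda>x. vectorize L n (observation r n (\<phi> x) (w x))) \<in> S \<rightarrow>\<^sub>M RN (model_dim L n)"
  unfolding observation_eq_gue vectorize_gue_eq
proof (intro measurable_restrict borel_measurable_times borel_measurable_add borel_measurable_const)
  fix k assume "k \<in> {..<model_dim L n}"
  then have q: "coord n k \<in> noise_index L n" by (auto intro: coord_mem)
  show "(\<lambda>x. w x (coord n k)) \<in> borel_measurable S"
    by (rule measurable_compose[OF assms(2) measurable_noise_component[OF q]])
  have "(\<lambda>\<phi>. signal_coord r n \<phi> (coord n k)) \<in> borel_measurable (phase_space n)"
    using borel_measurable_times[OF borel_measurable_const[of "noise_sd (coord n k)"] measurable_std_signal[OF q, of r]] noise_sd_pos[of "coord n k"]
    by (simp add: std_signal_def less_imp_neq[symmetric])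
  then show "(\<lambda>x. signal_coord r n (\<phi> x) (coord n k)) \<in> borel_measurable S"
    by (rule measurable_compose[OF assms(1)])
qed

lemma pair_sigma_finiteI: "prob_space M1 \<Longrightarrow> prob_space M2 \<Longrightarrow> pair_sigma_finite M1 M2"
  by (intro pair_sigma_finite.intro prob_space_imp_sigma_finite)

text \<open>
  Adding and subtracting the machine's own Gaussian noise splits one sample of signal strength \<open>r\<close> into
  two independent ones of strengths \<open>\<alpha> r\<close> and \<open>\<beta> r\<close>.
\<close>

lemma split_sample:
  fixes F :: "(nat \<Rightarrow> real) \<Rightarrow> (nat \<Rightarrow> real) \<Rightarrow> (nat \<Rightarrow> real) \<Rightarrow> ennreal"
  assumes ab: "\<alpha>\<^sup>2 + \<beta>\<^sup>2 = 1" "\<beta> > 0"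
    and F: "(\<lambda>x. F (fst x) (fst (snd x)) (snd (snd x))) \<in> borel_measurable (RN (model_dim L n) \<Otimes>\<^sub>M (RN (model_dim L n) \<Otimes>\<^sub>M seed))"
  shows "(\<integral>\<^sup>+y. \<integral>\<^sup>+u. F (\<lambda>k\<in>{..<model_dim L n}. \<alpha> * y k + \<beta> * noise_coef n k * u (noise_pos n k))
      (\<lambda>k\<in>{..<model_dim L n}. \<beta> * y k - \<alpha> * noise_coef n k * u (noise_pos n k)) (\<lambda>j. u (model_dim L n + j)) \<partial>seed \<partial>planted (sync_problem r L n))
    = (\<integral>\<^sup>+\<phi>. \<integral>\<^sup>+w. \<integral>\<^sup>+v. \<integral>\<^sup>+z. F (vectorize L n (observation (\<alpha> * r) n \<phi> w)) (vectorize L n (observation (\<beta> * r) n \<phi> z)) v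
        \<partial>noise_space L n \<partial>seed \<partial>noise_space L n \<partial>phase_space n)"
proof -
  let ?N = "model_dim L n" and ?W = "noise_space L n" and ?P = "phase_space n" and ?K = "noise_index L n"
  interpret W: prob_space ?W by (rule prob_space_noise)
  interpret P: prob_space ?P by (rule prob_space_phase)
  interpret S: prob_space seed by (rule prob_space_seed)
  let ?vo = "\<lambda>r \<phi> w. vectorize L n (observation r n \<phi> w)"
  have mF: "(\<lambda>x. F (p x) (q x) (s x)) \<in> borel_measurable X"
    if "p \<in> X \<rightarrow>\<^sub>M RN ?N" "q \<in> X \<rightarrow>\<^sub>M RN ?N" "s \<in> X \<rightarrow>\<^sub>M seed" for p q s and X :: "'x measure"
    using measurable_compose[OF measurable_Pair[OF that(1) measurable_Pair[OF that(2,3)]] F] by simp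
  let ?A = "\<lambda>y u. \<lambda>k\<in>{..<?N}. \<alpha> * y k + \<beta> * noise_coef n k * u (noise_pos n k)"
  let ?B = "\<lambda>y u. \<lambda>k\<in>{..<?N}. \<beta> * y k - \<alpha> * noise_coef n k * u (noise_pos n k)"
  let ?sh = "\<lambda>u j. u (?N + j)"
  have comp: "(\<lambda>x. p x k) \<in> borel_measurable X" if "p \<in> X \<rightarrow>\<^sub>M RN ?N" "k < ?N" for p k and X :: "'x measure"
    using measurable_compose[OF that(1) measurable_component_singleton[of k "{..<?N}" "\<lambda>_. borel"]] that(2) by simp
  have scomp: "(\<lambda>x. u x j) \<in> borel_measurable X" if "u \<in> X \<rightarrow>\<^sub>M seed" for u j and X :: "'x measure"
    by (rule measurable_compose[OF that measurable_seed_component])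
  have mA: "(\<lambda>x. ?A (p x) (u x)) \<in> X \<rightarrow>\<^sub>M RN ?N" "(\<lambda>x. ?B (p x) (u x)) \<in> X \<rightarrow>\<^sub>M RN ?N"
    if "p \<in> X \<rightarrow>\<^sub>M RN ?N" "u \<in> X \<rightarrow>\<^sub>M seed" for p u and X :: "'x measure"
    using comp[OF that(1)] scomp[OF that(2)]
    by (auto intro!: measurable_restrict borel_measurable_add borel_measurable_diff borel_measurable_times)
  have msh: "(\<lambda>x. ?sh (u x)) \<in> X \<rightarrow>\<^sub>M seed" if "u \<in> X \<rightarrow>\<^sub>M seed" for u and X :: "'x measure"
    unfolding seed_def
  proof (rule measurable_PiM_single')
    show "(\<lambda>x. ?sh (u x)) \<in> space X \<rightarrow> (\<Pi>\<^sub>E i\<in>UNIV. space std_gauss)" by auto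
    show "(\<lambda>x. u x (?N + i)) \<in> X \<rightarrow>\<^sub>M std_gauss" for i
      using scomp[OF that, of "?N + i"] by (simp cong: measurable_cong_sets)
  qed
  have mvo: "(\<lambda>x. ?vo r (fst x) (snd x)) \<in> ?P \<Otimes>\<^sub>M ?W \<rightarrow>\<^sub>M RN ?N" for r
    by (rule measurable_vectorize_observation) auto
  \<comment> \<open>Both combinations are linear: they are observations of strengths \<alpha> r and
    \<beta> r, with noises obtained by rotating \<open>w\<close> and the artificial noise.\<close>
  have Y: "?A (?vo r \<phi> w) u = ?vo (\<alpha> * r) \<phi> (\<lambda>q\<in>?K. \<alpha> * w q + \<beta> * (\<lambda>q\<in>?K. noise_sd q * u (num n q)) q)"
    "?B (?vo r \<phi> w) u = ?vo (\<beta> * r) \<phi> (\<lambda>q\<in>?K. \<beta> * w q - \<alpha> * (\<lambda>q\<in>?K. noise_sd q * u (num n q)) q)" for \<phi> w u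
  proof -
    show "?A (?vo r \<phi> w) u = ?vo (\<alpha> * r) \<phi> (\<lambda>q\<in>?K. \<alpha> * w q + \<beta> * (\<lambda>q\<in>?K. noise_sd q * u (num n q)) q)"
    proof
      fix k show "?A (?vo r \<phi> w) u k = ?vo (\<alpha> * r) \<phi> (\<lambda>q\<in>?K. \<alpha> * w q + \<beta> * (\<lambda>q\<in>?K. noise_sd q * u (num n q)) q) k"
        using coord_mem[of k L n]
        by (cases "k < ?N") (simp_all add: vectorize_observation_nth noise_coef_def noise_pos_def algebra_simps, simp add: vectorize_def)
    qed
    show "?B (?vo r \<phi> w) u = ?vo (\<beta> * r) \<phi> (\<lambda>q\<in>?K. \<beta> * w q - \<alpha> * (\<lambda>q\<in>?K. noise_sd q * u (num n q)) q)"
    proof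
      fix k show "?B (?vo r \<phi> w) u k = ?vo (\<beta> * r) \<phi> (\<lambda>q\<in>?K. \<beta> * w q - \<alpha> * (\<lambda>q\<in>?K. noise_sd q * u (num n q)) q) k"
        using coord_mem[of k L n]
        by (cases "k < ?N") (simp_all add: vectorize_observation_nth noise_coef_def noise_pos_def algebra_simps, simp add: vectorize_def)
    qed
  qed
  let ?F' = "\<lambda>y u. F (?A y u) (?B y u) (?sh u)"
  have mF': "(\<lambda>x. ?F' (p x) (u x)) \<in> borel_measurable X" if "p \<in> X \<rightarrow>\<^sub>M RN ?N" "u \<in> X \<rightarrow>\<^sub>M seed" for p u and X :: "'x measure"
    by (rule mF) (use mA[OF that] msh[OF that(2)] in auto)
  have inner: "(\<integral>\<^sup>+u. ?F' (?vo r \<phi> w) u \<partial>seed)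
      = (\<integral>\<^sup>+v. \<integral>\<^sup>+z. F (?vo (\<alpha> * r) \<phi> (\<lambda>q\<in>?K. \<alpha> * w q + \<beta> * z q)) (?vo (\<beta> * r) \<phi> (\<lambda>q\<in>?K. \<beta> * w q - \<alpha> * z q)) v \<partial>?W \<partial>seed)"
    if \<phi>: "\<phi> \<in> space ?P" and w: "w \<in> space ?W" for \<phi> w
  proof -
    have c: "(\<lambda>_. ?vo r \<phi> w) \<in> X \<rightarrow>\<^sub>M RN ?N" for X :: "'x measure"
      by (rule measurable_const) (auto simp: space_PiM vectorize_def)
    have f: "(\<lambda>u. ?F' (?vo r \<phi> w) u) \<in> borel_measurable seed" by (rule mF'[OF c]) auto
    let ?G = "\<lambda>z v. F (?vo (\<alpha> * r) \<phi> (\<lambda>q\<in>?K. \<alpha> * w q + \<beta> * z q)) (?vo (\<beta> * r) \<phi> (\<lambda>q\<in>?K. \<beta> * w q - \<alpha> * z q)) v"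
    let ?z = "\<lambda>g. \<lambda>q\<in>?K. noise_sd q * g (num n q)"
    have e: "?F' (?vo r \<phi> w) (comb_seq ?N g v) = ?G (?z g) v" for g v
    proof -
      have "?z (comb_seq ?N g v) = ?z g"
        by (intro restrict_ext) (simp add: comb_seq_less num_less)
      moreover have "?sh (comb_seq ?N g v) = v" by (simp add: comb_seq_def fun_eq_iff)
      ultimately show ?thesis unfolding Y by simp
    qed
    have mG: "(\<lambda>x. ?G (s x) (v x)) \<in> borel_measurable X"
      if s: "s \<in> X \<rightarrow>\<^sub>M PiM ?K (\<lambda>_. borel)" and v: "v \<in> X \<rightarrow>\<^sub>M seed" for s v and X :: "'x measure"
    proof (rule mF[OF _ _ v])
      have sc: "(\<lambda>x. s x q) \<in> borel_measurable X" if "q \<in> ?K" for q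
        using measurable_compose[OF s measurable_component_singleton[OF that]] by simp
      have sW: "sets ?W = sets (PiM ?K (\<lambda>_. borel))" unfolding noise_space_eq by (rule sets_PiM_cong) auto
      have m: "(\<lambda>x. \<lambda>q\<in>?K. a * w q + b * s x q) \<in> X \<rightarrow>\<^sub>M ?W" for a b
        unfolding measurable_cong_sets[OF refl sW] using sc by (intro measurable_restrict) auto
      show "(\<lambda>x. ?vo (\<alpha> * r) \<phi> (\<lambda>q\<in>?K. \<alpha> * w q + \<beta> * s x q)) \<in> X \<rightarrow>\<^sub>M RN ?N"
        by (rule measurable_vectorize_observation[OF measurable_const[OF \<phi>] m])
      show "(\<lambda>x. ?vo (\<beta> * r) \<phi> (\<lambda>q\<in>?K. \<beta> * w q - \<alpha> * s x q)) \<in> X \<rightarrow>\<^sub>M RN ?N"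
        using measurable_vectorize_observation[OF measurable_const[OF \<phi>] m[of \<beta> "- \<alpha>"], of "\<beta> * r"] by simp
    qed
    have mz: "?z \<in> seed \<rightarrow>\<^sub>M PiM ?K (\<lambda>_. borel)"
      by (intro measurable_restrict borel_measurable_times measurable_seed_component borel_measurable_const)
    have "(\<integral>\<^sup>+u. ?F' (?vo r \<phi> w) u \<partial>seed) = (\<integral>\<^sup>+g. \<integral>\<^sup>+v. ?G (?z g) v \<partial>seed \<partial>seed)"
      by (subst nn_integral_seed_split[OF f, of ?N]) (simp only: e)
    also have "\<dots> = (\<integral>\<^sup>+v. \<integral>\<^sup>+g. ?G (?z g) v \<partial>seed \<partial>seed)"
      by (intro pair_sigma_finite.Fubini' pair_sigma_finiteI prob_space_seed)
         (unfold case_prod_unfold, intro mG measurable_compose[OF _ mz], simp_all)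
    also have "\<dots> = (\<integral>\<^sup>+v. \<integral>\<^sup>+z. ?G z v \<partial>?W \<partial>seed)"
    proof (rule nn_integral_cong)
      fix v assume v: "v \<in> space seed"
      show "(\<integral>\<^sup>+g. ?G (?z g) v \<partial>seed) = (\<integral>\<^sup>+z. ?G z v \<partial>?W)"
        by (rule nn_integral_seed_noise[OF inj_num, where f="\<lambda>z. ?G z v"]) (intro mG measurable_const[OF v], simp)
    qed
    finally show ?thesis .
  qed
  let ?H = "\<lambda>\<phi> w z v. F (?vo (\<alpha> * r) \<phi> w) (?vo (\<beta> * r) \<phi> z) v"
  have sW: "sets ?W = sets (PiM ?K (\<lambda>_. borel))" unfolding noise_space_eq by (rule sets_PiM_cong) auto
  have mH: "(\<lambda>x. ?H \<phi> (w x) (z x) (v x)) \<in> borel_measurable X"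
    if "\<phi> \<in> space ?P" "w \<in> X \<rightarrow>\<^sub>M ?W" "z \<in> X \<rightarrow>\<^sub>M ?W" "v \<in> X \<rightarrow>\<^sub>M seed" for \<phi> w z v and X :: "'x measure"
    by (intro mF measurable_vectorize_observation measurable_const that)
  have "(\<integral>\<^sup>+y. \<integral>\<^sup>+u. ?F' y u \<partial>seed \<partial>planted (sync_problem r L n))
      = (\<integral>\<^sup>+x. \<integral>\<^sup>+u. ?F' (?vo r (fst x) (snd x)) u \<partial>seed \<partial>(?P \<Otimes>\<^sub>M ?W))"
  proof -
    have "(\<lambda>y. \<integral>\<^sup>+u. ?F' y u \<partial>seed) \<in> borel_measurable (RN ?N)"
      by (intro S.borel_measurable_nn_integral) (unfold case_prod_unfold, intro mF', simp_all)
    then show ?thesis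
      unfolding sync_problem_def testing_problem.select_convs case_prod_unfold
      by (subst nn_integral_distr[OF mvo]) simp_all
  qed
  also have "\<dots> = (\<integral>\<^sup>+\<phi>. \<integral>\<^sup>+w. \<integral>\<^sup>+u. ?F' (?vo r \<phi> w) u \<partial>seed \<partial>?W \<partial>?P)"
  proof -
    have "(\<lambda>x. \<integral>\<^sup>+u. ?F' (?vo r (fst x) (snd x)) u \<partial>seed) \<in> borel_measurable (?P \<Otimes>\<^sub>M ?W)"
      by (intro S.borel_measurable_nn_integral) (unfold case_prod_unfold, intro mF' measurable_compose[OF _ mvo], simp_all)
    then show ?thesis by (subst W.nn_integral_fst[symmetric]) simp_all
  qed
  also have "\<dots> = (\<integral>\<^sup>+\<phi>. \<integral>\<^sup>+w. \<integral>\<^sup>+v. \<integral>\<^sup>+z. ?H \<phi> w z v \<partial>?W \<partial>seed \<partial>?W \<partial>?P)"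
  proof (rule nn_integral_cong)
    fix \<phi> assume \<phi>: "\<phi> \<in> space ?P"
    let ?R = "\<lambda>w z v. ?H \<phi> (\<lambda>q\<in>?K. \<alpha> * w q + \<beta> * z q) (\<lambda>q\<in>?K. \<beta> * w q - \<alpha> * z q) v"
    have swap: "(\<integral>\<^sup>+w. \<integral>\<^sup>+v. \<integral>\<^sup>+z. T w z v \<partial>?W \<partial>seed \<partial>?W) = (\<integral>\<^sup>+v. \<integral>\<^sup>+w. \<integral>\<^sup>+z. T w z v \<partial>?W \<partial>?W \<partial>seed)"
      if "(\<lambda>x. T (snd (fst x)) (snd x) (fst (fst x))) \<in> borel_measurable ((seed \<Otimes>\<^sub>M ?W) \<Otimes>\<^sub>M ?W)" for T
    proof (intro pair_sigma_finite.Fubini' pair_sigma_finiteI prob_space_seed prob_space_noise)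
      show "(\<lambda>(v, w). \<integral>\<^sup>+z. T w z v \<partial>?W) \<in> borel_measurable (seed \<Otimes>\<^sub>M ?W)"
        unfolding case_prod_unfold by (intro W.borel_measurable_nn_integral) (simp add: case_prod_unfold that)
    qed
    have wc: "(\<lambda>x. p x q) \<in> borel_measurable X" if "p \<in> X \<rightarrow>\<^sub>M ?W" "q \<in> ?K" for p q and X :: "'x measure"
      by (rule measurable_compose[OF that(1) measurable_noise_component[OF that(2)]])
    have rot: "(\<lambda>x. \<lambda>q\<in>?K. a * p x q + b * p' x q) \<in> X \<rightarrow>\<^sub>M ?W" if "p \<in> X \<rightarrow>\<^sub>M ?W" "p' \<in> X \<rightarrow>\<^sub>M ?W" for p p' a b and X :: "'x measure"
      unfolding measurable_cong_sets[OF refl sW] using wc[OF that(1)] wc[OF that(2)]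
      by (intro measurable_restrict borel_measurable_add borel_measurable_times borel_measurable_const) auto
    have mR: "(\<lambda>x. ?R (w x) (z x) (v x)) \<in> borel_measurable X"
      if "w \<in> X \<rightarrow>\<^sub>M ?W" "z \<in> X \<rightarrow>\<^sub>M ?W" "v \<in> X \<rightarrow>\<^sub>M seed" for w z v and X :: "'x measure"
      using mH[OF \<phi> rot[OF that(1,2), of \<alpha> \<beta>] rot[OF that(1,2), of \<beta> "- \<alpha>"] that(3)] by simp
    have "(\<integral>\<^sup>+w. \<integral>\<^sup>+u. ?F' (?vo r \<phi> w) u \<partial>seed \<partial>?W) = (\<integral>\<^sup>+w. \<integral>\<^sup>+v. \<integral>\<^sup>+z. ?R w z v \<partial>?W \<partial>seed \<partial>?W)"
      by (rule nn_integral_cong) (rule inner[OF \<phi>])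
    also have "\<dots> = (\<integral>\<^sup>+v. \<integral>\<^sup>+w. \<integral>\<^sup>+z. ?R w z v \<partial>?W \<partial>?W \<partial>seed)"
      by (intro swap mR) simp_all
    \<comment> \<open>The rotation takes place at fixed phases and fixed remaining Gaussians,
      between the noise of the sample and the artificial one.\<close>
    also have "\<dots> = (\<integral>\<^sup>+v. \<integral>\<^sup>+w. \<integral>\<^sup>+z. ?H \<phi> w z v \<partial>?W \<partial>?W \<partial>seed)"
    proof (rule nn_integral_cong)
      fix v assume v: "v \<in> space seed"
      have s2: "sets (?W \<Otimes>\<^sub>M ?W) = sets (PiM ?K (\<lambda>_. borel) \<Otimes>\<^sub>M PiM ?K (\<lambda>_. borel))"
        by (rule sets_pair_measure_cong[OF sW sW])
      have "(\<lambda>x. ?H \<phi> (fst x) (snd x) v) \<in> borel_measurable (?W \<Otimes>\<^sub>M ?W)"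
        by (intro mH[OF \<phi>] measurable_const[OF v]) simp_all
      then have "case_prod (\<lambda>w z. ?H \<phi> w z v) \<in> borel_measurable (PiM ?K (\<lambda>_. borel) \<Otimes>\<^sub>M PiM ?K (\<lambda>_. borel))"
        unfolding case_prod_unfold measurable_cong_sets[OF s2 refl] .
      from nn_integral_PiM_rotation[where \<sigma>=noise_sd, OF finite_noise_index ab noise_sd_pos this]
      show "(\<integral>\<^sup>+w. \<integral>\<^sup>+z. ?R w z v \<partial>?W \<partial>?W) = (\<integral>\<^sup>+w. \<integral>\<^sup>+z. ?H \<phi> w z v \<partial>?W \<partial>?W)"
        by (simp only: noise_space_eq)
    qed
    also have "\<dots> = (\<integral>\<^sup>+w. \<integral>\<^sup>+v. \<integral>\<^sup>+z. ?H \<phi> w z v \<partial>?W \<partial>seed \<partial>?W)"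
      by (rule swap[symmetric]) (intro mH[OF \<phi>], simp_all)
    finally show "(\<integral>\<^sup>+w. \<integral>\<^sup>+u. ?F' (?vo r \<phi> w) u \<partial>seed \<partial>?W) = \<dots>" .
  qed
  finally show ?thesis .
qed

text \<open>At strength 0 the phases are invisible. Thus \<open>split_sample\<close> covers the null
  law too.\<close>

lemma null_law_eq_planted: "null_law (sync_problem lam L n) = planted (sync_problem 0 L n)"
proof -
  let ?W = "noise_space L n" and ?P = "phase_space n"
  have "observation 0 n \<phi> w = gue w" for \<phi> w
    by (simp add: observation_def signal_def fun_eq_iff)
  then have "planted (sync_problem 0 L n) = distr (?P \<Otimes>\<^sub>M ?W) (RN (model_dim L n)) ((\<lambda>w. vectorize L n (gue w)) \<circ> snd)"
    by (simp add: sync_problem_def case_prod_unfold comp_def)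
  also have "\<dots> = distr (distr (?P \<Otimes>\<^sub>M ?W) ?W snd) (RN (model_dim L n)) (\<lambda>w. vectorize L n (gue w))"
  proof (rule distr_distr[symmetric])
    show "(\<lambda>w. vectorize L n (gue w)) \<in> ?W \<rightarrow>\<^sub>M RN (model_dim L n)"
      unfolding vectorize_gue_eq
      by (intro measurable_restrict borel_measurable_times borel_measurable_const measurable_noise_component) (auto intro: coord_mem)
  qed simp
  also have "distr (?P \<Otimes>\<^sub>M ?W) ?W snd = ?W"
    by (rule distr_pair_snd_prob[OF prob_space_phase prob_space_noise])
  finally show ?thesis by (simp add: sync_problem_def)
qed

section \<open>Gaussian tails of linear forms\<close>

lemma normal_mgf:
  assumes "\<sigma> > 0"
  shows "(\<integral>\<^sup>+x. ennreal (exp (c * x)) \<partial>density lborel (\<lambda>x. ennreal (normal_density 0 \<sigma> x))) = ennreal (exp (c\<^sup>2 * \<sigma>\<^sup>2 / 2))"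
proof -
  have e: "normal_density 0 \<sigma> x * exp (c * x) = exp (c\<^sup>2 * \<sigma>\<^sup>2 / 2) * normal_density (c * \<sigma>\<^sup>2) \<sigma> x" for x
  proof -
    \<comment> \<open>Completing the square.\<close>
    have "- x\<^sup>2 / (2 * \<sigma>\<^sup>2) + c * x = c\<^sup>2 * \<sigma>\<^sup>2 / 2 + - (x - c * \<sigma>\<^sup>2)\<^sup>2 / (2 * \<sigma>\<^sup>2)"
      using assms by (simp add: field_simps power2_eq_square)
    then have "exp (- x\<^sup>2 / (2 * \<sigma>\<^sup>2)) * exp (c * x) = exp (c\<^sup>2 * \<sigma>\<^sup>2 / 2) * exp (- (x - c * \<sigma>\<^sup>2)\<^sup>2 / (2 * \<sigma>\<^sup>2))"
      by (simp only: exp_add[symmetric])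
    then show ?thesis by (simp add: normal_density_def)
  qed
  have "(\<integral>\<^sup>+x. ennreal (exp (c * x)) \<partial>density lborel (\<lambda>x. ennreal (normal_density 0 \<sigma> x))) = (\<integral>\<^sup>+x. ennreal (normal_density 0 \<sigma> x * exp (c * x)) \<partial>lborel)"
    by (simp add: nn_integral_density ennreal_mult)
  also have "\<dots> = ennreal (exp (c\<^sup>2 * \<sigma>\<^sup>2 / 2)) * (\<integral>\<^sup>+x. ennreal (normal_density (c * \<sigma>\<^sup>2) \<sigma> x) \<partial>lborel)"
    unfolding e by (simp add: ennreal_mult nn_integral_cmult)
  also have "(\<integral>\<^sup>+x. ennreal (normal_density (c * \<sigma>\<^sup>2) \<sigma> x) \<partial>lborel) = 1"
    using assms by (simp add: nn_integral_eq_integral normal_density_nonneg)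
  finally show ?thesis by simp
qed

lemma noise_mgf:
  "(\<integral>\<^sup>+z. ennreal (exp (\<Sum>q\<in>noise_index L n. h q * z q)) \<partial>noise_space L n)
    = ennreal (exp (\<Sum>q\<in>noise_index L n. (h q)\<^sup>2 * (noise_sd q)\<^sup>2 / 2))"
proof -
  let ?\<mu> = "\<lambda>q. density lborel (\<lambda>x. ennreal (normal_density 0 (noise_sd q) x))"
  interpret product_sigma_finite ?\<mu>
    unfolding product_sigma_finite_def by (intro allI prob_space_imp_sigma_finite prob_space_normal_density noise_sd_pos)
  have "(\<integral>\<^sup>+z. ennreal (exp (\<Sum>q\<in>noise_index L n. h q * z q)) \<partial>noise_space L n)
      = (\<integral>\<^sup>+z. (\<Prod>q\<in>noise_index L n. ennreal (exp (h q * z q))) \<partial>PiM (noise_index L n) ?\<mu>)"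
    by (simp add: noise_space_eq exp_sum prod_ennreal)
  also have "\<dots> = (\<Prod>q\<in>noise_index L n. \<integral>\<^sup>+x. ennreal (exp (h q * x)) \<partial>?\<mu> q)"
    by (rule product_nn_integral_prod) auto
  also have "\<dots> = ennreal (exp (\<Sum>q\<in>noise_index L n. (h q)\<^sup>2 * (noise_sd q)\<^sup>2 / 2))"
    by (simp add: normal_mgf[OF noise_sd_pos] exp_sum prod_ennreal)
  finally show ?thesis .
qed

lemma sum_symmetrize_le:
  fixes g h :: "nat \<Rightarrow> nat \<Rightarrow> real"
  assumes "\<And>i j. h i j + h j i \<le> g i j + g j i"
  shows "(\<Sum>i<n. \<Sum>j<n. h i j) \<le> (\<Sum>i<n. \<Sum>j<n. g i j)"
proof -
  have e: "(\<Sum>i<n. \<Sum>j<n. f i j + f j i) = 2 * (\<Sum>i<n. \<Sum>j<n. f i j)" for f :: "nat \<Rightarrow> nat \<Rightarrow> real"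
    using sum.swap[of "\<lambda>i j. f j i" "{..<n}" "{..<n}"] unfolding sum.distrib by linarith
  have "(\<Sum>i<n. \<Sum>j<n. h i j + h j i) \<le> (\<Sum>i<n. \<Sum>j<n. g i j + g j i)" by (intro sum_mono assms)
  then show ?thesis unfolding e by linarith
qed

text \<open>The coefficient of \<open>z (l, i, j)\<close> in the Frobenius product of X with
  \<open>gue z l\<close>. A coordinate above the diagonal is the real part of two mirror entries;
  one below is their imaginary part, with opposite signs.\<close>

definition gue_form :: "cmat \<Rightarrow> nat \<Rightarrow> nat \<Rightarrow> real" where
  "gue_form X i j = (if i = j then Re (X i i) else if i < j then Re (X i j) + Re (X j i) else Im (X j i) - Im (X i j))"

lemma frob_inner_gue: "frob_inner n X (gue z l) = (\<Sum>i<n. \<Sum>j<n. gue_form X i j * z (l, i, j))"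
proof -
  have "(\<Sum>i<n. \<Sum>j<n. gue_form X i j * z (l, i, j)) = (\<Sum>i<n. \<Sum>j<n. Re (cnj (X i j) * gue z l i j))"
    by (rule sum_symmetrize) (auto simp: gue_form_def gue_def algebra_simps)
  then show ?thesis by (simp add: frob_inner_def)
qed

text \<open>The left side is the variance of the linear form. A coordinate shared by two entries
  contributes (a + b)^2 / 2 or (a - b)^2 / 2, each at most a^2 + b^2; for Hermitian X there is
  equality.\<close>

lemma gue_form_norm: "(\<Sum>i<n. \<Sum>j<n. (gue_form X i j)\<^sup>2 * (noise_sd (l, i, j))\<^sup>2) \<le> (frob_norm n X)\<^sup>2"
proof -
  have "(\<Sum>i<n. \<Sum>j<n. (gue_form X i j)\<^sup>2 * (noise_sd (l, i, j))\<^sup>2) \<le> (\<Sum>i<n. \<Sum>j<n. (cmod (X i j))\<^sup>2)"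
  proof (rule sum_symmetrize_le)
    have sq: "(a + b)\<^sup>2 / 2 \<le> a\<^sup>2 + b\<^sup>2" "(a - b)\<^sup>2 / 2 \<le> a\<^sup>2 + b\<^sup>2" for a b :: real
      using zero_le_power2[of "a - b"] zero_le_power2[of "a + b"] by (simp_all add: power2_eq_square algebra_simps)
    show "(gue_form X i j)\<^sup>2 * (noise_sd (l, i, j))\<^sup>2 + (gue_form X j i)\<^sup>2 * (noise_sd (l, j, i))\<^sup>2 \<le> (cmod (X i j))\<^sup>2 + (cmod (X j i))\<^sup>2" for i j
      using sq(1)[of "Re (X i j)" "Re (X j i)"] sq(2)[of "Im (X i j)" "Im (X j i)"]
        sq(1)[of "Re (X j i)" "Re (X i j)"] sq(2)[of "Im (X j i)" "Im (X i j)"]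
      by (cases i j rule: linorder_cases) (auto simp: gue_form_def noise_sd_def cmod_power2 real_sqrt_divide power_divide)
  qed
  also have "\<dots> = (frob_norm n X)\<^sup>2"
    by (simp add: frob_norm_def sum_nonneg)
  finally show ?thesis .
qed

lemma sum_noise_index: "(\<Sum>q\<in>noise_index L n. f q) = (\<Sum>l\<in>{1..L}. \<Sum>i<n. \<Sum>j<n. f (l, i, j))" for f :: "_ \<Rightarrow> real"
  by (simp add: noise_index_def sum.cartesian_product case_prod_unfold)

text \<open>Chernoff's bound at t = a / |X|: the exponential moment is at most exp(a^2 / 2), and the
  threshold contributes exp(- a^2).\<close>

lemma gue_tail:
  assumes l: "l \<in> {1..L}" and a: "a > 0" and X: "frob_norm n X > 0"
  shows "(\<integral>\<^sup>+z. indicator {z. a * frob_norm n X \<le> frob_inner n X (gue z l)} z \<partial>noise_space L n) \<le> ennreal (exp (- a\<^sup>2 / 2))"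
proof -
  let ?X = "frob_norm n X"
  define t where "t = a / ?X"
  have t: "t > 0" using a X by (simp add: t_def)
  let ?h = "\<lambda>(l', i, j). if l' = l then t * gue_form X i j else 0"
  have h: "(\<Sum>q\<in>noise_index L n. ?h q * z q) = t * frob_inner n X (gue z l)" for z
  proof -
    have "(\<Sum>q\<in>noise_index L n. ?h q * z q) = (\<Sum>l'\<in>{1..L}. if l' = l then t * frob_inner n X (gue z l) else 0)"
      unfolding sum_noise_index frob_inner_gue by (intro sum.cong refl) (simp add: sum_distrib_left mult.assoc)
    then show ?thesis using l by simp
  qed
  have "(\<Sum>q\<in>noise_index L n. (?h q)\<^sup>2 * (noise_sd q)\<^sup>2 / 2)
      = (\<Sum>l'\<in>{1..L}. if l' = l then t\<^sup>2 / 2 * (\<Sum>i<n. \<Sum>j<n. (gue_form X i j)\<^sup>2 * (noise_sd (l, i, j))\<^sup>2) else 0)"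
    unfolding sum_noise_index by (intro sum.cong refl) (simp add: sum_distrib_left power_mult_distrib mult.assoc)
  also have "\<dots> = t\<^sup>2 / 2 * (\<Sum>i<n. \<Sum>j<n. (gue_form X i j)\<^sup>2 * (noise_sd (l, i, j))\<^sup>2)" using l by simp
  also have "\<dots> \<le> t\<^sup>2 / 2 * ?X\<^sup>2" by (intro mult_left_mono gue_form_norm) simp
  also have "\<dots> = a\<^sup>2 / 2" using X by (simp add: t_def power_divide)
  finally have v: "(\<Sum>q\<in>noise_index L n. (?h q)\<^sup>2 * (noise_sd q)\<^sup>2 / 2) \<le> a\<^sup>2 / 2" .
  have pt: "indicator {z. a * ?X \<le> frob_inner n X (gue z l)} z \<le> ennreal (exp (- a\<^sup>2)) * ennreal (exp (\<Sum>q\<in>noise_index L n. ?h q * z q))" for z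
  proof (cases "a * ?X \<le> frob_inner n X (gue z l)")
    case True
    have "a\<^sup>2 = t * (a * ?X)" using X by (simp add: t_def power2_eq_square)
    also have "\<dots> \<le> t * frob_inner n X (gue z l)" using True t by (intro mult_left_mono) auto
    finally have "1 \<le> exp (- a\<^sup>2 + t * frob_inner n X (gue z l))" by simp
    then show ?thesis using True unfolding h exp_add by (simp add: ennreal_mult[symmetric])
  qed simp
  have mz: "(\<lambda>z. ennreal (exp (\<Sum>q\<in>noise_index L n. ?h q * z q))) \<in> borel_measurable (noise_space L n)"
    unfolding noise_space_eq
    by (intro measurable_compose[OF _ measurable_ennreal] borel_measurable_exp borel_measurable_sum borel_measurable_times borel_measurable_const)
       (auto intro!: measurable_component_singleton cong: measurable_cong_sets)
  have "(\<integral>\<^sup>+z. indicator {z. a * ?X \<le> frob_inner n X (gue z l)} z \<partial>noise_space L n)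
      \<le> (\<integral>\<^sup>+z. ennreal (exp (- a\<^sup>2)) * ennreal (exp (\<Sum>q\<in>noise_index L n. ?h q * z q)) \<partial>noise_space L n)"
    by (rule nn_integral_mono) (rule pt)
  also have "\<dots> = ennreal (exp (- a\<^sup>2)) * ennreal (exp (\<Sum>q\<in>noise_index L n. (?h q)\<^sup>2 * (noise_sd q)\<^sup>2 / 2))"
    by (subst nn_integral_cmult[OF mz]) (simp only: noise_mgf)
  also have "\<dots> \<le> ennreal (exp (- a\<^sup>2)) * ennreal (exp (a\<^sup>2 / 2))"
    using v by (intro mult_left_mono ennreal_leI) auto
  also have "\<dots> = ennreal (exp (- a\<^sup>2 / 2))" by (simp add: ennreal_mult[symmetric] flip: exp_add)
  finally show ?thesis .
qed

section \<open>Frobenius products as sums over memory cells\<close>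

lemma sum_pairs: "(\<Sum>q<2 * m. f q) = (\<Sum>e<m. f (2 * e) + f (2 * e + 1))" for f :: "nat \<Rightarrow> real"
  by (induction m) (auto simp: algebra_simps)

lemma sum_square_index: "(\<Sum>e<m * n. f e) = (\<Sum>i<m. \<Sum>j<n. f (i * n + j))" for f :: "nat \<Rightarrow> real"
proof (induction m)
  case (Suc m)
  have "{..<Suc m * n} = {..<m * n} \<union> {m * n..<m * n + n}" by auto
  then have "(\<Sum>e<Suc m * n. f e) = sum f ({..<m * n} \<union> {m * n..<m * n + n})" by (simp only:)
  also have "\<dots> = (\<Sum>e<m * n. f e) + (\<Sum>e\<in>{m * n..<m * n + n}. f e)"
    by (rule sum.union_disjoint) auto
  also have "(\<Sum>e\<in>{m * n..<m * n + n}. f e) = (\<Sum>j<n. f (m * n + j))"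
    using sum.shift_bounds_nat_ivl[of f 0 "m * n" n] by (simp add: add.commute lessThan_atLeast0)
  finally show ?case using Suc by simp
qed simp

lemma vectorize_block:
  assumes "l \<in> {1..L}" "i < n" "j < n"
  shows "vectorize L n Y (2 * ((l - 1) * (n * n)) + 2 * (i * n + j)) = Re (Y l i j)"
    and "vectorize L n Y (2 * ((l - 1) * (n * n)) + (2 * (i * n + j) + 1)) = Im (Y l i j)"
proof -
  let ?e = "(l - 1) * (n * n) + (i * n + j)"
  have lt: "i * n + j < n * n" 
  proof -
    have "i * n + j < Suc i * n" using assms by simp
    also have "\<dots> \<le> n * n" using assms by (intro mult_le_mono1) simp
    finally show ?thesis .
  qed
  have e1: "Suc (?e div (n * n)) = l" using lt assms by simp
  have e: "?e = ((l - 1) * n + i) * n + j" by (simp add: algebra_simps)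
  have "(((l - 1) * n + i) * n + j) div n = (l - 1) * n + i" using assms by simp
  then have e23: "?e div n mod n = i" "?e mod n = j" unfolding e using assms by simp_all
  have "?e < Suc (l - 1) * (n * n)" using lt by simp
  also have "\<dots> \<le> L * (n * n)" using assms by (intro mult_le_mono1) auto
  finally have b: "2 * ?e + 1 < model_dim L n" by (simp add: model_dim_def)
  have d: "2 * ?e div 2 = ?e" "(2 * ?e + 1) div 2 = ?e" by simp_all
  have "vectorize L n Y (2 * ?e) = Re (Y l i j)" "vectorize L n Y (2 * ?e + 1) = Im (Y l i j)"
    using b unfolding vectorize_def Let_def by (simp_all only: d e1 e23 restrict_apply lessThan_iff) simp_all
  then show "vectorize L n Y (2 * ((l - 1) * (n * n)) + 2 * (i * n + j)) = Re (Y l i j)"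
    "vectorize L n Y (2 * ((l - 1) * (n * n)) + (2 * (i * n + j) + 1)) = Im (Y l i j)"
    by (simp_all add: distrib_left add.assoc)
qed

lemma sum_block_inner:
  assumes "l \<in> {1..L}"
  shows "(\<Sum>q<2 * (n * n). x q * vectorize L n Y (2 * ((l - 1) * (n * n)) + q)) = frob_inner n (matrix_of n x) (Y l)"
  unfolding sum_pairs sum_square_index[of _ n n] frob_inner_def Re_sum
  by (intro sum.cong refl) (use assms in \<open>simp add: vectorize_block[OF assms, simplified] matrix_of_def\<close>)

lemma sum_block_norm: "(\<Sum>q<2 * (n * n). x q * x q) = (frob_norm n (matrix_of n x))\<^sup>2"
proof -
  have "(\<Sum>q<2 * (n * n). x q * x q) = (\<Sum>i<n. \<Sum>j<n. (cmod (matrix_of n x i j))\<^sup>2)"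
    unfolding sum_pairs sum_square_index[of _ n n] cmod_power2 by (simp add: matrix_of_def power2_eq_square)
  then show ?thesis by (simp add: frob_norm_def sum_nonneg)
qed

section \<open>From weak recovery to weak detection\<close>

lemma result_cong_input: "(\<And>i. i < N \<Longrightarrow> y i = y' i) \<Longrightarrow> result p N y \<omega> = result p N y' \<omega>"
proof -
  assume "\<And>i. i < N \<Longrightarrow> y i = y' i"
  then have "init_config N y = init_config N y'" by (auto simp: init_config_def)
  then show ?thesis by (simp add: result_def run_def)
qed

lemma frob_inner_le: "frob_inner n A B \<le> frob_norm n A * frob_norm n B"
proof -
  have "frob_inner n A B \<le> (\<Sum>i<n. \<Sum>j<n. cmod (A i j) * cmod (B i j))"
    unfolding frob_inner_def Re_sum
    by (intro sum_mono) (metis complex_Re_le_cmod complex_mod_cnj norm_mult)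
  also have "\<dots> = (\<Sum>x\<in>{..<n} \<times> {..<n}. cmod (A (fst x) (snd x)) * cmod (B (fst x) (snd x)))"
    unfolding sum.cartesian_product by (simp add: case_prod_unfold)
  also have "\<dots> \<le> sqrt ((\<Sum>x\<in>{..<n} \<times> {..<n}. (cmod (A (fst x) (snd x)))\<^sup>2) * (\<Sum>x\<in>{..<n} \<times> {..<n}. (cmod (B (fst x) (snd x)))\<^sup>2))"
    by (rule real_le_rsqrt) (rule Cauchy_Schwarz_ineq_sum)
  also have "\<dots> = frob_norm n A * frob_norm n B"
    unfolding frob_norm_def sum.cartesian_product by (simp add: case_prod_unfold real_sqrt_mult)
  finally show ?thesis .
qed

lemma frob_norm_nonneg [simp]: "0 \<le> frob_norm n A"
  by (simp add: frob_norm_def sum_nonneg)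

lemma frob_inner_zero: "frob_norm n A = 0 \<Longrightarrow> frob_inner n A B = 0"
proof -
  assume "frob_norm n A = 0"
  then have "A i j = 0" if "i < n" "j < n" for i j
    using that by (simp add: frob_norm_def sum_nonneg_eq_0_iff sum_nonneg)
  then show ?thesis by (simp add: frob_inner_def)
qed

lemma frob_inner_add: "frob_inner n A (\<lambda>i j. B i j + C i j) = frob_inner n A B + frob_inner n A C"
  by (simp add: frob_inner_def distrib_left sum.distrib)

lemma frob_norm_signal:
  assumes "lam \<ge> 0" "n > 0"
  shows "frob_norm n (signal lam n \<phi> l) = lam * sqrt (real n)"
proof -
  have "cmod (signal lam n \<phi> l i j) = lam / sqrt (real n)" for i j
    using assms by (simp add: signal_cis norm_mult norm_divide)
  then have "frob_norm n (signal lam n \<phi> l) = sqrt (real n * (real n * (lam / sqrt (real n))\<^sup>2))"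
    by (simp add: frob_norm_def)
  also have "real n * (real n * (lam / sqrt (real n))\<^sup>2) = lam\<^sup>2 * real n"
    using assms by (simp add: power_divide)
  finally show ?thesis using assms by (simp add: real_sqrt_mult)
qed

lemma frob_inner_signal_scale:
  "lam \<noteq> 0 \<Longrightarrow> frob_inner n A (signal s n \<phi> l) = s / lam * frob_inner n A (signal lam n \<phi> l)"
proof -
  assume "lam \<noteq> 0"
  then have "signal s n \<phi> l i j = complex_of_real (s / lam) * signal lam n \<phi> l i j" for i j
    by (simp add: signal_def)
  then have "frob_inner n A (signal s n \<phi> l) = Re (\<Sum>i<n. \<Sum>j<n. complex_of_real (s / lam) * (cnj (A i j) * signal lam n \<phi> l i j))"
    by (simp add: frob_inner_def mult.left_commute)
  also have "\<dots> = Re (complex_of_real (s / lam) * (\<Sum>i<n. \<Sum>j<n. cnj (A i j) * signal lam n \<phi> l i j))"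
    by (simp only: sum_distrib_left)
  finally show ?thesis by (simp add: frob_inner_def)
qed

lemma nn_integral_seed_shift:
  assumes f: "f \<in> borel_measurable seed"
  shows "(\<integral>\<^sup>+u. f (\<lambda>r. u (m + r)) \<partial>seed) = (\<integral>\<^sup>+u. f u \<partial>seed)"
proof -
  interpret S: prob_space seed by (rule prob_space_seed)
  have "(\<lambda>u r. u (m + r)) \<in> seed \<rightarrow>\<^sub>M PiM UNIV (\<lambda>_. std_gauss)"
  proof (rule measurable_PiM_single')
    show "(\<lambda>u. u (m + i)) \<in> seed \<rightarrow>\<^sub>M std_gauss" for i
      using measurable_seed_component[of "m + i"] by (simp cong: measurable_cong_sets)
  qed auto
  then have "(\<lambda>u. f (\<lambda>r. u (m + r))) \<in> borel_measurable seed"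
    using f unfolding seed_def by (rule measurable_compose)
  from nn_integral_seed_split[OF this, of m]
  have "(\<integral>\<^sup>+u. f (\<lambda>r. u (m + r)) \<partial>seed) = (\<integral>\<^sup>+g. \<integral>\<^sup>+v. f v \<partial>seed \<partial>seed)"
    by (simp add: comb_seq_def)
  then show ?thesis by (simp add: S.emeasure_space_1)
qed

locale sync_tester =
  fixes n L l M T :: nat and p :: "instr list" and lam r a :: real
  assumes n: "n > 0" and l: "l \<in> {1..L}" and Mpos: "M > 0" and lam: "0 < lam" "lam < r" and a: "a > 0"
    and halting: "\<And>y \<omega>. \<exists>t\<le>T. halted p (run p (model_dim L n) y \<omega> t)"
begin

abbreviation "N \<equiv> model_dim L n"
text \<open>With \<alpha> r = lam the first half of a split sample has the law that the estimator
  expects; \<beta> r = sqrt(r^2 - lam^2) is the strength left for the second half.\<close>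

definition "\<alpha> = lam / r"
definition "\<beta> = sqrt (1 - \<alpha>\<^sup>2)"
definition "off = 2 * ((l - 1) * (n * n))"

lemma \<alpha>: "0 < \<alpha>" "\<alpha> < 1" "\<alpha> * r = lam"
  using lam by (auto simp: \<alpha>_def)

lemma \<beta>: "\<beta> > 0" "\<alpha>\<^sup>2 + \<beta>\<^sup>2 = 1"
proof -
  have "\<alpha>\<^sup>2 < 1" using \<alpha> by (simp add: power_less_one_iff abs_square_less_1)
  then show "\<beta> > 0" "\<alpha>\<^sup>2 + \<beta>\<^sup>2 = 1" by (simp_all add: \<beta>_def)
qed

lemma off_le: "off + 2 * (n * n) \<le> N"
proof -
  have "off + 2 * (n * n) = 2 * (Suc (l - 1) * (n * n))" by (simp add: off_def)
  also have "\<dots> \<le> 2 * (L * (n * n))" using l by (intro mult_le_mono2 mult_le_mono1) auto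
  finally show ?thesis by (simp add: model_dim_def mult.assoc)
qed

sublocale tester M N T "2 * (n * n)" off p \<alpha> \<beta> "a\<^sup>2" "noise_coef n" "noise_pos n"
  by unfold_locales (use Mpos noise_pos_less off_le halting in auto)

definition test :: "(nat \<Rightarrow> real) \<Rightarrow> (nat \<Rightarrow> real) \<Rightarrow> bool" where
  "test y u = sample_test p N (2 * (n * n)) off \<alpha> \<beta> (a\<^sup>2) (noise_coef n) (noise_pos n) y u"

text \<open>\<open>sample_test\<close> in terms of the two halves and the remaining Gaussians, the
  form to which \<open>split_sample\<close> applies.\<close>

definition decide :: "(nat \<Rightarrow> real) \<Rightarrow> (nat \<Rightarrow> real) \<Rightarrow> (nat \<Rightarrow> real) \<Rightarrow> bool" where
  "decide y1 y2 v \<longleftrightarrow> a\<^sup>2 * (\<Sum>q<2 * (n * n). result p N y1 v q * result p N y1 v q)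
     < (max 0 (\<Sum>q<2 * (n * n). result p N y1 v q * y2 (off + q)))\<^sup>2"

lemma test_eq_decide:
  "test y u = decide (\<lambda>k\<in>{..<N}. \<alpha> * y k + \<beta> * noise_coef n k * u (noise_pos n k))
      (\<lambda>k\<in>{..<N}. \<beta> * y k - \<alpha> * noise_coef n k * u (noise_pos n k)) (\<lambda>j. u (N + j))"
proof -
  have "result p N (\<lambda>k. \<alpha> * y k + \<beta> * noise_coef n k * u (noise_pos n k)) (\<lambda>j. u (N + j))
    = result p N (\<lambda>k\<in>{..<N}. \<alpha> * y k + \<beta> * noise_coef n k * u (noise_pos n k)) (\<lambda>j. u (N + j))"
    by (rule result_cong_input) simp
  then show ?thesis
    using off_le by (simp add: test_def sample_test_def decide_def Let_def)
qed

lemma test_cong: "(\<And>k. k < N \<Longrightarrow> y k = y' k) \<Longrightarrow> test y u = test y' u"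
  unfolding test_eq_decide by (simp cong: restrict_cong)

text \<open>As a |X| is nonnegative, comparing it with the positive part or with the correlation
  itself is the same. An output X = 0 never passes, the inequality being strict.\<close>

lemma decide_iff:
  "decide y1 (vectorize L n Y) v \<longleftrightarrow>
     a * frob_norm n (matrix_of n (result p N y1 v)) < frob_inner n (matrix_of n (result p N y1 v)) (Y l)"
proof -
  let ?X = "matrix_of n (result p N y1 v)"
  let ?s = "frob_inner n ?X (Y l)"
  have "decide y1 (vectorize L n Y) v \<longleftrightarrow> (a * frob_norm n ?X)\<^sup>2 < (max 0 ?s)\<^sup>2"
    unfolding decide_def off_def sum_block_inner[OF l] sum_block_norm by (simp add: power_mult_distrib)
  also have "\<dots> \<longleftrightarrow> a * frob_norm n ?X < max 0 ?s"
  proof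
    have "0 \<le> a * frob_norm n ?X" using a by simp
    then show "a * frob_norm n ?X < max 0 ?s \<Longrightarrow> (a * frob_norm n ?X)\<^sup>2 < (max 0 ?s)\<^sup>2"
      by (rule power_strict_mono[rotated]) auto
  qed (rule power2_less_imp_less, auto)
  also have "\<dots> \<longleftrightarrow> a * frob_norm n ?X < ?s"
      proof -
    have "0 \<le> a * frob_norm n ?X" using a by simp
    then show ?thesis by (auto simp: max_def)
  qed
  finally show ?thesis .
qed

lemma decide_measurable:
  "Measurable.pred (RN N \<Otimes>\<^sub>M (RN N \<Otimes>\<^sub>M seed)) (\<lambda>x. decide (fst x) (fst (snd x)) (snd (snd x)))"
proof -
  let ?S = "RN N \<Otimes>\<^sub>M (RN N \<Otimes>\<^sub>M seed)"
  have c: "(\<lambda>y. y k) \<in> borel_measurable (RN N)" if "k < N" for k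
    using measurable_component_singleton[of k "{..<N}" "\<lambda>_. borel"] that by simp
  have 1: "(\<lambda>x. fst x k) \<in> borel_measurable ?S" if "k < N" for k
    by (rule measurable_compose[OF measurable_fst c[OF that]])
  have 2: "(\<lambda>x. fst (snd x) k) \<in> borel_measurable ?S" if "k < N" for k
    by (rule measurable_compose[OF measurable_snd measurable_compose[OF measurable_fst c[OF that]]])
  have 3: "(\<lambda>x. snd (snd x) j) \<in> borel_measurable ?S" for j
    by (rule measurable_compose[OF measurable_snd measurable_compose[OF measurable_snd measurable_seed_component]])
  have X [measurable]: "(\<lambda>x. result p N (fst x) (snd (snd x)) q) \<in> borel_measurable ?S" for q
    by (rule borel_measurable_result) (use 1 3 in auto)
  have "(\<lambda>x. \<Sum>q<2 * (n * n). result p N (fst x) (snd (snd x)) q * fst (snd x) (off + q)) \<in> borel_measurable ?S"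
    by (intro borel_measurable_sum borel_measurable_times X 2) (use off_le in auto)
  then show ?thesis unfolding decide_def by measurable
qed

lemma test_integral:
  "(\<integral>\<^sup>+y. \<integral>\<^sup>+u. indicator B (test y u) \<partial>seed \<partial>planted (sync_problem s L n))
    = (\<integral>\<^sup>+\<phi>. \<integral>\<^sup>+w. \<integral>\<^sup>+v. \<integral>\<^sup>+z. indicator B (decide (vectorize L n (observation (\<alpha> * s) n \<phi> w)) (vectorize L n (observation (\<beta> * s) n \<phi> z)) v)
        \<partial>noise_space L n \<partial>seed \<partial>noise_space L n \<partial>phase_space n)"
  unfolding test_eq_decide
proof (rule split_sample[where F="\<lambda>y1 y2 v. indicator B (decide y1 y2 v)"])
  show "(\<lambda>x. indicator B (decide (fst x) (fst (snd x)) (snd (snd x))) :: ennreal) \<in> borel_measurable (RN N \<Otimes>\<^sub>M (RN N \<Otimes>\<^sub>M seed))"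
    by (rule measurable_compose[OF decide_measurable]) simp
qed (use \<beta> in auto)

text \<open>Once the first half and the remaining Gaussians are fixed, X is a fixed matrix while the
  second half is pure noise, so \<open>gue_tail\<close> bounds the innermost integral.\<close>

lemma null_pass:
  "(\<integral>\<^sup>+y. \<integral>\<^sup>+u. indicator {True} (test y u) \<partial>seed \<partial>null_law (sync_problem r L n)) \<le> ennreal (exp (- a\<^sup>2 / 2))"
proof -
  interpret W: prob_space "noise_space L n" by (rule prob_space_noise)
  interpret P: prob_space "phase_space n" by (rule prob_space_phase)
  interpret S: prob_space seed by (rule prob_space_seed)
  have obs0: "observation (\<beta> * 0) n \<phi> z = gue z" for \<phi> z
    by (simp add: observation_def signal_def fun_eq_iff)
  have "(\<integral>\<^sup>+y. \<integral>\<^sup>+u. indicator {True} (test y u) \<partial>seed \<partial>null_law (sync_problem r L n))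
    = (\<integral>\<^sup>+\<phi>. \<integral>\<^sup>+w. \<integral>\<^sup>+v. \<integral>\<^sup>+z. indicator {True} (decide (vectorize L n (observation (\<alpha> * 0) n \<phi> w)) (vectorize L n (observation (\<beta> * 0) n \<phi> z)) v)
        \<partial>noise_space L n \<partial>seed \<partial>noise_space L n \<partial>phase_space n)"
    unfolding null_law_eq_planted using test_integral[where B="{True}" and s=0] by simp
  also have "\<dots> \<le> (\<integral>\<^sup>+\<phi>. \<integral>\<^sup>+w. \<integral>\<^sup>+v. ennreal (exp (- a\<^sup>2 / 2)) \<partial>seed \<partial>noise_space L n \<partial>phase_space n)"
  proof (intro nn_integral_mono)
    fix \<phi> w v
    let ?y = "vectorize L n (observation (\<alpha> * 0) n \<phi> w)"
    let ?X = "matrix_of n (result p N ?y v)"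
    show "(\<integral>\<^sup>+z. indicator {True} (decide ?y (vectorize L n (observation (\<beta> * 0) n \<phi> z)) v) \<partial>noise_space L n) \<le> ennreal (exp (- a\<^sup>2 / 2))"
    proof (cases "frob_norm n ?X > 0")
      case True
      have "(\<integral>\<^sup>+z. indicator {True} (decide ?y (vectorize L n (observation (\<beta> * 0) n \<phi> z)) v) \<partial>noise_space L n)
          \<le> (\<integral>\<^sup>+z. indicator {z. a * frob_norm n ?X \<le> frob_inner n ?X (gue z l)} z \<partial>noise_space L n)"
        unfolding decide_iff obs0 by (intro nn_integral_mono) (auto simp: indicator_def)
      also have "\<dots> \<le> ennreal (exp (- a\<^sup>2 / 2))" by (rule gue_tail[OF l a True])
      finally show ?thesis .
    next
      case False
      then have "frob_norm n ?X = 0" using frob_norm_nonneg[of n ?X] by linarith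
      then have "\<not> decide ?y (vectorize L n (observation (\<beta> * 0) n \<phi> z)) v" for z
        unfolding decide_iff by (simp add: frob_inner_zero)
      then show ?thesis by simp
    qed
  qed
  also have "\<dots> = ennreal (exp (- a\<^sup>2 / 2))"
    by (simp add: W.emeasure_space_1 P.emeasure_space_1 S.emeasure_space_1)
  finally show ?thesis .
qed

definition corr :: "(nat \<Rightarrow> real) \<Rightarrow> (nat \<times> nat \<times> nat \<Rightarrow> real) \<Rightarrow> (nat \<Rightarrow> real) \<Rightarrow> real" where
  "corr \<phi> w v = (let X = matrix_of n (result p N (vectorize L n (observation lam n \<phi> w)) v); \<Theta> = signal lam n \<phi> l
     in frob_inner n X \<Theta> / (frob_norm n X * frob_norm n \<Theta>))"

lemma corr_le_1: "corr \<phi> w v \<le> 1"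
  unfolding corr_def Let_def
  by (intro divide_le_eq_1[THEN iffD2]) (use frob_inner_le frob_norm_nonneg in \<open>auto simp: less_le\<close>)

text \<open>There are two ways to fail: the correlation with the signal is below c / 2, which has
  probability at most 1 - c / 2, or the noise of the second half contributes at most - a |X|.
  Otherwise the signal contributes at least 2 a |X|, by the bound on a, and more than half of it
  remains.\<close>

lemma planted_fail:
  assumes c: "c > 0" "c \<le> expected_correlation lam L n l p" and ac: "a \<le> \<beta> * r * sqrt (real n) * c / 4"
  shows "(\<integral>\<^sup>+y. \<integral>\<^sup>+u. indicator {False} (test y u) \<partial>seed \<partial>planted (sync_problem r L n))
    \<le> ennreal (1 - c / 2 + exp (- a\<^sup>2 / 2))"
proof -
  let ?W = "noise_space L n" and ?P = "phase_space n" and ?e = "exp (- a\<^sup>2 / 2)"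
  interpret W: prob_space ?W by (rule prob_space_noise)
  interpret P: prob_space ?P by (rule prob_space_phase)
  interpret S: prob_space seed by (rule prob_space_seed)
  interpret WS: pair_prob_space ?W seed ..
  interpret PWS: pair_prob_space ?P "?W \<Otimes>\<^sub>M seed" ..
  let ?\<Omega> = "?P \<Otimes>\<^sub>M (?W \<Otimes>\<^sub>M seed)"
  let ?F = "\<lambda>x. corr (fst x) (fst (snd x)) (snd (snd x))"
  have EF: "expected_correlation lam L n l p = (\<integral>x. ?F x \<partial>?\<Omega>)"
    unfolding expected_correlation_def corr_def case_prod_unfold by simp
  have iF: "integrable ?\<Omega> ?F"
  \<comment> \<open>A function that is not integrable has integral 0 by convention, contrary to c >
    0.\<close>
  proof (rule ccontr)
    assume "\<not> integrable ?\<Omega> ?F"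
    then have "(\<integral>x. ?F x \<partial>?\<Omega>) = 0" by (rule not_integrable_integral_eq)
    then show False using c EF by simp
  qed
  have sup: "{x \<in> space ?\<Omega>. ?F x < c / 2} \<in> sets ?\<Omega>"
    using borel_measurable_integrable[OF iF] by measurable
  let ?B = "\<lambda>\<phi> w v. indicator {x. corr (fst x) (fst (snd x)) (snd (snd x)) < c / 2} (\<phi>, w, v) :: ennreal"
  have lower: "measure ?\<Omega> {x \<in> space ?\<Omega>. ?F x < c / 2} \<le> 1 - c / 2"
  proof -
    let ?A = "{x \<in> space ?\<Omega>. ?F x < c / 2}"
    have "c \<le> (\<integral>x. ?F x \<partial>?\<Omega>)" using c EF by simp
    \<comment> \<open>The correlation is at most 1, and below c / 2 on A. Integration gives (1 - c /
      2) P(A) <= 1 - c, and P(A) <= 1 turns this into P(A) <= 1 - c / 2.\<close>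
    also have "\<dots> \<le> (\<integral>x. 1 - (1 - c / 2) * indicator ?A x \<partial>?\<Omega>)"
    proof (rule integral_mono[OF iF])
      show "integrable ?\<Omega> (\<lambda>x. 1 - (1 - c / 2) * indicator ?A x)"
        using sup by (intro Bochner_Integration.integrable_diff integrable_mult_right) (auto intro: integrable_real_indicator simp: PWS.emeasure_eq_measure)
      show "?F x \<le> 1 - (1 - c / 2) * indicator ?A x" if "x \<in> space ?\<Omega>" for x
        using that corr_le_1 by (auto simp: indicator_def)
    qed
    also have "\<dots> = 1 - (1 - c / 2) * measure ?\<Omega> ?A"
      using sup PWS.prob_space by (subst Bochner_Integration.integral_diff) (auto intro: integrable_real_indicator simp: PWS.emeasure_eq_measure)
    finally have 1: "(1 - c / 2) * measure ?\<Omega> ?A \<le> 1 - c" by simp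
    have "measure ?\<Omega> ?A \<le> 1" by simp
    then have "c / 2 * measure ?\<Omega> ?A \<le> c / 2" using c by simp
    with 1 show ?thesis by (simp add: left_diff_distrib)
  qed
  have inner: "(\<integral>\<^sup>+z. indicator {False} (decide (vectorize L n (observation lam n \<phi> w)) (vectorize L n (observation (\<beta> * r) n \<phi> z)) v) \<partial>?W)
      \<le> ?B \<phi> w v + ennreal ?e" for \<phi> w v
  proof (cases "corr \<phi> w v < c / 2")
    case True
    have "(\<integral>\<^sup>+z. indicator {False} (decide (vectorize L n (observation lam n \<phi> w)) (vectorize L n (observation (\<beta> * r) n \<phi> z)) v) \<partial>?W) \<le> (\<integral>\<^sup>+z. 1 \<partial>?W)"
      by (intro nn_integral_mono) (auto simp: indicator_def)
    also have "\<dots> = 1" by (simp add: W.emeasure_space_1)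
    also have "1 \<le> ?B \<phi> w v + ennreal ?e" using True by (simp add: add_increasing2)
    finally show ?thesis .
  next
    case False
    let ?y = "vectorize L n (observation lam n \<phi> w)"
    let ?X = "matrix_of n (result p N ?y v)"
    let ?\<Theta> = "signal lam n \<phi> l"
    have co: "c / 2 \<le> frob_inner n ?X ?\<Theta> / (frob_norm n ?X * frob_norm n ?\<Theta>)"
      using False by (simp add: corr_def Let_def)
    have X0: "frob_norm n ?X \<noteq> 0" using co c by (cases "frob_norm n ?X = 0") auto
    then have X: "frob_norm n ?X > 0" using frob_norm_nonneg[of n ?X] by linarith
    have Th: "frob_norm n ?\<Theta> = lam * sqrt (real n)" using lam n by (intro frob_norm_signal) auto
    have Thp: "frob_norm n ?\<Theta> > 0" using lam n by (simp add: Th)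
    have ge: "c / 2 * (frob_norm n ?X * frob_norm n ?\<Theta>) \<le> frob_inner n ?X ?\<Theta>"
      using co X Thp by (simp add: pos_le_divide_eq)
    have sig: "2 * a * frob_norm n ?X \<le> frob_inner n ?X (signal (\<beta> * r) n \<phi> l)"
    proof -
      have "2 * a * frob_norm n ?X \<le> 2 * (\<beta> * r * sqrt (real n) * c / 4) * frob_norm n ?X"
        using ac X by (intro mult_right_mono mult_left_mono) auto
      also have "\<dots> = \<beta> * r / lam * (c / 2 * (frob_norm n ?X * frob_norm n ?\<Theta>))"
        using lam by (simp add: Th field_simps)
      also have "\<dots> \<le> \<beta> * r / lam * frob_inner n ?X ?\<Theta>"
        using lam \<beta> ge by (intro mult_left_mono) auto
      also have "\<dots> = frob_inner n ?X (signal (\<beta> * r) n \<phi> l)"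
        using frob_inner_signal_scale[of lam n ?X "\<beta> * r" \<phi> l] lam by simp
      finally show ?thesis .
    qed
    \<comment> \<open>The lower tail for X is the upper tail for its negative.\<close>
    define X' where "X' = (\<lambda>i j. - ?X i j)"
    have neg: "frob_inner n X' Z = - frob_inner n ?X Z" "frob_norm n X' = frob_norm n ?X" for Z
      by (simp_all add: X'_def frob_inner_def frob_norm_def sum_negf)
    have "(\<integral>\<^sup>+z. indicator {False} (decide ?y (vectorize L n (observation (\<beta> * r) n \<phi> z)) v) \<partial>?W)
        \<le> (\<integral>\<^sup>+z. indicator {z. a * frob_norm n X' \<le> frob_inner n X' (gue z l)} z \<partial>?W)"
    proof (rule nn_integral_mono)
      fix z
      have "frob_inner n ?X (observation (\<beta> * r) n \<phi> z l) = frob_inner n ?X (signal (\<beta> * r) n \<phi> l) + frob_inner n ?X (gue z l)"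
        using frob_inner_add[of n ?X "signal (\<beta> * r) n \<phi> l" "gue z l"] by (simp add: observation_def[abs_def])
      then have "\<not> decide ?y (vectorize L n (observation (\<beta> * r) n \<phi> z)) v \<Longrightarrow> a * frob_norm n X' \<le> frob_inner n X' (gue z l)"
        unfolding decide_iff neg using sig by simp
      then show "indicator {False} (decide ?y (vectorize L n (observation (\<beta> * r) n \<phi> z)) v)
          \<le> (indicator {z. a * frob_norm n X' \<le> frob_inner n X' (gue z l)} z :: ennreal)"
        by (auto simp: indicator_def)
    qed
    also have "\<dots> \<le> ennreal ?e" by (rule gue_tail[OF l a]) (simp add: neg X)
    also have "\<dots> \<le> ?B \<phi> w v + ennreal ?e" by (simp add: add_increasing)
    finally show ?thesis .
  qed
  have "(\<integral>\<^sup>+y. \<integral>\<^sup>+u. indicator {False} (test y u) \<partial>seed \<partial>planted (sync_problem r L n))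
    = (\<integral>\<^sup>+\<phi>. \<integral>\<^sup>+w. \<integral>\<^sup>+v. \<integral>\<^sup>+z. indicator {False} (decide (vectorize L n (observation lam n \<phi> w)) (vectorize L n (observation (\<beta> * r) n \<phi> z)) v)
        \<partial>?W \<partial>seed \<partial>?W \<partial>?P)"
    using test_integral[where B="{False}" and s=r] \<alpha>(3) by simp
  also have "\<dots> \<le> (\<integral>\<^sup>+\<phi>. \<integral>\<^sup>+w. \<integral>\<^sup>+v. indicator {x \<in> space ?\<Omega>. ?F x < c / 2} (\<phi>, w, v) + ennreal ?e \<partial>seed \<partial>?W \<partial>?P)"
  proof (intro nn_integral_mono)
    fix \<phi> w v assume "\<phi> \<in> space ?P" "w \<in> space ?W" "v \<in> space seed"
    then show "(\<integral>\<^sup>+z. indicator {False} (decide (vectorize L n (observation lam n \<phi> w)) (vectorize L n (observation (\<beta> * r) n \<phi> z)) v) \<partial>?W)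
      \<le> indicator {x \<in> space ?\<Omega>. ?F x < c / 2} (\<phi>, w, v) + ennreal ?e"
      using inner[of \<phi> w v] by (simp add: indicator_def space_pair_measure)
  qed
  also have "\<dots> = (\<integral>\<^sup>+x. indicator {x \<in> space ?\<Omega>. ?F x < c / 2} x + ennreal ?e \<partial>?\<Omega>)"
  proof -
    have m: "(\<lambda>x. indicator {x \<in> space ?\<Omega>. ?F x < c / 2} x + ennreal ?e) \<in> borel_measurable ?\<Omega>"
      using sup by (intro borel_measurable_add borel_measurable_indicator) auto
    have "(\<integral>\<^sup>+x. indicator {x \<in> space ?\<Omega>. ?F x < c / 2} x + ennreal ?e \<partial>?\<Omega>)
        = (\<integral>\<^sup>+\<phi>. \<integral>\<^sup>+y. indicator {x \<in> space ?\<Omega>. ?F x < c / 2} (\<phi>, y) + ennreal ?e \<partial>(?W \<Otimes>\<^sub>M seed) \<partial>?P)"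
      by (rule sigma_finite_measure.nn_integral_fst[OF _ m, symmetric])
         (intro prob_space_imp_sigma_finite prob_space_pair prob_space_noise prob_space_seed)
    also have "\<dots> = (\<integral>\<^sup>+\<phi>. \<integral>\<^sup>+w. \<integral>\<^sup>+v. indicator {x \<in> space ?\<Omega>. ?F x < c / 2} (\<phi>, w, v) + ennreal ?e \<partial>seed \<partial>?W \<partial>?P)"
    proof (rule nn_integral_cong)
      fix \<phi> assume "\<phi> \<in> space ?P"
      then have "(\<lambda>y. indicator {x \<in> space ?\<Omega>. ?F x < c / 2} (\<phi>, y) + ennreal ?e) \<in> borel_measurable (?W \<Otimes>\<^sub>M seed)"
        by (intro measurable_compose[OF measurable_Pair1' m])
      then show "(\<integral>\<^sup>+y. indicator {x \<in> space ?\<Omega>. ?F x < c / 2} (\<phi>, y) + ennreal ?e \<partial>(?W \<Otimes>\<^sub>M seed))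
         = (\<integral>\<^sup>+w. \<integral>\<^sup>+v. indicator {x \<in> space ?\<Omega>. ?F x < c / 2} (\<phi>, w, v) + ennreal ?e \<partial>seed \<partial>?W)"
        by (rule S.nn_integral_fst[symmetric])
    qed
    finally show ?thesis by simp
  qed
  also have "\<dots> = emeasure ?\<Omega> {x \<in> space ?\<Omega>. ?F x < c / 2} + ennreal ?e"
    using sup PWS.emeasure_space_1 by (subst nn_integral_add) auto
  also have "\<dots> \<le> ennreal (1 - c / 2) + ennreal ?e"
    using lower by (intro add_right_mono) (simp add: PWS.emeasure_eq_measure ennreal_leI)
  also have "\<dots> = ennreal (1 - c / 2 + ?e)"
    using order_trans[OF measure_nonneg lower] by (intro ennreal_plus[symmetric]) auto
  finally show ?thesis .
qed

end

section \<open>From one sample to M samples\<close>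

lemma measurable_concat_samples:
  assumes D: "\<And>j. j < M \<Longrightarrow> sets (D j) = sets (RN N)"
  shows "concat_samples N M \<in> PiM {..<M} D \<rightarrow>\<^sub>M RN (M * N)"
  unfolding concat_samples_def
proof (rule measurable_restrict)
  fix k assume "k \<in> {..<M * N}"
  then have k: "k < M * N" by simp
  then have N: "N > 0" by (cases N) auto
  have kM: "k div N < M" "k mod N < N" using k N by (auto simp: less_mult_imp_div_less)
  have "(\<lambda>x. x (k mod N)) \<in> borel_measurable (D (k div N))"
    unfolding measurable_cong_sets[OF D[OF kM(1)] refl]
    using measurable_component_singleton[of "k mod N" "{..<N}" "\<lambda>_. borel"] kM by simp
  then show "(\<lambda>s. s (k div N) (k mod N)) \<in> borel_measurable (PiM {..<M} D)"
    using kM by (intro measurable_compose[OF measurable_component_singleton]) auto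
qed

lemma nn_integral_block:
  assumes D: "\<And>j. j < M \<Longrightarrow> prob_space (D j)" "\<And>j. j < M \<Longrightarrow> sets (D j) = sets (RN N)"
    and \<kappa>: "\<kappa> < M" and h: "h \<in> borel_measurable (RN N)"
  shows "(\<integral>\<^sup>+y. h (\<lambda>k\<in>{..<N}. y (\<kappa> * N + k)) \<partial>distr (PiM {..<M} D) (RN (M * N)) (concat_samples N M)) = (\<integral>\<^sup>+x. h x \<partial>D \<kappa>)"
proof -
  have lt: "\<kappa> * N + k < M * N" if "k < N" for k
  proof -
    have "\<kappa> * N + k < Suc \<kappa> * N" using that by simp
    also have "\<dots> \<le> M * N" using \<kappa> by (intro mult_le_mono1) simp
    finally show ?thesis .
  qed
  have mb: "(\<lambda>y. \<lambda>k\<in>{..<N}. y (\<kappa> * N + k)) \<in> RN (M * N) \<rightarrow>\<^sub>M RN N"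
    by (rule measurable_restrict) (use lt in \<open>auto intro: measurable_component_singleton\<close>)
  have blk: "(\<lambda>k\<in>{..<N}. concat_samples N M s (\<kappa> * N + k)) = s \<kappa>" if "s \<in> space (PiM {..<M} D)" for s
  proof -
    have "s \<kappa> \<in> space (RN N)"
      using that \<kappa> sets_eq_imp_space_eq[OF D(2)[OF \<kappa>]] by (auto simp: space_PiM)
    then have "s \<kappa> \<in> extensional {..<N}" by (auto simp: space_PiM PiE_iff)
    then show ?thesis
      using lt by (intro ext) (auto simp: concat_samples_def extensional_def)
  qed
  have h': "h \<in> borel_measurable (D \<kappa>)" unfolding measurable_cong_sets[OF D(2)[OF \<kappa>] refl] by (rule h)
  have "(\<integral>\<^sup>+y. h (\<lambda>k\<in>{..<N}. y (\<kappa> * N + k)) \<partial>distr (PiM {..<M} D) (RN (M * N)) (concat_samples N M))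
      = (\<integral>\<^sup>+s. h (s \<kappa>) \<partial>PiM {..<M} D)"
    by (subst nn_integral_distr[OF measurable_concat_samples[OF D(2)]])
       (auto intro!: measurable_compose[OF mb h] nn_integral_cong simp: blk)
  also have "\<dots> = (\<integral>\<^sup>+x. h x \<partial>distr (PiM {..<M} D) (D \<kappa>) (\<lambda>s. s \<kappa>))"
    using \<kappa> h' by (subst nn_integral_distr) auto
  also have "distr (PiM {..<M} D) (D \<kappa>) (\<lambda>s. s \<kappa>) = D \<kappa>"
    by (rule distr_PiM_component) (use D \<kappa> in auto)
  finally show ?thesis .
qed

text \<open>A non-measurable event has \<open>measure\<close> 0, so the estimate of the integral may
  presuppose measurability.\<close>

lemma prob_output_le:
  assumes "sets \<mu> = sets (RN K)" "B \<ge> 0"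
    and E: "{(y, \<omega>) \<in> space (\<mu> \<Otimes>\<^sub>M seed). result p K y \<omega> 0 = b} \<in> sets (\<mu> \<Otimes>\<^sub>M seed) \<Longrightarrow>
      (\<integral>\<^sup>+y. \<integral>\<^sup>+u. indicator {(y, \<omega>) \<in> space (\<mu> \<Otimes>\<^sub>M seed). result p K y \<omega> 0 = b} (y, u) \<partial>seed \<partial>\<mu>) \<le> ennreal B"
  shows "prob_output p K \<mu> b \<le> B"
proof -
  let ?E = "{(y, \<omega>) \<in> space (\<mu> \<Otimes>\<^sub>M seed). result p K y \<omega> 0 = b}"
  interpret S: prob_space seed by (rule prob_space_seed)
  have "emeasure (\<mu> \<Otimes>\<^sub>M seed) ?E \<le> ennreal B"
  proof (cases "?E \<in> sets (\<mu> \<Otimes>\<^sub>M seed)")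
    case True
    then show ?thesis using E[OF True] by (subst S.emeasure_pair_measure[OF True]) simp
  next
    case False
    then show ?thesis by (simp add: emeasure_notin_sets)
  qed
  with assms(2) show ?thesis unfolding prob_output_def measure_def by (rule enn2real_leI)
qed

lemma sets_null_law [simp]: "sets (null_law (sync_problem r L n)) = sets (RN (model_dim L n))"
  and sets_planted [simp]: "sets (planted (sync_problem r L n)) = sets (RN (model_dim L n))"
  by (simp_all add: sync_problem_def)

lemma prob_space_planted: "prob_space (planted (sync_problem r L n))"
proof -
  have "(\<lambda>x. vectorize L n (observation r n (fst x) (snd x))) \<in> phase_space n \<Otimes>\<^sub>M noise_space L n \<rightarrow>\<^sub>M RN (model_dim L n)"
    by (rule measurable_vectorize_observation) auto
  then show ?thesis
    unfolding sync_problem_def testing_problem.select_convs case_prod_unfold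
    by (intro prob_space.prob_space_distr prob_space_pair prob_space_phase prob_space_noise)
qed

lemma prob_space_null: "prob_space (null_law (sync_problem r L n))"
  unfolding null_law_eq_planted by (rule prob_space_planted)

context sync_tester
begin

lemma test_measurable: "Measurable.pred (RN N \<Otimes>\<^sub>M seed) (\<lambda>x. test (fst x) (snd x))"
proof -
  let ?S = "RN N \<Otimes>\<^sub>M seed"
  have c: "(\<lambda>x. fst x k) \<in> borel_measurable ?S" if "k < N" for k
    using measurable_compose[OF measurable_fst measurable_component_singleton[of k "{..<N}" "\<lambda>_. borel"]] that by simp
  have s: "(\<lambda>x. snd x j) \<in> borel_measurable ?S" for j
    by (rule measurable_compose[OF measurable_snd measurable_seed_component])
  have 1: "(\<lambda>x. \<lambda>k\<in>{..<N}. \<alpha> * fst x k + \<beta> * noise_coef n k * snd x (noise_pos n k)) \<in> ?S \<rightarrow>\<^sub>M RN N"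
    "(\<lambda>x. \<lambda>k\<in>{..<N}. \<beta> * fst x k - \<alpha> * noise_coef n k * snd x (noise_pos n k)) \<in> ?S \<rightarrow>\<^sub>M RN N"
    using c s by (auto intro!: measurable_restrict borel_measurable_add borel_measurable_diff borel_measurable_times)
  have 2: "(\<lambda>x j. snd x (N + j)) \<in> ?S \<rightarrow>\<^sub>M seed"
    unfolding seed_def
  proof (rule measurable_PiM_single')
    show "(\<lambda>x. snd x (N + i)) \<in> RN N \<Otimes>\<^sub>M PiM UNIV (\<lambda>_. std_gauss) \<rightarrow>\<^sub>M std_gauss" for i
      using s[of "N + i"] unfolding seed_def by (simp cong: measurable_cong_sets)
  qed auto
  show ?thesis
    unfolding test_eq_decide
    using measurable_compose[OF measurable_Pair[OF 1(1) measurable_Pair[OF 1(2) 2]] decide_measurable] by simp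
qed

lemma passes_eq: "passes y \<omega> \<kappa> = test (\<lambda>k\<in>{..<N}. y (\<kappa> * N + k)) (\<lambda>r. \<omega> (\<kappa> * R + r))"
  unfolding passes_def test_def[symmetric] by (rule test_cong) simp

lemma section_measurable:
  assumes "y \<in> space (RN N)"
  shows "(\<lambda>u. indicator B (test y u) :: ennreal) \<in> borel_measurable seed"
proof -
  have "Measurable.pred seed (\<lambda>u. test y u)"
    using measurable_compose[OF measurable_Pair1'[OF assms] test_measurable] by simp
  then show ?thesis by (rule measurable_compose) simp
qed

lemma section_shift:
  assumes "y \<in> space (RN N)"
  shows "(\<lambda>u. indicator B (test y (\<lambda>r. u (m + r))) :: ennreal) \<in> borel_measurable seed"
proof -
  have "(\<lambda>u r. u (m + r)) \<in> seed \<rightarrow>\<^sub>M PiM UNIV (\<lambda>_. std_gauss)"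
  proof (rule measurable_PiM_single')
    show "(\<lambda>u. u (m + i)) \<in> seed \<rightarrow>\<^sub>M std_gauss" for i
      using measurable_seed_component[of "m + i"] by (simp cong: measurable_cong_sets)
  qed auto
  then show ?thesis
    using section_measurable[OF assms] unfolding seed_def by (rule measurable_compose)
qed

lemma test_integral_measurable:
  "(\<lambda>y. \<integral>\<^sup>+u. indicator B (test y u) \<partial>seed) \<in> borel_measurable (RN N)"
proof -
  interpret S: prob_space seed by (rule prob_space_seed)
  have "(\<lambda>x. indicator B (test (fst x) (snd x)) :: ennreal) \<in> borel_measurable (RN N \<Otimes>\<^sub>M seed)"
    by (rule measurable_compose[OF test_measurable]) simp
  then show ?thesis by (intro S.borel_measurable_nn_integral) (simp add: case_prod_unfold)
qed

lemma block_in_space: "(\<lambda>k\<in>{..<N}. y (\<kappa> * N + k)) \<in> space (RN N)" for y :: "nat \<Rightarrow> real"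
  by (simp add: space_PiM)

text \<open>Shifting the seed to the Gaussians owned by sample \<kappa> preserves its law, and the
  other samples integrate out.\<close>

lemma block_integral:
  assumes "\<And>j. j < M \<Longrightarrow> prob_space (D j)" "\<And>j. j < M \<Longrightarrow> sets (D j) = sets (RN N)" "\<kappa> < M"
  shows "(\<integral>\<^sup>+y. \<integral>\<^sup>+u. indicator B (passes y u \<kappa>) \<partial>seed \<partial>distr (PiM {..<M} D) (RN (M * N)) (concat_samples N M))
    = (\<integral>\<^sup>+y. \<integral>\<^sup>+u. indicator B (test y u) \<partial>seed \<partial>D \<kappa>)"
proof -
  have "(\<integral>\<^sup>+u. indicator B (passes y u \<kappa>) \<partial>seed) = (\<integral>\<^sup>+u. indicator B (test (\<lambda>k\<in>{..<N}. y (\<kappa> * N + k)) u) \<partial>seed)" for y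
    unfolding passes_eq by (rule nn_integral_seed_shift[OF section_measurable[OF block_in_space]])
  then show ?thesis
    using nn_integral_block[OF assms(1,2,3) test_integral_measurable] by simp
qed

lemma block_integral_measurable:
  "(\<lambda>y. \<integral>\<^sup>+u. indicator B (passes y u \<kappa>) \<partial>seed) \<in> borel_measurable (RN (M * N))" if "\<kappa> < M"
proof -
  have e: "(\<integral>\<^sup>+u. indicator B (passes y u \<kappa>) \<partial>seed) = (\<integral>\<^sup>+u. indicator B (test (\<lambda>k\<in>{..<N}. y (\<kappa> * N + k)) u) \<partial>seed)" for y
    unfolding passes_eq by (rule nn_integral_seed_shift[OF section_measurable[OF block_in_space]])
  have "(\<lambda>y. \<lambda>k\<in>{..<N}. y (\<kappa> * N + k)) \<in> RN (M * N) \<rightarrow>\<^sub>M RN N"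
    by (rule measurable_restrict) (use block_less[OF that] in \<open>auto intro: measurable_component_singleton\<close>)
  from measurable_compose[OF this test_integral_measurable] show ?thesis unfolding e .
qed

text \<open>Under the null law a union bound over the M samples. Under the planted law the program
  answers 0 only if, in particular, the sample with the signal fails, whatever the others
  do.\<close>

lemma error_sum_prog:
  assumes c: "c > 0" "c \<le> expected_correlation lam L n l p" and ac: "a \<le> \<beta> * r * sqrt (real n) * c / 4"
  shows "error_sum prog (hidden_sample (sync_problem r L n) M) \<le> (real M + 1) * exp (- a\<^sup>2 / 2) + (1 - c / 2)"
proof -
  let ?e = "exp (- a\<^sup>2 / 2)" and ?Q = "null_law (sync_problem r L n)" and ?P = "planted (sync_problem r L n)"
  interpret S: prob_space seed by (rule prob_space_seed)
  have dim: "dim (sync_problem r L n) = N" by (simp add: sync_problem_def)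
  have null: "null_law (hidden_sample (sync_problem r L n) M) = distr (PiM {..<M} (\<lambda>_. ?Q)) (RN (M * N)) (concat_samples N M)"
    by (simp add: hidden_sample_def dim)
  let ?K = "\<lambda>\<kappa>. distr (PiM {..<M} (\<lambda>j. if j = \<kappa> then ?P else ?Q)) (RN (M * N)) (concat_samples N M)"
  have pl: "planted (hidden_sample (sync_problem r L n) M) = measure_pmf (pmf_of_set {..<M}) \<bind> ?K"
    unfolding hidden_sample_def testing_problem.select_convs dim by (rule refl)
  have D: "prob_space (if j = \<kappa> then ?P else ?Q)" "sets (if j = \<kappa> then ?P else ?Q) = sets (RN N)" for j \<kappa>
    by (simp_all add: prob_space_planted prob_space_null)
  have PK: "prob_space (?K \<kappa>)" for \<kappa>
    by (intro prob_space.prob_space_distr prob_space_PiM measurable_concat_samples D)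
  have c2: "0 \<le> 1 - c / 2 + ?e"
  proof -
    have "expected_correlation lam L n l p \<le> 1"
    proof -
      interpret O: prob_space "phase_space n \<Otimes>\<^sub>M (noise_space L n \<Otimes>\<^sub>M seed)"
        by (intro prob_space_pair prob_space_phase prob_space_noise prob_space_seed)
      let ?F = "\<lambda>x. corr (fst x) (fst (snd x)) (snd (snd x))"
      have EF: "expected_correlation lam L n l p = (\<integral>x. ?F x \<partial>(phase_space n \<Otimes>\<^sub>M (noise_space L n \<Otimes>\<^sub>M seed)))"
        unfolding expected_correlation_def corr_def case_prod_unfold by simp
      have "(\<integral>x. ?F x \<partial>(phase_space n \<Otimes>\<^sub>M (noise_space L n \<Otimes>\<^sub>M seed))) \<le> (\<integral>x. 1 \<partial>(phase_space n \<Otimes>\<^sub>M (noise_space L n \<Otimes>\<^sub>M seed)))"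
        by (rule integral_mono') (auto intro: corr_le_1)
      then show ?thesis using EF by (simp add: O.prob_space)
    qed
    then have "c / 2 \<le> 1" using c by linarith
    then show ?thesis using exp_ge_zero[of "- a\<^sup>2 / 2"] by linarith
  qed
  have 1: "prob_output prog (M * N) (null_law (hidden_sample (sync_problem r L n) M)) 1 \<le> real M * ?e"
    unfolding null
  proof (rule prob_output_le)
    let ?N = "distr (PiM {..<M} (\<lambda>_. ?Q)) (RN (M * N)) (concat_samples N M)"
    let ?E = "{(y, \<omega>) \<in> space (?N \<Otimes>\<^sub>M seed). result prog (M * N) y \<omega> 0 = 1}"
    have "(\<integral>\<^sup>+y. \<integral>\<^sup>+u. indicator ?E (y, u) \<partial>seed \<partial>?N) \<le> (\<integral>\<^sup>+y. \<integral>\<^sup>+u. (\<Sum>\<kappa><M. indicator {True} (passes y u \<kappa>)) \<partial>seed \<partial>?N)"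
    proof (intro nn_integral_mono)
      fix y u
      show "indicator ?E (y, u) \<le> (\<Sum>\<kappa><M. indicator {True} (passes y u \<kappa>) :: ennreal)"
      proof (cases "\<exists>\<kappa><M. passes y u \<kappa>")
        case True
        then obtain \<kappa> where \<kappa>: "\<kappa> < M" "passes y u \<kappa>" by blast
        have "indicator ?E (y, u) \<le> (indicator {True} (passes y u \<kappa>) :: ennreal)" using \<kappa> by (simp add: indicator_def)
        also have "\<dots> \<le> (\<Sum>\<kappa><M. indicator {True} (passes y u \<kappa>))" using \<kappa> by (intro member_le_sum) auto
        finally show ?thesis .
      qed (auto simp: indicator_def result_prog)
    qed
    also have "\<dots> = (\<integral>\<^sup>+y. (\<Sum>\<kappa><M. \<integral>\<^sup>+u. indicator {True} (passes y u \<kappa>) \<partial>seed) \<partial>?N)"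
      unfolding passes_eq by (intro nn_integral_cong nn_integral_sum section_shift block_in_space)
    also have "\<dots> = (\<Sum>\<kappa><M. \<integral>\<^sup>+y. \<integral>\<^sup>+u. indicator {True} (passes y u \<kappa>) \<partial>seed \<partial>?N)"
      by (intro nn_integral_sum) (simp add: block_integral_measurable)
    also have "\<dots> = (\<Sum>\<kappa><M. \<integral>\<^sup>+y. \<integral>\<^sup>+u. indicator {True} (test y u) \<partial>seed \<partial>?Q)"
      by (intro sum.cong refl block_integral) (auto simp: prob_space_null)
    also have "\<dots> \<le> (\<Sum>\<kappa><M. ennreal ?e)"
      by (intro sum_mono null_pass)
    also have "\<dots> = ennreal (real M * ?e)" by (simp add: ennreal_mult ennreal_of_nat_eq_real_of_nat)
    finally show "(\<integral>\<^sup>+y. \<integral>\<^sup>+u. indicator ?E (y, u) \<partial>seed \<partial>?N) \<le> ennreal (real M * ?e)" .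
  qed simp_all
  have 0: "prob_output prog (M * N) (planted (hidden_sample (sync_problem r L n) M)) 0 \<le> 1 - c / 2 + ?e"
    unfolding pl
  proof (rule prob_output_le[OF _ c2])
    let ?N = "measure_pmf (pmf_of_set {..<M}) \<bind> ?K"
    show sN: "sets ?N = sets (RN (M * N))" by (rule sets_bind) auto
    let ?E = "{(y, \<omega>) \<in> space (?N \<Otimes>\<^sub>M seed). result prog (M * N) y \<omega> 0 = 0}"
    assume E: "?E \<in> sets (?N \<Otimes>\<^sub>M seed)"
    have g: "(\<lambda>y. \<integral>\<^sup>+u. indicator ?E (y, u) \<partial>seed) \<in> borel_measurable (RN (M * N))"
    proof -
      have "(\<lambda>y. \<integral>\<^sup>+u. indicator ?E (y, u) \<partial>seed) \<in> borel_measurable ?N"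
        using E by (intro S.borel_measurable_nn_integral_fst) simp
      then show ?thesis unfolding measurable_cong_sets[OF sN refl] .
    qed
    have le: "(\<integral>\<^sup>+y. \<integral>\<^sup>+u. indicator ?E (y, u) \<partial>seed \<partial>?K \<kappa>) \<le> ennreal (1 - c / 2 + ?e)" if "\<kappa> < M" for \<kappa>
    proof -
      have "(\<integral>\<^sup>+y. \<integral>\<^sup>+u. indicator ?E (y, u) \<partial>seed \<partial>?K \<kappa>) \<le> (\<integral>\<^sup>+y. \<integral>\<^sup>+u. indicator {False} (passes y u \<kappa>) \<partial>seed \<partial>?K \<kappa>)"
        using that by (intro nn_integral_mono) (auto simp: indicator_def result_prog)
      also have "\<dots> = (\<integral>\<^sup>+y. \<integral>\<^sup>+u. indicator {False} (test y u) \<partial>seed \<partial>(if \<kappa> = \<kappa> then ?P else ?Q))"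
        by (rule block_integral[where D="\<lambda>j. if j = \<kappa> then ?P else ?Q"]) (simp_all add: prob_space_planted prob_space_null that)
      also have "\<dots> = (\<integral>\<^sup>+y. \<integral>\<^sup>+u. indicator {False} (test y u) \<partial>seed \<partial>?P)" by simp
      also have "\<dots> \<le> ennreal (1 - c / 2 + ?e)" by (rule planted_fail[OF c ac])
      finally show ?thesis .
    qed
    have "(\<integral>\<^sup>+y. \<integral>\<^sup>+u. indicator ?E (y, u) \<partial>seed \<partial>?N) = (\<Sum>\<kappa><M. \<integral>\<^sup>+y. \<integral>\<^sup>+u. indicator ?E (y, u) \<partial>seed \<partial>?K \<kappa>) / of_nat M"
      by (rule nn_integral_bind_pmf_of_set[OF Mpos PK _ g]) simp
    also have "\<dots> \<le> (\<Sum>\<kappa><M. ennreal (1 - c / 2 + ?e)) / of_nat M"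
      by (intro divide_right_mono_ennreal sum_mono le) simp
    also have "\<dots> = ennreal (1 - c / 2 + ?e)"
    proof -
      have s: "(\<Sum>\<kappa><M. ennreal (1 - c / 2 + ?e)) = of_nat M * ennreal (1 - c / 2 + ?e)" by simp
      show ?thesis unfolding s using Mpos
        by (subst mult.commute, intro mult_divide_eq_ennreal) auto
    qed
    finally show "(\<integral>\<^sup>+y. \<integral>\<^sup>+u. indicator ?E (y, u) \<partial>seed \<partial>?N) \<le> ennreal (1 - c / 2 + ?e)" .
  qed
  have "dim (hidden_sample (sync_problem r L n) M) = M * N" by (simp add: hidden_sample_def dim)
  then show ?thesis using 0 1 by (simp add: error_sum_def distrib_right)
qed

lemma binary_valued_prog: "binary_valued prog (M * N)"
  by (simp add: binary_valued_def result_prog)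

end

section \<open>Asymptotics\<close>

lemma runs_in_time_mono: "runs_in_time p N T \<Longrightarrow> T \<le> T' \<Longrightarrow> runs_in_time p N T'"
  unfolding runs_in_time_def by (meson order_trans)

text \<open>With the signal zero the quotient is 0 / 0 = 0. Weak recovery therefore forces
  \<open>lam n > 0\<close> for large n.\<close>

lemma expected_correlation_zero: "expected_correlation 0 L n l p = 0"
  by (simp add: expected_correlation_def signal_def frob_norm_def case_prod_unfold)

lemma subpolynomial_le_powr:
  assumes "subpolynomial f" "\<eta> > 0"
  shows "\<forall>\<^sub>F n in sequentially. 0 < f n \<and> f n \<le> real n powr \<eta>"
proof -
  from assms(1) obtain \<epsilon> where \<epsilon>: "\<epsilon> \<longlonglongrightarrow> 0" and f: "\<forall>\<^sub>F n in sequentially. f n = real n powr \<epsilon> n"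
    unfolding subpolynomial_def by blast
  have "\<forall>\<^sub>F n in sequentially. \<epsilon> n < \<eta>" using order_tendstoD(2)[OF \<epsilon> assms(2)] .
  with f eventually_ge_at_top[of 1] show ?thesis
    by eventually_elim (auto intro!: powr_mono)
qed

text \<open>The dimension cancels from N^(D / (C ln N)). Taking more samples thus leaves the
  permitted time as it is.\<close>

lemma low_degree_time_eq:
  assumes "dim (X n) > 1" "C > 0"
  shows "low_degree_time C D X n = exp (real (D n) / C)"
proof -
  have "ln (real (dim (X n))) > 0" using assms(1) by simp
  then show ?thesis using assms by (simp add: low_degree_time_def powr_def)
qed

lemma Adv_square_le:
  "(Adv D (sync_problem lam L n))\<^sup>2 \<le> ereal (adv_bound lam L n D)"
proof -
  have 1: "1 \<le> Adv D (sync_problem lam L n)" and 2: "Adv D (sync_problem lam L n) \<le> ereal (sqrt (adv_bound lam L n D))"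
    by (rule Adv_sync_problem)+
  then obtain v where v: "Adv D (sync_problem lam L n) = ereal v"
    by (cases "Adv D (sync_problem lam L n)") auto
  have "0 \<le> v" "v \<le> sqrt (adv_bound lam L n D)" using 1 2 unfolding v by (simp_all add: one_ereal_def)
  then have "v\<^sup>2 \<le> (sqrt (adv_bound lam L n D))\<^sup>2" by (intro power_mono)
  then show ?thesis unfolding v by (simp add: adv_bound_nonneg)
qed

lemma detection_from_recovery:
  assumes n: "n > 0" and l: "l \<in> {1..L}" and M: "M > 0" and lam: "0 < lam" "lam < r"
    and p: "runs_in_time p (model_dim L n) T" and T: "T \<ge> 0"
    and c: "c > 0" "c \<le> expected_correlation lam L n l p"
    and a: "a > 0" "a \<le> sqrt (r\<^sup>2 - lam\<^sup>2) * sqrt (real n) * c / 4"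
  shows "\<exists>q. binary_valued q (M * model_dim L n) \<and>
    runs_in_time q (M * model_dim L n) (60 * real M * (real (model_dim L n) + 1) * (T + 1)) \<and>
    error_sum q (hidden_sample (sync_problem r L n) M) \<le> (real M + 1) * exp (- a\<^sup>2 / 2) + (1 - c / 2)"
proof -
  \<comment> \<open>Time bounds are real, step counts are natural numbers.\<close>
  define T' where "T' = nat \<lfloor>T\<rfloor>"
  have T': "real T' \<le> T" using T by (simp add: T'_def)
  have le: "k \<le> T'" if "real k \<le> T" for k using that by (simp add: T'_def le_nat_iff le_floor_iff)
  interpret sync_tester n L l M T' p lam r a
  proof unfold_locales
    show "\<exists>t\<le>T'. halted p (run p (model_dim L n) y \<omega> t)" for y \<omega>
      using p le unfolding runs_in_time_def by blast
  qed (use n l M lam a in auto)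
  have "sqrt (r\<^sup>2 - lam\<^sup>2) = \<beta> * r"
  proof -
    have "r\<^sup>2 - lam\<^sup>2 = (1 - \<alpha>\<^sup>2) * r\<^sup>2"
      using lam by (simp add: \<alpha>_def power_divide left_diff_distrib)
    then show ?thesis using lam by (simp add: \<beta>_def real_sqrt_mult)
  qed
  then have e: "error_sum prog (hidden_sample (sync_problem r L n) M) \<le> (real M + 1) * exp (- a\<^sup>2 / 2) + (1 - c / 2)"
    using assms(8-11) by (intro error_sum_prog) auto
  have "length p \<le> T'" using p le unfolding runs_in_time_def by blast
  from prog_time[OF this]
  have "runs_in_time prog (M * N) (60 * real M * (real N + 1) * (T + 1))"
    by (rule runs_in_time_mono) (intro mult_left_mono, use T' in auto)
  with e binary_valued_prog show ?thesis by blast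
qed

text \<open>Majorants, here and in \<open>adv_envelope\<close>, of the dimension and of
  \<open>adv_bound\<close>, with n^(1/64) put for L and n^(1/8) for D. The final estimates then
  compare explicit functions of n.\<close>

definition dim_envelope :: "nat \<Rightarrow> real" where
  "dim_envelope n = 2 * real n powr (1 / 64) * real n ^ 2"

definition adv_envelope :: "nat \<Rightarrow> real" where
  "adv_envelope n = exp (1 + 2 * real n powr (1 / 64) *
     ln (2 * exp 1 * (real n powr (1 / 8) + 1) * (2 * real n powr (1 / 8) + 1)))"

text \<open>The logarithm of the left side is of order n^(1/64) ln n, against n^(1/8) on the right.
  The - 1 accounts for the floor in the definition of D.\<close>

lemma envelope_time:
  assumes "K > 0"
  shows "\<forall>\<^sub>F n in sequentially. 60 * (dim_envelope n * (2 + adv_envelope n)) * (dim_envelope n + 1) *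
    (exp (real n powr (1 / 64)) + 1) \<le> exp (K * (real n powr (1 / 8) - 1))"
  unfolding dim_envelope_def adv_envelope_def using assms by real_asymp

lemma envelope_error:
  assumes "K > 0" "c > 0"
  shows "\<forall>\<^sub>F n in sequentially. (dim_envelope n * (2 + adv_envelope n) + 1) * exp (- (K * real n)) \<le> c"
proof -
  have "(\<lambda>n. (dim_envelope n * (2 + adv_envelope n) + 1) * exp (- (K * real n))) \<longlonglongrightarrow> 0"
    unfolding dim_envelope_def adv_envelope_def using assms by real_asymp
  from order_tendstoD(2)[OF this assms(2)] show ?thesis by eventually_elim simp
qed

lemma adv_bound_le_envelope:
  assumes n: "n \<ge> 1" "8 \<le> real n powr (1 / 8)" and L: "real L \<le> real n powr (1 / 64)"
    and D: "real D \<le> real n powr (1 / 8)" and lam: "\<bar>lam\<bar> \<le> 1"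
  shows "adv_bound lam L n D \<le> adv_envelope n"
proof -
  let ?x = "real n powr (1 / 8)"
  \<comment> \<open>Against sqrt n = n^(4/8) the cube n^(3/8) leaves one power n^(1/8) to spare,
    which absorbs the constant 8.\<close>
  have "(2 * real D) ^ 3 \<le> (2 * ?x) ^ 3" using D by (intro power_mono) auto
  also have "\<dots> = 8 * ?x ^ 3" by (simp add: power_mult_distrib)
  also have "\<dots> \<le> ?x * ?x ^ 3" using n by (intro mult_right_mono) auto
  also have "\<dots> = sqrt (real n)"
    using n by (simp add: powr_half_sqrt[symmetric] powr_realpow[symmetric] powr_powr powr_add[symmetric] power_Suc[symmetric] del: power_Suc)
  finally have "adv_bound lam L n D \<le> exp 1 * (2 * exp 1 * (real D + 1) * (2 * real D + 1)) ^ (2 * L)"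
    using n lam by (intro adv_bound_le) auto
  also have "\<dots> \<le> exp 1 * (2 * exp 1 * (?x + 1) * (2 * ?x + 1)) ^ (2 * L)"
    using D by (intro mult_left_mono power_mono mult_mono) auto
  also have "\<dots> = exp (1 + real (2 * L) * ln (2 * exp 1 * (?x + 1) * (2 * ?x + 1)))"
  proof -
    have "0 < 2 * exp 1 * (?x + 1) * (2 * ?x + 1)" using n by (intro mult_pos_pos add_pos_pos) auto
    then show ?thesis by (simp only: exp_add exp_of_nat_mult exp_ln)
  qed
  also have "\<dots> \<le> adv_envelope n"
  proof -
    \<comment> \<open>A base of at least 1 has a nonnegative logarithm, so the exponent may be
      increased from 2 L to its majorant.\<close>
    have "1 * 1 * 1 \<le> 2 * exp 1 * (?x + 1) * (2 * ?x + 1)"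
    proof (intro mult_mono)
      show "1 \<le> 2 * exp (1::real)" using exp_ge_add_one_self[of "1::real"] by linarith
    qed auto
    then have "0 \<le> ln (2 * exp 1 * (?x + 1) * (2 * ?x + 1))" by (intro ln_ge_zero) simp
    then show ?thesis unfolding adv_envelope_def exp_le_cancel_iff using L
      by (intro add_left_mono mult_right_mono) auto
  qed
  finally show ?thesis .
qed

theorem theorem2p13:
  fixes lam :: "nat \<Rightarrow> real" and L l :: "nat \<Rightarrow> nat" and \<delta> :: real
  assumes "subpolynomial (\<lambda>n. real (L n))"
    and "\<delta> > 0" and "\<And>n. 0 \<le> lam n \<and> lam n < 1 - \<delta>"
    and "sync_heuristic"
    and "\<forall>\<^sub>F n in sequentially. l n \<in> {1..L n}"
  shows "\<not> (\<exists>A. subexponential_time (\<lambda>n. model_dim (L n) n) A \<and> weak_recovery lam L l A)"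
proof
  assume "\<exists>A. subexponential_time (\<lambda>n. model_dim (L n) n) A \<and> weak_recovery lam L l A"
  then obtain A f c where f: "subpolynomial f"
    and A: "\<forall>\<^sub>F n in sequentially. runs_in_time (A n) (model_dim (L n) n) (exp (f n))"
    and c: "c > 0" "\<forall>\<^sub>F n in sequentially. c \<le> expected_correlation (lam n) (L n) n (l n) (A n)"
    unfolding subexponential_time_def weak_recovery_def by blast
  have \<delta>1: "\<delta> < 1" using assms(3)[of 0] by linarith
  \<comment> \<open>Halfway between 1 - \<delta> and 1: still below the threshold, with a fixed
    surplus over every \<open>lam n\<close>.\<close>
  define r where "r = 1 - \<delta> / 2"
  have r: "0 < r" "r < 1" "1 - \<delta> < r" using \<delta>1 assms(2) by (auto simp: r_def)
  \<comment> \<open>A lower bound, uniform in n, on the strength sqrt(r^2 - lam^2) of the second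
    half.\<close>
  define k where "k = sqrt (r\<^sup>2 - (1 - \<delta>)\<^sup>2)"
  have k: "k > 0" using power_strict_mono[of "1 - \<delta>" r 2] r \<delta>1 by (simp add: k_def)
  have k_le: "k \<le> sqrt (r\<^sup>2 - (lam n)\<^sup>2)" for n
  proof -
    have "(lam n)\<^sup>2 \<le> (1 - \<delta>)\<^sup>2" using assms(3)[of n] by (intro power_mono) auto
    then show ?thesis by (simp add: k_def)
  qed
  define D where "D n = nat \<lfloor>real n powr (1 / 8)\<rfloor>" for n :: nat
  have D: "real (D n) \<le> real n powr (1 / 8)" "real n powr (1 / 8) - 1 \<le> real (D n)" for n
    unfolding D_def by (simp, linarith)
  \<comment> \<open>The summand 2 keeps \<Delta> above 1, as the class requires, and M above 1 for
    large n.\<close>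
  define \<Delta> where "\<Delta> n = 2 + adv_bound r (L n) n (D n)" for n
  have \<Delta>: "2 \<le> \<Delta> n" for n by (simp add: \<Delta>_def adv_bound_nonneg)
  let ?N = "\<lambda>n. model_dim (L n) n"
  \<comment> \<open>The largest sample number that the class admits. It makes \<Delta> / M of order
    1 / N, hence tend to 0.\<close>
  define M where "M n = nat \<lfloor>real (?N n) * \<Delta> n\<rfloor>" for n
  define X where "X n = hidden_sample (sync_problem r (L n) n) (M n)" for n
  have dimX: "dim (X n) = M n * ?N n" for n by (simp add: X_def hidden_sample_def sync_problem_def)
  have M_le: "real (M n) \<le> real (?N n) * \<Delta> n" for n
    using \<Delta>[of n] by (simp add: M_def)
  have Lp: "\<forall>\<^sub>F n in sequentially. 0 < real (L n) \<and> real (L n) \<le> real n powr (1 / 64)"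
    by (rule subpolynomial_le_powr[OF assms(1)]) simp
  have fp: "\<forall>\<^sub>F n in sequentially. 0 < f n \<and> f n \<le> real n powr (1 / 64)"
    by (rule subpolynomial_le_powr[OF f]) simp
  have big: "\<forall>\<^sub>F n in sequentially. 8 \<le> real n powr (1 / 8)" by real_asymp
  have M_large: "\<forall>\<^sub>F n in sequentially. M n > 1 \<and> \<Delta> n / real (M n) \<le> 1 / real n"
    using Lp eventually_ge_at_top[of 1]
  proof eventually_elim
    case (elim n)
    have N: "2 * real n \<le> real (?N n)"
    proof -
      have "2 * 1 * n * 1 \<le> ?N n" unfolding model_dim_def using elim by (intro mult_le_mono) auto
      then show ?thesis by simp
    qed
    have "2 * real n * \<Delta> n \<le> real (?N n) * \<Delta> n" using N \<Delta>[of n] by (intro mult_right_mono) auto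
    moreover have "2 * 1 * 2 \<le> 2 * real n * \<Delta> n" using \<Delta>[of n] elim by (intro mult_mono) auto
    moreover have "real (?N n) * \<Delta> n - 1 < real (M n)" unfolding M_def by linarith
    ultimately have 1: "1 < real (M n)" and 2: "real n * \<Delta> n \<le> real (M n)" by linarith+
    have "\<Delta> n / real (M n) \<le> 1 / real n" using 1 2 elim by (simp add: field_simps)
    with 1 show ?case by simp
  qed
  have \<Delta>M: "(\<lambda>n. \<Delta> n / real (M n)) \<longlonglongrightarrow> 0"
  proof (rule tendsto_sandwich[OF _ _ tendsto_const lim_1_over_n])
    show "\<forall>\<^sub>F n in sequentially. 0 \<le> \<Delta> n / real (M n)" using \<Delta> by (intro always_eventually allI divide_nonneg_nonneg) (auto intro: order_trans[of 0 2])
    show "\<forall>\<^sub>F n in sequentially. \<Delta> n / real (M n) \<le> 1 / real n" using M_large by eventually_elim simp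
  qed
  have X: "X \<in> hidden_sample_problems (\<lambda>_. r) L \<Delta>"
  proof -
    have "\<forall>\<^sub>F n in sequentially. 0 < M n \<and> real (M n) \<le> real (?N n) * \<Delta> n"
      using M_large by eventually_elim (use M_le in auto)
    with \<Delta>M show ?thesis unfolding hidden_sample_problems_def X_def by blast
  qed
  \<comment> \<open>The margin is \<delta> / 4 because r = 1 - \<delta> / 2 has to stay strictly
    below it.\<close>
  have adm: "admissible (\<lambda>_. r) L"
    unfolding admissible_def using assms(1,2) r by (intro conjI exI[of _ "\<delta> / 4"]) (auto simp: r_def)
  have "1 < \<Delta> n \<and> (Adv (D n) (sync_problem r (L n) n))\<^sup>2 \<le> ereal (\<Delta> n)" for n
    using \<Delta>[of n] Adv_square_le[of "D n" r "L n" n] by (auto simp: \<Delta>_def elim!: order_trans)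
  with assms(4) adm have "low_degree_heuristic (hidden_sample_problems (\<lambda>_. r) L \<Delta>)"
    unfolding sync_heuristic_def by blast
  then obtain C where C: "C > 0"
    and hard: "(\<lambda>n. Adv (D n) (X n)) \<longlonglongrightarrow> 1 \<Longrightarrow>
      \<not> (\<exists>A. test_in_time A X (low_degree_time C D X) \<and> weak_detection A X)"
    using X unfolding low_degree_heuristic_def by meson
  have adv: "(\<lambda>n. Adv (D n) (X n)) \<longlonglongrightarrow> 1"
  proof (rule tendsto_sandwich[OF _ _ tendsto_const])
    show "\<forall>\<^sub>F n in sequentially. 1 \<le> Adv (D n) (X n)"
      using M_large unfolding X_def by eventually_elim (auto intro: Adv_hidden_sample)
    show "\<forall>\<^sub>F n in sequentially. Adv (D n) (X n) \<le> ereal (sqrt (1 + \<Delta> n / real (M n)))"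
      using M_large
    proof eventually_elim
      case (elim n)
      have "Adv (D n) (X n) \<le> ereal (sqrt (1 + adv_bound r (L n) n (D n) / real (M n)))"
        unfolding X_def using elim by (intro Adv_hidden_sample) auto
      also have "\<dots> \<le> ereal (sqrt (1 + \<Delta> n / real (M n)))"
        unfolding ereal_less_eq by (intro real_sqrt_le_mono add_left_mono divide_right_mono) (auto simp: \<Delta>_def)
      finally show ?case .
    qed
    have "(\<lambda>n. sqrt (1 + \<Delta> n / real (M n))) \<longlonglongrightarrow> sqrt (1 + 0)"
      by (intro tendsto_intros \<Delta>M)
    then show "(\<lambda>n. ereal (sqrt (1 + \<Delta> n / real (M n)))) \<longlonglongrightarrow> 1"
      by (simp add: one_ereal_def)
  qed
  \<comment> \<open>As large as \<open>planted_fail\<close> permits uniformly in n. Being of order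
    sqrt n, it makes exp(- a^2 / 2) exponentially small in n, while M is exp(o(n)).\<close>
  define a where "a n = k * sqrt (real n) * c / 4" for n :: nat
  have a2: "(a n)\<^sup>2 / 2 = (k * c)\<^sup>2 / 32 * real n" for n
    by (simp add: a_def power_mult_distrib power_divide)
  have env: "\<forall>\<^sub>F n in sequentially. real (?N n) \<le> dim_envelope n \<and> \<Delta> n \<le> 2 + adv_envelope n"
    using Lp big eventually_ge_at_top[of 1]
  proof eventually_elim
    case (elim n)
    have "real (?N n) = 2 * real (L n) * real n ^ 2" by (simp add: model_dim_def power2_eq_square)
    also have "\<dots> \<le> dim_envelope n" unfolding dim_envelope_def using elim by (intro mult_right_mono) auto
    finally show ?case
      using adv_bound_le_envelope[of n "L n" "D n" r] elim D(1)[of n] r by (simp add: \<Delta>_def)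
  qed
  have C': "1 / C > 0" and K: "(k * c)\<^sup>2 / 32 > 0" and c4: "c / 4 > 0" using C k c(1) by auto
  have "\<forall>\<^sub>F n in sequentially. \<exists>q. (binary_valued q (dim (X n)) \<and>
      runs_in_time q (dim (X n)) (low_degree_time C D X n)) \<and> error_sum q (X n) \<le> 1 - c / 4"
    using Lp fp M_large env A c(2) assms(5) eventually_ge_at_top[of 1]
      envelope_time[OF C'] envelope_error[OF K c4]
  proof eventually_elim
    case (elim n)
    have lam: "0 < lam n" "lam n < r"
    proof -
      have "lam n \<noteq> 0" using elim(6) c(1) by (auto simp: expected_correlation_zero)
      then show "0 < lam n" "lam n < r" using assms(3)[of n] r by auto
    qed
    have an: "0 < a n" "a n \<le> sqrt (r\<^sup>2 - (lam n)\<^sup>2) * sqrt (real n) * c / 4"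
      unfolding a_def using k c(1) elim k_le[of n] by (auto intro!: divide_right_mono mult_right_mono)
    have env0: "0 \<le> 2 + adv_envelope n" by (simp add: adv_envelope_def)
    have Mn: "real (M n) \<le> dim_envelope n * (2 + adv_envelope n)"
    proof -
      have "real (?N n) * \<Delta> n \<le> dim_envelope n * (2 + adv_envelope n)"
        using elim \<Delta>[of n] by (intro mult_mono) auto
      with M_le[of n] show ?thesis by linarith
    qed
    obtain q where q: "binary_valued q (M n * ?N n)"
      "runs_in_time q (M n * ?N n) (60 * real (M n) * (real (?N n) + 1) * (exp (f n) + 1))"
      "error_sum q (X n) \<le> (real (M n) + 1) * exp (- (a n)\<^sup>2 / 2) + (1 - c / 2)"
      unfolding X_def using detection_from_recovery[of n "l n" "L n" "M n" "lam n" r "A n" "exp (f n)" c "a n"] elim lam an c(1)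
      by (auto simp: model_dim_def)
    have N1: "1 \<le> ?N n" unfolding model_dim_def using elim by simp
    then have "1 < dim (X n)" unfolding dimX using elim less_le_trans[of 1 "M n" "M n * ?N n"] by simp
    then have time: "low_degree_time C D X n = exp (real (D n) / C)" using C by (intro low_degree_time_eq)
    have "60 * real (M n) * (real (?N n) + 1) * (exp (f n) + 1)
      \<le> 60 * (dim_envelope n * (2 + adv_envelope n)) * (dim_envelope n + 1) * (exp (real n powr (1 / 64)) + 1)"
      using elim Mn env0 by (intro mult_mono mult_nonneg_nonneg) auto
    also have "\<dots> \<le> exp (1 / C * (real n powr (1 / 8) - 1))" using elim C by simp
    also have "\<dots> \<le> low_degree_time C D X n"
      unfolding time using D(2)[of n] C by (simp add: divide_right_mono)
    finally have t: "runs_in_time q (dim (X n)) (low_degree_time C D X n)"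
      using q(2) unfolding dimX by (rule runs_in_time_mono[rotated])
    have e: "- (a n)\<^sup>2 / 2 = - ((k * c)\<^sup>2 / 32 * real n)" using a2[of n] by linarith
    have "(real (M n) + 1) * exp (- (a n)\<^sup>2 / 2)
      \<le> (dim_envelope n * (2 + adv_envelope n) + 1) * exp (- ((k * c)\<^sup>2 / 32 * real n))"
      unfolding e using Mn by (intro mult_right_mono) auto
    also have "\<dots> \<le> c / 4" using elim k c(1) by simp
    \<comment> \<open>The union bound costs c / 4 out of the gain c / 2.\<close>
    finally have "error_sum q (X n) \<le> 1 - c / 4" using q(3) by linarith
    with q(1) t show ?case unfolding dimX by blast
  qed
  \<comment> \<open>For the remaining finitely many n the choice is arbitrary; running time and
    detection concern large n only.\<close>
  then have q: "\<forall>\<^sub>F n in sequentially. let q = (SOME q. (binary_valued q (dim (X n)) \<and>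
      runs_in_time q (dim (X n)) (low_degree_time C D X n)) \<and> error_sum q (X n) \<le> 1 - c / 4) in
      (binary_valued q (dim (X n)) \<and> runs_in_time q (dim (X n)) (low_degree_time C D X n)) \<and> error_sum q (X n) \<le> 1 - c / 4"
    unfolding Let_def by (rule eventually_mono) (rule someI_ex)
  define q where "q n = (SOME q. (binary_valued q (dim (X n)) \<and>
      runs_in_time q (dim (X n)) (low_degree_time C D X n)) \<and> error_sum q (X n) \<le> 1 - c / 4)" for n
  have "test_in_time q X (low_degree_time C D X)"
    unfolding test_in_time_def using q by (rule eventually_mono) (simp add: q_def Let_def)
  moreover have "weak_detection q X"
    unfolding weak_detection_def using q c(1)
    by (intro exI[of _ "c / 4"] conjI) (auto elim!: eventually_mono simp: q_def Let_def)
  ultimately show False using hard[OF adv] by blast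
qed

end
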